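(* Let $\mathsf{M}$ be a monoidal category and let $\mathcal{D}$ be a 2-category with finite products of 0-cells that admits the construction of Kleisli algebras (for $\mathsf{M}$-graded monads), i.e. the inclusion 2-functor $\Delta_{\mathrm{op},\mathcal{D}}:\mathcal{D}\to\Sigma_{\mathsf{M}}\mathsf{Mnd}_{\mathrm{op}}(\mathcal{D})$ has a left 2-adjoint $\mathsf{K}_{\mathcal{D}}$. Furthermore, suppose the left 2-adjoint $\mathsf{K}_{\mathcal{D}}:\Sigma_{\mathsf{M}}\mathsf{Mnd}_{\mathrm{op}}(\mathcal{D})\to\mathcal{D}$ preserves finite products of 0-cells in its domain. Then the 2-category $\mathsf{Mon}(\mathcal{D})$ admits the construction of Kleisli algebras, and they are standard with respect to $\mathcal{D}$.
   Context: Juxtaposition or $\cdot$ denotes composition of 1-cells ($FG$ means $F$ after $G$) and whiskering, $\circ$ vertical composition of 2-cells, $*$ horizontal composition of 2-cells; $1_{\mathcal{D}}$ is the terminal 0-cell of $\mathcal{D}$. **Monoidal objects.** Let $\mathcal{D}$ be a 2-category with finite products of 0-cells. A monoidal object in $\mathcal{D}$ is $(C,\otimes_C,I_C,\alpha_C,\lambda_C,\rho_C)$ with $C$ a 0-cell, 1-cells $\otimes_C:C\times C\to C$, $I_C:1_{\mathcal{D}}\to C$, and invertible 2-cells $\alpha_C:\otimes_C(1_C\times\otimes_C)\to\otimes_C(\otimes_C\times 1_C)$, $\lambda_C:\otimes_C\langle I_C,1_C\rangle\to 1_C$, $\rho_C:\otimes_C\langle 1_C,I_C\rangle\to 1_C$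 (in the pairings $I_C$ stands for $C\to 1_{\mathcal{D}}\to C$) satisfying the pentagon and triangle axioms of a monoidal category. A lax monoidal morphism $C\to C'$ is $(F,\phi,\overline{\phi})$ with $F:C\to C'$ a 1-cell and 2-cells $\phi:\otimes_{C'}(F\times F)\to F\otimes_C$, $\overline{\phi}:I_{C'}\to F I_C$ satisfying the usual associativity and two unit axioms of a lax monoidal functor. A transformation $(F,\phi,\overline\phi)\to(F',\phi',\overline{\phi'})$ is a 2-cell $\tau:F\to F'$ with $\phi'\circ\otimes_{C'}(\tau\times\tau)=\tau\otimes_C\circ\phi$ and $\overline{\phi'}=\tau I_C\circ\overline\phi$. These form the 2-category $\mathsf{Mon}(\mathcal{D})$, which again has finite products of 0-cells; $U_{\mathcal{D}}:\mathsf{Mon}(\mathcal{D})\to\mathcal{D}$ is the forgetful 2-functor. **Graded monads.** Let $(\mathsf{M},\otimes_M,I_M)$ be a monoidal category. An $\mathsf{M}$-graded monad over a 2-category $\mathcal{D}$ is a lax 2-functor $\Sigma(\mathsf{M})\to\mathcal{D}$, where $\Sigma(\mathsf{M})$ is the one-object bicategory with hom-category $\mathsf{M}$ and composition given by the tensor. Equivalently it is $(C,F,\gamma,\delta)$ with $C$ a 0-cell, $F:\mathsf{M}\to\mathcal{D}(C,C)$ a functor (written $X\mapsto F_X$, $f\mapsto Ff$), 2-cells $\gamma_{X,Y}:F_XF_Y\to F_{X\otimes_M Y}$ natural in $X,Y$, and a 2-cell $\delta:1_C\to F_{I_M}$, such that (up to the associator of $\mathsf{M}$) $\gamma_{X\otimes_M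 Y,Z}\circ\gamma_{X,Y}F_Z=\gamma_{X,Y\otimes_M Z}\circ F_X\gamma_{Y,Z}$, and $F_{\rho_X}\circ\gamma_{X,I_M}\circ F_X\delta=1_{F_X}$, $F_{\lambda_X}\circ\gamma_{I_M,X}\circ\delta F_X=1_{F_X}$, where $\lambda,\rho$ are the unitors of $\mathsf{M}$. An oplax morphism of $\mathsf{M}$-graded monads $(C,F,\gamma,\delta)\to(D,G,\mu,\eta)$ is $(\Omega,\omega)$ with $\Omega:C\to D$ a 1-cell and 2-cells $\omega_X:G_X\Omega\to\Omega F_X$ natural in $X\in\mathsf{M}$ such that $\omega_{X\otimes_M Y}\circ\mu_{X,Y}\Omega=\Omega\gamma_{X,Y}\circ\omega_XF_Y\circ G_X\omega_Y$ and $\omega_{I_M}\circ\eta\Omega=\Omega\delta$. A transformation $(\Omega,\omega)\to(\Xi,\xi)$ of oplax morphisms is a 2-cell $\beta:\Omega\to\Xi$ such that $\xi_Y\circ(Gf*\beta)=(\beta*Ff)\circ\omega_X$ for every $f:X\to Y$ in $\mathsf{M}$. These form the 2-category $\Sigma_{\mathsf{M}}\mathsf{Mnd}_{\mathrm{op}}(\mathcal{D})$. A 2-functor $G:\mathcal{D}\to\mathcal{C}$ induces a 2-functor $\Sigma_{\mathsf{M}}\mathsf{Mnd}_{\mathrm{op}}(G)$, by postcomposing lax 2-functors with $G$. **Kleisli algebras.** The inclusion 2-functor $\Delta_{\mathrm{op},\mathcal{D}}:\mathcal{D}\to\Sigma_{\mathsf{M}}\mathsf{Mnd}_{\mathrm{op}}(\mathcal{D})$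 sends $C$ to the graded monad with $F$ constant at $1_C$ and $\gamma,\delta$ identities (and acts on 1- and 2-cells in the evident way). $\mathcal{D}$ admits the construction of Kleisli algebras if $\Delta_{\mathrm{op},\mathcal{D}}$ has a left 2-adjoint $\mathsf{K}_{\mathcal{D}}:\Sigma_{\mathsf{M}}\mathsf{Mnd}_{\mathrm{op}}(\mathcal{D})\to\mathcal{D}$. **Standardness.** If $\mathcal{D}$ and $\mathcal{C}$ admit the construction of Kleisli algebras, a 2-functor $G:\mathcal{D}\to\mathcal{C}$ preserves Kleisli objects in its domain if the square formed by $\mathsf{K}_{\mathcal{D}}$, $\mathsf{K}_{\mathcal{C}}$, $\Sigma_{\mathsf{M}}\mathsf{Mnd}_{\mathrm{op}}(G)$ and $G$ commutes up to the canonical isomorphism, i.e. the canonical comparison $\mathsf{K}_{\mathcal{C}}\cdot\Sigma_{\mathsf{M}}\mathsf{Mnd}_{\mathrm{op}}(G)\to G\cdot\mathsf{K}_{\mathcal{D}}$ (the mate of the equality $\Sigma_{\mathsf{M}}\mathsf{Mnd}_{\mathrm{op}}(G)\cdot\Delta_{\mathrm{op},\mathcal{D}}=\Delta_{\mathrm{op},\mathcal{C}}\cdot G$) is an isomorphism. Kleisli objects of $\mathsf{Mon}(\mathcal{D})$ are standard with respect to $\mathcal{D}$ if $U_{\mathcal{D}}:\mathsf{Mon}(\mathcal{D})\to\mathcal{D}$ preserves Kleisli objects in this sense.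
   Formalization: The structure cells of oplax morphisms are taken as Ω F_X → G_X Ω (axioms reversed accordingly), not G_X Ω → Ω F_X as printed; with the printed direction the left 2-adjoint does not give Kleisli objects and the theorem is false. *)

theory Defs
  imports Main "HOL-Library.FuncSet"
begin

section \<open>Strict 2-categories, 2-functors, 2-natural transformations, 2-adjunctions\<close>

text \<open>
  Two-cells are composed vertically by \<open>\<bullet>\<close> and horizontally by \<open>\<star>\<close>; all three compositions are
  written in applicative order.  Whiskering is horizontal composition with an identity 2-cell.
\<close>

record ('o, 'a, 'c) twocat =
  Obj :: "'o set"
  Arr :: "'a set"
  Cel :: "'c set"
  src :: "'a \<Rightarrow> 'o"
  trg :: "'a \<Rightarrow> 'o"
  vdom :: "'c \<Rightarrow> 'a"
  vcod :: "'c \<Rightarrow> 'a"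
  id1 :: "'o \<Rightarrow> 'a"
  id2 :: "'a \<Rightarrow> 'c"
  cmp :: "'a \<Rightarrow> 'a \<Rightarrow> 'a"  (infixr "\<cdot>\<index>" 75)
  vcmp :: "'c \<Rightarrow> 'c \<Rightarrow> 'c"  (infixr "\<bullet>\<index>" 65)
  hcmp :: "'c \<Rightarrow> 'c \<Rightarrow> 'c"  (infixr "\<star>\<index>" 75)

definition hom :: "('o, 'a, 'c, 'z) twocat_scheme \<Rightarrow> 'o \<Rightarrow> 'o \<Rightarrow> 'a set" where
  "hom D A B = {f \<in> Arr D. src D f = A \<and> trg D f = B}"

definition cell :: "('o, 'a, 'c, 'z) twocat_scheme \<Rightarrow> 'a \<Rightarrow> 'a \<Rightarrow> 'c set" where
  "cell D f g = {\<tau> \<in> Cel D. vdom D \<tau> = f \<and> vcod D \<tau> = g}"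

abbreviation whisker_left :: "('o, 'a, 'c, 'z) twocat_scheme \<Rightarrow> 'a \<Rightarrow> 'c \<Rightarrow> 'c"
    (infixr "\<rhd>\<index>" 75) where
  "f \<rhd>\<^bsub>D\<^esub> \<tau> \<equiv> id2 D f \<star>\<^bsub>D\<^esub> \<tau>"

abbreviation whisker_right :: "('o, 'a, 'c, 'z) twocat_scheme \<Rightarrow> 'c \<Rightarrow> 'a \<Rightarrow> 'c"
    (infixr "\<lhd>\<index>" 75) where
  "\<tau> \<lhd>\<^bsub>D\<^esub> f \<equiv> \<tau> \<star>\<^bsub>D\<^esub> id2 D f"

locale two_category =
  fixes D :: "('o, 'a, 'c, 'z) twocat_scheme"
  assumes src_Obj: "f \<in> Arr D \<Longrightarrow> src D f \<in> Obj D"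
    and trg_Obj: "f \<in> Arr D \<Longrightarrow> trg D f \<in> Obj D"
    and vdom_Arr: "\<tau> \<in> Cel D \<Longrightarrow> vdom D \<tau> \<in> Arr D"
    and vcod_Arr: "\<tau> \<in> Cel D \<Longrightarrow> vcod D \<tau> \<in> Arr D"
    and parallel_src: "\<tau> \<in> Cel D \<Longrightarrow> src D (vdom D \<tau>) = src D (vcod D \<tau>)"
    and parallel_trg: "\<tau> \<in> Cel D \<Longrightarrow> trg D (vdom D \<tau>) = trg D (vcod D \<tau>)"
    and id1_hom: "A \<in> Obj D \<Longrightarrow> id1 D A \<in> hom D A A"
    and cmp_hom: "f \<in> hom D A B \<Longrightarrow> g \<in> hom D B C \<Longrightarrow> g \<cdot>\<^bsub>D\<^esub> f \<in> hom D A C"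
    and cmp_id_left: "f \<in> hom D A B \<Longrightarrow> id1 D B \<cdot>\<^bsub>D\<^esub> f = f"
    and cmp_id_right: "f \<in> hom D A B \<Longrightarrow> f \<cdot>\<^bsub>D\<^esub> id1 D A = f"
    and cmp_assoc: "f \<in> hom D A B \<Longrightarrow> g \<in> hom D B C \<Longrightarrow> h \<in> hom D C E \<Longrightarrow>
      (h \<cdot>\<^bsub>D\<^esub> g) \<cdot>\<^bsub>D\<^esub> f = h \<cdot>\<^bsub>D\<^esub> (g \<cdot>\<^bsub>D\<^esub> f)"
    and id2_cell: "f \<in> Arr D \<Longrightarrow> id2 D f \<in> cell D f f"
    and vcmp_cell: "\<sigma> \<in> cell D f g \<Longrightarrow> \<tau> \<in> cell D g h \<Longrightarrow> \<tau> \<bullet>\<^bsub>D\<^esub> \<sigma> \<in> cell D f h"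
    and vcmp_id_left: "\<sigma> \<in> cell D f g \<Longrightarrow> id2 D g \<bullet>\<^bsub>D\<^esub> \<sigma> = \<sigma>"
    and vcmp_id_right: "\<sigma> \<in> cell D f g \<Longrightarrow> \<sigma> \<bullet>\<^bsub>D\<^esub> id2 D f = \<sigma>"
    and vcmp_assoc: "\<sigma> \<in> cell D f g \<Longrightarrow> \<tau> \<in> cell D g h \<Longrightarrow> \<upsilon> \<in> cell D h k \<Longrightarrow>
      (\<upsilon> \<bullet>\<^bsub>D\<^esub> \<tau>) \<bullet>\<^bsub>D\<^esub> \<sigma> = \<upsilon> \<bullet>\<^bsub>D\<^esub> (\<tau> \<bullet>\<^bsub>D\<^esub> \<sigma>)"
    and hcmp_cell: "\<sigma> \<in> cell D f f' \<Longrightarrow> \<tau> \<in> cell D g g' \<Longrightarrow> trg D f = src D g \<Longrightarrow>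
      \<tau> \<star>\<^bsub>D\<^esub> \<sigma> \<in> cell D (g \<cdot>\<^bsub>D\<^esub> f) (g' \<cdot>\<^bsub>D\<^esub> f')"
    and hcmp_id_left: "\<sigma> \<in> cell D f f' \<Longrightarrow> trg D f = B \<Longrightarrow> id2 D (id1 D B) \<star>\<^bsub>D\<^esub> \<sigma> = \<sigma>"
    and hcmp_id_right: "\<sigma> \<in> cell D f f' \<Longrightarrow> src D f = A \<Longrightarrow> \<sigma> \<star>\<^bsub>D\<^esub> id2 D (id1 D A) = \<sigma>"
    and hcmp_assoc: "\<sigma> \<in> cell D f f' \<Longrightarrow> \<tau> \<in> cell D g g' \<Longrightarrow> \<upsilon> \<in> cell D h h' \<Longrightarrow>
      trg D f = src D g \<Longrightarrow> trg D g = src D h \<Longrightarrow>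
      (\<upsilon> \<star>\<^bsub>D\<^esub> \<tau>) \<star>\<^bsub>D\<^esub> \<sigma> = \<upsilon> \<star>\<^bsub>D\<^esub> (\<tau> \<star>\<^bsub>D\<^esub> \<sigma>)"
    and hcmp_id2: "f \<in> hom D A B \<Longrightarrow> g \<in> hom D B C \<Longrightarrow>
      id2 D g \<star>\<^bsub>D\<^esub> id2 D f = id2 D (g \<cdot>\<^bsub>D\<^esub> f)"
    and interchange: "\<sigma> \<in> cell D f f' \<Longrightarrow> \<sigma>' \<in> cell D f' f'' \<Longrightarrow>
      \<tau> \<in> cell D g g' \<Longrightarrow> \<tau>' \<in> cell D g' g'' \<Longrightarrow> trg D f = src D g \<Longrightarrow>
      (\<tau>' \<bullet>\<^bsub>D\<^esub> \<tau>) \<star>\<^bsub>D\<^esub> (\<sigma>' \<bullet>\<^bsub>D\<^esub> \<sigma>) = (\<tau>' \<star>\<^bsub>D\<^esub> \<sigma>') \<bullet>\<^bsub>D\<^esub> (\<tau> \<star>\<^bsub>D\<^esub> \<sigma>)"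

definition invertible_cell :: "('o, 'a, 'c, 'z) twocat_scheme \<Rightarrow> 'c \<Rightarrow> bool" where
  "invertible_cell D \<tau> \<longleftrightarrow> \<tau> \<in> Cel D \<and>
     (\<exists>\<sigma> \<in> cell D (vcod D \<tau>) (vdom D \<tau>).
        \<sigma> \<bullet>\<^bsub>D\<^esub> \<tau> = id2 D (vdom D \<tau>) \<and> \<tau> \<bullet>\<^bsub>D\<^esub> \<sigma> = id2 D (vcod D \<tau>))"

datatype ('o, 'a, 'c, 'p, 'b, 'd) twofun =
  TwoFun (on0: "'o \<Rightarrow> 'p") (on1: "'a \<Rightarrow> 'b") (on2: "'c \<Rightarrow> 'd")

locale two_functor = dom: two_category C + cod: two_category D
  for C :: "('o, 'a, 'c, 'y) twocat_scheme" and D :: "('p, 'b, 'd, 'z) twocat_scheme" +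
  fixes F :: "('o, 'a, 'c, 'p, 'b, 'd) twofun"
  assumes on0_Obj: "A \<in> Obj C \<Longrightarrow> on0 F A \<in> Obj D"
    and on1_hom: "f \<in> hom C A B \<Longrightarrow> on1 F f \<in> hom D (on0 F A) (on0 F B)"
    and on2_cell: "\<tau> \<in> cell C f g \<Longrightarrow> on2 F \<tau> \<in> cell D (on1 F f) (on1 F g)"
    and on1_id: "A \<in> Obj C \<Longrightarrow> on1 F (id1 C A) = id1 D (on0 F A)"
    and on1_cmp: "f \<in> hom C A B \<Longrightarrow> g \<in> hom C B E \<Longrightarrow>
      on1 F (g \<cdot>\<^bsub>C\<^esub> f) = on1 F g \<cdot>\<^bsub>D\<^esub> on1 F f"
    and on2_id: "f \<in> Arr C \<Longrightarrow> on2 F (id2 C f) = id2 D (on1 F f)"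
    and on2_vcmp: "\<sigma> \<in> cell C f g \<Longrightarrow> \<tau> \<in> cell C g h \<Longrightarrow>
      on2 F (\<tau> \<bullet>\<^bsub>C\<^esub> \<sigma>) = on2 F \<tau> \<bullet>\<^bsub>D\<^esub> on2 F \<sigma>"
    and on2_hcmp: "\<sigma> \<in> cell C f f' \<Longrightarrow> \<tau> \<in> cell C g g' \<Longrightarrow> trg C f = src C g \<Longrightarrow>
      on2 F (\<tau> \<star>\<^bsub>C\<^esub> \<sigma>) = on2 F \<tau> \<star>\<^bsub>D\<^esub> on2 F \<sigma>"

definition twofun_id :: "('o, 'a, 'c, 'o, 'a, 'c) twofun" where
  "twofun_id = TwoFun (\<lambda>A. A) (\<lambda>f. f) (\<lambda>\<tau>. \<tau>)"

definition twofun_comp ::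
    "('p, 'b, 'd, 'q, 'e, 'f) twofun \<Rightarrow> ('o, 'a, 'c, 'p, 'b, 'd) twofun \<Rightarrow>
     ('o, 'a, 'c, 'q, 'e, 'f) twofun" where
  "twofun_comp G F = TwoFun (on0 G \<circ> on0 F) (on1 G \<circ> on1 F) (on2 G \<circ> on2 F)"

locale two_natural = S: two_functor C D F + T: two_functor C D G
  for C :: "('o, 'a, 'c, 'y) twocat_scheme" and D :: "('p, 'b, 'd, 'z) twocat_scheme"
    and F G :: "('o, 'a, 'c, 'p, 'b, 'd) twofun" +
  fixes \<theta> :: "'o \<Rightarrow> 'b"
  assumes component: "A \<in> Obj C \<Longrightarrow> \<theta> A \<in> hom D (on0 F A) (on0 G A)"
    and natural1: "f \<in> hom C A B \<Longrightarrow> \<theta> B \<cdot>\<^bsub>D\<^esub> on1 F f = on1 G f \<cdot>\<^bsub>D\<^esub> \<theta> A"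
    and natural2: "\<tau> \<in> cell C f g \<Longrightarrow> f \<in> hom C A B \<Longrightarrow>
      \<theta> B \<rhd>\<^bsub>D\<^esub> on2 F \<tau> = on2 G \<tau> \<lhd>\<^bsub>D\<^esub> \<theta> A"

definition two_natural_iso ::
    "('o, 'a, 'c, 'y) twocat_scheme \<Rightarrow> ('p, 'b, 'd, 'z) twocat_scheme \<Rightarrow>
     ('o, 'a, 'c, 'p, 'b, 'd) twofun \<Rightarrow> ('o, 'a, 'c, 'p, 'b, 'd) twofun \<Rightarrow> ('o \<Rightarrow> 'b) \<Rightarrow> bool" where
  "two_natural_iso C D F G \<theta> \<longleftrightarrow> two_natural C D F G \<theta> \<and>
     (\<exists>\<theta>'. two_natural C D G F \<theta>' \<and>
        (\<forall>A \<in> Obj C. \<theta>' A \<cdot>\<^bsub>D\<^esub> \<theta> A = id1 D (on0 F A) \<and> \<theta> A \<cdot>\<^bsub>D\<^esub> \<theta>' A = id1 D (on0 G A)))"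

text \<open>\<open>two_adjunction C D L R \<eta> \<epsilon>\<close>: the 2-functor \<open>L : C \<rightarrow> D\<close> is left 2-adjoint to \<open>R : D \<rightarrow> C\<close>.\<close>

locale two_adjunction =
  unit: two_natural C C twofun_id "twofun_comp R L" \<eta> +
  counit: two_natural D D "twofun_comp L R" twofun_id \<epsilon> +
  left: two_functor C D L + right: two_functor D C R
  for C :: "('o, 'a, 'c, 'y) twocat_scheme" and D :: "('p, 'b, 'd, 'z) twocat_scheme"
    and L :: "('o, 'a, 'c, 'p, 'b, 'd) twofun" and R :: "('p, 'b, 'd, 'o, 'a, 'c) twofun"
    and \<eta> :: "'o \<Rightarrow> 'a" and \<epsilon> :: "'p \<Rightarrow> 'b" +
  assumes triangle_left: "A \<in> Obj C \<Longrightarrow> \<epsilon> (on0 L A) \<cdot>\<^bsub>D\<^esub> on1 L (\<eta> A) = id1 D (on0 L A)"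
    and triangle_right: "X \<in> Obj D \<Longrightarrow> on1 R (\<epsilon> X) \<cdot>\<^bsub>C\<^esub> \<eta> (on0 R X) = id1 C (on0 R X)"


section \<open>Finite products of 0-cells\<close>

text \<open>
  The universal properties are the 2-categorical ones: \<open>hom X T\<close> is the terminal category, and
  \<open>hom X P\<close> is isomorphic, as a category, to \<open>hom X A \<times> hom X B\<close> by composition with \<open>p\<close> and \<open>q\<close>.
\<close>

definition terminal_0cell :: "('o, 'a, 'c, 'z) twocat_scheme \<Rightarrow> 'o \<Rightarrow> bool" where
  "terminal_0cell D T \<longleftrightarrow> T \<in> Obj D \<and>
     (\<forall>X \<in> Obj D. (\<exists>!f. f \<in> hom D X T) \<and>
        (\<forall>f \<in> hom D X T. \<forall>g \<in> hom D X T. \<exists>!\<tau>. \<tau> \<in> cell D f g))"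

definition product_0cell ::
    "('o, 'a, 'c, 'z) twocat_scheme \<Rightarrow> 'o \<Rightarrow> 'o \<Rightarrow> 'o \<Rightarrow> 'a \<Rightarrow> 'a \<Rightarrow> bool" where
  "product_0cell D A B P p q \<longleftrightarrow>
     p \<in> hom D P A \<and> q \<in> hom D P B \<and>
     (\<forall>X \<in> Obj D.
        (\<forall>f \<in> hom D X A. \<forall>g \<in> hom D X B.
           \<exists>!h. h \<in> hom D X P \<and> p \<cdot>\<^bsub>D\<^esub> h = f \<and> q \<cdot>\<^bsub>D\<^esub> h = g) \<and>
        (\<forall>h \<in> hom D X P. \<forall>k \<in> hom D X P.
           \<forall>\<sigma> \<in> cell D (p \<cdot>\<^bsub>D\<^esub> h) (p \<cdot>\<^bsub>D\<^esub> k). \<forall>\<tau> \<in> cell D (q \<cdot>\<^bsub>D\<^esub> h) (q \<cdot>\<^bsub>D\<^esub> k).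
             \<exists>!\<theta>. \<theta> \<in> cell D h k \<and> p \<rhd>\<^bsub>D\<^esub> \<theta> = \<sigma> \<and> q \<rhd>\<^bsub>D\<^esub> \<theta> = \<tau>))"

definition preserves_finite_products ::
    "('o, 'a, 'c, 'y) twocat_scheme \<Rightarrow> ('p, 'b, 'd, 'z) twocat_scheme \<Rightarrow>
     ('o, 'a, 'c, 'p, 'b, 'd) twofun \<Rightarrow> bool" where
  "preserves_finite_products C D F \<longleftrightarrow>
     (\<forall>T. terminal_0cell C T \<longrightarrow> terminal_0cell D (on0 F T)) \<and>
     (\<forall>A B P p q. product_0cell C A B P p q \<longrightarrow>
        product_0cell D (on0 F A) (on0 F B) (on0 F P) (on1 F p) (on1 F q))"

text \<open>A 2-category with a choice of finite products.\<close>

record ('o, 'a, 'c) fp_twocat = "('o, 'a, 'c) twocat" +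
  One :: "'o"
  Prd :: "'o \<Rightarrow> 'o \<Rightarrow> 'o"
  Pr1 :: "'o \<Rightarrow> 'o \<Rightarrow> 'a"
  Pr2 :: "'o \<Rightarrow> 'o \<Rightarrow> 'a"

locale fp_two_category = two_category D for D :: "('o, 'a, 'c, 'z) fp_twocat_scheme" +
  assumes terminal_One: "terminal_0cell D (One D)"
    and product_Prd: "A \<in> Obj D \<Longrightarrow> B \<in> Obj D \<Longrightarrow>
      product_0cell D A B (Prd D A B) (Pr1 D A B) (Pr2 D A B)"

definition bang :: "('o, 'a, 'c, 'z) fp_twocat_scheme \<Rightarrow> 'o \<Rightarrow> 'a" where
  "bang D X = (THE f. f \<in> hom D X (One D))"

definition pair1 :: "('o, 'a, 'c, 'z) fp_twocat_scheme \<Rightarrow> 'a \<Rightarrow> 'a \<Rightarrow> 'a"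
    ("\<langle>_, _\<rangle>\<index>") where
  "\<langle>f, g\<rangle>\<^bsub>D\<^esub> = (THE h. h \<in> hom D (src D f) (Prd D (trg D f) (trg D g)) \<and>
     Pr1 D (trg D f) (trg D g) \<cdot>\<^bsub>D\<^esub> h = f \<and> Pr2 D (trg D f) (trg D g) \<cdot>\<^bsub>D\<^esub> h = g)"

definition pair2 :: "('o, 'a, 'c, 'z) fp_twocat_scheme \<Rightarrow> 'c \<Rightarrow> 'c \<Rightarrow> 'c"
    ("\<lblot>_, _\<rblot>\<index>") where
  "\<lblot>\<sigma>, \<tau>\<rblot>\<^bsub>D\<^esub> =
     (let A = trg D (vdom D \<sigma>); B = trg D (vdom D \<tau>) in
      THE \<theta>. \<theta> \<in> cell D \<langle>vdom D \<sigma>, vdom D \<tau>\<rangle>\<^bsub>D\<^esub> \<langle>vcod D \<sigma>, vcod D \<tau>\<rangle>\<^bsub>D\<^esub> \<and>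
        Pr1 D A B \<rhd>\<^bsub>D\<^esub> \<theta> = \<sigma> \<and> Pr2 D A B \<rhd>\<^bsub>D\<^esub> \<theta> = \<tau>)"

definition prod1 :: "('o, 'a, 'c, 'z) fp_twocat_scheme \<Rightarrow> 'a \<Rightarrow> 'a \<Rightarrow> 'a" where
  "prod1 D f g = \<langle>f \<cdot>\<^bsub>D\<^esub> Pr1 D (src D f) (src D g), g \<cdot>\<^bsub>D\<^esub> Pr2 D (src D f) (src D g)\<rangle>\<^bsub>D\<^esub>"

definition prod2 :: "('o, 'a, 'c, 'z) fp_twocat_scheme \<Rightarrow> 'c \<Rightarrow> 'c \<Rightarrow> 'c" where
  "prod2 D \<sigma> \<tau> =
     (let A = src D (vdom D \<sigma>); B = src D (vdom D \<tau>) in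
      \<lblot>\<sigma> \<lhd>\<^bsub>D\<^esub> Pr1 D A B, \<tau> \<lhd>\<^bsub>D\<^esub> Pr2 D A B\<rblot>\<^bsub>D\<^esub>)"


section \<open>The 2-category of monoidal objects\<close>

text \<open>
  In the 2-categories built below, a 1-cell carries its source and target, and a 2-cell is a 2-cell
  of the base 2-category framed by its source and target 1-cells.
\<close>

datatype ('x, 'c) framed = Framed (fdom: 'x) (fcod: 'x) (fcell: 'c)

datatype ('o, 'a, 'c) monobj =
  MonObj (mobj: 'o) (mtens: 'a) (munit: 'a) (massoc: 'c) (mlunit: 'c) (mrunit: 'c)

datatype ('o, 'a, 'c) laxmor =
  LaxMor (lsrc: "('o, 'a, 'c) monobj") (ltrg: "('o, 'a, 'c) monobj")
    (larr: 'a) (lmult: 'c) (lunit: 'c)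

text \<open>
  The next definitions evaluate the structure of a monoidal object at generalized elements
  \<open>f, g, h : X \<rightarrow> C\<close>.  The triple product is bracketed as \<open>(C \<times> C) \<times> C\<close>, so that
  \<open>1 \<times> \<otimes>\<close> becomes \<open>\<langle>x, \<otimes>\<langle>y, z\<rangle>\<rangle>\<close> and \<open>\<otimes> \<times> 1\<close> becomes \<open>\<langle>\<otimes>\<langle>x, y\<rangle>, z\<rangle>\<close> on the three
  projections \<open>x, y, z\<close>.
\<close>

definition tens1 :: "('o, 'a, 'c, 'z) fp_twocat_scheme \<Rightarrow> ('o, 'a, 'c) monobj \<Rightarrow> 'a \<Rightarrow> 'a \<Rightarrow> 'a" where
  "tens1 D C f g = mtens C \<cdot>\<^bsub>D\<^esub> \<langle>f, g\<rangle>\<^bsub>D\<^esub>"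

definition tens2 :: "('o, 'a, 'c, 'z) fp_twocat_scheme \<Rightarrow> ('o, 'a, 'c) monobj \<Rightarrow> 'c \<Rightarrow> 'c \<Rightarrow> 'c" where
  "tens2 D C \<sigma> \<tau> = mtens C \<rhd>\<^bsub>D\<^esub> \<lblot>\<sigma>, \<tau>\<rblot>\<^bsub>D\<^esub>"

definition unit_at :: "('o, 'a, 'c, 'z) fp_twocat_scheme \<Rightarrow> ('o, 'a, 'c) monobj \<Rightarrow> 'o \<Rightarrow> 'a" where
  "unit_at D C X = munit C \<cdot>\<^bsub>D\<^esub> bang D X"

definition assoc_at ::
    "('o, 'a, 'c, 'z) fp_twocat_scheme \<Rightarrow> ('o, 'a, 'c) monobj \<Rightarrow> 'a \<Rightarrow> 'a \<Rightarrow> 'a \<Rightarrow> 'c" where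
  "assoc_at D C f g h = massoc C \<lhd>\<^bsub>D\<^esub> \<langle>\<langle>f, g\<rangle>\<^bsub>D\<^esub>, h\<rangle>\<^bsub>D\<^esub>"

definition lmult_at ::
    "('o, 'a, 'c, 'z) fp_twocat_scheme \<Rightarrow> ('o, 'a, 'c) laxmor \<Rightarrow> 'a \<Rightarrow> 'a \<Rightarrow> 'c" where
  "lmult_at D F f g = lmult F \<lhd>\<^bsub>D\<^esub> \<langle>f, g\<rangle>\<^bsub>D\<^esub>"

definition triple_projs :: "('o, 'a, 'c, 'z) fp_twocat_scheme \<Rightarrow> 'o \<Rightarrow> 'a \<times> 'a \<times> 'a" where
  "triple_projs D c =
     (let c2 = Prd D c c in
      (Pr1 D c c \<cdot>\<^bsub>D\<^esub> Pr1 D c2 c, Pr2 D c c \<cdot>\<^bsub>D\<^esub> Pr1 D c2 c, Pr2 D c2 c))"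

definition quadruple_projs :: "('o, 'a, 'c, 'z) fp_twocat_scheme \<Rightarrow> 'o \<Rightarrow> 'a \<times> 'a \<times> 'a \<times> 'a" where
  "quadruple_projs D c =
     (let c3 = Prd D (Prd D c c) c; (x, y, z) = triple_projs D c; r = Pr1 D c3 c in
      (x \<cdot>\<^bsub>D\<^esub> r, y \<cdot>\<^bsub>D\<^esub> r, z \<cdot>\<^bsub>D\<^esub> r, Pr2 D c3 c))"

definition pentagon :: "('o, 'a, 'c, 'z) fp_twocat_scheme \<Rightarrow> ('o, 'a, 'c) monobj \<Rightarrow> bool" where
  "pentagon D C \<longleftrightarrow>
     (let (w, x, y, z) = quadruple_projs D (mobj C) in
      assoc_at D C (tens1 D C w x) y z \<bullet>\<^bsub>D\<^esub> assoc_at D C w x (tens1 D C y z) =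
      tens2 D C (assoc_at D C w x y) (id2 D z) \<bullet>\<^bsub>D\<^esub> assoc_at D C w (tens1 D C x y) z
        \<bullet>\<^bsub>D\<^esub> tens2 D C (id2 D w) (assoc_at D C x y z))"

definition unit_triangle :: "('o, 'a, 'c, 'z) fp_twocat_scheme \<Rightarrow> ('o, 'a, 'c) monobj \<Rightarrow> bool" where
  "unit_triangle D C \<longleftrightarrow>
     (let c = mobj C; x = Pr1 D c c; y = Pr2 D c c in
      tens2 D C (mrunit C \<lhd>\<^bsub>D\<^esub> x) (id2 D y) \<bullet>\<^bsub>D\<^esub> assoc_at D C x (unit_at D C (Prd D c c)) y =
      tens2 D C (id2 D x) (mlunit C \<lhd>\<^bsub>D\<^esub> y))"

definition monoidal_object :: "('o, 'a, 'c, 'z) fp_twocat_scheme \<Rightarrow> ('o, 'a, 'c) monobj \<Rightarrow> bool" where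
  "monoidal_object D C \<longleftrightarrow>
     (let c = mobj C; (x, y, z) = triple_projs D c in
      c \<in> Obj D \<and>
      mtens C \<in> hom D (Prd D c c) c \<and>
      munit C \<in> hom D (One D) c \<and>
      massoc C \<in> cell D (tens1 D C x (tens1 D C y z)) (tens1 D C (tens1 D C x y) z) \<and>
      mlunit C \<in> cell D (tens1 D C (unit_at D C c) (id1 D c)) (id1 D c) \<and>
      mrunit C \<in> cell D (tens1 D C (id1 D c) (unit_at D C c)) (id1 D c) \<and>
      invertible_cell D (massoc C) \<and> invertible_cell D (mlunit C) \<and> invertible_cell D (mrunit C) \<and>
      pentagon D C \<and> unit_triangle D C)"

definition lax_assoc :: "('o, 'a, 'c, 'z) fp_twocat_scheme \<Rightarrow> ('o, 'a, 'c) laxmor \<Rightarrow> bool" where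
  "lax_assoc D F \<longleftrightarrow>
     (let C = lsrc F; C' = ltrg F; f = larr F; (x, y, z) = triple_projs D (mobj C) in
      (f \<rhd>\<^bsub>D\<^esub> assoc_at D C x y z) \<bullet>\<^bsub>D\<^esub> lmult_at D F x (tens1 D C y z)
        \<bullet>\<^bsub>D\<^esub> tens2 D C' (id2 D (f \<cdot>\<^bsub>D\<^esub> x)) (lmult_at D F y z) =
      lmult_at D F (tens1 D C x y) z \<bullet>\<^bsub>D\<^esub> tens2 D C' (lmult_at D F x y) (id2 D (f \<cdot>\<^bsub>D\<^esub> z))
        \<bullet>\<^bsub>D\<^esub> assoc_at D C' (f \<cdot>\<^bsub>D\<^esub> x) (f \<cdot>\<^bsub>D\<^esub> y) (f \<cdot>\<^bsub>D\<^esub> z))"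

definition lax_left_unit :: "('o, 'a, 'c, 'z) fp_twocat_scheme \<Rightarrow> ('o, 'a, 'c) laxmor \<Rightarrow> bool" where
  "lax_left_unit D F \<longleftrightarrow>
     (let C = lsrc F; C' = ltrg F; f = larr F; c = mobj C in
      (f \<rhd>\<^bsub>D\<^esub> mlunit C) \<bullet>\<^bsub>D\<^esub> lmult_at D F (unit_at D C c) (id1 D c)
        \<bullet>\<^bsub>D\<^esub> tens2 D C' (lunit F \<lhd>\<^bsub>D\<^esub> bang D c) (id2 D f) =
      mlunit C' \<lhd>\<^bsub>D\<^esub> f)"

definition lax_right_unit :: "('o, 'a, 'c, 'z) fp_twocat_scheme \<Rightarrow> ('o, 'a, 'c) laxmor \<Rightarrow> bool" where
  "lax_right_unit D F \<longleftrightarrow>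
     (let C = lsrc F; C' = ltrg F; f = larr F; c = mobj C in
      (f \<rhd>\<^bsub>D\<^esub> mrunit C) \<bullet>\<^bsub>D\<^esub> lmult_at D F (id1 D c) (unit_at D C c)
        \<bullet>\<^bsub>D\<^esub> tens2 D C' (id2 D f) (lunit F \<lhd>\<^bsub>D\<^esub> bang D c) =
      mrunit C' \<lhd>\<^bsub>D\<^esub> f)"

definition lax_monoidal :: "('o, 'a, 'c, 'z) fp_twocat_scheme \<Rightarrow> ('o, 'a, 'c) laxmor \<Rightarrow> bool" where
  "lax_monoidal D F \<longleftrightarrow>
     (let C = lsrc F; C' = ltrg F; f = larr F in
      monoidal_object D C \<and> monoidal_object D C' \<and>
      f \<in> hom D (mobj C) (mobj C') \<and>
      lmult F \<in> cell D (mtens C' \<cdot>\<^bsub>D\<^esub> prod1 D f f) (f \<cdot>\<^bsub>D\<^esub> mtens C) \<and>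
      lunit F \<in> cell D (munit C') (f \<cdot>\<^bsub>D\<^esub> munit C) \<and>
      lax_assoc D F \<and> lax_left_unit D F \<and> lax_right_unit D F)"

definition monoidal_transformation ::
    "('o, 'a, 'c, 'z) fp_twocat_scheme \<Rightarrow> (('o, 'a, 'c) laxmor, 'c) framed \<Rightarrow> bool" where
  "monoidal_transformation D T \<longleftrightarrow>
     (let F = fdom T; F' = fcod T; \<tau> = fcell T in
      lax_monoidal D F \<and> lax_monoidal D F' \<and> lsrc F = lsrc F' \<and> ltrg F = ltrg F' \<and>
      \<tau> \<in> cell D (larr F) (larr F') \<and>
      lmult F' \<bullet>\<^bsub>D\<^esub> (mtens (ltrg F) \<rhd>\<^bsub>D\<^esub> prod2 D \<tau> \<tau>) = (\<tau> \<lhd>\<^bsub>D\<^esub> mtens (lsrc F)) \<bullet>\<^bsub>D\<^esub> lmult F \<and>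
      lunit F' = (\<tau> \<lhd>\<^bsub>D\<^esub> munit (lsrc F)) \<bullet>\<^bsub>D\<^esub> lunit F)"

definition lax_id :: "('o, 'a, 'c, 'z) fp_twocat_scheme \<Rightarrow> ('o, 'a, 'c) monobj \<Rightarrow> ('o, 'a, 'c) laxmor" where
  "lax_id D C = LaxMor C C (id1 D (mobj C)) (id2 D (mtens C)) (id2 D (munit C))"

definition lax_comp ::
    "('o, 'a, 'c, 'z) fp_twocat_scheme \<Rightarrow> ('o, 'a, 'c) laxmor \<Rightarrow> ('o, 'a, 'c) laxmor \<Rightarrow> ('o, 'a, 'c) laxmor" where
  "lax_comp D G F = LaxMor (lsrc F) (ltrg G) (larr G \<cdot>\<^bsub>D\<^esub> larr F)
     ((larr G \<rhd>\<^bsub>D\<^esub> lmult F) \<bullet>\<^bsub>D\<^esub> (lmult G \<lhd>\<^bsub>D\<^esub> prod1 D (larr F) (larr F)))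
     ((larr G \<rhd>\<^bsub>D\<^esub> lunit F) \<bullet>\<^bsub>D\<^esub> lunit G)"

definition Mon :: "('o, 'a, 'c, 'z) fp_twocat_scheme \<Rightarrow>
    (('o, 'a, 'c) monobj, ('o, 'a, 'c) laxmor, (('o, 'a, 'c) laxmor, 'c) framed) twocat" where
  "Mon D = \<lparr>
     Obj = {C. monoidal_object D C},
     Arr = {F. lax_monoidal D F},
     Cel = {T. monoidal_transformation D T},
     src = lsrc, trg = ltrg, vdom = fdom, vcod = fcod,
     id1 = lax_id D,
     id2 = (\<lambda>F. Framed F F (id2 D (larr F))),
     cmp = lax_comp D,
     vcmp = (\<lambda>T S. Framed (fdom S) (fcod T) (fcell T \<bullet>\<^bsub>D\<^esub> fcell S)),
     hcmp = (\<lambda>T S. Framed (lax_comp D (fdom T) (fdom S)) (lax_comp D (fcod T) (fcod S))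
                     (fcell T \<star>\<^bsub>D\<^esub> fcell S)) \<rparr>"

definition Mon_forget ::
    "(('o, 'a, 'c) monobj, ('o, 'a, 'c) laxmor, (('o, 'a, 'c) laxmor, 'c) framed, 'o, 'a, 'c) twofun" where
  "Mon_forget = TwoFun mobj larr fcell"


section \<open>Monoidal categories\<close>

text \<open>The associator is oriented as \<open>x \<otimes> (y \<otimes> z) \<rightarrow> (x \<otimes> y) \<otimes> z\<close>, as for monoidal objects above.\<close>

record ('m, 'n) moncat =
  MOb :: "'m set"
  MAr :: "'n set"
  Mdom :: "'n \<Rightarrow> 'm"
  Mcod :: "'n \<Rightarrow> 'm"
  Mid :: "'m \<Rightarrow> 'n"
  Mcmp :: "'n \<Rightarrow> 'n \<Rightarrow> 'n"  (infixr "\<circ>\<^sub>M\<index>" 65)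
  Mten :: "'m \<Rightarrow> 'm \<Rightarrow> 'm"  (infixr "\<otimes>\<index>" 75)
  MtenA :: "'n \<Rightarrow> 'n \<Rightarrow> 'n"  (infixr "\<otimes>\<^sub>A\<index>" 75)
  MI :: "'m"
  Massoc :: "'m \<Rightarrow> 'm \<Rightarrow> 'm \<Rightarrow> 'n"
  Mlunit :: "'m \<Rightarrow> 'n"
  Mrunit :: "'m \<Rightarrow> 'n"

definition Mhom :: "('m, 'n) moncat \<Rightarrow> 'm \<Rightarrow> 'm \<Rightarrow> 'n set" where
  "Mhom M x y = {f \<in> MAr M. Mdom M f = x \<and> Mcod M f = y}"

definition Miso :: "('m, 'n) moncat \<Rightarrow> 'm \<Rightarrow> 'm \<Rightarrow> 'n set" where
  "Miso M x y = {f \<in> Mhom M x y. \<exists>g \<in> Mhom M y x. g \<circ>\<^sub>M\<^bsub>M\<^esub> f = Mid M x \<and> f \<circ>\<^sub>M\<^bsub>M\<^esub> g = Mid M y}"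

locale monoidal_category =
  fixes M :: "('m, 'n) moncat"
  assumes Mdom_MOb: "f \<in> MAr M \<Longrightarrow> Mdom M f \<in> MOb M"
    and Mcod_MOb: "f \<in> MAr M \<Longrightarrow> Mcod M f \<in> MOb M"
    and Mid_Mhom: "x \<in> MOb M \<Longrightarrow> Mid M x \<in> Mhom M x x"
    and Mcmp_Mhom: "f \<in> Mhom M x y \<Longrightarrow> g \<in> Mhom M y z \<Longrightarrow> g \<circ>\<^sub>M\<^bsub>M\<^esub> f \<in> Mhom M x z"
    and Mcmp_id_left: "f \<in> Mhom M x y \<Longrightarrow> Mid M y \<circ>\<^sub>M\<^bsub>M\<^esub> f = f"
    and Mcmp_id_right: "f \<in> Mhom M x y \<Longrightarrow> f \<circ>\<^sub>M\<^bsub>M\<^esub> Mid M x = f"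
    and Mcmp_assoc: "f \<in> Mhom M w x \<Longrightarrow> g \<in> Mhom M x y \<Longrightarrow> h \<in> Mhom M y z \<Longrightarrow>
      (h \<circ>\<^sub>M\<^bsub>M\<^esub> g) \<circ>\<^sub>M\<^bsub>M\<^esub> f = h \<circ>\<^sub>M\<^bsub>M\<^esub> (g \<circ>\<^sub>M\<^bsub>M\<^esub> f)"
    and MI_MOb: "MI M \<in> MOb M"
    and Mten_MOb: "x \<in> MOb M \<Longrightarrow> y \<in> MOb M \<Longrightarrow> x \<otimes>\<^bsub>M\<^esub> y \<in> MOb M"
    and MtenA_Mhom: "f \<in> Mhom M x y \<Longrightarrow> g \<in> Mhom M x' y' \<Longrightarrow>
      f \<otimes>\<^sub>A\<^bsub>M\<^esub> g \<in> Mhom M (x \<otimes>\<^bsub>M\<^esub> x') (y \<otimes>\<^bsub>M\<^esub> y')"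
    and MtenA_id: "x \<in> MOb M \<Longrightarrow> y \<in> MOb M \<Longrightarrow> Mid M x \<otimes>\<^sub>A\<^bsub>M\<^esub> Mid M y = Mid M (x \<otimes>\<^bsub>M\<^esub> y)"
    and MtenA_Mcmp: "f \<in> Mhom M x y \<Longrightarrow> g \<in> Mhom M y z \<Longrightarrow>
      f' \<in> Mhom M x' y' \<Longrightarrow> g' \<in> Mhom M y' z' \<Longrightarrow>
      (g \<circ>\<^sub>M\<^bsub>M\<^esub> f) \<otimes>\<^sub>A\<^bsub>M\<^esub> (g' \<circ>\<^sub>M\<^bsub>M\<^esub> f') = (g \<otimes>\<^sub>A\<^bsub>M\<^esub> g') \<circ>\<^sub>M\<^bsub>M\<^esub> (f \<otimes>\<^sub>A\<^bsub>M\<^esub> f')"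
    and Massoc_Miso: "x \<in> MOb M \<Longrightarrow> y \<in> MOb M \<Longrightarrow> z \<in> MOb M \<Longrightarrow>
      Massoc M x y z \<in> Miso M (x \<otimes>\<^bsub>M\<^esub> (y \<otimes>\<^bsub>M\<^esub> z)) ((x \<otimes>\<^bsub>M\<^esub> y) \<otimes>\<^bsub>M\<^esub> z)"
    and Massoc_natural: "f \<in> Mhom M x x' \<Longrightarrow> g \<in> Mhom M y y' \<Longrightarrow> h \<in> Mhom M z z' \<Longrightarrow>
      Massoc M x' y' z' \<circ>\<^sub>M\<^bsub>M\<^esub> (f \<otimes>\<^sub>A\<^bsub>M\<^esub> (g \<otimes>\<^sub>A\<^bsub>M\<^esub> h)) =
      ((f \<otimes>\<^sub>A\<^bsub>M\<^esub> g) \<otimes>\<^sub>A\<^bsub>M\<^esub> h) \<circ>\<^sub>M\<^bsub>M\<^esub> Massoc M x y z"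
    and Mlunit_Miso: "x \<in> MOb M \<Longrightarrow> Mlunit M x \<in> Miso M (MI M \<otimes>\<^bsub>M\<^esub> x) x"
    and Mlunit_natural: "f \<in> Mhom M x y \<Longrightarrow>
      Mlunit M y \<circ>\<^sub>M\<^bsub>M\<^esub> (Mid M (MI M) \<otimes>\<^sub>A\<^bsub>M\<^esub> f) = f \<circ>\<^sub>M\<^bsub>M\<^esub> Mlunit M x"
    and Mrunit_Miso: "x \<in> MOb M \<Longrightarrow> Mrunit M x \<in> Miso M (x \<otimes>\<^bsub>M\<^esub> MI M) x"
    and Mrunit_natural: "f \<in> Mhom M x y \<Longrightarrow>
      Mrunit M y \<circ>\<^sub>M\<^bsub>M\<^esub> (f \<otimes>\<^sub>A\<^bsub>M\<^esub> Mid M (MI M)) = f \<circ>\<^sub>M\<^bsub>M\<^esub> Mrunit M x"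
    and Mpentagon: "w \<in> MOb M \<Longrightarrow> x \<in> MOb M \<Longrightarrow> y \<in> MOb M \<Longrightarrow> z \<in> MOb M \<Longrightarrow>
      Massoc M (w \<otimes>\<^bsub>M\<^esub> x) y z \<circ>\<^sub>M\<^bsub>M\<^esub> Massoc M w x (y \<otimes>\<^bsub>M\<^esub> z) =
      (Massoc M w x y \<otimes>\<^sub>A\<^bsub>M\<^esub> Mid M z) \<circ>\<^sub>M\<^bsub>M\<^esub> Massoc M w (x \<otimes>\<^bsub>M\<^esub> y) z
        \<circ>\<^sub>M\<^bsub>M\<^esub> (Mid M w \<otimes>\<^sub>A\<^bsub>M\<^esub> Massoc M x y z)"
    and Mtriangle: "x \<in> MOb M \<Longrightarrow> y \<in> MOb M \<Longrightarrow>
      (Mrunit M x \<otimes>\<^sub>A\<^bsub>M\<^esub> Mid M y) \<circ>\<^sub>M\<^bsub>M\<^esub> Massoc M x (MI M) y = Mid M x \<otimes>\<^sub>A\<^bsub>M\<^esub> Mlunit M y"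


section \<open>The 2-category of graded monads and oplax morphisms\<close>

text \<open>
  Families indexed by the objects or arrows of the grading category are extensional functions, so
  that equality of graded monads and of their morphisms is equality of the families.
\<close>

datatype ('o, 'a, 'c, 'm, 'n) gmonad =
  GMonad (gbase: 'o) (gobj: "'m \<Rightarrow> 'a") (garr: "'n \<Rightarrow> 'c") (gmult: "'m \<Rightarrow> 'm \<Rightarrow> 'c") (gunit: 'c)

datatype ('o, 'a, 'c, 'm, 'n) oplaxmor =
  OplaxMor (osrc: "('o, 'a, 'c, 'm, 'n) gmonad") (otrg: "('o, 'a, 'c, 'm, 'n) gmonad")
    (oarr: 'a) (ocell: "'m \<Rightarrow> 'c")

definition graded_monad ::
    "('m, 'n) moncat \<Rightarrow> ('o, 'a, 'c, 'z) twocat_scheme \<Rightarrow> ('o, 'a, 'c, 'm, 'n) gmonad \<Rightarrow> bool" where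
  "graded_monad M D A \<longleftrightarrow>
     (let C = gbase A; F = gobj A; F' = garr A; \<gamma> = gmult A; \<delta> = gunit A in
      C \<in> Obj D \<and>
      F \<in> (\<Pi>\<^sub>E x \<in> MOb M. hom D C C) \<and>
      F' \<in> (\<Pi>\<^sub>E f \<in> MAr M. cell D (F (Mdom M f)) (F (Mcod M f))) \<and>
      (\<forall>x \<in> MOb M. F' (Mid M x) = id2 D (F x)) \<and>
      (\<forall>x y z. \<forall>f \<in> Mhom M x y. \<forall>g \<in> Mhom M y z. F' (g \<circ>\<^sub>M\<^bsub>M\<^esub> f) = F' g \<bullet>\<^bsub>D\<^esub> F' f) \<and>
      \<gamma> \<in> (\<Pi>\<^sub>E x \<in> MOb M. \<Pi>\<^sub>E y \<in> MOb M. cell D (F x \<cdot>\<^bsub>D\<^esub> F y) (F (x \<otimes>\<^bsub>M\<^esub> y))) \<and>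
      (\<forall>x y x' y'. \<forall>f \<in> Mhom M x x'. \<forall>g \<in> Mhom M y y'.
         \<gamma> x' y' \<bullet>\<^bsub>D\<^esub> (F' f \<star>\<^bsub>D\<^esub> F' g) = F' (f \<otimes>\<^sub>A\<^bsub>M\<^esub> g) \<bullet>\<^bsub>D\<^esub> \<gamma> x y) \<and>
      \<delta> \<in> cell D (id1 D C) (F (MI M)) \<and>
      (\<forall>x \<in> MOb M. \<forall>y \<in> MOb M. \<forall>z \<in> MOb M.
         \<gamma> (x \<otimes>\<^bsub>M\<^esub> y) z \<bullet>\<^bsub>D\<^esub> (\<gamma> x y \<lhd>\<^bsub>D\<^esub> F z) =
         F' (Massoc M x y z) \<bullet>\<^bsub>D\<^esub> \<gamma> x (y \<otimes>\<^bsub>M\<^esub> z) \<bullet>\<^bsub>D\<^esub> (F x \<rhd>\<^bsub>D\<^esub> \<gamma> y z)) \<and>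
      (\<forall>x \<in> MOb M. F' (Mrunit M x) \<bullet>\<^bsub>D\<^esub> \<gamma> x (MI M) \<bullet>\<^bsub>D\<^esub> (F x \<rhd>\<^bsub>D\<^esub> \<delta>) = id2 D (F x)) \<and>
      (\<forall>x \<in> MOb M. F' (Mlunit M x) \<bullet>\<^bsub>D\<^esub> \<gamma> (MI M) x \<bullet>\<^bsub>D\<^esub> (\<delta> \<lhd>\<^bsub>D\<^esub> F x) = id2 D (F x)))"

text \<open>
  The structure cells of an oplax morphism \<open>(\<Omega>, \<omega>) : (C, F) \<rightarrow> (D, G)\<close> have the orientation of
  Street's monad opfunctors, \<open>\<omega> x : \<Omega> \<cdot> F x \<rightarrow> G x \<cdot> \<Omega>\<close>.  This is the orientation for which the
  left 2-adjoint of the inclusion yields Kleisli objects: a morphism from \<open>(C, F)\<close> to a trivial graded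
  monad is a cocone \<open>\<omega> x : \<Omega> \<cdot> F x \<rightarrow> \<Omega>\<close>.  For the orientation \<open>G x \<cdot> \<Omega> \<rightarrow> \<Omega> \<cdot> F x\<close> and the trivial
  grading, the left 2-adjoint of the inclusion is the functor taking a monad to its underlying 0-cell.
\<close>

definition oplax_morphism ::
    "('m, 'n) moncat \<Rightarrow> ('o, 'a, 'c, 'z) twocat_scheme \<Rightarrow> ('o, 'a, 'c, 'm, 'n) oplaxmor \<Rightarrow> bool" where
  "oplax_morphism M D W \<longleftrightarrow>
     (let A = osrc W; B = otrg W; F = gobj A; G = gobj B; \<Omega> = oarr W; \<omega> = ocell W in
      graded_monad M D A \<and> graded_monad M D B \<and>
      \<Omega> \<in> hom D (gbase A) (gbase B) \<and>
      \<omega> \<in> (\<Pi>\<^sub>E x \<in> MOb M. cell D (\<Omega> \<cdot>\<^bsub>D\<^esub> F x) (G x \<cdot>\<^bsub>D\<^esub> \<Omega>)) \<and>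
      (\<forall>x y. \<forall>f \<in> Mhom M x y.
         \<omega> y \<bullet>\<^bsub>D\<^esub> (\<Omega> \<rhd>\<^bsub>D\<^esub> garr A f) = (garr B f \<lhd>\<^bsub>D\<^esub> \<Omega>) \<bullet>\<^bsub>D\<^esub> \<omega> x) \<and>
      (\<forall>x \<in> MOb M. \<forall>y \<in> MOb M.
         \<omega> (x \<otimes>\<^bsub>M\<^esub> y) \<bullet>\<^bsub>D\<^esub> (\<Omega> \<rhd>\<^bsub>D\<^esub> gmult A x y) =
         (gmult B x y \<lhd>\<^bsub>D\<^esub> \<Omega>) \<bullet>\<^bsub>D\<^esub> (G x \<rhd>\<^bsub>D\<^esub> \<omega> y) \<bullet>\<^bsub>D\<^esub> (\<omega> x \<lhd>\<^bsub>D\<^esub> F y)) \<and>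
      \<omega> (MI M) \<bullet>\<^bsub>D\<^esub> (\<Omega> \<rhd>\<^bsub>D\<^esub> gunit A) = gunit B \<lhd>\<^bsub>D\<^esub> \<Omega>)"

definition oplax_transformation ::
    "('m, 'n) moncat \<Rightarrow> ('o, 'a, 'c, 'z) twocat_scheme \<Rightarrow>
     (('o, 'a, 'c, 'm, 'n) oplaxmor, 'c) framed \<Rightarrow> bool" where
  "oplax_transformation M D T \<longleftrightarrow>
     (let W = fdom T; V = fcod T; A = osrc W; B = otrg W; \<beta> = fcell T in
      oplax_morphism M D W \<and> oplax_morphism M D V \<and> osrc W = osrc V \<and> otrg W = otrg V \<and>
      \<beta> \<in> cell D (oarr W) (oarr V) \<and>
      (\<forall>x y. \<forall>f \<in> Mhom M x y.
         ocell V y \<bullet>\<^bsub>D\<^esub> (\<beta> \<star>\<^bsub>D\<^esub> garr A f) = (garr B f \<star>\<^bsub>D\<^esub> \<beta>) \<bullet>\<^bsub>D\<^esub> ocell W x))"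

definition oplax_id ::
    "('m, 'n) moncat \<Rightarrow> ('o, 'a, 'c, 'z) twocat_scheme \<Rightarrow> ('o, 'a, 'c, 'm, 'n) gmonad \<Rightarrow>
     ('o, 'a, 'c, 'm, 'n) oplaxmor" where
  "oplax_id M D A = OplaxMor A A (id1 D (gbase A)) (\<lambda>x \<in> MOb M. id2 D (gobj A x))"

definition oplax_comp ::
    "('m, 'n) moncat \<Rightarrow> ('o, 'a, 'c, 'z) twocat_scheme \<Rightarrow> ('o, 'a, 'c, 'm, 'n) oplaxmor \<Rightarrow>
     ('o, 'a, 'c, 'm, 'n) oplaxmor \<Rightarrow> ('o, 'a, 'c, 'm, 'n) oplaxmor" where
  "oplax_comp M D V W = OplaxMor (osrc W) (otrg V) (oarr V \<cdot>\<^bsub>D\<^esub> oarr W)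
     (\<lambda>x \<in> MOb M. (ocell V x \<lhd>\<^bsub>D\<^esub> oarr W) \<bullet>\<^bsub>D\<^esub> (oarr V \<rhd>\<^bsub>D\<^esub> ocell W x))"

definition GMnd :: "('m, 'n) moncat \<Rightarrow> ('o, 'a, 'c, 'z) twocat_scheme \<Rightarrow>
    (('o, 'a, 'c, 'm, 'n) gmonad, ('o, 'a, 'c, 'm, 'n) oplaxmor,
     (('o, 'a, 'c, 'm, 'n) oplaxmor, 'c) framed) twocat" where
  "GMnd M D = \<lparr>
     Obj = {A. graded_monad M D A},
     Arr = {W. oplax_morphism M D W},
     Cel = {T. oplax_transformation M D T},
     src = osrc, trg = otrg, vdom = fdom, vcod = fcod,
     id1 = oplax_id M D,
     id2 = (\<lambda>W. Framed W W (id2 D (oarr W))),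
     cmp = oplax_comp M D,
     vcmp = (\<lambda>T S. Framed (fdom S) (fcod T) (fcell T \<bullet>\<^bsub>D\<^esub> fcell S)),
     hcmp = (\<lambda>T S. Framed (oplax_comp M D (fdom T) (fdom S)) (oplax_comp M D (fcod T) (fcod S))
                     (fcell T \<star>\<^bsub>D\<^esub> fcell S)) \<rparr>"

definition GMnd_map_obj ::
    "('m, 'n) moncat \<Rightarrow> ('o, 'a, 'c, 'p, 'b, 'd) twofun \<Rightarrow>
     ('o, 'a, 'c, 'm, 'n) gmonad \<Rightarrow> ('p, 'b, 'd, 'm, 'n) gmonad" where
  "GMnd_map_obj M G A = GMonad (on0 G (gbase A))
     (\<lambda>x \<in> MOb M. on1 G (gobj A x)) (\<lambda>f \<in> MAr M. on2 G (garr A f))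
     (\<lambda>x \<in> MOb M. \<lambda>y \<in> MOb M. on2 G (gmult A x y)) (on2 G (gunit A))"

definition GMnd_map_arr ::
    "('m, 'n) moncat \<Rightarrow> ('o, 'a, 'c, 'p, 'b, 'd) twofun \<Rightarrow>
     ('o, 'a, 'c, 'm, 'n) oplaxmor \<Rightarrow> ('p, 'b, 'd, 'm, 'n) oplaxmor" where
  "GMnd_map_arr M G W = OplaxMor (GMnd_map_obj M G (osrc W)) (GMnd_map_obj M G (otrg W))
     (on1 G (oarr W)) (\<lambda>x \<in> MOb M. on2 G (ocell W x))"

definition GMnd_map :: "('m, 'n) moncat \<Rightarrow> ('o, 'a, 'c, 'p, 'b, 'd) twofun \<Rightarrow>
    (('o, 'a, 'c, 'm, 'n) gmonad, ('o, 'a, 'c, 'm, 'n) oplaxmor, (('o, 'a, 'c, 'm, 'n) oplaxmor, 'c) framed,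
     ('p, 'b, 'd, 'm, 'n) gmonad, ('p, 'b, 'd, 'm, 'n) oplaxmor, (('p, 'b, 'd, 'm, 'n) oplaxmor, 'd) framed)
    twofun" where
  "GMnd_map M G = TwoFun (GMnd_map_obj M G) (GMnd_map_arr M G)
     (\<lambda>T. Framed (GMnd_map_arr M G (fdom T)) (GMnd_map_arr M G (fcod T)) (on2 G (fcell T)))"


section \<open>Kleisli algebras\<close>

definition incl_obj ::
    "('m, 'n) moncat \<Rightarrow> ('o, 'a, 'c, 'z) twocat_scheme \<Rightarrow> 'o \<Rightarrow> ('o, 'a, 'c, 'm, 'n) gmonad" where
  "incl_obj M D C = GMonad C (\<lambda>x \<in> MOb M. id1 D C) (\<lambda>f \<in> MAr M. id2 D (id1 D C))
     (\<lambda>x \<in> MOb M. \<lambda>y \<in> MOb M. id2 D (id1 D C)) (id2 D (id1 D C))"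

definition incl_arr ::
    "('m, 'n) moncat \<Rightarrow> ('o, 'a, 'c, 'z) twocat_scheme \<Rightarrow> 'a \<Rightarrow> ('o, 'a, 'c, 'm, 'n) oplaxmor" where
  "incl_arr M D f = OplaxMor (incl_obj M D (src D f)) (incl_obj M D (trg D f)) f (\<lambda>x \<in> MOb M. id2 D f)"

definition incl :: "('m, 'n) moncat \<Rightarrow> ('o, 'a, 'c, 'z) twocat_scheme \<Rightarrow>
    ('o, 'a, 'c, ('o, 'a, 'c, 'm, 'n) gmonad, ('o, 'a, 'c, 'm, 'n) oplaxmor,
     (('o, 'a, 'c, 'm, 'n) oplaxmor, 'c) framed) twofun" where
  "incl M D = TwoFun (incl_obj M D) (incl_arr M D)
     (\<lambda>\<tau>. Framed (incl_arr M D (vdom D \<tau>)) (incl_arr M D (vcod D \<tau>)) \<tau>)"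

abbreviation kleisli_adjunction where
  "kleisli_adjunction M D K \<eta> \<epsilon> \<equiv> two_adjunction (GMnd M D) D K (incl M D) \<eta> \<epsilon>"

definition admits_kleisli :: "('m, 'n) moncat \<Rightarrow> ('o, 'a, 'c, 'z) twocat_scheme \<Rightarrow> bool" where
  "admits_kleisli M D \<longleftrightarrow> (\<exists>K \<eta> \<epsilon>. kleisli_adjunction M D K \<eta> \<epsilon>)"

text \<open>
  The mate of the identity \<open>GMnd_map M G \<cdot> incl M D = incl M C \<cdot> G\<close>, for Kleisli adjunctions with
  unit \<open>\<eta>\<close> over \<open>D\<close> and left adjoint \<open>K'\<close> and counit \<open>\<epsilon>'\<close> over \<open>C\<close>.
\<close>

definition kleisli_comparison where
  "kleisli_comparison M C G K \<eta> K' \<epsilon>' =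
     (\<lambda>A. \<epsilon>' (on0 G (on0 K A)) \<cdot>\<^bsub>C\<^esub> on1 K' (on1 (GMnd_map M G) (\<eta> A)))"

text \<open>
  Left 2-adjoints are unique up to isomorphism, so the condition does not depend on the chosen
  Kleisli adjunctions; it is required for all choices.
\<close>

definition preserves_kleisli ::
    "('m, 'n) moncat \<Rightarrow> ('o, 'a, 'c, 'y) twocat_scheme \<Rightarrow> ('p, 'b, 'd, 'z) twocat_scheme \<Rightarrow>
     ('o, 'a, 'c, 'p, 'b, 'd) twofun \<Rightarrow> bool" where
  "preserves_kleisli M D C G \<longleftrightarrow>
     admits_kleisli M D \<and> admits_kleisli M C \<and> two_functor D C G \<and>
     (\<forall>K \<eta> \<epsilon> K' \<eta>' \<epsilon>'. kleisli_adjunction M D K \<eta> \<epsilon> \<longrightarrow> kleisli_adjunction M C K' \<eta>' \<epsilon>' \<longrightarrow>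
        two_natural_iso (GMnd M D) C (twofun_comp K' (GMnd_map M G)) (twofun_comp G K)
          (kleisli_comparison M C G K \<eta> K' \<epsilon>'))"

definition kleisli_standard :: "('m, 'n) moncat \<Rightarrow> ('o, 'a, 'c, 'z) fp_twocat_scheme \<Rightarrow> bool" where
  "kleisli_standard M D \<longleftrightarrow> preserves_kleisli M (Mon D) D Mon_forget"

end

theory Submission
  imports Defs
begin

text \<open>
  Let \<open>A\<close> be a graded monad on a monoidal object \<open>C\<close>, and let \<open>(W, w)\<close> be the universal cocone on
  the underlying graded monad, with vertex \<open>k\<close>.  The 1-cells of \<open>A\<close> being lax monoidal and its
  2-cells monoidal means that the tensor and the unit of \<open>C\<close> are oplax morphisms of graded monads.
  Since \<open>K\<close> preserves finite products, \<open>W \<times> W\<close>, \<open>(W \<times> W) \<times> W\<close>, ... are universal cocones too, and so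
  is the identity of the terminal 0-cell.  Therefore \<open>W \<cdot> \<otimes>\<close> factors through \<open>W \<times> W\<close>, which gives the
  tensor of \<open>k\<close>; the coherence 2-cells of \<open>C\<close> descend by the 2-dimensional part of universality, and
  satisfy the axioms because whiskering with a universal cocone is faithful.  For this structure
  \<open>W\<close> is strict monoidal, and lax monoidal structures and monoidal 2-cells descend along \<open>W\<close> in the
  same way, so the cocone is universal among monoidal objects.  Its image in \<open>D\<close> is universal by
  construction, and the comparison for arbitrary Kleisli adjunctions is invertible because
  universal arrows are unique up to isomorphism.
\<close>

section \<open>Calculus in a strict 2-category\<close>

text \<open>Two conditions shape the development. A 2-cell descends along \<open>W\<close> only if
  it commutes with all the actions \<open>w m\<close>; for the associator and the unitors of
  \<open>C\<close> this turns out to be the lax associativity and unit axioms of the 1-cells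
  \<open>gobj A m\<close>, whiskered with \<open>W\<close>. Moreover, the cells to be compared live
  over iterated products. The structure of a monoidal object is therefore evaluated at arbitrary
  1-cells \<open>x\<close>, \<open>y\<close>, \<open>z\<close> with a common source: precomposition
  with \<open>W2\<close>, \<open>W3\<close> or \<open>W4\<close> is then a substitution, which
  rewriting carries out. Universality means an isomorphism of hom-categories, not an equivalence, so
  factorizations are equalities. This is why \<open>W\<close> comes out strict and no comparison
  cells have to be carried along. Adjunctions are not manipulated directly. They are translated into
  universal arrows, which can be treated one object at a time, and these into cocones, which mention
  only cells of the base; the left 2-adjoint over monoidal objects is assembled from universal
  arrows at the end.\<close>

locale strict_2cat = two_category D for D :: "('o, 'a, 'c, 'z) twocat_scheme" (structure)
begin

lemma hom_iff: "f \<in> hom D A B \<longleftrightarrow> f \<in> Arr D \<and> src D f = A \<and> trg D f = B"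
  by (simp add: hom_def)

lemma cell_iff: "t \<in> cell D f g \<longleftrightarrow> t \<in> Cel D \<and> vdom D t = f \<and> vcod D t = g"
  by (simp add: cell_def)

lemma Arr_hom: "f \<in> Arr D \<Longrightarrow> f \<in> hom D (src D f) (trg D f)"
  by (simp add: hom_iff)

lemma Cel_cell: "t \<in> Cel D \<Longrightarrow> t \<in> cell D (vdom D t) (vcod D t)"
  by (simp add: cell_iff)

text \<open>Typing is expressed by membership in the carriers and by the values of
  \<open>src\<close>, \<open>trg\<close>, \<open>vdom\<close> and \<open>vcod\<close>, not by
  \<open>hom\<close> and \<open>cell\<close> with free boundaries. Side conditions of this kind are
  computed by rewriting, whereas boundaries would have to be guessed.\<close>

lemma typing_Obj [simp]: "f \<in> Arr D \<Longrightarrow> src D f \<in> Obj D" "f \<in> Arr D \<Longrightarrow> trg D f \<in> Obj D"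
  by (simp_all add: src_Obj trg_Obj)

lemma typing_Arr [simp]: "t \<in> Cel D \<Longrightarrow> vdom D t \<in> Arr D" "t \<in> Cel D \<Longrightarrow> vcod D t \<in> Arr D"
  by (simp_all add: vdom_Arr vcod_Arr)

lemma parallel [simp]:
  "t \<in> Cel D \<Longrightarrow> src D (vcod D t) = src D (vdom D t)"
  "t \<in> Cel D \<Longrightarrow> trg D (vcod D t) = trg D (vdom D t)"
  by (simp_all add: parallel_src parallel_trg)

lemma typing_id1 [simp]:
  assumes "A \<in> Obj D"
  shows "id1 D A \<in> Arr D" "src D (id1 D A) = A" "trg D (id1 D A) = A"
  using id1_hom[OF assms] by (simp_all add: hom_iff)

lemma typing_cmp [simp]:
  assumes "f \<in> Arr D" "g \<in> Arr D" "trg D f = src D g"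
  shows "g \<cdot> f \<in> Arr D" "src D (g \<cdot> f) = src D f" "trg D (g \<cdot> f) = trg D g"
  using cmp_hom[of f "src D f" "src D g" g "trg D g"] assms by (simp_all add: hom_iff)

lemma typing_id2 [simp]:
  assumes "f \<in> Arr D"
  shows "id2 D f \<in> Cel D" "vdom D (id2 D f) = f" "vcod D (id2 D f) = f"
  using id2_cell[OF assms] by (simp_all add: cell_iff)

lemma typing_vcmp [simp]:
  assumes "s \<in> Cel D" "t \<in> Cel D" "vcod D s = vdom D t"
  shows "t \<bullet> s \<in> Cel D" "vdom D (t \<bullet> s) = vdom D s" "vcod D (t \<bullet> s) = vcod D t"
  using vcmp_cell[of s "vdom D s" "vdom D t" t "vcod D t"] assms by (simp_all add: cell_iff)

lemma typing_hcmp [simp]: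
  assumes "s \<in> Cel D" "t \<in> Cel D" "trg D (vdom D s) = src D (vdom D t)"
  shows "t \<star> s \<in> Cel D" "vdom D (t \<star> s) = vdom D t \<cdot> vdom D s" "vcod D (t \<star> s) = vcod D t \<cdot> vcod D s"
  using hcmp_cell[of s "vdom D s" "vcod D s" t "vdom D t" "vcod D t"] assms by (simp_all add: cell_iff)

lemma id1_cmp [simp]: "f \<in> Arr D \<Longrightarrow> trg D f = B \<Longrightarrow> id1 D B \<cdot> f = f"
  using cmp_id_left Arr_hom by blast

lemma cmp_id1 [simp]: "f \<in> Arr D \<Longrightarrow> src D f = B \<Longrightarrow> f \<cdot> id1 D B = f"
  using cmp_id_right Arr_hom by blast

lemma cmp_assoc' [simp]: "f \<in> Arr D \<Longrightarrow> g \<in> Arr D \<Longrightarrow> h \<in> Arr D \<Longrightarrow> trg D f = src D g \<Longrightarrow> trg D g = src D h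
  \<Longrightarrow> (h \<cdot> g) \<cdot> f = h \<cdot> (g \<cdot> f)"
  by (rule cmp_assoc[of f "src D f" "src D g" g "src D h" h "trg D h"]) (auto simp: hom_iff)

lemma id2_vcmp [simp]: "t \<in> Cel D \<Longrightarrow> vcod D t = f \<Longrightarrow> id2 D f \<bullet> t = t"
  using vcmp_id_left Cel_cell by blast

lemma vcmp_id2 [simp]: "t \<in> Cel D \<Longrightarrow> vdom D t = f \<Longrightarrow> t \<bullet> id2 D f = t"
  using vcmp_id_right Cel_cell by blast

lemma vcmp_assoc' [simp]: "s \<in> Cel D \<Longrightarrow> t \<in> Cel D \<Longrightarrow> u \<in> Cel D \<Longrightarrow> vcod D s = vdom D t \<Longrightarrow> vcod D t = vdom D u
  \<Longrightarrow> (u \<bullet> t) \<bullet> s = u \<bullet> (t \<bullet> s)"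
  by (rule vcmp_assoc[of s "vdom D s" "vdom D t" t "vdom D u" u "vcod D u"]) (auto simp: cell_iff)

lemma hcmp_assoc' [simp]: "s \<in> Cel D \<Longrightarrow> t \<in> Cel D \<Longrightarrow> u \<in> Cel D \<Longrightarrow> trg D (vdom D s) = src D (vdom D t)
  \<Longrightarrow> trg D (vdom D t) = src D (vdom D u) \<Longrightarrow> (u \<star> t) \<star> s = u \<star> (t \<star> s)"
  by (rule hcmp_assoc[OF Cel_cell Cel_cell Cel_cell])

lemma hcmp_id2' [simp]: "f \<in> Arr D \<Longrightarrow> g \<in> Arr D \<Longrightarrow> trg D f = src D g \<Longrightarrow> id2 D g \<star> id2 D f = id2 D (g \<cdot> f)"
  by (rule hcmp_id2[of f "src D f" "src D g" g "trg D g"]) (auto simp: hom_iff)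

lemma id1_whisker [simp]: "t \<in> Cel D \<Longrightarrow> trg D (vdom D t) = B \<Longrightarrow> id2 D (id1 D B) \<star> t = t"
  by (rule hcmp_id_left[OF Cel_cell])

lemma whisker_id1 [simp]: "t \<in> Cel D \<Longrightarrow> src D (vdom D t) = B \<Longrightarrow> t \<star> id2 D (id1 D B) = t"
  by (rule hcmp_id_right[OF Cel_cell])

text \<open>Nesting to the right merges two right whiskerings by itself, through
  \<open>hcmp_id2'\<close>, but \<open>g \<rhd> (f \<rhd> t)\<close> is already nested to the right.
  This rule completes the normal form, in which a cell carries at most one whisker on each
  side.\<close>

lemma whisker_whisker [simp]: "t \<in> Cel D \<Longrightarrow> f \<in> Arr D \<Longrightarrow> g \<in> Arr D \<Longrightarrow> trg D (vdom D t) = src D f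
  \<Longrightarrow> trg D f = src D g \<Longrightarrow> g \<rhd> (f \<rhd> t) = (g \<cdot> f) \<rhd> t"
  by (metis hcmp_assoc' hcmp_id2' typing_id2(1,2))

lemma interchange': "s \<in> Cel D \<Longrightarrow> s' \<in> Cel D \<Longrightarrow> t \<in> Cel D \<Longrightarrow> t' \<in> Cel D \<Longrightarrow> vcod D s = vdom D s'
  \<Longrightarrow> vcod D t = vdom D t' \<Longrightarrow> trg D (vdom D s) = src D (vdom D t)
  \<Longrightarrow> (t' \<bullet> t) \<star> (s' \<bullet> s) = (t' \<star> s') \<bullet> (t \<star> s)"
  by (rule interchange[of s "vdom D s" "vdom D s'" s' "vcod D s'" t "vdom D t" "vdom D t'" t' "vcod D t'"])
    (auto simp: cell_iff)

lemma whisker_left_vcmp [simp]: "s \<in> Cel D \<Longrightarrow> t \<in> Cel D \<Longrightarrow> vcod D s = vdom D t \<Longrightarrow> f \<in> Arr D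
  \<Longrightarrow> trg D (vdom D t) = src D f \<Longrightarrow> f \<rhd> (t \<bullet> s) = (f \<rhd> t) \<bullet> (f \<rhd> s)"
  using interchange'[of s t "id2 D f" "id2 D f"] by (metis parallel(2) typing_id2 vcmp_id2)

lemma whisker_right_vcmp [simp]: "s \<in> Cel D \<Longrightarrow> t \<in> Cel D \<Longrightarrow> vcod D s = vdom D t \<Longrightarrow> f \<in> Arr D
  \<Longrightarrow> src D (vdom D t) = trg D f \<Longrightarrow> (t \<bullet> s) \<lhd> f = (t \<lhd> f) \<bullet> (s \<lhd> f)"
  using interchange'[of "id2 D f" "id2 D f" s t] by (metis parallel(1) typing_id2 vcmp_id2)

lemma hcmp_left_first: "s \<in> Cel D \<Longrightarrow> t \<in> Cel D \<Longrightarrow> trg D (vdom D s) = src D (vdom D t)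
  \<Longrightarrow> t \<star> s = (t \<lhd> vcod D s) \<bullet> (vdom D t \<rhd> s)"
  using interchange'[of s "id2 D (vcod D s)" "id2 D (vdom D t)" t] by simp

lemma hcmp_right_first: "s \<in> Cel D \<Longrightarrow> t \<in> Cel D \<Longrightarrow> trg D (vdom D s) = src D (vdom D t)
  \<Longrightarrow> t \<star> s = (vcod D t \<rhd> s) \<bullet> (t \<lhd> vdom D s)"
  using interchange'[of "id2 D (vdom D s)" s t "id2 D (vcod D t)"] by simp

text \<open>Both sides are the horizontal composite \<open>t \<star> s\<close>. The boundaries are
  variables constrained by equations, so that the rule unifies with a goal written with concrete
  1-cells.\<close>

lemma exchange: "s \<in> Cel D \<Longrightarrow> t \<in> Cel D \<Longrightarrow> trg D (vdom D s) = src D (vdom D t) \<Longrightarrow>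
   vdom D s = f \<Longrightarrow> vcod D s = f' \<Longrightarrow> vdom D t = g \<Longrightarrow> vcod D t = g' \<Longrightarrow>
   (t \<lhd> f') \<bullet> (g \<rhd> s) = (g' \<rhd> s) \<bullet> (t \<lhd> f)"
  using hcmp_left_first hcmp_right_first by metis

text \<open>With vertical composites nested to the right, a rule for \<open>a \<bullet> b\<close> no
  longer matches when a further factor stands to the right of \<open>b\<close>. This is the same
  rule with a tail; pasting of diagrams below is a chain of such rewrites.\<close>

lemma vcmp_extend: "a \<bullet> b = c \<Longrightarrow> a \<in> Cel D \<Longrightarrow> b \<in> Cel D \<Longrightarrow> x \<in> Cel D \<Longrightarrow> vdom D a = vcod D b \<Longrightarrow> vdom D b = vcod D x
  \<Longrightarrow> a \<bullet> (b \<bullet> x) = c \<bullet> x"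
  using vcmp_assoc'[of x b a] by simp

lemma vcmp_extend3: "a \<bullet> (b \<bullet> c) = d \<Longrightarrow> a \<in> Cel D \<Longrightarrow> b \<in> Cel D \<Longrightarrow> c \<in> Cel D \<Longrightarrow> x \<in> Cel D
  \<Longrightarrow> vdom D a = vcod D b \<Longrightarrow> vdom D b = vcod D c \<Longrightarrow> vdom D c = vcod D x
  \<Longrightarrow> a \<bullet> (b \<bullet> (c \<bullet> x)) = d \<bullet> x"
  by auto

end

section \<open>2-functors and universal arrows\<close>

lemma strict_2cat_iff: "strict_2cat D \<longleftrightarrow> two_category D"
  by (simp add: strict_2cat_def)

sublocale two_functor \<subseteq> dom: strict_2cat C
  by (simp add: strict_2cat_iff dom.two_category_axioms)

sublocale two_functor \<subseteq> cod: strict_2cat D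
  by (simp add: strict_2cat_iff cod.two_category_axioms)

context two_functor
begin

lemma on0 [simp]: "A \<in> Obj C \<Longrightarrow> on0 F A \<in> Obj D"
  by (rule on0_Obj)

lemma typing_on1 [simp]:
  assumes "f \<in> Arr C"
  shows "on1 F f \<in> Arr D" "src D (on1 F f) = on0 F (src C f)" "trg D (on1 F f) = on0 F (trg C f)"
  using on1_hom[OF dom.Arr_hom[OF assms]] by (simp_all add: cod.hom_iff)

lemma typing_on2 [simp]:
  assumes "t \<in> Cel C"
  shows "on2 F t \<in> Cel D" "vdom D (on2 F t) = on1 F (vdom C t)" "vcod D (on2 F t) = on1 F (vcod C t)"
  using on2_cell[OF dom.Cel_cell[OF assms]] by (simp_all add: cod.cell_iff)

lemma functorial [simp]:
  "A \<in> Obj C \<Longrightarrow> on1 F (id1 C A) = id1 D (on0 F A)"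
  "f \<in> Arr C \<Longrightarrow> on2 F (id2 C f) = id2 D (on1 F f)"
  "f \<in> Arr C \<Longrightarrow> g \<in> Arr C \<Longrightarrow> trg C f = src C g \<Longrightarrow> on1 F (g \<cdot>\<^bsub>C\<^esub> f) = on1 F g \<cdot>\<^bsub>D\<^esub> on1 F f"
  "s \<in> Cel C \<Longrightarrow> t \<in> Cel C \<Longrightarrow> vcod C s = vdom C t \<Longrightarrow> on2 F (t \<bullet>\<^bsub>C\<^esub> s) = on2 F t \<bullet>\<^bsub>D\<^esub> on2 F s"
  "s \<in> Cel C \<Longrightarrow> t \<in> Cel C \<Longrightarrow> trg C (vdom C s) = src C (vdom C t) \<Longrightarrow>
    on2 F (t \<star>\<^bsub>C\<^esub> s) = on2 F t \<star>\<^bsub>D\<^esub> on2 F s"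
  using on1_id on2_id on1_cmp[OF dom.Arr_hom, of f g "trg C g"]
    on2_vcmp[OF dom.Cel_cell, of s t "vcod C t"] on2_hcmp[OF dom.Cel_cell dom.Cel_cell]
  by (simp_all add: dom.hom_iff dom.cell_iff)

end

context two_natural
begin

lemma typing_component [simp]:
  assumes "A \<in> Obj C"
  shows "\<theta> A \<in> Arr D" "src D (\<theta> A) = on0 F A" "trg D (\<theta> A) = on0 G A"
  using component[OF assms] by (simp_all add: S.cod.hom_iff)

lemma nat1: "f \<in> Arr C \<Longrightarrow> \<theta> (trg C f) \<cdot>\<^bsub>D\<^esub> on1 F f = on1 G f \<cdot>\<^bsub>D\<^esub> \<theta> (src C f)"
  by (rule natural1[OF S.dom.Arr_hom])

lemma nat2: "t \<in> Cel C \<Longrightarrow>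
  \<theta> (trg C (vdom C t)) \<rhd>\<^bsub>D\<^esub> on2 F t = on2 G t \<lhd>\<^bsub>D\<^esub> \<theta> (src C (vdom C t))"
  by (rule natural2[OF S.dom.Cel_cell]) (simp_all add: S.dom.hom_iff)

end

lemma on_twofun_id [simp]: "on0 twofun_id A = A" "on1 twofun_id f = f" "on2 twofun_id t = t"
  by (simp_all add: twofun_id_def)

lemma on_twofun_comp [simp]:
  "on0 (twofun_comp G F) A = on0 G (on0 F A)"
  "on1 (twofun_comp G F) f = on1 G (on1 F f)"
  "on2 (twofun_comp G F) t = on2 G (on2 F t)"
  by (simp_all add: twofun_comp_def)

lemma two_functor_id: "two_category C \<Longrightarrow> two_functor C C twofun_id"
  by (simp add: two_functor_def two_functor_axioms_def)

lemma two_functor_comp: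
  assumes "two_functor C D F" "two_functor D E G"
  shows "two_functor C E (twofun_comp G F)"
proof -
  interpret F: two_functor C D F by fact
  interpret G: two_functor D E G by fact
  show ?thesis
    by unfold_locales
      (auto simp: F.dom.hom_iff F.dom.cell_iff G.cod.hom_iff G.cod.cell_iff F.cod.hom_iff F.cod.cell_iff)
qed

text \<open>Precomposition with \<open>u\<close> is to be an isomorphism of hom-categories,
  bijective on 1-cells and on 2-cells. This is the objectwise form of a left 2-adjoint to
  \<open>R\<close>.\<close>

definition universal_arrow ::
    "('o, 'a, 'c, 'y) twocat_scheme \<Rightarrow> ('p, 'b, 'd, 'z) twocat_scheme \<Rightarrow>
     ('p, 'b, 'd, 'o, 'a, 'c) twofun \<Rightarrow> 'o \<Rightarrow> 'p \<Rightarrow> 'a \<Rightarrow> bool" where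
  "universal_arrow C D R A k u \<longleftrightarrow> k \<in> Obj D \<and> u \<in> hom C A (on0 R k) \<and>
     (\<forall>X \<in> Obj D.
        (\<forall>f \<in> hom C A (on0 R X). \<exists>!h. h \<in> hom D k X \<and> on1 R h \<cdot>\<^bsub>C\<^esub> u = f) \<and>
        (\<forall>h \<in> hom D k X. \<forall>h' \<in> hom D k X. \<forall>\<sigma> \<in> cell C (on1 R h \<cdot>\<^bsub>C\<^esub> u) (on1 R h' \<cdot>\<^bsub>C\<^esub> u).
           \<exists>!\<tau>. \<tau> \<in> cell D h h' \<and> on2 R \<tau> \<lhd>\<^bsub>C\<^esub> u = \<sigma>))"

context two_functor
begin

lemma universal_typing:
  assumes "universal_arrow D C F A k u"
  shows "k \<in> Obj C" "u \<in> Arr D" "src D u = A" "trg D u = on0 F k" "A \<in> Obj D"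
  using assms cod.typing_Obj by (auto simp: universal_arrow_def cod.hom_iff)

lemma universal_ext1:
  assumes "universal_arrow D C F A k u" "f \<in> Arr D" "src D f = A" "trg D f = on0 F X" "X \<in> Obj C"
  obtains h where "h \<in> Arr C" "src C h = k" "trg C h = X" "on1 F h \<cdot>\<^bsub>D\<^esub> u = f"
proof -
  have "\<exists>!h. h \<in> hom C k X \<and> on1 F h \<cdot>\<^bsub>D\<^esub> u = f"
    using assms by (auto simp: universal_arrow_def cod.hom_iff)
  then show ?thesis using that by (auto simp: dom.hom_iff)
qed

lemma universal_cancel1:
  assumes u: "universal_arrow D C F A k u" and "h \<in> Arr C" "h' \<in> Arr C" "src C h = k" "src C h' = k"
    "trg C h = trg C h'" "on1 F h \<cdot>\<^bsub>D\<^esub> u = on1 F h' \<cdot>\<^bsub>D\<^esub> u"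
  shows "h = h'"
proof -
  note universal_typing[OF u, simp]
  have "on1 F h \<cdot>\<^bsub>D\<^esub> u \<in> hom D A (on0 F (trg C h))" using assms by (simp add: cod.hom_iff)
  then have "\<exists>!g. g \<in> hom C k (trg C h) \<and> on1 F g \<cdot>\<^bsub>D\<^esub> u = on1 F h \<cdot>\<^bsub>D\<^esub> u"
    using assms by (auto simp: universal_arrow_def)
  then show ?thesis using assms by (metis dom.hom_iff)
qed

lemma universal_ext2:
  assumes "universal_arrow D C F A k u" "s \<in> Cel D" "vdom D s = on1 F h \<cdot>\<^bsub>D\<^esub> u" "vcod D s = on1 F h' \<cdot>\<^bsub>D\<^esub> u"
     "h \<in> Arr C" "h' \<in> Arr C" "src C h = k" "src C h' = k" "trg C h = trg C h'"
  obtains t where "t \<in> Cel C" "vdom C t = h" "vcod C t = h'" "on2 F t \<lhd>\<^bsub>D\<^esub> u = s"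
proof -
  have "h \<in> hom C k (trg C h)" "h' \<in> hom C k (trg C h)" "s \<in> cell D (on1 F h \<cdot>\<^bsub>D\<^esub> u) (on1 F h' \<cdot>\<^bsub>D\<^esub> u)"
    "trg C h \<in> Obj C"
    using assms by (auto simp: dom.hom_iff cod.cell_iff)
  then have "\<exists>!t. t \<in> cell C h h' \<and> on2 F t \<lhd>\<^bsub>D\<^esub> u = s"
    using assms(1) unfolding universal_arrow_def by blast
  then show ?thesis using that by (auto simp: dom.cell_iff)
qed

lemma universal_cancel2:
  assumes u: "universal_arrow D C F A k u" and "t \<in> Cel C" "t' \<in> Cel C"
    "src C (vdom C t) = k" "vdom C t = vdom C t'" "vcod C t = vcod C t'"
    "on2 F t \<lhd>\<^bsub>D\<^esub> u = on2 F t' \<lhd>\<^bsub>D\<^esub> u"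
  shows "t = t'"
proof -
  note universal_typing[OF u, simp]
  have "vdom C t \<in> hom C k (trg C (vdom C t))" "vcod C t \<in> hom C k (trg C (vdom C t))"
    "trg C (vdom C t) \<in> Obj C"
    "on2 F t \<lhd>\<^bsub>D\<^esub> u \<in> cell D (on1 F (vdom C t) \<cdot>\<^bsub>D\<^esub> u) (on1 F (vcod C t) \<cdot>\<^bsub>D\<^esub> u)"
    using assms by (auto simp: dom.hom_iff cod.cell_iff)
  then have "\<exists>!r. r \<in> cell C (vdom C t) (vcod C t) \<and> on2 F r \<lhd>\<^bsub>D\<^esub> u = on2 F t \<lhd>\<^bsub>D\<^esub> u"
    using u unfolding universal_arrow_def by blast
  then show ?thesis using assms by (metis dom.cell_iff)
qed

lemma universal_arrowI:
  assumes "k \<in> Obj C" "u \<in> Arr D" "src D u = A" "trg D u = on0 F k"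
    and ext1: "\<And>X f. X \<in> Obj C \<Longrightarrow> f \<in> Arr D \<Longrightarrow> src D f = A \<Longrightarrow> trg D f = on0 F X \<Longrightarrow>
      \<exists>h \<in> Arr C. src C h = k \<and> trg C h = X \<and> on1 F h \<cdot>\<^bsub>D\<^esub> u = f"
    and cancel1: "\<And>h h'. h \<in> Arr C \<Longrightarrow> h' \<in> Arr C \<Longrightarrow> src C h = k \<Longrightarrow> src C h' = k \<Longrightarrow>
      trg C h = trg C h' \<Longrightarrow> on1 F h \<cdot>\<^bsub>D\<^esub> u = on1 F h' \<cdot>\<^bsub>D\<^esub> u \<Longrightarrow> h = h'"
    and ext2: "\<And>h h' s. h \<in> Arr C \<Longrightarrow> h' \<in> Arr C \<Longrightarrow> src C h = k \<Longrightarrow> src C h' = k \<Longrightarrow>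
      trg C h = trg C h' \<Longrightarrow> s \<in> Cel D \<Longrightarrow> vdom D s = on1 F h \<cdot>\<^bsub>D\<^esub> u \<Longrightarrow> vcod D s = on1 F h' \<cdot>\<^bsub>D\<^esub> u \<Longrightarrow>
      \<exists>t \<in> Cel C. vdom C t = h \<and> vcod C t = h' \<and> on2 F t \<lhd>\<^bsub>D\<^esub> u = s"
    and cancel2: "\<And>t t'. t \<in> Cel C \<Longrightarrow> t' \<in> Cel C \<Longrightarrow> src C (vdom C t) = k \<Longrightarrow> vdom C t = vdom C t' \<Longrightarrow>
      vcod C t = vcod C t' \<Longrightarrow> on2 F t \<lhd>\<^bsub>D\<^esub> u = on2 F t' \<lhd>\<^bsub>D\<^esub> u \<Longrightarrow> t = t'"
  shows "universal_arrow D C F A k u"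
  unfolding universal_arrow_def
proof (intro conjI ballI, goal_cases)
  case (3 X f)
  then obtain h where "h \<in> Arr C" "src C h = k" "trg C h = X" "on1 F h \<cdot>\<^bsub>D\<^esub> u = f"
    using ext1[of X f] by (auto simp: cod.hom_iff)
  then show ?case using cancel1 by (intro ex1I[of _ h]) (auto simp: dom.hom_iff)
next
  case (4 X h h' s)
  then have "\<exists>t \<in> Cel C. vdom C t = h \<and> vcod C t = h' \<and> on2 F t \<lhd>\<^bsub>D\<^esub> u = s"
    using ext2[of h h' s] by (auto simp: dom.hom_iff cod.cell_iff)
  then obtain t where t: "t \<in> Cel C" "vdom C t = h" "vcod C t = h'" "on2 F t \<lhd>\<^bsub>D\<^esub> u = s" by blast
  have "src C h = k" using 4 by (simp add: dom.hom_iff)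
  show ?case
  proof (rule ex1I[of _ t])
    show "t \<in> cell C h h' \<and> on2 F t \<lhd>\<^bsub>D\<^esub> u = s" using t by (simp add: dom.cell_iff)
    show "t' = t" if "t' \<in> cell C h h' \<and> on2 F t' \<lhd>\<^bsub>D\<^esub> u = s" for t'
      by (rule cancel2) (use that t \<open>src C h = k\<close> in \<open>simp_all add: dom.cell_iff\<close>)
  qed
qed (use assms in \<open>auto simp: cod.hom_iff\<close>)

end

section \<open>2-adjunctions from universal arrows\<close>

context two_adjunction
begin

text \<open>The transpose of \<open>f\<close> is \<open>\<epsilon> X \<cdot> on1 L f\<close>; that
  of a 2-cell is its image under \<open>L\<close> whiskered with \<open>\<epsilon>\<close>. One
  triangle identity makes the transposes factorizations, the other makes them unique.\<close>

lemma unit_universal: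
  assumes A: "A \<in> Obj C"
  shows "universal_arrow C D R A (on0 L A) (\<eta> A)"
proof (rule right.universal_arrowI)
  have u [simp]: "\<eta> A \<in> Arr C" "src C (\<eta> A) = A" "trg C (\<eta> A) = on0 R (on0 L A)"
    using A unit.typing_component[OF A] by simp_all
  have n1: "on1 R (on1 L f) \<cdot>\<^bsub>C\<^esub> \<eta> A = \<eta> (trg C f) \<cdot>\<^bsub>C\<^esub> f" if "f \<in> Arr C" "src C f = A" for f
    using unit.nat1[OF that(1)] that by simp
  have n2: "on2 R (on2 L t) \<lhd>\<^bsub>C\<^esub> \<eta> A = \<eta> (trg C (vdom C t)) \<rhd>\<^bsub>C\<^esub> t" if "t \<in> Cel C" "src C (vdom C t) = A" for t
    using unit.nat2[OF that(1)] that by simp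
  have tl: "\<epsilon> (on0 L A) \<cdot>\<^bsub>D\<^esub> on1 L (\<eta> A) = id1 D (on0 L A)" using triangle_left[OF A] .
  have tr: "on1 R (\<epsilon> X) \<cdot>\<^bsub>C\<^esub> (\<eta> (on0 R X) \<cdot>\<^bsub>C\<^esub> f) = f" if "X \<in> Obj D" "f \<in> Arr C" "trg C f = on0 R X" for X f
    using triangle_right[OF that(1)] that 
      unit.S.dom.cmp_assoc'[of f "\<eta> (on0 R X)" "on1 R (\<epsilon> X)"]
      unit.typing_component[of "on0 R X"] counit.typing_component[of X] by simp
  note counit.typing_component[simp]
  note unit.typing_component[simp]
  show "on0 L A \<in> Obj D" "\<eta> A \<in> Arr C" "src C (\<eta> A) = A" "trg C (\<eta> A) = on0 R (on0 L A)"
    using A by simp_all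
  show "\<exists>h \<in> Arr D. src D h = on0 L A \<and> trg D h = X \<and> on1 R h \<cdot>\<^bsub>C\<^esub> \<eta> A = f"
    if "X \<in> Obj D" "f \<in> Arr C" "src C f = A" "trg C f = on0 R X" for X f
    using that A by (intro bexI[of _ "\<epsilon> X \<cdot>\<^bsub>D\<^esub> on1 L f"]) (auto simp: n1 tr)
  \<comment> \<open>Recovering \<open>h\<close> from its composite with the unit yields
    cancellation, and in the 2-dimensional part also the boundaries of the transposed
    2-cell.\<close>
  have c1: "\<epsilon> (trg D h) \<cdot>\<^bsub>D\<^esub> on1 L (on1 R h \<cdot>\<^bsub>C\<^esub> \<eta> A) = h" if "h \<in> Arr D" "src D h = on0 L A" for h
  proof -
    have "\<epsilon> (trg D h) \<cdot>\<^bsub>D\<^esub> on1 L (on1 R h \<cdot>\<^bsub>C\<^esub> \<eta> A) = (\<epsilon> (trg D h) \<cdot>\<^bsub>D\<^esub> on1 L (on1 R h)) \<cdot>\<^bsub>D\<^esub> on1 L (\<eta> A)"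
      using that A by simp
    also have "\<dots> = (h \<cdot>\<^bsub>D\<^esub> \<epsilon> (on0 L A)) \<cdot>\<^bsub>D\<^esub> on1 L (\<eta> A)"
      using counit.nat1[OF that(1)] that by simp
    finally show ?thesis using that A tl by simp
  qed
  show "h = h'" if "h \<in> Arr D" "h' \<in> Arr D" "src D h = on0 L A" "src D h' = on0 L A" "trg D h = trg D h'"
     "on1 R h \<cdot>\<^bsub>C\<^esub> \<eta> A = on1 R h' \<cdot>\<^bsub>C\<^esub> \<eta> A" for h h'
    using c1[of h] c1[of h'] that by metis
  show "\<exists>t \<in> Cel D. vdom D t = h \<and> vcod D t = h' \<and> on2 R t \<lhd>\<^bsub>C\<^esub> \<eta> A = s"
    if "h \<in> Arr D" "h' \<in> Arr D" "src D h = on0 L A" "src D h' = on0 L A" "trg D h = trg D h'"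
      "s \<in> Cel C" "vdom C s = on1 R h \<cdot>\<^bsub>C\<^esub> \<eta> A" "vcod C s = on1 R h' \<cdot>\<^bsub>C\<^esub> \<eta> A" for h h' s
  proof (rule bexI[of _ "\<epsilon> (trg D h) \<rhd>\<^bsub>D\<^esub> on2 L s"], intro conjI)
    have s: "src C (vdom C s) = A" "trg C (vdom C s) = on0 R (trg D h)" using that A by simp_all
    show "\<epsilon> (trg D h) \<rhd>\<^bsub>D\<^esub> on2 L s \<in> Cel D" using that A s by simp
    show "vdom D (\<epsilon> (trg D h) \<rhd>\<^bsub>D\<^esub> on2 L s) = h" using that A s c1[of h] by simp
    show "vcod D (\<epsilon> (trg D h) \<rhd>\<^bsub>D\<^esub> on2 L s) = h'" using that A s c1[of h'] by simp
    have "on2 R (\<epsilon> (trg D h) \<rhd>\<^bsub>D\<^esub> on2 L s) \<lhd>\<^bsub>C\<^esub> \<eta> A 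
      = on1 R (\<epsilon> (trg D h)) \<rhd>\<^bsub>C\<^esub> (on2 R (on2 L s) \<lhd>\<^bsub>C\<^esub> \<eta> A)" using that A s by simp
    also have "\<dots> = (on1 R (\<epsilon> (trg D h)) \<cdot>\<^bsub>C\<^esub> \<eta> (on0 R (trg D h))) \<rhd>\<^bsub>C\<^esub> s"
      using that(1-6) A s by (simp add: n2)
    finally show "on2 R (\<epsilon> (trg D h) \<rhd>\<^bsub>D\<^esub> on2 L s) \<lhd>\<^bsub>C\<^esub> \<eta> A = s"
      using that(1-6) s triangle_right[of "trg D h"] by simp
  qed
  have c2: "\<epsilon> (trg D (vdom D t)) \<rhd>\<^bsub>D\<^esub> on2 L (on2 R t \<lhd>\<^bsub>C\<^esub> \<eta> A) = t"
    if "t \<in> Cel D" "src D (vdom D t) = on0 L A" for t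
  proof -
    have "\<epsilon> (trg D (vdom D t)) \<rhd>\<^bsub>D\<^esub> on2 L (on2 R t \<lhd>\<^bsub>C\<^esub> \<eta> A) = (\<epsilon> (trg D (vdom D t)) \<rhd>\<^bsub>D\<^esub> on2 L (on2 R t)) \<lhd>\<^bsub>D\<^esub> on1 L (\<eta> A)"
      using that A by simp
    also have "\<dots> = (t \<lhd>\<^bsub>D\<^esub> \<epsilon> (on0 L A)) \<lhd>\<^bsub>D\<^esub> on1 L (\<eta> A)"
      using counit.nat2[OF that(1)] that by simp
    finally show ?thesis using that A tl by simp
  qed
  show "t = t'" if "t \<in> Cel D" "t' \<in> Cel D" "src D (vdom D t) = on0 L A" "vdom D t = vdom D t'"
      "vcod D t = vcod D t'" "on2 R t \<lhd>\<^bsub>C\<^esub> \<eta> A = on2 R t' \<lhd>\<^bsub>C\<^esub> \<eta> A" for t t'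
    using c2[of t] c2[of t'] that by metis
qed

end

context two_functor
begin

text \<open>Factorizations through the new arrow are those through \<open>u\<close>, precomposed
  with \<open>h'\<close>. This moves universality between isomorphic vertices.\<close>

lemma universal_iso:
  assumes u: "universal_arrow D C F A k u"
    and h [simp]: "h \<in> Arr C" "src C h = k" "trg C h = l" "h' \<in> Arr C" "src C h' = l" "trg C h' = k"
    and iso: "h' \<cdot>\<^bsub>C\<^esub> h = id1 C k" "h \<cdot>\<^bsub>C\<^esub> h' = id1 C l"
  shows "universal_arrow D C F A l (on1 F h \<cdot>\<^bsub>D\<^esub> u)"
proof (rule universal_arrowI)
  note universal_typing[OF u, simp]
  have l [simp]: "l \<in> Obj C" using h(1,3) dom.typing_Obj by metis
  have i1 [simp]: "on1 F h' \<cdot>\<^bsub>D\<^esub> (on1 F h \<cdot>\<^bsub>D\<^esub> u) = u"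
  proof -
    have "on1 F h' \<cdot>\<^bsub>D\<^esub> (on1 F h \<cdot>\<^bsub>D\<^esub> u) = on1 F (h' \<cdot>\<^bsub>C\<^esub> h) \<cdot>\<^bsub>D\<^esub> u" by simp
    then show ?thesis by (simp add: iso del: functorial(3))
  qed
  have i2: "g \<cdot>\<^bsub>C\<^esub> (h \<cdot>\<^bsub>C\<^esub> h') = g" if "g \<in> Arr C" "src C g = l" for g
    using that by (simp add: iso)
  show "l \<in> Obj C" "on1 F h \<cdot>\<^bsub>D\<^esub> u \<in> Arr D" "src D (on1 F h \<cdot>\<^bsub>D\<^esub> u) = A" "trg D (on1 F h \<cdot>\<^bsub>D\<^esub> u) = on0 F l"
    by simp_all
  show "\<exists>g \<in> Arr C. src C g = l \<and> trg C g = X \<and> on1 F g \<cdot>\<^bsub>D\<^esub> (on1 F h \<cdot>\<^bsub>D\<^esub> u) = f"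
    if X: "X \<in> Obj C" "f \<in> Arr D" "src D f = A" "trg D f = on0 F X" for X f
  proof -
    obtain g where "g \<in> Arr C" "src C g = k" "trg C g = X" "on1 F g \<cdot>\<^bsub>D\<^esub> u = f"
      using universal_ext1[OF u X(2,3,4,1)] by blast
    then show ?thesis by (intro bexI[of _ "g \<cdot>\<^bsub>C\<^esub> h'"]) simp_all
  qed
  show "g = g'" if "g \<in> Arr C" "g' \<in> Arr C" "src C g = l" "src C g' = l" "trg C g = trg C g'"
    "on1 F g \<cdot>\<^bsub>D\<^esub> (on1 F h \<cdot>\<^bsub>D\<^esub> u) = on1 F g' \<cdot>\<^bsub>D\<^esub> (on1 F h \<cdot>\<^bsub>D\<^esub> u)" for g g'
  proof -
    have "g \<cdot>\<^bsub>C\<^esub> h = g' \<cdot>\<^bsub>C\<^esub> h" by (rule universal_cancel1[OF u]) (use that in simp_all)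
    then have "(g \<cdot>\<^bsub>C\<^esub> h) \<cdot>\<^bsub>C\<^esub> h' = (g' \<cdot>\<^bsub>C\<^esub> h) \<cdot>\<^bsub>C\<^esub> h'" by simp
    then show ?thesis using that by (simp add: iso)
  qed
  show "\<exists>t \<in> Cel C. vdom C t = g \<and> vcod C t = g' \<and> on2 F t \<lhd>\<^bsub>D\<^esub> (on1 F h \<cdot>\<^bsub>D\<^esub> u) = s"
    if g: "g \<in> Arr C" "g' \<in> Arr C" "src C g = l" "src C g' = l" "trg C g = trg C g'"
      "s \<in> Cel D" "vdom D s = on1 F g \<cdot>\<^bsub>D\<^esub> (on1 F h \<cdot>\<^bsub>D\<^esub> u)" "vcod D s = on1 F g' \<cdot>\<^bsub>D\<^esub> (on1 F h \<cdot>\<^bsub>D\<^esub> u)"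
    for g g' s
  proof -
    obtain t where "t \<in> Cel C" "vdom C t = g \<cdot>\<^bsub>C\<^esub> h" "vcod C t = g' \<cdot>\<^bsub>C\<^esub> h" "on2 F t \<lhd>\<^bsub>D\<^esub> u = s"
      by (rule universal_ext2[OF u, of s "g \<cdot>\<^bsub>C\<^esub> h" "g' \<cdot>\<^bsub>C\<^esub> h"]) (use g in simp_all)
    then show ?thesis using g
      by (intro bexI[of _ "t \<lhd>\<^bsub>C\<^esub> h'"]) (simp_all add: i2)
  qed
  show "t = t'" if t: "t \<in> Cel C" "t' \<in> Cel C" "src C (vdom C t) = l" "vdom C t = vdom C t'"
      "vcod C t = vcod C t'" "on2 F t \<lhd>\<^bsub>D\<^esub> (on1 F h \<cdot>\<^bsub>D\<^esub> u) = on2 F t' \<lhd>\<^bsub>D\<^esub> (on1 F h \<cdot>\<^bsub>D\<^esub> u)" for t t'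
  proof -
    have "src C (vdom C t') = l" using t by simp
    have "t \<lhd>\<^bsub>C\<^esub> h = t' \<lhd>\<^bsub>C\<^esub> h"
      by (rule universal_cancel2[OF u]) (use t \<open>src C (vdom C t') = l\<close> in simp_all)
    then have "(t \<lhd>\<^bsub>C\<^esub> h) \<lhd>\<^bsub>C\<^esub> h' = (t' \<lhd>\<^bsub>C\<^esub> h) \<lhd>\<^bsub>C\<^esub> h'" by simp
    then show ?thesis using t \<open>src C (vdom C t') = l\<close> by (simp add: iso)
  qed
qed

lemma universal_unique:
  assumes u: "universal_arrow D C F A k u" and v: "universal_arrow D C F A l v"
  obtains h h' where "h \<in> Arr C" "src C h = k" "trg C h = l" "h' \<in> Arr C" "src C h' = l" "trg C h' = k"
    "h' \<cdot>\<^bsub>C\<^esub> h = id1 C k" "h \<cdot>\<^bsub>C\<^esub> h' = id1 C l" "on1 F h \<cdot>\<^bsub>D\<^esub> u = v"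
proof -
  note universal_typing[OF u, simp] universal_typing[OF v, simp]
  obtain h where h: "h \<in> Arr C" "src C h = k" "trg C h = l" "on1 F h \<cdot>\<^bsub>D\<^esub> u = v"
    by (rule universal_ext1[OF u, of v l]) simp_all
  obtain h' where h': "h' \<in> Arr C" "src C h' = l" "trg C h' = k" "on1 F h' \<cdot>\<^bsub>D\<^esub> v = u"
    by (rule universal_ext1[OF v, of u k]) simp_all
  have "h' \<cdot>\<^bsub>C\<^esub> h = id1 C k" by (rule universal_cancel1[OF u]) (use h h' in simp_all)
  moreover have "h \<cdot>\<^bsub>C\<^esub> h' = id1 C l" by (rule universal_cancel1[OF v]) (use h h' in simp_all)
  ultimately show ?thesis using that h h' by blast
qed

text \<open>\<open>w\<close> differs from \<open>uP\<close> by the comparison of two products of the same 0-cells.\<close>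

lemma universal_product:
  assumes prodP: "product_0cell C kA kB kP r s" and uP: "universal_arrow D C F P kP uP"
    and uA: "universal_arrow D C F A kA uA" and uB: "universal_arrow D C F B kB uB"
    and p [simp]: "p \<in> Arr D" "src D p = P" "trg D p = A" and q [simp]: "q \<in> Arr D" "src D q = P" "trg D q = B"
    and rs: "on1 F r \<cdot>\<^bsub>D\<^esub> uP = uA \<cdot>\<^bsub>D\<^esub> p" "on1 F s \<cdot>\<^bsub>D\<^esub> uP = uB \<cdot>\<^bsub>D\<^esub> q"
    and vA: "universal_arrow D C F A lA vA" and vB: "universal_arrow D C F B lB vB"
    and prodQ: "product_0cell C lA lB Q r' s'"
    and w: "w \<in> Arr D" "src D w = P" "trg D w = on0 F Q"
    and rs': "on1 F r' \<cdot>\<^bsub>D\<^esub> w = vA \<cdot>\<^bsub>D\<^esub> p" "on1 F s' \<cdot>\<^bsub>D\<^esub> w = vB \<cdot>\<^bsub>D\<^esub> q"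
  shows "universal_arrow D C F P Q w"
proof -
  note universal_typing[OF uA, simp] universal_typing[OF uB, simp] universal_typing[OF uP, simp]
  note universal_typing[OF vA, simp] universal_typing[OF vB, simp]
  have [simp]: "r \<in> Arr C" "src C r = kP" "trg C r = kA" "s \<in> Arr C" "src C s = kP" "trg C s = kB"
    "r' \<in> Arr C" "src C r' = Q" "trg C r' = lA" "s' \<in> Arr C" "src C s' = Q" "trg C s' = lB"
    using prodP prodQ by (auto simp: product_0cell_def dom.hom_iff)
  have [simp]: "Q \<in> Obj C" using dom.typing_Obj(1)[of r'] by simp
  obtain a a' where a [simp]: "a \<in> Arr C" "src C a = kA" "trg C a = lA" "a' \<in> Arr C" "src C a' = lA" "trg C a' = kA"
    and aa: "a' \<cdot>\<^bsub>C\<^esub> a = id1 C kA" "a \<cdot>\<^bsub>C\<^esub> a' = id1 C lA" "on1 F a \<cdot>\<^bsub>D\<^esub> uA = vA"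
    using universal_unique[OF uA vA] by blast
  obtain b b' where b [simp]: "b \<in> Arr C" "src C b = kB" "trg C b = lB" "b' \<in> Arr C" "src C b' = lB" "trg C b' = kB"
    and bb: "b' \<cdot>\<^bsub>C\<^esub> b = id1 C kB" "b \<cdot>\<^bsub>C\<^esub> b' = id1 C lB" "on1 F b \<cdot>\<^bsub>D\<^esub> uB = vB"
    using universal_unique[OF uB vB] by blast
  have a1: "a \<cdot>\<^bsub>C\<^esub> (a' \<cdot>\<^bsub>C\<^esub> f) = f" if "f \<in> Arr C" "trg C f = lA" for f
    using that dom.cmp_assoc'[of f a' a] by (simp add: aa)
  have a2: "a' \<cdot>\<^bsub>C\<^esub> (a \<cdot>\<^bsub>C\<^esub> f) = f" if "f \<in> Arr C" "trg C f = kA" for f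
    using that dom.cmp_assoc'[of f a a'] by (simp add: aa)
  have b1: "b \<cdot>\<^bsub>C\<^esub> (b' \<cdot>\<^bsub>C\<^esub> f) = f" if "f \<in> Arr C" "trg C f = lB" for f
    using that dom.cmp_assoc'[of f b' b] by (simp add: bb)
  have b2: "b' \<cdot>\<^bsub>C\<^esub> (b \<cdot>\<^bsub>C\<^esub> f) = f" if "f \<in> Arr C" "trg C f = kB" for f
    using that dom.cmp_assoc'[of f b b'] by (simp add: bb)
  \<comment> \<open>The comparison of \<open>kP\<close> with \<open>Q\<close> is the factorization
    of \<open>w\<close> through \<open>uP\<close>. Its inverse cannot be found in the same way,
    since \<open>w\<close> is not yet known to be universal; it comes from the product property of
    \<open>kP\<close> and the inverses of \<open>a\<close> and \<open>b\<close>.\<close>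
  obtain h where h [simp]: "h \<in> Arr C" "src C h = kP" "trg C h = Q" and hw: "on1 F h \<cdot>\<^bsub>D\<^esub> uP = w"
    by (rule universal_ext1[OF uP w]) simp_all
  have h1: "r' \<cdot>\<^bsub>C\<^esub> h = a \<cdot>\<^bsub>C\<^esub> r"
    by (rule universal_cancel1[OF uP])
      (simp_all add: hw rs rs' flip: aa(3))
  have h2: "s' \<cdot>\<^bsub>C\<^esub> h = b \<cdot>\<^bsub>C\<^esub> s"
    by (rule universal_cancel1[OF uP])
      (simp_all add: hw rs rs' flip: bb(3))
  have "\<exists>!h'. h' \<in> hom C Q kP \<and> r \<cdot>\<^bsub>C\<^esub> h' = a' \<cdot>\<^bsub>C\<^esub> r' \<and> s \<cdot>\<^bsub>C\<^esub> h' = b' \<cdot>\<^bsub>C\<^esub> s'"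
  proof -
    have "a' \<cdot>\<^bsub>C\<^esub> r' \<in> hom C Q kA" "b' \<cdot>\<^bsub>C\<^esub> s' \<in> hom C Q kB" by (simp_all add: dom.hom_iff)
    then show ?thesis using prodP by (simp add: product_0cell_def)
  qed
  then obtain h' where h' [simp]: "h' \<in> Arr C" "src C h' = Q" "trg C h' = kP"
    and h'1: "r \<cdot>\<^bsub>C\<^esub> h' = a' \<cdot>\<^bsub>C\<^esub> r'" and h'2: "s \<cdot>\<^bsub>C\<^esub> h' = b' \<cdot>\<^bsub>C\<^esub> s'" by (auto simp: dom.hom_iff)
  \<comment> \<open>The projections of a product are jointly monic, which identifies both composites
    of \<open>h\<close> and \<open>h'\<close> with identities.\<close>
  have m: "f = g" if "product_0cell C X Y Z p q" "f \<in> Arr C" "g \<in> Arr C" "src C f = src C g" "trg C f = Z"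
    "trg C g = Z" "p \<cdot>\<^bsub>C\<^esub> f = p \<cdot>\<^bsub>C\<^esub> g" "q \<cdot>\<^bsub>C\<^esub> f = q \<cdot>\<^bsub>C\<^esub> g" for X Y Z p q f g
  proof -
    have "p \<in> hom C Z X" "q \<in> hom C Z Y" using that(1) by (auto simp: product_0cell_def)
    then have "p \<cdot>\<^bsub>C\<^esub> g \<in> hom C (src C g) X" "q \<cdot>\<^bsub>C\<^esub> g \<in> hom C (src C g) Y"
      using that(2-6) by (auto simp: dom.hom_iff)
    then have "\<exists>!h. h \<in> hom C (src C g) Z \<and> p \<cdot>\<^bsub>C\<^esub> h = p \<cdot>\<^bsub>C\<^esub> g \<and> q \<cdot>\<^bsub>C\<^esub> h = q \<cdot>\<^bsub>C\<^esub> g"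
      using that(1,3) by (simp add: product_0cell_def)
    then show ?thesis using that by (metis dom.hom_iff)
  qed
  have "r' \<cdot>\<^bsub>C\<^esub> (h \<cdot>\<^bsub>C\<^esub> h') = r'" using h1 h'1 dom.cmp_assoc'[of h' h r'] by (simp add: a1)
  moreover have "s' \<cdot>\<^bsub>C\<^esub> (h \<cdot>\<^bsub>C\<^esub> h') = s'" using h2 h'2 dom.cmp_assoc'[of h' h s'] by (simp add: b1)
  ultimately have hh': "h \<cdot>\<^bsub>C\<^esub> h' = id1 C Q" using m[OF prodQ, of "h \<cdot>\<^bsub>C\<^esub> h'" "id1 C Q"] by simp
  have "r \<cdot>\<^bsub>C\<^esub> (h' \<cdot>\<^bsub>C\<^esub> h) = r" using h1 h'1 dom.cmp_assoc'[of h h' r] by (simp add: a2)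
  moreover have "s \<cdot>\<^bsub>C\<^esub> (h' \<cdot>\<^bsub>C\<^esub> h) = s" using h2 h'2 dom.cmp_assoc'[of h h' s] by (simp add: b2)
  ultimately have h'h: "h' \<cdot>\<^bsub>C\<^esub> h = id1 C kP" using m[OF prodP, of "h' \<cdot>\<^bsub>C\<^esub> h" "id1 C kP"] by simp
  show ?thesis
    using universal_iso[OF uP h h' h'h hh'] by (simp add: hw)
qed

end

lemma (in strict_2cat) cell_hom:
  assumes "t \<in> cell D f g" "f \<in> hom D A B"
  shows "t \<in> Cel D" "vdom D t = f" "vcod D t = g" "f \<in> Arr D" "src D f = A" "trg D f = B" "A \<in> Obj D" "B \<in> Obj D"
    "g \<in> Arr D" "src D g = A" "trg D g = B"
  using assms typing_Obj[of f] typing_Arr(2)[of t] parallel[of t] by (auto simp: cell_iff hom_iff)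

context two_functor
begin

text \<open>\<open>L\<close> transposes composites with the universal arrows. Every law stated in
  \<open>C\<close> equates cells out of some \<open>k A\<close>, so it can be tested after composing
  with \<open>u A\<close>; the laws stated in \<open>D\<close> are the defining equations of the
  transposes.\<close>

lemma adjunction_of_universal_arrows:
  assumes univ: "\<And>A. A \<in> Obj D \<Longrightarrow> \<exists>k u. universal_arrow D C F A k u"
  shows "\<exists>L \<eta> \<epsilon>. two_adjunction D C L F \<eta> \<epsilon>"
proof -
  obtain k u where U: "\<And>A. A \<in> Obj D \<Longrightarrow> universal_arrow D C F A (k A) (u A)"
    using univ by metis
  note [simp] = universal_typing[OF U]
  \<comment> \<open>The choice is harmless: factorizations are unique, and uniqueness enters through
    \<open>universal_cancel1\<close>.\<close>
  define tr where "tr A X f = (SOME h. h \<in> Arr C \<and> src C h = k A \<and> trg C h = X \<and> on1 F h \<cdot>\<^bsub>D\<^esub> u A = f)" for A X f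
  have tr: "tr A X f \<in> Arr C \<and> src C (tr A X f) = k A \<and> trg C (tr A X f) = X \<and> on1 F (tr A X f) \<cdot>\<^bsub>D\<^esub> u A = f"
    if "f \<in> Arr D" "src D f = A" "trg D f = on0 F X" "X \<in> Obj C" for A X f
    unfolding tr_def by (rule someI_ex) (metis that universal_ext1 U dom.typing_Obj cod.typing_Obj)
  define L1 where "L1 f = tr (src D f) (k (trg D f)) (u (trg D f) \<cdot>\<^bsub>D\<^esub> f)" for f
  have L1 [simp]: "L1 f \<in> Arr C" "src C (L1 f) = k (src D f)" "trg C (L1 f) = k (trg D f)"
    "on1 F (L1 f) \<cdot>\<^bsub>D\<^esub> u (src D f) = u (trg D f) \<cdot>\<^bsub>D\<^esub> f" if "f \<in> Arr D" for f
    using tr[of "u (trg D f) \<cdot>\<^bsub>D\<^esub> f" "src D f" "k (trg D f)"] that by (simp_all add: L1_def)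
  have L1u: "on1 F (L1 f) \<cdot>\<^bsub>D\<^esub> u A = u (trg D f) \<cdot>\<^bsub>D\<^esub> f" if "f \<in> Arr D" "src D f = A" for f A
    using L1(4)[OF that(1)] that(2) by simp
  define L2 where "L2 t = (SOME s. s \<in> Cel C \<and> vdom C s = L1 (vdom D t) \<and> vcod C s = L1 (vcod D t) \<and>
     on2 F s \<lhd>\<^bsub>D\<^esub> u (src D (vdom D t)) = u (trg D (vdom D t)) \<rhd>\<^bsub>D\<^esub> t)" for t
  have L2': "L2 t \<in> Cel C \<and> vdom C (L2 t) = L1 (vdom D t) \<and> vcod C (L2 t) = L1 (vcod D t) \<and>
     on2 F (L2 t) \<lhd>\<^bsub>D\<^esub> u (src D (vdom D t)) = u (trg D (vdom D t)) \<rhd>\<^bsub>D\<^esub> t" if t: "t \<in> Cel D" for t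
    unfolding L2_def
  proof (rule someI_ex)
    have "src D (vdom D t) \<in> Obj D" using t by simp
    note U = U[OF this]
    show "\<exists>s. s \<in> Cel C \<and> vdom C s = L1 (vdom D t) \<and> vcod C s = L1 (vcod D t) \<and>
      on2 F s \<lhd>\<^bsub>D\<^esub> u (src D (vdom D t)) = u (trg D (vdom D t)) \<rhd>\<^bsub>D\<^esub> t"
      by (rule universal_ext2[OF U, of "u (trg D (vdom D t)) \<rhd>\<^bsub>D\<^esub> t" "L1 (vdom D t)" "L1 (vcod D t)"])
        (use t in \<open>auto simp: L1u\<close>)
  qed
  then have L2 [simp]: "L2 t \<in> Cel C" "vdom C (L2 t) = L1 (vdom D t)" "vcod C (L2 t) = L1 (vcod D t)"
    if "t \<in> Cel D" for t
    using that by blast+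
  have L2u: "on2 F (L2 t) \<lhd>\<^bsub>D\<^esub> u A = u (trg D (vdom D t)) \<rhd>\<^bsub>D\<^esub> t" if "t \<in> Cel D" "src D (vdom D t) = A" for t A
    using L2'[OF that(1)] that(2) by simp
  define e where "e X = tr (on0 F X) X (id1 D (on0 F X))" for X
  have e [simp]: "e X \<in> Arr C" "src C (e X) = k (on0 F X)" "trg C (e X) = X"
    "on1 F (e X) \<cdot>\<^bsub>D\<^esub> u (on0 F X) = id1 D (on0 F X)" if "X \<in> Obj C" for X
    using tr[of "id1 D (on0 F X)" "on0 F X" X] that by (simp_all add: e_def)
  have eu: "on1 F (e X) \<cdot>\<^bsub>D\<^esub> (u A \<cdot>\<^bsub>D\<^esub> g) = g" if "X \<in> Obj C" "g \<in> Arr D" "trg D g = on0 F X" "A = on0 F X" for X g A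
    using that cod.cmp_assoc'[of g "u A" "on1 F (e X)"] by simp
  have L1c: "on1 F (L1 f) \<cdot>\<^bsub>D\<^esub> (u A \<cdot>\<^bsub>D\<^esub> g) = u (trg D f) \<cdot>\<^bsub>D\<^esub> (f \<cdot>\<^bsub>D\<^esub> g)"
    if "f \<in> Arr D" "src D f = A" "g \<in> Arr D" "trg D g = A" for f A g
    using that L1u[OF that(1,2)] cod.cmp_assoc'[of g "u A" "on1 F (L1 f)"] by auto
  let ?L = "TwoFun k L1 L2"
  have L_fun: "two_functor D C ?L"
  proof (unfold_locales, goal_cases)
    case (4 A)
    then show ?case using universal_cancel1[OF U[OF 4], of "L1 (id1 D A)" "id1 C (k A)"] by (simp add: L1u)
  next
    case (5 f A B g E)
    then have "A \<in> Obj D" and f: "f \<in> Arr D" "g \<in> Arr D" "trg D f = B" "src D g = B" "src D f = A"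
      by (auto simp: cod.hom_iff)
    then show ?case
      using universal_cancel1[OF U[OF \<open>A \<in> Obj D\<close>], of "L1 (g \<cdot>\<^bsub>D\<^esub> f)" "L1 g \<cdot>\<^bsub>C\<^esub> L1 f"] by (simp add: L1u L1c)
  next
    case (6 f)
    then have "src D f \<in> Obj D" by simp
    then show ?case using 6 universal_cancel2[OF U[OF \<open>src D f \<in> Obj D\<close>], of "L2 (id2 D f)" "id2 C (L1 f)"] by (simp add: L1u L2u)
  next
    case (7 s f g t h)
    then have "src D f \<in> Obj D" and f: "s \<in> Cel D" "t \<in> Cel D" "vdom D s = f" "vcod D s = g" "vdom D t = g"
      "src D g = src D f" "trg D g = trg D f" "f \<in> Arr D" "g \<in> Arr D"
      using cod.parallel[of s] cod.typing_Arr[of s] cod.typing_Obj by (auto simp: cod.cell_iff)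
    have "L2 (t \<bullet>\<^bsub>D\<^esub> s) = L2 t \<bullet>\<^bsub>C\<^esub> L2 s"
      by (rule universal_cancel2[OF U[OF \<open>src D f \<in> Obj D\<close>]]) (use f in \<open>simp_all add: L2u\<close>)
    then show ?case by simp
  next
    case (8 s f f' t g g')
    then have "src D f \<in> Obj D" and f: "s \<in> Cel D" "t \<in> Cel D" "vdom D s = f" "vcod D s = f'" "vdom D t = g"
      "vcod D t = g'" "src D f' = src D f" "trg D f' = trg D f" "src D g' = src D g" "trg D g' = trg D g" "f \<in> Arr D" "g \<in> Arr D"
      "f' \<in> Arr D" "g' \<in> Arr D" "trg D f = src D g"
      using cod.parallel[of s] cod.typing_Arr[of s] cod.parallel[of t] cod.typing_Arr[of t] cod.typing_Obj
      by (auto simp: cod.cell_iff)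
    have "L2 (t \<star>\<^bsub>D\<^esub> s) = L2 t \<star>\<^bsub>C\<^esub> L2 s"
    proof (rule universal_cancel2[OF U[OF \<open>src D f \<in> Obj D\<close>]])
      show "L2 (t \<star>\<^bsub>D\<^esub> s) \<in> Cel C" "L2 t \<star>\<^bsub>C\<^esub> L2 s \<in> Cel C" "src C (vdom C (L2 (t \<star>\<^bsub>D\<^esub> s))) = k (src D f)"
        using f by simp_all
      show "vdom C (L2 (t \<star>\<^bsub>D\<^esub> s)) = vdom C (L2 t \<star>\<^bsub>C\<^esub> L2 s)"
        "vcod C (L2 (t \<star>\<^bsub>D\<^esub> s)) = vcod C (L2 t \<star>\<^bsub>C\<^esub> L2 s)"
        by (rule universal_cancel1[OF U[OF \<open>src D f \<in> Obj D\<close>]]; use f in \<open>simp add: L1u L1c\<close>)+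
      \<comment> \<open>The universal arrow is moved through the two factors in turn, past
        \<open>s\<close> first and then past \<open>t\<close>.\<close>
      have "on2 F (L2 t \<star>\<^bsub>C\<^esub> L2 s) \<lhd>\<^bsub>D\<^esub> u (src D f) = on2 F (L2 t) \<star>\<^bsub>D\<^esub> (on2 F (L2 s) \<lhd>\<^bsub>D\<^esub> u (src D f))"
        using f by simp
      also have "\<dots> = (on2 F (L2 t) \<lhd>\<^bsub>D\<^esub> u (src D g)) \<star>\<^bsub>D\<^esub> s"
        using f by (simp add: L2u[of s])
      also have "\<dots> = (u (trg D g) \<rhd>\<^bsub>D\<^esub> t) \<star>\<^bsub>D\<^esub> s"
        using f L2u[of t "src D g"] by (simp del: cod.hcmp_assoc')
      also have "\<dots> = u (trg D g) \<rhd>\<^bsub>D\<^esub> (t \<star>\<^bsub>D\<^esub> s)"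
        using f by simp
      finally show "on2 F (L2 (t \<star>\<^bsub>D\<^esub> s)) \<lhd>\<^bsub>D\<^esub> u (src D f) = on2 F (L2 t \<star>\<^bsub>C\<^esub> L2 s) \<lhd>\<^bsub>D\<^esub> u (src D f)"
        using f by (simp add: L2u)
    qed
    then show ?case by simp
  qed (auto simp: cod.hom_iff cod.cell_iff dom.hom_iff dom.cell_iff universal_typing[OF U])
  interpret L: two_functor D C ?L by (rule L_fun)
  have unit: "two_natural D D twofun_id (twofun_comp F ?L) u"
  proof (intro two_natural.intro two_natural_axioms.intro)
    show "two_functor D D twofun_id" by (rule two_functor_id[OF cod.two_category_axioms])
    show "two_functor D D (twofun_comp F ?L)"
      by (rule two_functor_comp[OF L_fun two_functor_axioms])
  qed (auto simp: cod.hom_iff cod.cell_iff universal_typing[OF U] L1u L2u)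
  have counit: "two_natural C C (twofun_comp ?L F) twofun_id e"
  proof (intro two_natural.intro two_natural_axioms.intro)
    show "two_functor C C twofun_id" by (rule two_functor_id[OF dom.two_category_axioms])
    show "two_functor C C (twofun_comp ?L F)"
      by (rule two_functor_comp[OF two_functor_axioms L_fun])
    show "e A \<in> hom C (on0 (twofun_comp ?L F) A) (on0 twofun_id A)" if "A \<in> Obj C" for A
      using that by (simp add: dom.hom_iff)
    show "e B \<cdot>\<^bsub>C\<^esub> on1 (twofun_comp ?L F) f = on1 twofun_id f \<cdot>\<^bsub>C\<^esub> e A" if "f \<in> hom C A B" for f A B
    proof -
      have f: "f \<in> Arr C" "src C f = A" "trg C f = B" "A \<in> Obj C" "B \<in> Obj C"
        using that by (auto simp: dom.hom_iff)
      have "e B \<cdot>\<^bsub>C\<^esub> L1 (on1 F f) = f \<cdot>\<^bsub>C\<^esub> e A"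
        by (rule universal_cancel1[OF U[OF on0[OF f(4)]]]) (use f in \<open>simp_all add: L1u eu\<close>)
      then show ?thesis by simp
    qed
    show "e B \<rhd>\<^bsub>C\<^esub> on2 (twofun_comp ?L F) t = on2 twofun_id t \<lhd>\<^bsub>C\<^esub> e A"
      if "t \<in> cell C f g" "f \<in> hom C A B" for t f g A B
    proof -
      have f: "t \<in> Cel C" "vdom C t = f" "vcod C t = g" "f \<in> Arr C" "src C f = A" "trg C f = B" "A \<in> Obj C" "B \<in> Obj C"
        "g \<in> Arr C" "src C g = A" "trg C g = B"
        using dom.cell_hom[OF that] by blast+
      have n: "e B \<cdot>\<^bsub>C\<^esub> L1 (on1 F f) = f \<cdot>\<^bsub>C\<^esub> e A" if "f \<in> Arr C" "src C f = A" "trg C f = B" for f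
        by (rule universal_cancel1[OF U[OF on0[OF f(7)]]]) (use f(7,8) that in \<open>simp_all add: L1u eu\<close>)
      have "e B \<rhd>\<^bsub>C\<^esub> L2 (on2 F t) = t \<lhd>\<^bsub>C\<^esub> e A"
      proof (rule universal_cancel2[OF U[OF on0[OF f(7)]]])
        have "on2 F (e B \<rhd>\<^bsub>C\<^esub> L2 (on2 F t)) \<lhd>\<^bsub>D\<^esub> u (on0 F A) = (on1 F (e B) \<cdot>\<^bsub>D\<^esub> u (on0 F B)) \<rhd>\<^bsub>D\<^esub> on2 F t"
          using f by (simp add: L2u)
        also have "\<dots> = on2 F (t \<lhd>\<^bsub>C\<^esub> e A) \<lhd>\<^bsub>D\<^esub> u (on0 F A)" using f by simp
        finally show "on2 F (e B \<rhd>\<^bsub>C\<^esub> L2 (on2 F t)) \<lhd>\<^bsub>D\<^esub> u (on0 F A) = on2 F (t \<lhd>\<^bsub>C\<^esub> e A) \<lhd>\<^bsub>D\<^esub> u (on0 F A)" .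
      qed (use f in \<open>simp_all add: n\<close>)
      then show ?thesis by simp
    qed
  qed
  have "two_adjunction D C ?L F u e"
  proof (intro two_adjunction.intro two_adjunction_axioms.intro)
    show "e (on0 ?L A) \<cdot>\<^bsub>C\<^esub> on1 ?L (u A) = id1 C (on0 ?L A)" if "A \<in> Obj D" for A
    proof -
      have "e (k A) \<cdot>\<^bsub>C\<^esub> L1 (u A) = id1 C (k A)"
        by (rule universal_cancel1[OF U[OF that]]) (use that in \<open>simp_all add: L1u eu\<close>)
      then show ?thesis by simp
    qed
  qed (use unit counit L_fun two_functor_axioms in auto)
  then show ?thesis by blast
qed

end

section \<open>Comparison of two 2-adjunctions\<close>

lemma two_natural_isoI:
  assumes "two_natural C D F G \<theta>"
    and iso: "\<And>A. A \<in> Obj C \<Longrightarrow> \<exists>h \<in> Arr D. src D h = on0 G A \<and> trg D h = on0 F A \<and>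
      h \<cdot>\<^bsub>D\<^esub> \<theta> A = id1 D (on0 F A) \<and> \<theta> A \<cdot>\<^bsub>D\<^esub> h = id1 D (on0 G A)"
  shows "two_natural_iso C D F G \<theta>"
proof -
  interpret two_natural C D F G \<theta> by fact
  obtain \<phi> where \<phi> [simp]: "\<And>A. A \<in> Obj C \<Longrightarrow> \<phi> A \<in> Arr D" "\<And>A. A \<in> Obj C \<Longrightarrow> src D (\<phi> A) = on0 G A"
    "\<And>A. A \<in> Obj C \<Longrightarrow> trg D (\<phi> A) = on0 F A" 
    "\<And>A. A \<in> Obj C \<Longrightarrow> \<phi> A \<cdot>\<^bsub>D\<^esub> \<theta> A = id1 D (on0 F A)"
    "\<And>A. A \<in> Obj C \<Longrightarrow> \<theta> A \<cdot>\<^bsub>D\<^esub> \<phi> A = id1 D (on0 G A)"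
    using iso by metis
  have \<phi>\<theta>: "\<phi> A \<cdot>\<^bsub>D\<^esub> (\<theta> A \<cdot>\<^bsub>D\<^esub> g) = g" if "A \<in> Obj C" "g \<in> Arr D" "trg D g = on0 F A" for A g
    using that S.cod.cmp_assoc'[of g "\<theta> A" "\<phi> A"] by simp
  \<comment> \<open>The inverses were chosen objectwise; their naturality is that of
    \<open>\<theta>\<close> with inverses composed on both sides.\<close>
  have "two_natural C D G F \<phi>"
  proof (intro two_natural.intro two_natural_axioms.intro)
    show "\<phi> B \<cdot>\<^bsub>D\<^esub> on1 G f = on1 F f \<cdot>\<^bsub>D\<^esub> \<phi> A" if "f \<in> hom C A B" for f A B
    proof -
      have f: "f \<in> Arr C" "src C f = A" "trg C f = B" "A \<in> Obj C" "B \<in> Obj C"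
        using that by (auto simp: S.dom.hom_iff)
      have "\<phi> B \<cdot>\<^bsub>D\<^esub> on1 G f = \<phi> B \<cdot>\<^bsub>D\<^esub> (on1 G f \<cdot>\<^bsub>D\<^esub> \<theta> A) \<cdot>\<^bsub>D\<^esub> \<phi> A" using f by simp
      also have "\<dots> = on1 F f \<cdot>\<^bsub>D\<^esub> \<phi> A" 
        using nat1[OF f(1), symmetric] f by (simp add: \<phi>\<theta>)
      finally show ?thesis .
    qed
    show "\<phi> B \<rhd>\<^bsub>D\<^esub> on2 G t = on2 F t \<lhd>\<^bsub>D\<^esub> \<phi> A" if "t \<in> cell C f g" "f \<in> hom C A B" for t f g A B
    proof -
      have f: "t \<in> Cel C" "vdom C t = f" "vcod C t = g" "f \<in> Arr C" "src C f = A" "trg C f = B" "A \<in> Obj C" "B \<in> Obj C"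
        "g \<in> Arr C" "src C g = A" "trg C g = B"
        using S.dom.cell_hom[OF that] by blast+
      have "\<phi> B \<rhd>\<^bsub>D\<^esub> on2 G t = \<phi> B \<rhd>\<^bsub>D\<^esub> ((on2 G t \<lhd>\<^bsub>D\<^esub> \<theta> A) \<lhd>\<^bsub>D\<^esub> \<phi> A)" using f by simp
      also have "\<dots> = (\<phi> B \<cdot>\<^bsub>D\<^esub> \<theta> B) \<rhd>\<^bsub>D\<^esub> (on2 F t \<lhd>\<^bsub>D\<^esub> \<phi> A)"
        using nat2[OF f(1), symmetric] f by (simp del: \<phi>(4,5))
      also have "\<dots> = on2 F t \<lhd>\<^bsub>D\<^esub> \<phi> A" using f by simp
      finally show ?thesis .
    qed
  qed (auto simp: S.cod.hom_iff S.two_functor_axioms T.two_functor_axioms)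
  then show ?thesis using assms(1) \<phi>(4,5) by (auto simp: two_natural_iso_def)
qed

text \<open>Precomposed with the second unit, the component \<open>\<kappa> A\<close> becomes the
  image under \<open>H\<close> of the first unit. So it compares two universal arrows, and is
  invertible, as soon as that image is universal. It suffices that one universal arrow at
  \<open>A\<close> has a universal image: the unit differs from it by an isomorphism, and
  \<open>G\<close> preserves isomorphisms.\<close>

lemma comparison_iso:
  fixes C :: "('o, 'a, 'c, 'y) twocat_scheme" and D :: "('p, 'b, 'd, 'z) twocat_scheme"
    and C' :: "('o', 'a', 'c', 'y') twocat_scheme" and D' :: "('p', 'b', 'd', 'z') twocat_scheme"
  assumes adj: "two_adjunction C D L R \<eta> \<epsilon>" and adj': "two_adjunction C' D' L' R' \<eta>' \<epsilon>'"
    and G: "two_functor D D' G" and H: "two_functor C C' H"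
    and comm0: "\<And>X. X \<in> Obj D \<Longrightarrow> on0 H (on0 R X) = on0 R' (on0 G X)"
    and comm1: "\<And>f. f \<in> Arr D \<Longrightarrow> on1 H (on1 R f) = on1 R' (on1 G f)"
    and comm2: "\<And>t. t \<in> Cel D \<Longrightarrow> on2 H (on2 R t) = on2 R' (on2 G t)"
    and univ: "\<And>A. A \<in> Obj C \<Longrightarrow>
      \<exists>k u. universal_arrow C D R A k u \<and> universal_arrow C' D' R' (on0 H A) (on0 G k) (on1 H u)"
  shows "two_natural_iso C D' (twofun_comp L' H) (twofun_comp G L)
    (\<lambda>A. \<epsilon>' (on0 G (on0 L A)) \<cdot>\<^bsub>D'\<^esub> on1 L' (on1 H (\<eta> A)))"
proof -
  interpret two_adjunction C D L R \<eta> \<epsilon> by (rule adj)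
  interpret adj': two_adjunction C' D' L' R' \<eta>' \<epsilon>' by (rule adj')
  interpret G: two_functor D D' G by (rule G)
  interpret H: two_functor C C' H by (rule H)
  note unit.typing_component [simp] adj'.unit.typing_component [simp]
    adj'.counit.typing_component [simp] comm0 [simp] comm1 [simp] comm2 [simp]
  define \<kappa> where "\<kappa> A = \<epsilon>' (on0 G (on0 L A)) \<cdot>\<^bsub>D'\<^esub> on1 L' (on1 H (\<eta> A))" for A
  have \<kappa> [simp]: "\<kappa> A \<in> Arr D'" "src D' (\<kappa> A) = on0 L' (on0 H A)" "trg D' (\<kappa> A) = on0 G (on0 L A)"
    if "A \<in> Obj C" for A
    using that by (simp_all add: \<kappa>_def)
  have tr: "on1 R' (\<epsilon>' X) \<cdot>\<^bsub>C'\<^esub> (\<eta>' (on0 R' X) \<cdot>\<^bsub>C'\<^esub> f) = f"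
    if "X \<in> Obj D'" "f \<in> Arr C'" "trg C' f = on0 R' X" for X f
    using adj'.triangle_right[OF that(1)] that 
      adj'.unit.S.dom.cmp_assoc'[of f "\<eta>' (on0 R' X)" "on1 R' (\<epsilon>' X)"] by simp
  have \<kappa>\<eta>: "on1 R' (\<kappa> A) \<cdot>\<^bsub>C'\<^esub> \<eta>' (on0 H A) = on1 H (\<eta> A)" if "A \<in> Obj C" for A
  proof -
    have "on1 R' (\<kappa> A) \<cdot>\<^bsub>C'\<^esub> \<eta>' (on0 H A) =
      on1 R' (\<epsilon>' (on0 G (on0 L A))) \<cdot>\<^bsub>C'\<^esub> (on1 R' (on1 L' (on1 H (\<eta> A))) \<cdot>\<^bsub>C'\<^esub> \<eta>' (on0 H A))"
      using that by (simp add: \<kappa>_def)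
    also have "\<dots> = on1 R' (\<epsilon>' (on0 G (on0 L A))) \<cdot>\<^bsub>C'\<^esub> (\<eta>' (on0 R' (on0 G (on0 L A))) \<cdot>\<^bsub>C'\<^esub> on1 H (\<eta> A))"
      using that adj'.unit.nat1[of "on1 H (\<eta> A)"] by simp
    also have "\<dots> = on1 H (\<eta> A)" using that by (simp add: tr)
    finally show ?thesis .
  qed
  note U = adj'.unit_universal[OF H.on0]
  have fun1: "two_functor C D' (twofun_comp L' H)"
    by (rule two_functor_comp[OF H adj'.left.two_functor_axioms])
  have fun2: "two_functor C D' (twofun_comp G L)"
    by (rule two_functor_comp[OF left.two_functor_axioms G])
  \<comment> \<open>Naturality equates 1-cells out of \<open>on0 L' (on0 H A)\<close>, so it is
    tested after composing with \<open>\<eta>'\<close>.\<close>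
  have n1: "\<kappa> (trg C f) \<cdot>\<^bsub>D'\<^esub> on1 L' (on1 H f) = on1 G (on1 L f) \<cdot>\<^bsub>D'\<^esub> \<kappa> A"
    if f: "f \<in> Arr C" "src C f = A" for f A
  proof (rule adj'.right.universal_cancel1[OF U])
    have "A \<in> Obj C" using f by auto
    have "on1 R' (on1 L' (on1 H f)) \<cdot>\<^bsub>C'\<^esub> \<eta>' (on0 H A) = \<eta>' (on0 H (trg C f)) \<cdot>\<^bsub>C'\<^esub> on1 H f"
      using f adj'.unit.nat1[of "on1 H f"] by simp
    then have "on1 R' (\<kappa> (trg C f) \<cdot>\<^bsub>D'\<^esub> on1 L' (on1 H f)) \<cdot>\<^bsub>C'\<^esub> \<eta>' (on0 H A) =
       (on1 R' (\<kappa> (trg C f)) \<cdot>\<^bsub>C'\<^esub> \<eta>' (on0 H (trg C f))) \<cdot>\<^bsub>C'\<^esub> on1 H f"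
      using f \<open>A \<in> Obj C\<close> by simp
    also have "\<dots> = on1 H (\<eta> (trg C f) \<cdot>\<^bsub>C\<^esub> f)" using f \<open>A \<in> Obj C\<close> by (simp add: \<kappa>\<eta>)
    also have "\<dots> = on1 H (on1 R (on1 L f) \<cdot>\<^bsub>C\<^esub> \<eta> A)" using unit.nat1[of f] f by simp
    also have "\<dots> = on1 R' (on1 G (on1 L f)) \<cdot>\<^bsub>C'\<^esub> on1 H (\<eta> A)" using f \<open>A \<in> Obj C\<close> by simp
    also have "\<dots> = on1 R' (on1 G (on1 L f) \<cdot>\<^bsub>D'\<^esub> \<kappa> A) \<cdot>\<^bsub>C'\<^esub> \<eta>' (on0 H A)"
      using f \<open>A \<in> Obj C\<close> by (simp add: \<kappa>\<eta>)
    finally show "on1 R' (\<kappa> (trg C f) \<cdot>\<^bsub>D'\<^esub> on1 L' (on1 H f)) \<cdot>\<^bsub>C'\<^esub> \<eta>' (on0 H A) =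
      on1 R' (on1 G (on1 L f) \<cdot>\<^bsub>D'\<^esub> \<kappa> A) \<cdot>\<^bsub>C'\<^esub> \<eta>' (on0 H A)" .
  qed (use f in auto)
  have n2: "\<kappa> B \<rhd>\<^bsub>D'\<^esub> on2 L' (on2 H t) = on2 G (on2 L t) \<lhd>\<^bsub>D'\<^esub> \<kappa> A"
    if t: "t \<in> Cel C" "vdom C t = f" "vcod C t = g" "f \<in> Arr C" "src C f = A" "trg C f = B" "A \<in> Obj C" "B \<in> Obj C"
      "g \<in> Arr C" "src C g = A" "trg C g = B" for t f g A B
  proof (rule adj'.right.universal_cancel2[OF U])
    have nf: "\<kappa> B \<cdot>\<^bsub>D'\<^esub> on1 L' (on1 H f) = on1 G (on1 L f) \<cdot>\<^bsub>D'\<^esub> \<kappa> A" "\<kappa> B \<cdot>\<^bsub>D'\<^esub> on1 L' (on1 H g) = on1 G (on1 L g) \<cdot>\<^bsub>D'\<^esub> \<kappa> A"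
      using n1[of f A] n1[of g A] t by auto
    have "on2 R' (on2 L' (on2 H t)) \<lhd>\<^bsub>C'\<^esub> \<eta>' (on0 H A) = \<eta>' (on0 H B) \<rhd>\<^bsub>C'\<^esub> on2 H t"
      using t adj'.unit.nat2[of "on2 H t"] by simp
    then have "on2 R' (\<kappa> B \<rhd>\<^bsub>D'\<^esub> on2 L' (on2 H t)) \<lhd>\<^bsub>C'\<^esub> \<eta>' (on0 H A) =
       (on1 R' (\<kappa> B) \<cdot>\<^bsub>C'\<^esub> \<eta>' (on0 H B)) \<rhd>\<^bsub>C'\<^esub> on2 H t"
      using t by simp
    also have "\<dots> = on2 H (\<eta> B \<rhd>\<^bsub>C\<^esub> t)" using t by (simp add: \<kappa>\<eta>)
    also have "\<dots> = on2 H (on2 R (on2 L t) \<lhd>\<^bsub>C\<^esub> \<eta> A)" using unit.nat2[of t] t by simp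
    also have "\<dots> = on2 R' (on2 G (on2 L t)) \<lhd>\<^bsub>C'\<^esub> on1 H (\<eta> A)" using t by simp
    also have "\<dots> = on2 R' (on2 G (on2 L t) \<lhd>\<^bsub>D'\<^esub> \<kappa> A) \<lhd>\<^bsub>C'\<^esub> \<eta>' (on0 H A)"
      using t by (simp add: \<kappa>\<eta>)
    finally show "on2 R' (\<kappa> B \<rhd>\<^bsub>D'\<^esub> on2 L' (on2 H t)) \<lhd>\<^bsub>C'\<^esub> \<eta>' (on0 H A) = 
      on2 R' (on2 G (on2 L t) \<lhd>\<^bsub>D'\<^esub> \<kappa> A) \<lhd>\<^bsub>C'\<^esub> \<eta>' (on0 H A)" .
    show "vdom D' (\<kappa> B \<rhd>\<^bsub>D'\<^esub> on2 L' (on2 H t)) = vdom D' (on2 G (on2 L t) \<lhd>\<^bsub>D'\<^esub> \<kappa> A)" using t nf by simp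
    show "vcod D' (\<kappa> B \<rhd>\<^bsub>D'\<^esub> on2 L' (on2 H t)) = vcod D' (on2 G (on2 L t) \<lhd>\<^bsub>D'\<^esub> \<kappa> A)" using t nf by simp
  qed (use t in simp_all)
  have "two_natural_iso C D' (twofun_comp L' H) (twofun_comp G L) \<kappa>"
  proof (rule two_natural_isoI)
    show "two_natural C D' (twofun_comp L' H) (twofun_comp G L) \<kappa>"
    proof (intro two_natural.intro two_natural_axioms.intro fun1 fun2)
      show "\<kappa> A \<in> hom D' (on0 (twofun_comp L' H) A) (on0 (twofun_comp G L) A)" if "A \<in> Obj C" for A
        using that by (simp add: hom_def)
      show "\<kappa> B \<cdot>\<^bsub>D'\<^esub> on1 (twofun_comp L' H) f = on1 (twofun_comp G L) f \<cdot>\<^bsub>D'\<^esub> \<kappa> A" if "f \<in> hom C A B" for f A B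
        using that n1 by (auto simp: unit.S.dom.hom_iff)
      show "\<kappa> B \<rhd>\<^bsub>D'\<^esub> on2 (twofun_comp L' H) t = on2 (twofun_comp G L) t \<lhd>\<^bsub>D'\<^esub> \<kappa> A"
        if "t \<in> cell C f g" "f \<in> hom C A B" for t f g A B
        using n2[OF unit.S.dom.cell_hom[OF that]] by simp
    qed
    show "\<exists>h \<in> Arr D'. src D' h = on0 (twofun_comp G L) A \<and> trg D' h = on0 (twofun_comp L' H) A \<and>
      h \<cdot>\<^bsub>D'\<^esub> \<kappa> A = id1 D' (on0 (twofun_comp L' H) A) \<and> \<kappa> A \<cdot>\<^bsub>D'\<^esub> h = id1 D' (on0 (twofun_comp G L) A)"
      if A: "A \<in> Obj C" for A
    proof -
      obtain k u where u: "universal_arrow C D R A k u"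
        and u': "universal_arrow C' D' R' (on0 H A) (on0 G k) (on1 H u)" using univ[OF A] by blast
      note right.universal_typing[OF u, simp]
      obtain h h' where h: "h \<in> Arr D" "src D h = k" "trg D h = on0 L A" "h' \<in> Arr D" "src D h' = on0 L A"
        "trg D h' = k" "h' \<cdot>\<^bsub>D\<^esub> h = id1 D k" "h \<cdot>\<^bsub>D\<^esub> h' = id1 D (on0 L A)" "on1 R h \<cdot>\<^bsub>C\<^esub> u = \<eta> A"
        by (rule right.universal_unique[OF u unit_universal[OF A]])
      have i1: "on1 G h' \<cdot>\<^bsub>D'\<^esub> on1 G h = id1 D' (on0 G k)"
        using h G.functorial(3)[of h h'] by simp
      have i2: "on1 G h \<cdot>\<^bsub>D'\<^esub> on1 G h' = id1 D' (on0 G (on0 L A))"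
        using h A G.functorial(3)[of h' h] by simp
      \<comment> \<open>The unit is \<open>u\<close> followed by the isomorphism \<open>h\<close>,
        so universality of its image is transported along \<open>on1 G h\<close>.\<close>
      have "on1 H (\<eta> A) = on1 R' (on1 G h) \<cdot>\<^bsub>C'\<^esub> on1 H u"
        using h H.functorial(3)[of u "on1 R h"] by simp
      then have v: "universal_arrow C' D' R' (on0 H A) (on0 G (on0 L A)) (on1 H (\<eta> A))"
        using adj'.right.universal_iso[OF u' _ _ _ _ _ _ i1 i2] h by simp
      obtain g g' where g: "g \<in> Arr D'" "src D' g = on0 L' (on0 H A)" "trg D' g = on0 G (on0 L A)" "g' \<in> Arr D'"
        "src D' g' = on0 G (on0 L A)"
        "trg D' g' = on0 L' (on0 H A)" "g' \<cdot>\<^bsub>D'\<^esub> g = id1 D' (on0 L' (on0 H A))" "g \<cdot>\<^bsub>D'\<^esub> g' = id1 D' (on0 G (on0 L A))"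
        "on1 R' g \<cdot>\<^bsub>C'\<^esub> \<eta>' (on0 H A) = on1 H (\<eta> A)"
        by (rule adj'.right.universal_unique[OF U[OF A] v])
      have "g = \<kappa> A"
        by (rule adj'.right.universal_cancel1[OF U[OF A]]) (use g A \<kappa>\<eta> in simp_all)
      then show ?thesis using g by auto
    qed
  qed
  then show ?thesis by (simp add: \<kappa>_def[abs_def])
qed

text \<open>\<open>L (R T)\<close> and \<open>T\<close> are both terminal, hence isomorphic, and the
  unit followed by this isomorphism can only be the identity because \<open>R T\<close> is
  terminal.\<close>

lemma (in two_adjunction) universal_terminal:
  assumes T: "terminal_0cell D T" and RT: "terminal_0cell C (on0 R T)"
    and LRT: "terminal_0cell D (on0 L (on0 R T))"
  shows "universal_arrow C D R (on0 R T) T (id1 C (on0 R T))"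
proof -
  have [simp]: "T \<in> Obj D" using T by (simp add: terminal_0cell_def)
  let ?K = "on0 L (on0 R T)"
  have ex: "\<exists>h. h \<in> Arr E \<and> src E h = X \<and> trg E h = Y" if "terminal_0cell E Y" "X \<in> Obj E" for E X Y
    using that by (auto simp: terminal_0cell_def hom_def)
  have uniq: "h = h'" if "terminal_0cell E Y" "X \<in> Obj E" "h \<in> Arr E" "src E h = X" "trg E h = Y"
    "h' \<in> Arr E" "src E h' = X" "trg E h' = Y" for E X Y h h'
    using that unfolding terminal_0cell_def hom_def by blast
  obtain h where h: "h \<in> Arr D" "src D h = ?K" "trg D h = T" using ex[OF T, of ?K] by auto
  obtain h' where h': "h' \<in> Arr D" "src D h' = T" "trg D h' = ?K" using ex[OF LRT, of T] by auto
  have "on1 R h \<cdot>\<^bsub>C\<^esub> \<eta> (on0 R T) = id1 C (on0 R T)"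
    by (rule uniq[OF RT, of "on0 R T"]) (use h unit.typing_component[of "on0 R T"] in auto)
  moreover have "h' \<cdot>\<^bsub>D\<^esub> h = id1 D ?K"
    by (rule uniq[OF LRT, of ?K]) (use h h' in auto)
  moreover have "h \<cdot>\<^bsub>D\<^esub> h' = id1 D T"
    by (rule uniq[OF T, of T]) (use h h' in auto)
  ultimately show ?thesis
    using right.universal_iso[OF unit_universal[of "on0 R T"] h h'] by simp
qed

section \<open>The 2-category of graded monads\<close>

text \<open>Shared by \<open>GMnd\<close> and \<open>Mon\<close>. Their 2-cells are framed 2-cells
  of \<open>D\<close>, so equations between them hold because they hold in \<open>D\<close> for the
  contents and among 1-cells for the frames. Each construction still has to supply its category of
  1-cells and the closure of its 2-cells under the compositions. \<open>b\<close> and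
  \<open>b0\<close> stand for the underlying 1-cell and 0-cell.\<close>

lemma (in strict_2cat) framed_two_category:
  fixes E :: "('x, 'y, ('y, 'c) framed) twocat"
  assumes sel [simp]: "vdom E = fdom" "vcod E = fcod" "id2 E = (\<lambda>W. Framed W W (id2 D (b W)))"
      "vcmp E = (\<lambda>T S. Framed (fdom S) (fcod T) (fcell T \<bullet> fcell S))"
      "hcmp E = (\<lambda>T S. Framed (cmp E (fdom T) (fdom S)) (cmp E (fcod T) (fcod S)) (fcell T \<star> fcell S))"
    and b0 [simp]: "\<And>A. A \<in> Obj E \<Longrightarrow> b0 A \<in> Obj D"
    and arr [simp]: "\<And>f. f \<in> Arr E \<Longrightarrow> src E f \<in> Obj E" "\<And>f. f \<in> Arr E \<Longrightarrow> trg E f \<in> Obj E"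
      "\<And>f. f \<in> Arr E \<Longrightarrow> b f \<in> Arr D" "\<And>f. f \<in> Arr E \<Longrightarrow> src D (b f) = b0 (src E f)"
      "\<And>f. f \<in> Arr E \<Longrightarrow> trg D (b f) = b0 (trg E f)"
    and id1 [simp]: "\<And>A. A \<in> Obj E \<Longrightarrow> id1 E A \<in> Arr E" "\<And>A. A \<in> Obj E \<Longrightarrow> src E (id1 E A) = A"
      "\<And>A. A \<in> Obj E \<Longrightarrow> trg E (id1 E A) = A" "\<And>A. A \<in> Obj E \<Longrightarrow> b (id1 E A) = id1 D (b0 A)"
    and cmp [simp]: "\<And>f g. f \<in> Arr E \<Longrightarrow> g \<in> Arr E \<Longrightarrow> trg E f = src E g \<Longrightarrow> cmp E g f \<in> Arr E"
      "\<And>f g. f \<in> Arr E \<Longrightarrow> g \<in> Arr E \<Longrightarrow> trg E f = src E g \<Longrightarrow> src E (cmp E g f) = src E f"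
      "\<And>f g. f \<in> Arr E \<Longrightarrow> g \<in> Arr E \<Longrightarrow> trg E f = src E g \<Longrightarrow> trg E (cmp E g f) = trg E g"
      "\<And>f g. f \<in> Arr E \<Longrightarrow> g \<in> Arr E \<Longrightarrow> trg E f = src E g \<Longrightarrow> b (cmp E g f) = b g \<cdot> b f"
    and cat [simp]: "\<And>f. f \<in> Arr E \<Longrightarrow> cmp E (id1 E (trg E f)) f = f"
      "\<And>f. f \<in> Arr E \<Longrightarrow> cmp E f (id1 E (src E f)) = f"
      "\<And>f g h. f \<in> Arr E \<Longrightarrow> g \<in> Arr E \<Longrightarrow> h \<in> Arr E \<Longrightarrow> trg E f = src E g \<Longrightarrow> trg E g = src E h \<Longrightarrow>
        cmp E (cmp E h g) f = cmp E h (cmp E g f)"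
    and cel [simp]: "\<And>t. t \<in> Cel E \<Longrightarrow> fdom t \<in> Arr E" "\<And>t. t \<in> Cel E \<Longrightarrow> fcod t \<in> Arr E"
      "\<And>t. t \<in> Cel E \<Longrightarrow> src E (fcod t) = src E (fdom t)" "\<And>t. t \<in> Cel E \<Longrightarrow> trg E (fcod t) = trg E (fdom t)"
      "\<And>t. t \<in> Cel E \<Longrightarrow> fcell t \<in> Cel D" "\<And>t. t \<in> Cel E \<Longrightarrow> vdom D (fcell t) = b (fdom t)"
      "\<And>t. t \<in> Cel E \<Longrightarrow> vcod D (fcell t) = b (fcod t)"
    and closed [simp]: "\<And>f. f \<in> Arr E \<Longrightarrow> Framed f f (id2 D (b f)) \<in> Cel E"
      "\<And>s t. s \<in> Cel E \<Longrightarrow> t \<in> Cel E \<Longrightarrow> fcod s = fdom t \<Longrightarrow> Framed (fdom s) (fcod t) (fcell t \<bullet> fcell s) \<in> Cel E"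
      "\<And>s t. s \<in> Cel E \<Longrightarrow> t \<in> Cel E \<Longrightarrow> trg E (fdom s) = src E (fdom t) \<Longrightarrow>
        Framed (cmp E (fdom t) (fdom s)) (cmp E (fcod t) (fcod s)) (fcell t \<star> fcell s) \<in> Cel E"
  shows "two_category E"
proof -
  have h: "f \<in> hom E A B \<longleftrightarrow> f \<in> Arr E \<and> src E f = A \<and> trg E f = B" for f A B by (simp add: hom_def)
  have c: "t \<in> cell E f g \<longleftrightarrow> t \<in> Cel E \<and> fdom t = f \<and> fcod t = g" for t f g by (simp add: cell_def)
  have [simp]: "cmp E (id1 E B) f = f" if "f \<in> Arr E" "trg E f = B" for f B
    using that cat(1) by blast
  have [simp]: "cmp E f (id1 E B) = f" if "f \<in> Arr E" "src E f = B" for f B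
    using that cat(2) by blast
  show ?thesis
  proof (unfold_locales, goal_cases)
    case (22 s f f' s' f'' t g g' t' g'')
    then have s: "s \<in> Cel E" "s' \<in> Cel E" "t \<in> Cel E" "t' \<in> Cel E" "fdom s = f" "fcod s = f'" "fdom s' = f'" "fcod s' = f''"
      "fdom t = g" "fcod t = g'" "fdom t' = g'" "fcod t' = g''" "trg E f = src E g" by (auto simp: c)
    then have "vcod D (fcell s) = vdom D (fcell s')" "vcod D (fcell t) = vdom D (fcell t')"
      "trg D (vdom D (fcell s)) = src D (vdom D (fcell t))" using arr cel by metis+
    then show ?case using s by (simp add: interchange')
  qed (auto simp: h c framed.expand)
qed

locale graded = strict_2cat D + monoidal_category M
  for D :: "('o, 'a, 'c, 'z) twocat_scheme" (structure) and M :: "('m, 'n) moncat"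
begin

lemma Mhom_iff: "f \<in> Mhom M x y \<longleftrightarrow> f \<in> MAr M \<and> Mdom M f = x \<and> Mcod M f = y"
  by (simp add: Mhom_def)

lemma typing_M [simp]:
  "f \<in> MAr M \<Longrightarrow> Mdom M f \<in> MOb M" "f \<in> MAr M \<Longrightarrow> Mcod M f \<in> MOb M"
  "x \<in> MOb M \<Longrightarrow> Mid M x \<in> MAr M" "x \<in> MOb M \<Longrightarrow> Mdom M (Mid M x) = x" "x \<in> MOb M \<Longrightarrow> Mcod M (Mid M x) = x"
  "MI M \<in> MOb M" "x \<in> MOb M \<Longrightarrow> y \<in> MOb M \<Longrightarrow> x \<otimes>\<^bsub>M\<^esub> y \<in> MOb M"
  using Mid_Mhom by (auto simp: Mdom_MOb Mcod_MOb Mhom_iff MI_MOb Mten_MOb)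

lemma typing_M_coh [simp]:
  "x \<in> MOb M \<Longrightarrow> y \<in> MOb M \<Longrightarrow> z \<in> MOb M \<Longrightarrow> Massoc M x y z \<in> MAr M"
  "x \<in> MOb M \<Longrightarrow> y \<in> MOb M \<Longrightarrow> z \<in> MOb M \<Longrightarrow> Mdom M (Massoc M x y z) = x \<otimes>\<^bsub>M\<^esub> (y \<otimes>\<^bsub>M\<^esub> z)"
  "x \<in> MOb M \<Longrightarrow> y \<in> MOb M \<Longrightarrow> z \<in> MOb M \<Longrightarrow> Mcod M (Massoc M x y z) = (x \<otimes>\<^bsub>M\<^esub> y) \<otimes>\<^bsub>M\<^esub> z"
  "x \<in> MOb M \<Longrightarrow> Mlunit M x \<in> MAr M" "x \<in> MOb M \<Longrightarrow> Mdom M (Mlunit M x) = MI M \<otimes>\<^bsub>M\<^esub> x"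
  "x \<in> MOb M \<Longrightarrow> Mcod M (Mlunit M x) = x"
  "x \<in> MOb M \<Longrightarrow> Mrunit M x \<in> MAr M" "x \<in> MOb M \<Longrightarrow> Mdom M (Mrunit M x) = x \<otimes>\<^bsub>M\<^esub> MI M"
  "x \<in> MOb M \<Longrightarrow> Mcod M (Mrunit M x) = x"
  using Massoc_Miso[of x y z] Mlunit_Miso[of x] Mrunit_Miso[of x] by (auto simp: Miso_def Mhom_iff)

lemma typing_M_tenA [simp]:
  "f \<in> MAr M \<Longrightarrow> g \<in> MAr M \<Longrightarrow> f \<otimes>\<^sub>A\<^bsub>M\<^esub> g \<in> MAr M"
  "f \<in> MAr M \<Longrightarrow> g \<in> MAr M \<Longrightarrow> Mdom M (f \<otimes>\<^sub>A\<^bsub>M\<^esub> g) = Mdom M f \<otimes>\<^bsub>M\<^esub> Mdom M g"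
  "f \<in> MAr M \<Longrightarrow> g \<in> MAr M \<Longrightarrow> Mcod M (f \<otimes>\<^sub>A\<^bsub>M\<^esub> g) = Mcod M f \<otimes>\<^bsub>M\<^esub> Mcod M g"
  "f \<in> MAr M \<Longrightarrow> g \<in> MAr M \<Longrightarrow> Mcod M f = Mdom M g \<Longrightarrow> g \<circ>\<^sub>M\<^bsub>M\<^esub> f \<in> MAr M"
  "f \<in> MAr M \<Longrightarrow> g \<in> MAr M \<Longrightarrow> Mcod M f = Mdom M g \<Longrightarrow> Mdom M (g \<circ>\<^sub>M\<^bsub>M\<^esub> f) = Mdom M f"
  "f \<in> MAr M \<Longrightarrow> g \<in> MAr M \<Longrightarrow> Mcod M f = Mdom M g \<Longrightarrow> Mcod M (g \<circ>\<^sub>M\<^bsub>M\<^esub> f) = Mcod M g"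
  using MtenA_Mhom[of f "Mdom M f" "Mcod M f" g "Mdom M g" "Mcod M g"]
    Mcmp_Mhom[of f "Mdom M f" "Mcod M f" g "Mcod M g"] by (auto simp: Mhom_iff)

lemma graded_monad_typing:
  assumes "graded_monad M D A"
  shows "gbase A \<in> Obj D"
    "x \<in> MOb M \<Longrightarrow> gobj A x \<in> Arr D" "x \<in> MOb M \<Longrightarrow> src D (gobj A x) = gbase A" "x \<in> MOb M \<Longrightarrow> trg D (gobj A x) = gbase A"
    "f \<in> MAr M \<Longrightarrow> garr A f \<in> Cel D" "f \<in> MAr M \<Longrightarrow> vdom D (garr A f) = gobj A (Mdom M f)"
    "f \<in> MAr M \<Longrightarrow> vcod D (garr A f) = gobj A (Mcod M f)"
    "x \<in> MOb M \<Longrightarrow> y \<in> MOb M \<Longrightarrow> gmult A x y \<in> Cel D"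
    "x \<in> MOb M \<Longrightarrow> y \<in> MOb M \<Longrightarrow> vdom D (gmult A x y) = gobj A x \<cdot> gobj A y"
    "x \<in> MOb M \<Longrightarrow> y \<in> MOb M \<Longrightarrow> vcod D (gmult A x y) = gobj A (x \<otimes>\<^bsub>M\<^esub> y)"
    "gunit A \<in> Cel D" "vdom D (gunit A) = id1 D (gbase A)" "vcod D (gunit A) = gobj A (MI M)"
  using assms by (auto simp: graded_monad_def Let_def PiE_iff hom_iff cell_iff)

lemma graded_monad_eqs:
  assumes "graded_monad M D A"
  shows "x \<in> MOb M \<Longrightarrow> garr A (Mid M x) = id2 D (gobj A x)"
    "f \<in> MAr M \<Longrightarrow> g \<in> MAr M \<Longrightarrow> Mcod M f = Mdom M g \<Longrightarrow> garr A (g \<circ>\<^sub>M\<^bsub>M\<^esub> f) = garr A g \<bullet> garr A f"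
    "f \<in> MAr M \<Longrightarrow> g \<in> MAr M \<Longrightarrow> gmult A (Mcod M f) (Mcod M g) \<bullet> (garr A f \<star> garr A g) =
      garr A (f \<otimes>\<^sub>A\<^bsub>M\<^esub> g) \<bullet> gmult A (Mdom M f) (Mdom M g)"
    "x \<in> MOb M \<Longrightarrow> y \<in> MOb M \<Longrightarrow> z \<in> MOb M \<Longrightarrow> gmult A (x \<otimes>\<^bsub>M\<^esub> y) z \<bullet> (gmult A x y \<lhd> gobj A z) =
         garr A (Massoc M x y z) \<bullet> gmult A x (y \<otimes>\<^bsub>M\<^esub> z) \<bullet> (gobj A x \<rhd> gmult A y z)"
    "x \<in> MOb M \<Longrightarrow> garr A (Mrunit M x) \<bullet> gmult A x (MI M) \<bullet> (gobj A x \<rhd> gunit A) = id2 D (gobj A x)"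
    "x \<in> MOb M \<Longrightarrow> garr A (Mlunit M x) \<bullet> gmult A (MI M) x \<bullet> (gunit A \<lhd> gobj A x) = id2 D (gobj A x)"
  using assms by (simp_all add: graded_monad_def Let_def Mhom_iff)

lemma graded_monadI:
  assumes "gobj A \<in> extensional (MOb M)" "garr A \<in> extensional (MAr M)" "gmult A \<in> extensional (MOb M)"
    "\<And>x. x \<in> MOb M \<Longrightarrow> gmult A x \<in> extensional (MOb M)"
    "gbase A \<in> Obj D"
    "\<And>x. x \<in> MOb M \<Longrightarrow> gobj A x \<in> hom D (gbase A) (gbase A)"
    "\<And>f. f \<in> MAr M \<Longrightarrow> garr A f \<in> cell D (gobj A (Mdom M f)) (gobj A (Mcod M f))"
    "\<And>x y. x \<in> MOb M \<Longrightarrow> y \<in> MOb M \<Longrightarrow> gmult A x y \<in> cell D (gobj A x \<cdot> gobj A y) (gobj A (x \<otimes>\<^bsub>M\<^esub> y))"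
    "gunit A \<in> cell D (id1 D (gbase A)) (gobj A (MI M))"
    "\<And>x. x \<in> MOb M \<Longrightarrow> garr A (Mid M x) = id2 D (gobj A x)"
    "\<And>f g. f \<in> MAr M \<Longrightarrow> g \<in> MAr M \<Longrightarrow> Mcod M f = Mdom M g \<Longrightarrow> garr A (g \<circ>\<^sub>M\<^bsub>M\<^esub> f) = garr A g \<bullet> garr A f"
    "\<And>f g. f \<in> MAr M \<Longrightarrow> g \<in> MAr M \<Longrightarrow> gmult A (Mcod M f) (Mcod M g) \<bullet> (garr A f \<star> garr A g) =
      garr A (f \<otimes>\<^sub>A\<^bsub>M\<^esub> g) \<bullet> gmult A (Mdom M f) (Mdom M g)"
    "\<And>x y z. x \<in> MOb M \<Longrightarrow> y \<in> MOb M \<Longrightarrow> z \<in> MOb M \<Longrightarrow> gmult A (x \<otimes>\<^bsub>M\<^esub> y) z \<bullet> (gmult A x y \<lhd> gobj A z) =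
         garr A (Massoc M x y z) \<bullet> gmult A x (y \<otimes>\<^bsub>M\<^esub> z) \<bullet> (gobj A x \<rhd> gmult A y z)"
    "\<And>x. x \<in> MOb M \<Longrightarrow> garr A (Mrunit M x) \<bullet> gmult A x (MI M) \<bullet> (gobj A x \<rhd> gunit A) = id2 D (gobj A x)"
    "\<And>x. x \<in> MOb M \<Longrightarrow> garr A (Mlunit M x) \<bullet> gmult A (MI M) x \<bullet> (gunit A \<lhd> gobj A x) = id2 D (gobj A x)"
  shows "graded_monad M D A"
  using assms by (simp add: graded_monad_def Let_def Mhom_iff PiE_iff) (clarsimp simp: Mhom_iff)

lemma oplax_typing:
  assumes "oplax_morphism M D W"
  shows "graded_monad M D (osrc W)" "graded_monad M D (otrg W)"
    "oarr W \<in> Arr D" "src D (oarr W) = gbase (osrc W)" "trg D (oarr W) = gbase (otrg W)"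
    "x \<in> MOb M \<Longrightarrow> ocell W x \<in> Cel D" "x \<in> MOb M \<Longrightarrow> vdom D (ocell W x) = oarr W \<cdot> gobj (osrc W) x"
    "x \<in> MOb M \<Longrightarrow> vcod D (ocell W x) = gobj (otrg W) x \<cdot> oarr W" "ocell W \<in> extensional (MOb M)"
  using assms by (auto simp: oplax_morphism_def Let_def PiE_iff hom_iff cell_iff)

lemma oplax_eqs:
  assumes "oplax_morphism M D W"
  shows "f \<in> MAr M \<Longrightarrow> ocell W (Mcod M f) \<bullet> (oarr W \<rhd> garr (osrc W) f) = (garr (otrg W) f \<lhd> oarr W) \<bullet> ocell W (Mdom M f)"
    "x \<in> MOb M \<Longrightarrow> y \<in> MOb M \<Longrightarrow> ocell W (x \<otimes>\<^bsub>M\<^esub> y) \<bullet> (oarr W \<rhd> gmult (osrc W) x y) =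
         (gmult (otrg W) x y \<lhd> oarr W) \<bullet> (gobj (otrg W) x \<rhd> ocell W y) \<bullet> (ocell W x \<lhd> gobj (osrc W) y)"
    "ocell W (MI M) \<bullet> (oarr W \<rhd> gunit (osrc W)) = gunit (otrg W) \<lhd> oarr W"
  using assms by (simp_all add: oplax_morphism_def Let_def Mhom_iff)

lemma oplax_morphismI:
  assumes "graded_monad M D (osrc W)" "graded_monad M D (otrg W)"
    "oarr W \<in> hom D (gbase (osrc W)) (gbase (otrg W))"
    "\<And>x. x \<in> MOb M \<Longrightarrow> ocell W x \<in> cell D (oarr W \<cdot> gobj (osrc W) x) (gobj (otrg W) x \<cdot> oarr W)"
    "ocell W \<in> extensional (MOb M)"
    "\<And>f. f \<in> MAr M \<Longrightarrow> ocell W (Mcod M f) \<bullet> (oarr W \<rhd> garr (osrc W) f) = (garr (otrg W) f \<lhd> oarr W) \<bullet> ocell W (Mdom M f)"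
    "\<And>x y. x \<in> MOb M \<Longrightarrow> y \<in> MOb M \<Longrightarrow> ocell W (x \<otimes>\<^bsub>M\<^esub> y) \<bullet> (oarr W \<rhd> gmult (osrc W) x y) =
         (gmult (otrg W) x y \<lhd> oarr W) \<bullet> (gobj (otrg W) x \<rhd> ocell W y) \<bullet> (ocell W x \<lhd> gobj (osrc W) y)"
    "ocell W (MI M) \<bullet> (oarr W \<rhd> gunit (osrc W)) = gunit (otrg W) \<lhd> oarr W"
  shows "oplax_morphism M D W"
  using assms by (auto simp add: oplax_morphism_def Let_def Mhom_iff PiE_iff)

text \<open>Naturality in the grading is automatic for a transformation of oplax morphisms.\<close>

lemma oplax_transformation_iff:
  "oplax_transformation M D T \<longleftrightarrow> oplax_morphism M D (fdom T) \<and> oplax_morphism M D (fcod T) \<and>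
    osrc (fcod T) = osrc (fdom T) \<and> otrg (fcod T) = otrg (fdom T) \<and>
    fcell T \<in> cell D (oarr (fdom T)) (oarr (fcod T)) \<and>
    (\<forall>x \<in> MOb M. ocell (fcod T) x \<bullet> (fcell T \<lhd> gobj (osrc (fdom T)) x) =
       (gobj (otrg (fdom T)) x \<rhd> fcell T) \<bullet> ocell (fdom T) x)" (is "?L \<longleftrightarrow> ?R")
proof
  assume L: ?L
  then have W: "oplax_morphism M D (fdom T)" "oplax_morphism M D (fcod T)" "osrc (fcod T) = osrc (fdom T)"
    "otrg (fcod T) = otrg (fdom T)" "fcell T \<in> cell D (oarr (fdom T)) (oarr (fcod T))"
    and n: "\<And>f. f \<in> MAr M \<Longrightarrow> ocell (fcod T) (Mcod M f) \<bullet> (fcell T \<star> garr (osrc (fdom T)) f) =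
       (garr (otrg (fdom T)) f \<star> fcell T) \<bullet> ocell (fdom T) (Mdom M f)"
    by (auto simp: oplax_transformation_def Let_def Mhom_iff)
  have "ocell (fcod T) x \<bullet> (fcell T \<lhd> gobj (osrc (fdom T)) x) =
       (gobj (otrg (fdom T)) x \<rhd> fcell T) \<bullet> ocell (fdom T) x" if "x \<in> MOb M" for x
    using n[of "Mid M x"] that graded_monad_eqs(1)[OF oplax_typing(1)[OF W(1)]]
      graded_monad_eqs(1)[OF oplax_typing(2)[OF W(1)]] by simp
  with W show ?R by simp
next
  assume R: ?R
  note W = conjunct1[OF R] conjunct1[OF conjunct2[OF R]]
  note [simp] = oplax_typing[OF W(1)] oplax_typing[OF W(2)]
    graded_monad_typing[OF oplax_typing(1)[OF W(1)]] graded_monad_typing[OF oplax_typing(2)[OF W(1)]]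
  have [simp]: "osrc (fcod T) = osrc (fdom T)" "otrg (fcod T) = otrg (fdom T)"
    "fcell T \<in> Cel D" "vdom D (fcell T) = oarr (fdom T)" "vcod D (fcell T) = oarr (fcod T)"
    using R by (auto simp: cell_iff)
  have "ocell (fcod T) (Mcod M f) \<bullet> (fcell T \<star> garr (osrc (fdom T)) f) =
       (garr (otrg (fdom T)) f \<star> fcell T) \<bullet> ocell (fdom T) (Mdom M f)" if f: "f \<in> MAr M" for f
  proof -
    have e1: "ocell (fcod T) (Mcod M f) \<bullet> (oarr (fcod T) \<rhd> garr (osrc (fdom T)) f) = 
       (garr (otrg (fdom T)) f \<lhd> oarr (fcod T)) \<bullet> ocell (fcod T) (Mdom M f)"
      using oplax_eqs(1)[OF W(2) f] by simp
    have e2: "ocell (fcod T) (Mdom M f) \<bullet> (fcell T \<lhd> gobj (osrc (fdom T)) (Mdom M f)) =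
       (gobj (otrg (fdom T)) (Mdom M f) \<rhd> fcell T) \<bullet> ocell (fdom T) (Mdom M f)"
      using R f by simp
    have "ocell (fcod T) (Mcod M f) \<bullet> (fcell T \<star> garr (osrc (fdom T)) f) =
       ocell (fcod T) (Mcod M f) \<bullet> (oarr (fcod T) \<rhd> garr (osrc (fdom T)) f) \<bullet> (fcell T \<lhd> gobj (osrc (fdom T)) (Mdom M f))"
      using f by (simp add: hcmp_right_first[of "garr (osrc (fdom T)) f" "fcell T"])
    also have "\<dots> = (garr (otrg (fdom T)) f \<lhd> oarr (fcod T)) \<bullet> ocell (fcod T) (Mdom M f)
       \<bullet> (fcell T \<lhd> gobj (osrc (fdom T)) (Mdom M f))"
      using f by (simp add: vcmp_extend[OF e1])
    also have "\<dots> = (garr (otrg (fdom T)) f \<star> fcell T) \<bullet> ocell (fdom T) (Mdom M f)"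
      using f by (simp add: e2 hcmp_left_first[of "fcell T" "garr (otrg (fdom T)) f"])
    finally show ?thesis .
  qed
  then show ?L using R by (auto simp: oplax_transformation_def Let_def Mhom_iff cell_iff)
qed

end

section \<open>Composition of oplax morphisms and of their transformations\<close>

context graded
begin

lemma oplax_id_morphism:
  assumes A: "graded_monad M D A"
  shows "oplax_morphism M D (oplax_id M D A)"
  by (rule oplax_morphismI)
    (use A in \<open>simp_all add: oplax_id_def graded_monad_typing[OF A] hom_iff cell_iff\<close>)

lemma oplax_comp_sel [simp]:
  "osrc (oplax_comp M D V W) = osrc W" "otrg (oplax_comp M D V W) = otrg V"
  "oarr (oplax_comp M D V W) = oarr V \<cdot> oarr W"
  "x \<in> MOb M \<Longrightarrow> ocell (oplax_comp M D V W) x = (ocell V x \<lhd> oarr W) \<bullet> (oarr V \<rhd> ocell W x)"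
  by (simp_all add: oplax_comp_def)

lemma oplax_id_sel [simp]:
  "osrc (oplax_id M D A) = A" "otrg (oplax_id M D A) = A"
  "oarr (oplax_id M D A) = id1 D (gbase A)"
  "x \<in> MOb M \<Longrightarrow> ocell (oplax_id M D A) x = id2 D (gobj A x)"
  by (simp_all add: oplax_id_def)

lemma oplax_comp_morphism:
  assumes W: "oplax_morphism M D W" and V: "oplax_morphism M D V" and VW: "otrg W = osrc V"
  shows "oplax_morphism M D (oplax_comp M D V W)"
proof -
  note [simp] = oplax_typing[OF W] oplax_typing[OF V] graded_monad_typing[OF oplax_typing(1)[OF W]]
    graded_monad_typing[OF oplax_typing(1)[OF V]] graded_monad_typing[OF oplax_typing(2)[OF V]] VW
  show ?thesis
  proof (rule oplax_morphismI, goal_cases)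
    case (6 f)
    then have f: "f \<in> MAr M" .
    have e1: "(oarr V \<rhd> ocell W (Mcod M f)) \<bullet> ((oarr V \<cdot> oarr W) \<rhd> garr (osrc W) f) =
      (oarr V \<rhd> (garr (osrc V) f \<lhd> oarr W)) \<bullet> (oarr V \<rhd> ocell W (Mdom M f))"
      using arg_cong[OF oplax_eqs(1)[OF W f], of "\<lambda>t. oarr V \<rhd> t"] f by simp
    have e2: "(ocell V (Mcod M f) \<lhd> oarr W) \<bullet> (oarr V \<rhd> garr (osrc V) f \<lhd> oarr W) =
      (garr (otrg V) f \<lhd> (oarr V \<cdot> oarr W)) \<bullet> (ocell V (Mdom M f) \<lhd> oarr W)"
      using arg_cong[OF oplax_eqs(1)[OF V f], of "\<lambda>t. t \<lhd> oarr W"] f by simp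
    show ?case using f by (simp add: e1 vcmp_extend[OF e2])
  next
    case (7 x y)
    note x = 7
    have e1: "(oarr V \<rhd> ocell W (x \<otimes>\<^bsub>M\<^esub> y)) \<bullet> ((oarr V \<cdot> oarr W) \<rhd> gmult (osrc W) x y) =
      (oarr V \<rhd> (gmult (osrc V) x y \<lhd> oarr W)) \<bullet> ((oarr V \<cdot> gobj (osrc V) x) \<rhd> ocell W y) \<bullet> 
      (oarr V \<rhd> (ocell W x \<lhd> gobj (osrc W) y))"
      using arg_cong[OF oplax_eqs(2)[OF W x], of "\<lambda>t. oarr V \<rhd> t"] x by simp
    have e2: "(ocell V (x \<otimes>\<^bsub>M\<^esub> y) \<lhd> oarr W) \<bullet> (oarr V \<rhd> gmult (osrc V) x y \<lhd> oarr W) =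
      (gmult (otrg V) x y \<lhd> (oarr V \<cdot> oarr W)) \<bullet> (gobj (otrg V) x \<rhd> (ocell V y \<lhd> oarr W)) \<bullet> 
      (ocell V x \<lhd> (gobj (osrc V) y \<cdot> oarr W))"
      using arg_cong[OF oplax_eqs(2)[OF V x], of "\<lambda>t. t \<lhd> oarr W"] x by simp
    \<comment> \<open>The cells for \<open>x\<close> and for \<open>y\<close> act on different
      factors and are exchanged; the other two rewrites are the axioms of \<open>W\<close> and of
      \<open>V\<close>.\<close>
    have e3: "(ocell V x \<lhd> (gobj (osrc V) y \<cdot> oarr W)) \<bullet> ((oarr V \<cdot> gobj (osrc V) x) \<rhd> ocell W y) =
       ((gobj (otrg V) x \<cdot> oarr V) \<rhd> ocell W y) \<bullet> (ocell V x \<lhd> (oarr W \<cdot> gobj (osrc W) y))"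
      by (rule exchange) (use x in simp_all)
    show ?case using x by (simp add: e1 vcmp_extend[OF e2] vcmp_extend[OF e3])
  next
    case 8
    have e1: "(oarr V \<rhd> ocell W (MI M)) \<bullet> ((oarr V \<cdot> oarr W) \<rhd> gunit (osrc W)) = oarr V \<rhd> gunit (osrc V) \<lhd> oarr W"
      using arg_cong[OF oplax_eqs(3)[OF W], of "\<lambda>t. oarr V \<rhd> t"] by simp
    have e2: "(ocell V (MI M) \<lhd> oarr W) \<bullet> (oarr V \<rhd> gunit (osrc V) \<lhd> oarr W) = gunit (otrg V) \<lhd> (oarr V \<cdot> oarr W)"
      using arg_cong[OF oplax_eqs(3)[OF V], of "\<lambda>t. t \<lhd> oarr W"] by simp
    show ?case
      by (simp add: e1 e2)
  qed (auto simp: hom_iff cell_iff, auto simp: oplax_comp_def)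
qed

lemma GMnd_sel [simp]:
  "Obj (GMnd M D) = {A. graded_monad M D A}" "Arr (GMnd M D) = {W. oplax_morphism M D W}"
  "Cel (GMnd M D) = {T. oplax_transformation M D T}" "src (GMnd M D) = osrc" "trg (GMnd M D) = otrg"
  "vdom (GMnd M D) = fdom" "vcod (GMnd M D) = fcod" "id1 (GMnd M D) = oplax_id M D"
  "id2 (GMnd M D) = (\<lambda>W. Framed W W (id2 D (oarr W)))"
  "cmp (GMnd M D) = oplax_comp M D"
  "vcmp (GMnd M D) = (\<lambda>T S. Framed (fdom S) (fcod T) (fcell T \<bullet> fcell S))"
  "hcmp (GMnd M D) = (\<lambda>T S. Framed (oplax_comp M D (fdom T) (fdom S)) (oplax_comp M D (fcod T) (fcod S))
                     (fcell T \<star> fcell S))"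
  by (simp_all add: GMnd_def)

lemma oplaxmor_eqI:
  assumes "osrc W = osrc V" "otrg W = otrg V" "oarr W = oarr V" "ocell W \<in> extensional (MOb M)" "ocell V \<in> extensional (MOb M)"
    "\<And>x. x \<in> MOb M \<Longrightarrow> ocell W x = ocell V x"
  shows "W = V"
  using assms by (intro oplaxmor.expand) (auto intro: extensionalityI)

lemma oplax_transformation_hcmp:
  assumes S: "oplax_transformation M D S" and T: "oplax_transformation M D T" and ST: "otrg (fdom S) = osrc (fdom T)"
  shows "oplax_transformation M D (Framed (oplax_comp M D (fdom T) (fdom S)) (oplax_comp M D (fcod T) (fcod S))
                     (fcell T \<star> fcell S))"
proof -
  define s where s: "s = fcell S" define t where t: "t = fcell T"
  define W W' V V' where W: "W = fdom S" and W': "W' = fcod S" and V: "V = fdom T" and V': "V' = fcod T"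
  have m: "oplax_morphism M D W" "oplax_morphism M D W'" "oplax_morphism M D V" "oplax_morphism M D V'"
    and [simp]: "osrc W' = osrc W" "otrg W' = otrg W" "osrc V' = osrc V" "otrg V' = otrg V" "otrg W = osrc V"
     "s \<in> Cel D" "vdom D s = oarr W" "vcod D s = oarr W'" "t \<in> Cel D" "vdom D t = oarr V" "vcod D t = oarr V'"
    and c: "\<And>x. x \<in> MOb M \<Longrightarrow> ocell W' x \<bullet> (s \<lhd> gobj (osrc W) x) = (gobj (osrc V) x \<rhd> s) \<bullet> ocell W x"
     "\<And>x. x \<in> MOb M \<Longrightarrow> ocell V' x \<bullet> (t \<lhd> gobj (osrc V) x) = (gobj (otrg V) x \<rhd> t) \<bullet> ocell V x"
    using S T ST by (auto simp: oplax_transformation_iff s t W W' V V' cell_iff)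
  note [simp] = oplax_typing[OF m(1)] oplax_typing[OF m(2)] oplax_typing[OF m(3)] oplax_typing[OF m(4)]
    graded_monad_typing[OF oplax_typing(1)[OF m(1)]]
    graded_monad_typing[OF oplax_typing(1)[OF m(3)]] graded_monad_typing[OF oplax_typing(2)[OF m(3)]]
  have "ocell (oplax_comp M D V' W') x \<bullet> ((t \<star> s) \<lhd> gobj (osrc W) x) =
     (gobj (otrg V) x \<rhd> (t \<star> s)) \<bullet> ocell (oplax_comp M D V W) x" if x: "x \<in> MOb M" for x
  proof -
    have e1: "(oarr V' \<rhd> ocell W' x) \<bullet> (oarr V' \<rhd> s \<lhd> gobj (osrc W) x) = ((oarr V' \<cdot> gobj (osrc V) x) \<rhd> s) \<bullet> (oarr V' \<rhd> ocell W x)"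
      using arg_cong[OF c(1)[OF x], of "\<lambda>t. oarr V' \<rhd> t"] x by simp
    have e2: "(ocell V' x \<lhd> oarr W) \<bullet> (t \<lhd> (gobj (osrc V) x \<cdot> oarr W)) = (gobj (otrg V) x \<rhd> t \<lhd> oarr W) \<bullet> (ocell V x \<lhd> oarr W)"
      using arg_cong[OF c(2)[OF x], of "\<lambda>t. t \<lhd> oarr W"] x by simp
    have e3: "(oarr V' \<rhd> ocell W x) \<bullet> (t \<lhd> (oarr W \<cdot> gobj (osrc W) x)) = (t \<lhd> (gobj (osrc V) x \<cdot> oarr W)) \<bullet> (oarr V \<rhd> ocell W x)"
      by (rule exchange[symmetric]) (use x in simp_all)
    have e4: "(ocell V' x \<lhd> oarr W') \<bullet> ((oarr V' \<cdot> gobj (osrc V) x) \<rhd> s) = ((gobj (otrg V) x \<cdot> oarr V') \<rhd> s) \<bullet> (ocell V' x \<lhd> oarr W)"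
      by (rule exchange) (use x in simp_all)
    have "ocell (oplax_comp M D V' W') x \<bullet> ((t \<star> s) \<lhd> gobj (osrc W) x) =
      (ocell V' x \<lhd> oarr W') \<bullet> (oarr V' \<rhd> ocell W' x) \<bullet> (oarr V' \<rhd> s \<lhd> gobj (osrc W) x) \<bullet> (t \<lhd> (oarr W \<cdot> gobj (osrc W) x))"
      using x by (simp add: hcmp_right_first[of s t])
    also have "\<dots> = (ocell V' x \<lhd> oarr W') \<bullet> ((oarr V' \<cdot> gobj (osrc V) x) \<rhd> s) \<bullet> (t \<lhd> (gobj (osrc V) x \<cdot> oarr W)) \<bullet> (oarr V \<rhd> ocell W x)"
      using x by (simp add: vcmp_extend[OF e1] e3)
    also have "\<dots> = ((gobj (otrg V) x \<cdot> oarr V') \<rhd> s) \<bullet> (gobj (otrg V) x \<rhd> t \<lhd> oarr W) \<bullet> (ocell V x \<lhd> oarr W) \<bullet> (oarr V \<rhd> ocell W x)"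
      using x by (simp add: vcmp_extend[OF e4] vcmp_extend[OF e2])
    also have "\<dots> = (gobj (otrg V) x \<rhd> (t \<star> s)) \<bullet> ocell (oplax_comp M D V W) x"
      using x by (simp add: hcmp_right_first[of s t])
    finally show ?thesis .
  qed
  then show ?thesis
    using m by (simp add: oplax_transformation_iff oplax_comp_morphism cell_iff flip: s t W W' V V')
qed

lemma oplax_transformation_vcmp:
  assumes S: "oplax_transformation M D S" and T: "oplax_transformation M D T" and ST: "fcod S = fdom T"
  shows "oplax_transformation M D (Framed (fdom S) (fcod T) (fcell T \<bullet> fcell S))"
proof -
  define s where s: "s = fcell S" define t where t: "t = fcell T"
  define W W' W'' where W: "W = fdom S" and W': "W' = fdom T" and W'': "W'' = fcod T" 
  have m: "oplax_morphism M D W" "oplax_morphism M D W'" "oplax_morphism M D W''" 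
    and [simp]: "osrc W' = osrc W" "otrg W' = otrg W" "osrc W'' = osrc W" "otrg W'' = otrg W"
     "s \<in> Cel D" "vdom D s = oarr W" "vcod D s = oarr W'" "t \<in> Cel D" "vdom D t = oarr W'" "vcod D t = oarr W''"
    and c: "\<And>x. x \<in> MOb M \<Longrightarrow> ocell W' x \<bullet> (s \<lhd> gobj (osrc W) x) = (gobj (otrg W) x \<rhd> s) \<bullet> ocell W x"
     "\<And>x. x \<in> MOb M \<Longrightarrow> ocell W'' x \<bullet> (t \<lhd> gobj (osrc W) x) = (gobj (otrg W) x \<rhd> t) \<bullet> ocell W' x"
    using S T ST by (auto simp: oplax_transformation_iff s t W W' W'' cell_iff)
  note [simp] = oplax_typing[OF m(1)] oplax_typing[OF m(2)] oplax_typing[OF m(3)]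
    graded_monad_typing[OF oplax_typing(1)[OF m(1)]] graded_monad_typing[OF oplax_typing(2)[OF m(1)]]
  have "ocell W'' x \<bullet> ((t \<bullet> s) \<lhd> gobj (osrc W) x) = (gobj (otrg W) x \<rhd> (t \<bullet> s)) \<bullet> ocell W x" if x: "x \<in> MOb M" for x
    using x by (simp add: vcmp_extend[OF c(2)] c(1))
  then show ?thesis
    using m by (simp add: oplax_transformation_iff cell_iff flip: s t W W' W'')
qed

lemma oplax_transformation_id:
  assumes W: "oplax_morphism M D W"
  shows "oplax_transformation M D (Framed W W (id2 D (oarr W)))"
  using oplax_typing[OF W] graded_monad_typing[OF oplax_typing(1)[OF W]] graded_monad_typing[OF oplax_typing(2)[OF W]]
    W by (simp add: oplax_transformation_iff cell_iff)

lemma two_category_GMnd: "two_category (GMnd M D)"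
proof (rule framed_two_category[where b = oarr and ?b0.0 = gbase])
  show "cmp (GMnd M D) (id1 (GMnd M D) (trg (GMnd M D) W)) W = W" if "W \<in> Arr (GMnd M D)" for W
  proof -
    have W: "oplax_morphism M D W" using that by simp
    note [simp] = oplax_typing[OF W] graded_monad_typing[OF oplax_typing(1)[OF W]] graded_monad_typing[OF oplax_typing(2)[OF W]]
    show ?thesis
      by (rule oplaxmor_eqI) (simp_all, simp add: oplax_comp_def)
  qed
  show "cmp (GMnd M D) W (id1 (GMnd M D) (src (GMnd M D) W)) = W" if "W \<in> Arr (GMnd M D)" for W
  proof -
    have W: "oplax_morphism M D W" using that by simp
    note [simp] = oplax_typing[OF W] graded_monad_typing[OF oplax_typing(1)[OF W]] graded_monad_typing[OF oplax_typing(2)[OF W]]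
    show ?thesis
      by (rule oplaxmor_eqI) (simp_all, simp add: oplax_comp_def)
  qed
  show "cmp (GMnd M D) (cmp (GMnd M D) U V) W = cmp (GMnd M D) U (cmp (GMnd M D) V W)"
    if "W \<in> Arr (GMnd M D)" "V \<in> Arr (GMnd M D)" "U \<in> Arr (GMnd M D)" "trg (GMnd M D) W = src (GMnd M D) V"
      "trg (GMnd M D) V = src (GMnd M D) U" for W V U
  proof -
    have W: "oplax_morphism M D W" and V: "oplax_morphism M D V" and U: "oplax_morphism M D U"
      and [simp]: "otrg W = osrc V" "otrg V = osrc U"  using that by simp_all
    note [simp] = oplax_typing[OF W] graded_monad_typing[OF oplax_typing(1)[OF W]] 
       oplax_typing[OF V] graded_monad_typing[OF oplax_typing(1)[OF V]] graded_monad_typing[OF oplax_typing(2)[OF U]]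
       oplax_typing[OF U] graded_monad_typing[OF oplax_typing(1)[OF U]]
    show ?thesis
      by (rule oplaxmor_eqI) (simp_all, simp_all add: oplax_comp_def)
  qed
qed (auto simp: oplax_id_morphism oplax_comp_morphism oplax_typing graded_monad_typing oplax_transformation_id
    oplax_transformation_hcmp oplax_transformation_vcmp, auto simp: oplax_transformation_iff cell_iff)

end

section \<open>Cocones on a graded monad\<close>

context graded
begin

lemma incl_obj_sel [simp]:
  "gbase (incl_obj M D X) = X" "x \<in> MOb M \<Longrightarrow> gobj (incl_obj M D X) x = id1 D X"
  "f \<in> MAr M \<Longrightarrow> garr (incl_obj M D X) f = id2 D (id1 D X)"
  "x \<in> MOb M \<Longrightarrow> y \<in> MOb M \<Longrightarrow> gmult (incl_obj M D X) x y = id2 D (id1 D X)"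
  "gunit (incl_obj M D X) = id2 D (id1 D X)"
  by (simp_all add: incl_obj_def)

lemma incl_arr_sel [simp]:
  "osrc (incl_arr M D f) = incl_obj M D (src D f)" "otrg (incl_arr M D f) = incl_obj M D (trg D f)"
  "oarr (incl_arr M D f) = f" "x \<in> MOb M \<Longrightarrow> ocell (incl_arr M D f) x = id2 D f"
  by (simp_all add: incl_arr_def)

lemma incl_sel [simp]:
  "on0 (incl M D) = incl_obj M D" "on1 (incl M D) = incl_arr M D"
  "on2 (incl M D) t = Framed (incl_arr M D (vdom D t)) (incl_arr M D (vcod D t)) t"
  by (simp_all add: incl_def)

lemma incl_obj_graded: "X \<in> Obj D \<Longrightarrow> graded_monad M D (incl_obj M D X)"
  by (rule graded_monadI) (simp_all add: hom_iff cell_iff, simp_all add: incl_obj_def)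

lemma incl_arr_oplax: "f \<in> Arr D \<Longrightarrow> oplax_morphism M D (incl_arr M D f)"
  by (rule oplax_morphismI) (simp_all add: incl_obj_graded hom_iff cell_iff, simp_all add: incl_arr_def)

lemma incl_cell_transformation:
  assumes "t \<in> Cel D"
  shows "oplax_transformation M D (Framed (incl_arr M D (vdom D t)) (incl_arr M D (vcod D t)) t)"
  unfolding oplax_transformation_iff using assms by (simp add: incl_arr_oplax cell_iff)

lemma incl_arr_id: "X \<in> Obj D \<Longrightarrow> incl_arr M D (id1 D X) = oplax_id M D (incl_obj M D X)"
  by (rule oplaxmor_eqI) (simp_all add: incl_arr_def oplax_id_def)

lemma incl_arr_comp:
  assumes "f \<in> Arr D" "g \<in> Arr D" "trg D f = src D g"
  shows "incl_arr M D (g \<cdot> f) = oplax_comp M D (incl_arr M D g) (incl_arr M D f)"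
  by (rule oplaxmor_eqI) (use assms in simp_all, simp_all add: incl_arr_def oplax_comp_def)

lemma two_functor_incl: "two_functor D (GMnd M D) (incl M D)"
proof (intro two_functor.intro two_functor_axioms.intro two_category_GMnd two_category_axioms)
  show "on1 (incl M D) (g \<cdot> f) = on1 (incl M D) g \<cdot>\<^bsub>GMnd M D\<^esub> on1 (incl M D) f" 
    if "f \<in> hom D A B" "g \<in> hom D B E" for f g A B E
    using that by (simp add: hom_iff incl_arr_comp)
  show "on2 (incl M D) (t \<bullet> s) = on2 (incl M D) t \<bullet>\<^bsub>GMnd M D\<^esub> on2 (incl M D) s"
    if "s \<in> cell D f g" "t \<in> cell D g h" for s t f g h
    using that by (simp add: cell_iff)
  show "on2 (incl M D) (t \<star> s) = on2 (incl M D) t \<star>\<^bsub>GMnd M D\<^esub> on2 (incl M D) s"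
    if "s \<in> cell D f f'" "t \<in> cell D g g'" "trg D f = src D g" for s t f g f' g'
    using that by (auto simp: cell_iff incl_arr_comp)
qed (auto simp: hom_def cell_def incl_obj_graded incl_arr_oplax incl_cell_transformation incl_arr_id)

text \<open>An oplax morphism into a trivial graded monad, read in \<open>D\<close>: a right action
  of the graded monad on \<open>W\<close>. The family \<open>w\<close> is free outside
  \<open>MOb M\<close>, so that it may be given by a formula; extensionality is added in
  \<open>oplax_into_incl\<close>.\<close>

definition cocone where
  "cocone A X W w \<longleftrightarrow> W \<in> hom D (gbase A) X \<and> (\<forall>x \<in> MOb M. w x \<in> cell D (W \<cdot> gobj A x) W) \<and>
     (\<forall>f \<in> MAr M. w (Mcod M f) \<bullet> (W \<rhd> garr A f) = w (Mdom M f)) \<and>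
     (\<forall>x \<in> MOb M. \<forall>y \<in> MOb M. w (x \<otimes>\<^bsub>M\<^esub> y) \<bullet> (W \<rhd> gmult A x y) = w y \<bullet> (w x \<lhd> gobj A y)) \<and>
     w (MI M) \<bullet> (W \<rhd> gunit A) = id2 D W"

lemma oplax_into_incl:
  assumes "graded_monad M D (osrc V)" "otrg V = incl_obj M D X" "X \<in> Obj D"
  shows "oplax_morphism M D V \<longleftrightarrow> cocone (osrc V) X (oarr V) (ocell V) \<and> ocell V \<in> extensional (MOb M)"
proof
  assume V: "oplax_morphism M D V"
  note [simp] = oplax_typing[OF V] graded_monad_typing[OF assms(1)] assms(2,3)
  show "cocone (osrc V) X (oarr V) (ocell V) \<and> ocell V \<in> extensional (MOb M)"
    using oplax_eqs[OF V] by (simp add: cocone_def hom_iff cell_iff)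
next
  note [simp] = graded_monad_typing[OF assms(1)] assms
  assume c: "cocone (osrc V) X (oarr V) (ocell V) \<and> ocell V \<in> extensional (MOb M)"
  have [simp]: "oarr V \<in> Arr D" "src D (oarr V) = gbase (osrc V)" "trg D (oarr V) = X"
    "x \<in> MOb M \<Longrightarrow> ocell V x \<in> Cel D" "x \<in> MOb M \<Longrightarrow> vdom D (ocell V x) = oarr V \<cdot> gobj (osrc V) x"
    "x \<in> MOb M \<Longrightarrow> vcod D (ocell V x) = oarr V" for x
    using c by (simp_all add: cocone_def hom_iff cell_iff)
  show "oplax_morphism M D V"
    by (rule oplax_morphismI) (use c in \<open>auto simp add: cocone_def hom_iff cell_iff incl_obj_graded\<close>)
qed

text \<open>The universal property of a Kleisli object in terms of cells of the base alone. The
  compatibility of \<open>s\<close> with the actions says that \<open>s\<close> underlies a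
  transformation of oplax morphisms.\<close>

definition universal_cocone where
  "universal_cocone A k W w \<longleftrightarrow> k \<in> Obj D \<and> cocone A k W w \<and>
     (\<forall>X V v. X \<in> Obj D \<longrightarrow> cocone A X V v \<longrightarrow> (\<exists>h \<in> Arr D. src D h = k \<and> trg D h = X \<and> h \<cdot> W = V \<and>
        (\<forall>x \<in> MOb M. h \<rhd> w x = v x))) \<and>
     (\<forall>h \<in> Arr D. \<forall>h' \<in> Arr D. src D h = k \<longrightarrow> src D h' = k \<longrightarrow> trg D h = trg D h' \<longrightarrow> h \<cdot> W = h' \<cdot> W \<longrightarrow>
        (\<forall>x \<in> MOb M. h \<rhd> w x = h' \<rhd> w x) \<longrightarrow> h = h') \<and>
     (\<forall>h \<in> Arr D. \<forall>h' \<in> Arr D. \<forall>s \<in> cell D (h \<cdot> W) (h' \<cdot> W). src D h = k \<longrightarrow> src D h' = k \<longrightarrow> trg D h = trg D h' \<longrightarrow>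
        (\<forall>x \<in> MOb M. (h' \<rhd> w x) \<bullet> (s \<lhd> gobj A x) = s \<bullet> (h \<rhd> w x)) \<longrightarrow>
        (\<exists>t \<in> cell D h h'. t \<lhd> W = s)) \<and>
     (\<forall>t \<in> Cel D. \<forall>t' \<in> Cel D. src D (vdom D t) = k \<longrightarrow> vdom D t = vdom D t' \<longrightarrow> vcod D t = vcod D t' \<longrightarrow>
        t \<lhd> W = t' \<lhd> W \<longrightarrow> t = t')"

lemma oplax_comp_incl:
  assumes "oplax_morphism M D V" "otrg V = incl_obj M D k" "h \<in> Arr D" "src D h = k"
  shows "x \<in> MOb M \<Longrightarrow> ocell (oplax_comp M D (incl_arr M D h) V) x = h \<rhd> ocell V x"
  using assms(2-4) oplax_typing[OF assms(1)] graded_monad_typing[OF oplax_typing(1)[OF assms(1)]] by simp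

text \<open>Composing \<open>V\<close> with the inclusion of \<open>h\<close> whiskers its 1-cell
  and all its action cells with \<open>h\<close>, so the clauses of the two definitions correspond
  one by one. Universality becomes available for families given by formulas, without frames and
  restrictions.\<close>

lemma universal_arrow_iff_cocone:
  assumes A: "graded_monad M D A" 
  shows "universal_arrow (GMnd M D) D (incl M D) A k V \<longleftrightarrow>
    osrc V = A \<and> otrg V = incl_obj M D k \<and> ocell V \<in> extensional (MOb M) \<and>
    universal_cocone A k (oarr V) (ocell V)" (is "?U \<longleftrightarrow> ?C")
proof -
  interpret incl: two_functor D "GMnd M D" "incl M D" by (rule two_functor_incl)
  have "?U \<longleftrightarrow> ?C"
    if k: "k \<in> Obj D" and [simp]: "oplax_morphism M D V" "osrc V = A" "otrg V = incl_obj M D k"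
  proof -
    note [simp] = k oplax_typing[OF that(2)] graded_monad_typing[OF A]
    define W w where W: "W = oarr V" and w: "w = ocell V"
    have c: "cocone A k W w" using oplax_into_incl[of V k] A by (auto simp: W w)
    have Vtyp [simp]: "W \<in> Arr D" "src D W = gbase A" "trg D W = k"
      "x \<in> MOb M \<Longrightarrow> w x \<in> Cel D" "x \<in> MOb M \<Longrightarrow> vdom D (w x) = W \<cdot> gobj A x"
      "x \<in> MOb M \<Longrightarrow> vcod D (w x) = W" for x
      using c by (simp_all add: cocone_def hom_iff cell_iff)
    have oc [simp]: "x \<in> MOb M \<Longrightarrow> ocell (oplax_comp M D (incl_arr M D h) V) x = h \<rhd> w x"
      if "h \<in> Arr D" "src D h = k" for h x
      using oplax_comp_incl[of V k h x] that by (simp add: w)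
    have om: "oplax_morphism M D (oplax_comp M D (incl_arr M D h) V)" if "h \<in> Arr D" "src D h = k" for h
      using that by (intro oplax_comp_morphism incl_arr_oplax) simp_all
    have ceq: "oplax_comp M D (incl_arr M D h) V = U \<longleftrightarrow> h \<cdot> W = oarr U \<and> (\<forall>x \<in> MOb M. h \<rhd> w x = ocell U x)"
      if "h \<in> Arr D" "src D h = k" "osrc U = A" "otrg U = incl_obj M D (trg D h)" "ocell U \<in> extensional (MOb M)" for h U
    proof
      assume e: "h \<cdot> W = oarr U \<and> (\<forall>x \<in> MOb M. h \<rhd> w x = ocell U x)"
      show "oplax_comp M D (incl_arr M D h) V = U"
      proof (rule oplaxmor_eqI)
        show "ocell (oplax_comp M D (incl_arr M D h) V) x = ocell U x" if "x \<in> MOb M" for x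
          using e oc[OF \<open>h \<in> Arr D\<close> \<open>src D h = k\<close> that] that by metis
        show "oarr (oplax_comp M D (incl_arr M D h) V) = oarr U" using e by (simp flip: W)
      qed (use that in simp_all, simp add: oplax_comp_def)
    next
      assume e: "oplax_comp M D (incl_arr M D h) V = U"
      show "h \<cdot> W = oarr U \<and> (\<forall>x \<in> MOb M. h \<rhd> w x = ocell U x)"
        using arg_cong[OF e, of oarr] oc[OF \<open>h \<in> Arr D\<close> \<open>src D h = k\<close>] e by (metis W oplax_comp_sel(3) incl_arr_sel(3))
    qed
    have ce: "ocell (oplax_comp M D (incl_arr M D h) V) \<in> extensional (MOb M)" for h
      by (simp add: oplax_comp_def)
    have tr: "oplax_transformation M D (Framed (oplax_comp M D (incl_arr M D h) V) (oplax_comp M D (incl_arr M D h') V) s)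
       \<longleftrightarrow> s \<in> cell D (h \<cdot> W) (h' \<cdot> W) \<and> (\<forall>x \<in> MOb M. (h' \<rhd> w x) \<bullet> (s \<lhd> gobj A x) = s \<bullet> (h \<rhd> w x))"
      if "h \<in> Arr D" "h' \<in> Arr D" "src D h = k" "src D h' = k" "trg D h = trg D h'" for h h' s
      unfolding oplax_transformation_iff using that om[of h] om[of h'] by (auto simp: cell_iff simp flip: W w)
    have ww [simp]: "on2 (incl M D) t \<lhd>\<^bsub>GMnd M D\<^esub> V = Framed (oplax_comp M D (incl_arr M D (vdom D t)) V)
      (oplax_comp M D (incl_arr M D (vcod D t)) V) (t \<lhd> W)" for t by (simp add: W)
    show ?thesis
    proof
      assume U: ?U
      have "universal_cocone A k W w"
        unfolding universal_cocone_def
      proof (intro conjI allI ballI impI k c)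
        fix X Y y assume X: "X \<in> Obj D" "cocone A X Y y"
        \<comment> \<open>Restriction makes an arbitrary cocone a legitimate oplax morphism and
          keeps its values on \<open>MOb M\<close>.\<close>
        let ?Y = "OplaxMor A (incl_obj M D X) Y (restrict y (MOb M))"
        have "cocone A X Y (restrict y (MOb M))" using X by (auto simp: cocone_def)
        then have Y: "oplax_morphism M D ?Y" using oplax_into_incl[of ?Y X] A X by simp
        obtain h where "h \<in> Arr D" "src D h = k" "trg D h = X" "oplax_comp M D (incl_arr M D h) V = ?Y"
          by (rule incl.universal_ext1[OF U, of ?Y X]) (use Y X in simp_all)
        then show "\<exists>h \<in> Arr D. src D h = k \<and> trg D h = X \<and> h \<cdot> W = Y \<and> (\<forall>x \<in> MOb M. h \<rhd> w x = y x)"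
          using ceq[of h ?Y] by (intro bexI[of _ h]) auto
      next
        fix h h' assume h: "h \<in> Arr D" "h' \<in> Arr D" "src D h = k" "src D h' = k" "trg D h = trg D h'"
          "h \<cdot> W = h' \<cdot> W" "\<forall>x \<in> MOb M. h \<rhd> w x = h' \<rhd> w x"
        have "oplax_comp M D (incl_arr M D h) V = oplax_comp M D (incl_arr M D h') V"
          using ceq[of h "oplax_comp M D (incl_arr M D h') V"] h ce by (simp flip: W w)
        then show "h = h'" using incl.universal_cancel1[OF U h(1-5)] by simp
      next
        fix h h' s assume h: "h \<in> Arr D" "h' \<in> Arr D" "s \<in> cell D (h \<cdot> W) (h' \<cdot> W)" "src D h = k" "src D h' = k" "trg D h = trg D h'"
          "\<forall>x \<in> MOb M. (h' \<rhd> w x) \<bullet> (s \<lhd> gobj A x) = s \<bullet> (h \<rhd> w x)"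
        have "oplax_transformation M D (Framed (oplax_comp M D (incl_arr M D h) V) (oplax_comp M D (incl_arr M D h') V) s)"
          using tr[of h h' s] h by simp
        then obtain t where "t \<in> Cel D" "vdom D t = h" "vcod D t = h'" "on2 (incl M D) t \<lhd>\<^bsub>GMnd M D\<^esub> V = 
          Framed (oplax_comp M D (incl_arr M D h) V) (oplax_comp M D (incl_arr M D h') V) s"
          by - (rule incl.universal_ext2[OF U, of "Framed (oplax_comp M D (incl_arr M D h) V) (oplax_comp M D (incl_arr M D h') V) s" h h'],
            use h in simp_all)
        then show "\<exists>t \<in> cell D h h'. t \<lhd> W = s"
          by (intro bexI[of _ t]) (simp_all add: cell_iff W)
      next
        fix t t' assume t: "t \<in> Cel D" "t' \<in> Cel D" "src D (vdom D t) = k" "vdom D t = vdom D t'" "vcod D t = vcod D t'"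
          "t \<lhd> W = t' \<lhd> W"
        show "t = t'" by (rule incl.universal_cancel2[OF U t(1-5)]) (use t in \<open>simp only: ww\<close>)
      qed
      then show ?C by (simp add: W w)
    next
      assume C: ?C
      then have U: "universal_cocone A k W w" by (simp add: W w)
      show ?U
      proof (rule incl.universal_arrowI)
        show "\<exists>h \<in> Arr D. src D h = k \<and> trg D h = X \<and> on1 (incl M D) h \<cdot>\<^bsub>GMnd M D\<^esub> V = Y"
          if X: "X \<in> Obj D" "Y \<in> Arr (GMnd M D)" "src (GMnd M D) Y = A" "trg (GMnd M D) Y = on0 (incl M D) X" for X Y
        proof -
          have Y: "oplax_morphism M D Y" "osrc Y = A" "otrg Y = incl_obj M D X" using X by simp_all
          then have "cocone A X (oarr Y) (ocell Y)" "ocell Y \<in> extensional (MOb M)"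
            using oplax_into_incl[of Y X] A X(1) by simp_all
          then obtain h where h: "h \<in> Arr D" "src D h = k" "trg D h = X" "h \<cdot> W = oarr Y" "\<forall>x \<in> MOb M. h \<rhd> w x = ocell Y x"
            using U X(1) unfolding universal_cocone_def by blast
          then show ?thesis using ceq[of h Y] Y \<open>ocell Y \<in> extensional (MOb M)\<close> by (intro bexI[of _ h]) simp_all
        qed
        show "h = h'" if h: "h \<in> Arr D" "h' \<in> Arr D" "src D h = k" "src D h' = k" "trg D h = trg D h'"
          "on1 (incl M D) h \<cdot>\<^bsub>GMnd M D\<^esub> V = on1 (incl M D) h' \<cdot>\<^bsub>GMnd M D\<^esub> V" for h h'
        proof -
          have "h \<cdot> W = h' \<cdot> W \<and> (\<forall>x \<in> MOb M. h \<rhd> w x = h' \<rhd> w x)"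
            using ceq[of h "oplax_comp M D (incl_arr M D h') V"] h ce by (simp flip: W w)
          then show "h = h'" using U h(1-5) unfolding universal_cocone_def by blast
        qed
        show "\<exists>t \<in> Cel D. vdom D t = h \<and> vcod D t = h' \<and> on2 (incl M D) t \<lhd>\<^bsub>GMnd M D\<^esub> V = s"
          if h: "h \<in> Arr D" "h' \<in> Arr D" "src D h = k" "src D h' = k" "trg D h = trg D h'"
            "s \<in> Cel (GMnd M D)" "vdom (GMnd M D) s = on1 (incl M D) h \<cdot>\<^bsub>GMnd M D\<^esub> V"
            "vcod (GMnd M D) s = on1 (incl M D) h' \<cdot>\<^bsub>GMnd M D\<^esub> V" for h h' s
        proof -
          obtain s' where s: "s = Framed (oplax_comp M D (incl_arr M D h) V) (oplax_comp M D (incl_arr M D h') V) s'"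
            using h(7,8) by (cases s) simp
          then have "s' \<in> cell D (h \<cdot> W) (h' \<cdot> W) \<and> (\<forall>x \<in> MOb M. (h' \<rhd> w x) \<bullet> (s' \<lhd> gobj A x) = s' \<bullet> (h \<rhd> w x))"
            using tr[of h h' s'] h by simp
          then obtain t where "t \<in> cell D h h'" "t \<lhd> W = s'"
            using U h(1-5) unfolding universal_cocone_def by blast
          then show ?thesis using s by (intro bexI[of _ t]) (auto simp: cell_iff W)
        qed
        show "t = t'" if t: "t \<in> Cel D" "t' \<in> Cel D" "src D (vdom D t) = k" "vdom D t = vdom D t'" "vcod D t = vcod D t'"
           "on2 (incl M D) t \<lhd>\<^bsub>GMnd M D\<^esub> V = on2 (incl M D) t' \<lhd>\<^bsub>GMnd M D\<^esub> V" for t t'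
        proof -
          have "t \<lhd> W = t' \<lhd> W" using t(6) by (simp only: ww framed.inject)
          then show ?thesis using U t(1-5) unfolding universal_cocone_def by blast
        qed
      qed simp_all
    qed
  qed
  moreover have "k \<in> Obj D \<and> oplax_morphism M D V \<and> osrc V = A \<and> otrg V = incl_obj M D k" if ?U
    using that incl.universal_typing[OF that] by simp
  moreover have "k \<in> Obj D \<and> oplax_morphism M D V \<and> osrc V = A \<and> otrg V = incl_obj M D k" if ?C
    using that oplax_into_incl[of V k] A by (auto simp: universal_cocone_def)
  ultimately show ?thesis by blast
qed

end

section \<open>The 2-functor induced on graded monads\<close>

lemma two_functor_GMnd_map:
  assumes M: "monoidal_category M" and G: "two_functor C D G"
  shows "two_functor (GMnd M C) (GMnd M D) (GMnd_map M G)"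
proof -
  interpret G: two_functor C D G by (rule G)
  interpret C: graded C M by (simp add: graded_def M G.dom.strict_2cat_axioms)
  interpret D: graded D M by (simp add: graded_def M G.cod.strict_2cat_axioms)
  have obj: "graded_monad M D (GMnd_map_obj M G A)" if A: "graded_monad M C A" for A
  proof -
    note [simp] = C.graded_monad_typing[OF A]
    note e = C.graded_monad_eqs[OF A]
    show ?thesis
    proof (rule D.graded_monadI, goal_cases)
      case (12 f g)
      then show ?case using arg_cong[OF e(3)[OF 12], of "on2 G"] by (simp add: GMnd_map_obj_def)
    next
      case (13 x y z)
      then show ?case using arg_cong[OF e(4)[OF 13], of "on2 G"] by (simp add: GMnd_map_obj_def)
    next
      case (14 x)
      then show ?case using arg_cong[OF e(5)[OF 14], of "on2 G"] by (simp add: GMnd_map_obj_def)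
    next
      case (15 x)
      then show ?case using arg_cong[OF e(6)[OF 15], of "on2 G"] by (simp add: GMnd_map_obj_def)
    qed (simp_all add: GMnd_map_obj_def G.cod.hom_iff G.cod.cell_iff e(1,2))
  qed
  have arr: "oplax_morphism M D (GMnd_map_arr M G W)" if W: "oplax_morphism M C W" for W
  proof -
    note [simp] = C.graded_monad_typing[OF C.oplax_typing(1)[OF W]] C.graded_monad_typing[OF C.oplax_typing(2)[OF W]]
      C.oplax_typing[OF W]
    show ?thesis
    proof (rule D.oplax_morphismI, goal_cases)
      case (6 f)
      then show ?case using arg_cong[OF C.oplax_eqs(1)[OF W 6], of "on2 G"] by (simp add: GMnd_map_arr_def GMnd_map_obj_def)
    next
      case (7 x y)
      then show ?case using arg_cong[OF C.oplax_eqs(2)[OF W 7], of "on2 G"] by (simp add: GMnd_map_arr_def GMnd_map_obj_def)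
    next
      case 8
      show ?case using arg_cong[OF C.oplax_eqs(3)[OF W], of "on2 G"] by (simp add: GMnd_map_arr_def GMnd_map_obj_def)
    qed (simp_all add: GMnd_map_arr_def obj, simp_all add: GMnd_map_obj_def G.cod.hom_iff G.cod.cell_iff)
  qed
  have tra: "oplax_transformation M D (Framed (GMnd_map_arr M G (fdom T)) (GMnd_map_arr M G (fcod T)) (on2 G (fcell T)))"
    if T: "oplax_transformation M C T" for T
  proof -
    have W: "oplax_morphism M C (fdom T)" "oplax_morphism M C (fcod T)" and [simp]: "osrc (fcod T) = osrc (fdom T)"
      "otrg (fcod T) = otrg (fdom T)" "fcell T \<in> Cel C" "vdom C (fcell T) = oarr (fdom T)" "vcod C (fcell T) = oarr (fcod T)"
      and n: "\<And>x. x \<in> MOb M \<Longrightarrow> ocell (fcod T) x \<bullet>\<^bsub>C\<^esub> (fcell T \<lhd>\<^bsub>C\<^esub> gobj (osrc (fdom T)) x) =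
       (gobj (otrg (fdom T)) x \<rhd>\<^bsub>C\<^esub> fcell T) \<bullet>\<^bsub>C\<^esub> ocell (fdom T) x"
      using T by (auto simp: C.oplax_transformation_iff G.dom.cell_iff)
    note [simp] = C.graded_monad_typing[OF C.oplax_typing(1)[OF W(1)]] C.graded_monad_typing[OF C.oplax_typing(2)[OF W(1)]]
      C.oplax_typing[OF W(1)] C.oplax_typing[OF W(2)]
    have "on2 G (ocell (fcod T) x) \<bullet>\<^bsub>D\<^esub> (on2 G (fcell T) \<lhd>\<^bsub>D\<^esub> on1 G (gobj (osrc (fdom T)) x)) =
       (on1 G (gobj (otrg (fdom T)) x) \<rhd>\<^bsub>D\<^esub> on2 G (fcell T)) \<bullet>\<^bsub>D\<^esub> on2 G (ocell (fdom T) x)" if x: "x \<in> MOb M" for x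
      using arg_cong[OF n[OF x], of "on2 G"] x by simp
    then show ?thesis
      unfolding D.oplax_transformation_iff using arr[OF W(1)] arr[OF W(2)]
      by (auto simp: G.cod.cell_iff GMnd_map_arr_def GMnd_map_obj_def)
  qed
  have idm: "GMnd_map_arr M G (oplax_id M C A) = oplax_id M D (GMnd_map_obj M G A)" if A: "graded_monad M C A" for A
    by (rule D.oplaxmor_eqI)
      (use C.graded_monad_typing[OF A] in \<open>simp_all add: GMnd_map_arr_def GMnd_map_obj_def oplax_id_def\<close>)
  have cmpm: "GMnd_map_arr M G (oplax_comp M C V W) = oplax_comp M D (GMnd_map_arr M G V) (GMnd_map_arr M G W)"
    if W: "oplax_morphism M C W" and V: "oplax_morphism M C V" and VW: "otrg W = osrc V" for V W
  proof -
    note [simp] = C.graded_monad_typing[OF C.oplax_typing(1)[OF W]] C.graded_monad_typing[OF C.oplax_typing(2)[OF W]]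
      C.oplax_typing[OF W] C.graded_monad_typing[OF C.oplax_typing(1)[OF V]] C.graded_monad_typing[OF C.oplax_typing(2)[OF V]]
      C.oplax_typing[OF V]
    show ?thesis
      by (rule D.oplaxmor_eqI) (use VW in \<open>simp_all add: GMnd_map_arr_def oplax_comp_def GMnd_map_obj_def\<close>)
  qed
  show ?thesis
  proof (intro two_functor.intro two_functor_axioms.intro C.two_category_GMnd D.two_category_GMnd)
    show "on2 (GMnd_map M G) (t \<bullet>\<^bsub>GMnd M C\<^esub> s) = on2 (GMnd_map M G) t \<bullet>\<^bsub>GMnd M D\<^esub> on2 (GMnd_map M G) s"
      if "s \<in> cell (GMnd M C) f g" "t \<in> cell (GMnd M C) g h" for s t f g h
      using that by (auto simp: cell_def GMnd_map_def C.oplax_transformation_iff)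
    show "on2 (GMnd_map M G) (t \<star>\<^bsub>GMnd M C\<^esub> s) = on2 (GMnd_map M G) t \<star>\<^bsub>GMnd M D\<^esub> on2 (GMnd_map M G) s"
      if "s \<in> cell (GMnd M C) f f'" "t \<in> cell (GMnd M C) g g'" "trg (GMnd M C) f = src (GMnd M C) g" for s t f g f' g'
    proof -
      have "oplax_transformation M C s" "oplax_transformation M C t" "otrg (fdom s) = osrc (fdom t)"
        using that by (auto simp: cell_def)
      then show ?thesis
        using C.oplax_typing(3-5)[of "fdom s"] C.oplax_typing(3-5)[of "fdom t"]
        by (auto simp: GMnd_map_def C.oplax_transformation_iff G.dom.cell_iff cmpm)
    qed
  qed (auto simp: hom_def cell_def GMnd_map_def obj arr tra idm cmpm, simp_all add: GMnd_map_arr_def C.oplax_typing)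
qed

context
  fixes M :: "('m, 'n) moncat" and C :: "('o, 'a, 'c, 'y) twocat_scheme" and D :: "('p, 'b, 'd, 'z) twocat_scheme" and G
  assumes G: "two_functor C D G"
begin

interpretation G: two_functor C D G by (rule G)

lemma GMnd_map_obj_incl: "X \<in> Obj C \<Longrightarrow> GMnd_map_obj M G (incl_obj M C X) = incl_obj M D (on0 G X)"
  by (auto simp: GMnd_map_obj_def incl_obj_def fun_eq_iff restrict_def)

lemma GMnd_map_arr_incl: "f \<in> Arr C \<Longrightarrow> GMnd_map_arr M G (incl_arr M C f) = incl_arr M D (on1 G f)"
  using GMnd_map_obj_incl by (auto simp: GMnd_map_arr_def incl_arr_def fun_eq_iff restrict_def)

text \<open>The equality of 2-functors whose mate is \<open>kleisli_comparison\<close>. It is strict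
  because 2-functors preserve identities on the nose.\<close>

lemma GMnd_map_incl:
  "X \<in> Obj C \<Longrightarrow> on0 (GMnd_map M G) (on0 (incl M C) X) = on0 (incl M D) (on0 G X)"
  "f \<in> Arr C \<Longrightarrow> on1 (GMnd_map M G) (on1 (incl M C) f) = on1 (incl M D) (on1 G f)"
  "t \<in> Cel C \<Longrightarrow> on2 (GMnd_map M G) (on2 (incl M C) t) = on2 (incl M D) (on2 G t)"
  by (simp_all add: GMnd_map_def incl_def GMnd_map_obj_incl GMnd_map_arr_incl)

end

section \<open>Finite products and generalized elements\<close>

locale fp_2cat = fp_two_category D + strict_2cat D for D :: "('o, 'a, 'c, 'z) fp_twocat_scheme" (structure)
begin

lemma typing_Prd [simp]:
  assumes "A \<in> Obj D" "B \<in> Obj D"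
  shows "Prd D A B \<in> Obj D" "Pr1 D A B \<in> Arr D" "src D (Pr1 D A B) = Prd D A B" "trg D (Pr1 D A B) = A"
    "Pr2 D A B \<in> Arr D" "src D (Pr2 D A B) = Prd D A B" "trg D (Pr2 D A B) = B"
  using product_Prd[OF assms] src_Obj[of "Pr1 D A B"] by (auto simp: product_0cell_def hom_iff)

lemma pair1_ex1:
  assumes "f \<in> Arr D" "g \<in> Arr D" "src D f = src D g"
  shows "\<exists>!h. h \<in> hom D (src D f) (Prd D (trg D f) (trg D g)) \<and>
    Pr1 D (trg D f) (trg D g) \<cdot> h = f \<and> Pr2 D (trg D f) (trg D g) \<cdot> h = g"
  using product_Prd[of "trg D f" "trg D g"] assms by (simp add: product_0cell_def hom_iff)

lemma pair1_props:
  assumes "f \<in> Arr D" "g \<in> Arr D" "src D f = src D g"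
  shows "\<langle>f, g\<rangle> \<in> hom D (src D f) (Prd D (trg D f) (trg D g)) \<and>
    Pr1 D (trg D f) (trg D g) \<cdot> \<langle>f, g\<rangle> = f \<and> Pr2 D (trg D f) (trg D g) \<cdot> \<langle>f, g\<rangle> = g"
  unfolding pair1_def by (rule theI'[OF pair1_ex1[OF assms]])

lemma typing_pair1 [simp]:
  assumes "f \<in> Arr D" "g \<in> Arr D" "src D f = src D g"
  shows "\<langle>f, g\<rangle> \<in> Arr D" "src D \<langle>f, g\<rangle> = src D g" "trg D \<langle>f, g\<rangle> = Prd D (trg D f) (trg D g)"
  using pair1_props[OF assms] assms(3) by (simp_all add: hom_iff)

lemma proj_pair1 [simp]:
  assumes "f \<in> Arr D" "g \<in> Arr D" "src D f = src D g" "trg D f = A" "trg D g = B"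
  shows "Pr1 D A B \<cdot> \<langle>f, g\<rangle> = f" "Pr2 D A B \<cdot> \<langle>f, g\<rangle> = g"
  using pair1_props[OF assms(1-3)] assms(4,5) by simp_all

lemma arr_eqI:
  assumes "h \<in> Arr D" "h' \<in> Arr D" "src D h = src D h'" "trg D h = Prd D A B" "trg D h' = Prd D A B"
    "A \<in> Obj D" "B \<in> Obj D" "Pr1 D A B \<cdot> h = Pr1 D A B \<cdot> h'" "Pr2 D A B \<cdot> h = Pr2 D A B \<cdot> h'"
  shows "h = h'"
  using pair1_ex1[of "Pr1 D A B \<cdot> h" "Pr2 D A B \<cdot> h"] assms by (auto simp: hom_iff)

lemma pair1_cmp [simp]:
  assumes "f \<in> Arr D" "g \<in> Arr D" "src D f = src D g" "h \<in> Arr D" "trg D h = src D g"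
  shows "\<langle>f, g\<rangle> \<cdot> h = \<langle>f \<cdot> h, g \<cdot> h\<rangle>"
proof (rule arr_eqI)
  show "Pr1 D (trg D f) (trg D g) \<cdot> \<langle>f, g\<rangle> \<cdot> h = Pr1 D (trg D f) (trg D g) \<cdot> \<langle>f \<cdot> h, g \<cdot> h\<rangle>"
    using assms cmp_assoc'[of h "\<langle>f, g\<rangle>" "Pr1 D (trg D f) (trg D g)"] by simp
  show "Pr2 D (trg D f) (trg D g) \<cdot> \<langle>f, g\<rangle> \<cdot> h = Pr2 D (trg D f) (trg D g) \<cdot> \<langle>f \<cdot> h, g \<cdot> h\<rangle>"
    using assms cmp_assoc'[of h "\<langle>f, g\<rangle>" "Pr2 D (trg D f) (trg D g)"] by simp
qed (use assms in simp_all)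

lemma pair1_eta [simp]:
  "A \<in> Obj D \<Longrightarrow> B \<in> Obj D \<Longrightarrow> \<langle>Pr1 D A B, Pr2 D A B\<rangle> = id1 D (Prd D A B)"
  "A \<in> Obj D \<Longrightarrow> B \<in> Obj D \<Longrightarrow> h \<in> Arr D \<Longrightarrow> trg D h = Prd D A B \<Longrightarrow> \<langle>Pr1 D A B \<cdot> h, Pr2 D A B \<cdot> h\<rangle> = h"
  by (rule arr_eqI[where A = A and B = B]; simp)+

lemma cell_ex1:
  assumes "h \<in> Arr D" "k \<in> Arr D" "src D h = src D k" "trg D h = Prd D A B" "trg D k = Prd D A B"
    "A \<in> Obj D" "B \<in> Obj D" "s \<in> cell D (Pr1 D A B \<cdot> h) (Pr1 D A B \<cdot> k)" "t \<in> cell D (Pr2 D A B \<cdot> h) (Pr2 D A B \<cdot> k)"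
  shows "\<exists>!r. r \<in> cell D h k \<and> Pr1 D A B \<rhd> r = s \<and> Pr2 D A B \<rhd> r = t"
proof -
  have "h \<in> hom D (src D h) (Prd D A B)" "k \<in> hom D (src D h) (Prd D A B)" "src D h \<in> Obj D"
    using assms by (simp_all add: hom_iff)
  then show ?thesis using product_Prd[OF assms(6,7)] assms(8,9) unfolding product_0cell_def by blast
qed

lemma cell_eqI:
  assumes "s \<in> Cel D" "t \<in> Cel D" "vdom D s = vdom D t" "vcod D s = vcod D t" "trg D (vdom D s) = Prd D A B"
    "A \<in> Obj D" "B \<in> Obj D" "Pr1 D A B \<rhd> s = Pr1 D A B \<rhd> t" "Pr2 D A B \<rhd> s = Pr2 D A B \<rhd> t"
  shows "s = t"
proof -
  have "src D (vdom D s) = src D (vcod D s)" "trg D (vcod D s) = Prd D A B" "trg D (vdom D t) = Prd D A B"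
    using assms by simp_all
  then have "\<exists>!r. r \<in> cell D (vdom D s) (vcod D s) \<and> Pr1 D A B \<rhd> r = Pr1 D A B \<rhd> s \<and> Pr2 D A B \<rhd> r = Pr2 D A B \<rhd> s"
    using assms by (intro cell_ex1) (simp_all add: cell_iff)
  then show ?thesis using assms by (metis cell_iff)
qed

lemma pair2_props:
  assumes "s \<in> Cel D" "t \<in> Cel D" "src D (vdom D s) = src D (vdom D t)"
  shows "\<lblot>s, t\<rblot> \<in> cell D \<langle>vdom D s, vdom D t\<rangle> \<langle>vcod D s, vcod D t\<rangle> \<and>
    Pr1 D (trg D (vdom D s)) (trg D (vdom D t)) \<rhd> \<lblot>s, t\<rblot> = s \<and> Pr2 D (trg D (vdom D s)) (trg D (vdom D t)) \<rhd> \<lblot>s, t\<rblot> = t"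
  unfolding pair2_def Let_def
  by (rule theI', rule cell_ex1) (use assms in \<open>simp_all add: cell_iff\<close>)

lemma typing_pair2 [simp]:
  assumes "s \<in> Cel D" "t \<in> Cel D" "src D (vdom D s) = src D (vdom D t)"
  shows "\<lblot>s, t\<rblot> \<in> Cel D" "vdom D \<lblot>s, t\<rblot> = \<langle>vdom D s, vdom D t\<rangle>" "vcod D \<lblot>s, t\<rblot> = \<langle>vcod D s, vcod D t\<rangle>"
  using pair2_props[OF assms] by (simp_all add: cell_iff)

lemma proj_pair2 [simp]:
  assumes "s \<in> Cel D" "t \<in> Cel D" "src D (vdom D s) = src D (vdom D t)" "trg D (vdom D s) = A" "trg D (vdom D t) = B"
  shows "Pr1 D A B \<rhd> \<lblot>s, t\<rblot> = s" "Pr2 D A B \<rhd> \<lblot>s, t\<rblot> = t"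
  using pair2_props[OF assms(1-3)] assms(4,5) by simp_all

text \<open>When a pairing is composed further, nesting to the right groups it with \<open>r\<close>
  instead of with the projection, and \<open>proj_pair2\<close> no longer matches; this rule covers
  that form.\<close>

lemma proj_pair2_hcmp [simp]:
  assumes "s \<in> Cel D" "t \<in> Cel D" "src D (vdom D s) = src D (vdom D t)" "trg D (vdom D s) = A" "trg D (vdom D t) = B"
    "r \<in> Cel D" "trg D (vdom D r) = src D (vdom D t)"
  shows "Pr1 D A B \<rhd> (\<lblot>s, t\<rblot> \<star> r) = s \<star> r" "Pr2 D A B \<rhd> (\<lblot>s, t\<rblot> \<star> r) = t \<star> r"
proof -
  have [simp]: "A \<in> Obj D" "B \<in> Obj D" using assms by auto
  show "Pr1 D A B \<rhd> (\<lblot>s, t\<rblot> \<star> r) = s \<star> r"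
    using hcmp_assoc'[of r "\<lblot>s, t\<rblot>" "id2 D (Pr1 D A B)"] assms by (simp del: hcmp_assoc')
  show "Pr2 D A B \<rhd> (\<lblot>s, t\<rblot> \<star> r) = t \<star> r"
    using hcmp_assoc'[of r "\<lblot>s, t\<rblot>" "id2 D (Pr2 D A B)"] assms by (simp del: hcmp_assoc')
qed

lemma pair2_hcmp [simp]:
  assumes "s \<in> Cel D" "t \<in> Cel D" "src D (vdom D s) = src D (vdom D t)" 
    "r \<in> Cel D" "trg D (vdom D r) = src D (vdom D t)"
  shows "\<lblot>s, t\<rblot> \<star> r = \<lblot>s \<star> r, t \<star> r\<rblot>"
  by (rule cell_eqI[where A = "trg D (vdom D s)" and B = "trg D (vdom D t)"]) (use assms in simp_all)

lemma pair2_id2 [simp]: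
  assumes "f \<in> Arr D" "g \<in> Arr D" "src D f = src D g"
  shows "\<lblot>id2 D f, id2 D g\<rblot> = id2 D \<langle>f, g\<rangle>"
  by (rule cell_eqI[where A = "trg D f" and B = "trg D g"]) (use assms in simp_all)

lemma pair2_vcmp:
  assumes "s \<in> Cel D" "t \<in> Cel D" "src D (vdom D s) = src D (vdom D t)" "s' \<in> Cel D" "t' \<in> Cel D"
    "vcod D s = vdom D s'" "vcod D t = vdom D t'"
  shows "\<lblot>s', t'\<rblot> \<bullet> \<lblot>s, t\<rblot> = \<lblot>s' \<bullet> s, t' \<bullet> t\<rblot>"
proof -
  have [simp]: "src D (vdom D s') = src D (vdom D t)" "src D (vdom D t') = src D (vdom D t)" 
    "trg D (vdom D s') = trg D (vdom D s)" "trg D (vdom D t') = trg D (vdom D t)"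
    using assms parallel[of s] parallel[of t] by auto
  show ?thesis
    by (rule cell_eqI[where A = "trg D (vdom D s)" and B = "trg D (vdom D t)"]) (use assms in simp_all)
qed

lemma One_Obj [simp]: "One D \<in> Obj D"
  using terminal_One by (simp add: terminal_0cell_def)

lemma typing_bang [simp]:
  assumes "X \<in> Obj D"
  shows "bang D X \<in> Arr D" "src D (bang D X) = X" "trg D (bang D X) = One D"
proof -
  have "bang D X \<in> hom D X (One D)"
    unfolding bang_def by (rule theI') (use assms terminal_One in \<open>simp add: terminal_0cell_def\<close>)
  then show "bang D X \<in> Arr D" "src D (bang D X) = X" "trg D (bang D X) = One D" by (simp_all add: hom_iff)
qed

lemma bang_unique:
  assumes "f \<in> Arr D" "trg D f = One D"
  shows "f = bang D (src D f)"
proof -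
  have "\<exists>!g. g \<in> hom D (src D f) (One D)" using assms terminal_One by (simp add: terminal_0cell_def)
  moreover have "f \<in> hom D (src D f) (One D)" "bang D (src D f) \<in> hom D (src D f) (One D)"
    using assms by (simp_all add: hom_iff)
  ultimately show ?thesis by blast
qed

lemma bang_cmp [simp]: "f \<in> Arr D \<Longrightarrow> X = trg D f \<Longrightarrow> bang D X \<cdot> f = bang D (src D f)"
  using bang_unique[of "bang D X \<cdot> f"] by simp

section \<open>Tensor, unit and associator at generalized elements\<close>

definition tensor_object where
  "tensor_object C \<longleftrightarrow> mobj C \<in> Obj D \<and> mtens C \<in> hom D (Prd D (mobj C) (mobj C)) (mobj C)"

lemma tensor_object_typing:
  assumes "tensor_object C"
  shows "mobj C \<in> Obj D" "mtens C \<in> Arr D" "src D (mtens C) = Prd D (mobj C) (mobj C)" "trg D (mtens C) = mobj C"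
  using assms by (simp_all add: tensor_object_def hom_iff)

lemma tens1_typing [simp]:
  assumes "tensor_object C" "f \<in> Arr D" "g \<in> Arr D" "src D f = src D g" "trg D f = mobj C" "trg D g = mobj C"
  shows "tens1 D C f g \<in> Arr D" "src D (tens1 D C f g) = src D g" "trg D (tens1 D C f g) = mobj C"
  using assms tensor_object_typing[OF assms(1)] by (simp_all add: tens1_def)

lemma tens1_cmp [simp]:
  assumes "tensor_object C" "f \<in> Arr D" "g \<in> Arr D" "src D f = src D g" "trg D f = mobj C" "trg D g = mobj C"
    "h \<in> Arr D" "trg D h = src D g"
  shows "tens1 D C f g \<cdot> h = tens1 D C (f \<cdot> h) (g \<cdot> h)"
  using assms tensor_object_typing[OF assms(1)] by (simp add: tens1_def)

lemma tens2_typing [simp]: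
  assumes "tensor_object C" "s \<in> Cel D" "t \<in> Cel D" "src D (vdom D s) = src D (vdom D t)"
    "trg D (vdom D s) = mobj C" "trg D (vdom D t) = mobj C"
  shows "tens2 D C s t \<in> Cel D" "vdom D (tens2 D C s t) = tens1 D C (vdom D s) (vdom D t)"
    "vcod D (tens2 D C s t) = tens1 D C (vcod D s) (vcod D t)"
  using assms tensor_object_typing[OF assms(1)] by (simp_all add: tens2_def tens1_def)

lemma tens2_whisker [simp]:
  assumes "tensor_object C" "s \<in> Cel D" "t \<in> Cel D" "src D (vdom D s) = src D (vdom D t)"
    "trg D (vdom D s) = mobj C" "trg D (vdom D t) = mobj C" "h \<in> Arr D" "trg D h = src D (vdom D t)"
  shows "tens2 D C s t \<lhd> h = tens2 D C (s \<lhd> h) (t \<lhd> h)"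
  using assms tensor_object_typing[OF assms(1)] by (simp add: tens2_def)

lemma tens1_hcmp:
  assumes "tensor_object C" "f \<in> Arr D" "g \<in> Arr D" "src D f = src D g" "trg D f = mobj C" "trg D g = mobj C"
    "t \<in> Cel D" "trg D (vdom D t) = src D g"
  shows "tens1 D C f g \<rhd> t = tens2 D C (f \<rhd> t) (g \<rhd> t)"
proof -
  have "\<langle>f, g\<rangle> \<rhd> t = \<lblot>f \<rhd> t, g \<rhd> t\<rblot>"
    using pair2_hcmp[of "id2 D f" "id2 D g" t] assms by simp
  moreover have "(mtens C \<cdot> \<langle>f, g\<rangle>) \<rhd> t = mtens C \<rhd> (\<langle>f, g\<rangle> \<rhd> t)"
    using assms tensor_object_typing[OF assms(1)] by simp
  ultimately show ?thesis by (simp add: tens2_def tens1_def)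
qed

lemma tens2_id2 [simp]:
  assumes "tensor_object C" "f \<in> Arr D" "g \<in> Arr D" "src D f = src D g" "trg D f = mobj C" "trg D g = mobj C"
  shows "tens2 D C (id2 D f) (id2 D g) = id2 D (tens1 D C f g)"
  using assms tensor_object_typing[OF assms(1)] by (simp add: tens1_def tens2_def)

lemma tens2_vcmp:
  assumes "tensor_object C" "s \<in> Cel D" "t \<in> Cel D" "src D (vdom D s) = src D (vdom D t)"
    "trg D (vdom D s) = mobj C" "trg D (vdom D t) = mobj C" "s' \<in> Cel D" "t' \<in> Cel D"
    "vcod D s = vdom D s'" "vcod D t = vdom D t'"
  shows "tens2 D C s' t' \<bullet> tens2 D C s t = tens2 D C (s' \<bullet> s) (t' \<bullet> t)"
proof -
  have [simp]: "src D (vdom D s') = src D (vdom D t)" "src D (vdom D t') = src D (vdom D t)" 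
    "trg D (vdom D s') = mobj C" "trg D (vdom D t') = mobj C"
    using assms parallel[of s] parallel[of t] by auto
  have "\<langle>vcod D s, vcod D t\<rangle> = \<langle>vdom D s', vdom D t'\<rangle>" using assms by simp
  then show ?thesis
    using assms tensor_object_typing[OF assms(1)] pair2_vcmp[of s t s' t', symmetric] 
    by (simp add: tens2_def)
qed

lemma tens1_projs: "tensor_object C \<Longrightarrow> tens1 D C (Pr1 D (mobj C) (mobj C)) (Pr2 D (mobj C) (mobj C)) = mtens C"
  using tensor_object_typing[of C] by (simp add: tens1_def)

lemma mtens_prod1: "tensor_object C \<Longrightarrow> f \<in> Arr D \<Longrightarrow> trg D f = mobj C \<Longrightarrow> src D f = A \<Longrightarrow>
  mtens C \<cdot> prod1 D f f = tens1 D C (f \<cdot> Pr1 D A A) (f \<cdot> Pr2 D A A)"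
  by (simp add: tens1_def prod1_def)

lemma mtens_prod2: "tensor_object C \<Longrightarrow> t \<in> Cel D \<Longrightarrow> trg D (vdom D t) = mobj C \<Longrightarrow> src D (vdom D t) = A \<Longrightarrow>
  mtens C \<rhd> prod2 D t t = tens2 D C (t \<lhd> Pr1 D A A) (t \<lhd> Pr2 D A A)"
  by (simp add: tens2_def prod2_def)

lemma monoidal_tensor_object [simp]: "monoidal_object D C \<Longrightarrow> tensor_object C"
  by (auto simp: monoidal_object_def Let_def tensor_object_def triple_projs_def)

lemma monoidal_typing:
  assumes "monoidal_object D C"
  shows "mobj C \<in> Obj D" "munit C \<in> Arr D" "src D (munit C) = One D" "trg D (munit C) = mobj C"
    "mlunit C \<in> Cel D" "vdom D (mlunit C) = tens1 D C (unit_at D C (mobj C)) (id1 D (mobj C))" "vcod D (mlunit C) = id1 D (mobj C)"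
    "mrunit C \<in> Cel D" "vdom D (mrunit C) = tens1 D C (id1 D (mobj C)) (unit_at D C (mobj C))" "vcod D (mrunit C) = id1 D (mobj C)"
  using assms by (auto simp: monoidal_object_def Let_def hom_iff cell_iff triple_projs_def)

lemma unit_at_typing [simp]:
  assumes "munit C \<in> Arr D" "src D (munit C) = One D" "X \<in> Obj D"
  shows "unit_at D C X \<in> Arr D" "src D (unit_at D C X) = X" "trg D (unit_at D C X) = trg D (munit C)"
  using assms by (simp_all add: unit_at_def)

lemma unit_at_cmp [simp]:
  assumes "munit C \<in> Arr D" "src D (munit C) = One D" "f \<in> Arr D" "trg D f = X"
  shows "unit_at D C X \<cdot> f = unit_at D C (src D f)"
  using assms by (auto simp: unit_at_def)

text \<open>Typing of the associator alone. Like \<open>tensor_object\<close>, it isolates what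
  evaluation at generalized elements depends on, because that calculus is applied to the Kleisli
  object before its axioms are proved.\<close>

definition assoc_typed where
  "assoc_typed C \<longleftrightarrow> (let (x, y, z) = triple_projs D (mobj C) in
     massoc C \<in> cell D (tens1 D C x (tens1 D C y z)) (tens1 D C (tens1 D C x y) z))"

lemma monoidal_assoc_typed [simp]: "monoidal_object D C \<Longrightarrow> assoc_typed C"
  by (auto simp: monoidal_object_def Let_def assoc_typed_def triple_projs_def)

lemma massoc_typing:
  assumes "tensor_object C" "assoc_typed C"
  shows "massoc C \<in> Cel D"
    "vdom D (massoc C) = (let (x, y, z) = triple_projs D (mobj C) in tens1 D C x (tens1 D C y z))"
    "vcod D (massoc C) = (let (x, y, z) = triple_projs D (mobj C) in tens1 D C (tens1 D C x y) z)"
    "src D (vdom D (massoc C)) = Prd D (Prd D (mobj C) (mobj C)) (mobj C)"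
  using assms tensor_object_typing[OF assms(1)] by (auto simp: assoc_typed_def cell_iff triple_projs_def Let_def)

lemma assoc_at_typing [simp]:
  assumes "tensor_object C" "assoc_typed C" "f \<in> Arr D" "g \<in> Arr D" "h \<in> Arr D" "src D f = src D h" "src D g = src D h"
    "trg D f = mobj C" "trg D g = mobj C" "trg D h = mobj C"
  shows "assoc_at D C f g h \<in> Cel D" "vdom D (assoc_at D C f g h) = tens1 D C f (tens1 D C g h)"
    "vcod D (assoc_at D C f g h) = tens1 D C (tens1 D C f g) h"
  using assms massoc_typing[OF assms(1,2)] tensor_object_typing[OF assms(1)]
  by (simp_all add: assoc_at_def triple_projs_def Let_def)

lemma assoc_at_whisker [simp]:
  assumes "tensor_object C" "assoc_typed C" "f \<in> Arr D" "g \<in> Arr D" "h \<in> Arr D" "src D f = src D h" "src D g = src D h"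
    "trg D f = mobj C" "trg D g = mobj C" "trg D h = mobj C" "k \<in> Arr D" "trg D k = src D h"
  shows "assoc_at D C f g h \<lhd> k = assoc_at D C (f \<cdot> k) (g \<cdot> k) (h \<cdot> k)"
  using assms massoc_typing[OF assms(1,2)] tensor_object_typing[OF assms(1)]
  by (simp add: assoc_at_def)

text \<open>Every ingredient of the axiom is stable under precomposition, so whiskering the axiom at
  the four projections with the tuple of \<open>w\<close>, \<open>x\<close>, \<open>y\<close>,
  \<open>z\<close> gives it at these arrows. The other axioms are instantiated in the same
  way.\<close>

lemma pentagon_at:
  assumes C: "monoidal_object D C" and "w \<in> Arr D" "x \<in> Arr D" "y \<in> Arr D" "z \<in> Arr D" 
    "src D w = X" "src D x = X" "src D y = X" "src D z = X" "trg D w = mobj C" "trg D x = mobj C" "trg D y = mobj C" "trg D z = mobj C"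
  shows "assoc_at D C (tens1 D C w x) y z \<bullet> assoc_at D C w x (tens1 D C y z) =
      tens2 D C (assoc_at D C w x y) (id2 D z) \<bullet> assoc_at D C w (tens1 D C x y) z
        \<bullet> tens2 D C (id2 D w) (assoc_at D C x y z)"
proof -
  have "pentagon D C" using C by (auto simp: monoidal_object_def Let_def triple_projs_def)
  from arg_cong[OF this[unfolded pentagon_def quadruple_projs_def triple_projs_def Let_def, simplified],
      of "\<lambda>t. t \<lhd> \<langle>\<langle>\<langle>w, x\<rangle>, y\<rangle>, z\<rangle>"]
  show ?thesis using assms monoidal_typing[OF C] by simp
qed

lemma triangle_at:
  assumes C: "monoidal_object D C" and "x \<in> Arr D" "y \<in> Arr D" 
    "src D x = X" "src D y = X" "trg D x = mobj C" "trg D y = mobj C" 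
  shows "tens2 D C (mrunit C \<lhd> x) (id2 D y) \<bullet> assoc_at D C x (unit_at D C X) y =
      tens2 D C (id2 D x) (mlunit C \<lhd> y)"
proof -
  have "unit_triangle D C" using C by (auto simp: monoidal_object_def Let_def triple_projs_def)
  from arg_cong[OF this[unfolded unit_triangle_def Let_def], of "\<lambda>t. t \<lhd> \<langle>x, y\<rangle>"]
  show ?thesis using assms monoidal_typing[OF C] by (auto simp: assms)
qed

end

section \<open>The 2-category of monoidal objects\<close>

context fp_2cat
begin

text \<open>Merging whiskers turns a projection followed by \<open>f\<close> into a single whisker
  by \<open>f \<cdot> Pr1 D A B\<close>, where \<open>proj_pair2\<close> does not see the
  projection; this rule still evaluates it.\<close>

lemma cmp_proj_pair2 [simp]:
  assumes "s \<in> Cel D" "t \<in> Cel D" "src D (vdom D s) = src D (vdom D t)" "trg D (vdom D s) = A" "trg D (vdom D t) = B"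
    "f \<in> Arr D"
  shows "src D f = A \<Longrightarrow> (f \<cdot> Pr1 D A B) \<rhd> \<lblot>s, t\<rblot> = f \<rhd> s" "src D f = B \<Longrightarrow> (f \<cdot> Pr2 D A B) \<rhd> \<lblot>s, t\<rblot> = f \<rhd> t"
proof -
  have [simp]: "A \<in> Obj D" "B \<in> Obj D" using assms by auto
  show "src D f = A \<Longrightarrow> (f \<cdot> Pr1 D A B) \<rhd> \<lblot>s, t\<rblot> = f \<rhd> s"
    using assms whisker_whisker[of "\<lblot>s, t\<rblot>" "Pr1 D A B" f] by simp
  show "src D f = B \<Longrightarrow> (f \<cdot> Pr2 D A B) \<rhd> \<lblot>s, t\<rblot> = f \<rhd> t"
    using assms whisker_whisker[of "\<lblot>s, t\<rblot>" "Pr2 D A B" f] by simp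
qed

definition lax_typed where
  "lax_typed F \<longleftrightarrow> monoidal_object D (lsrc F) \<and> monoidal_object D (ltrg F) \<and>
      larr F \<in> hom D (mobj (lsrc F)) (mobj (ltrg F)) \<and>
      lmult F \<in> cell D (mtens (ltrg F) \<cdot> prod1 D (larr F) (larr F)) (larr F \<cdot> mtens (lsrc F)) \<and>
      lunit F \<in> cell D (munit (ltrg F)) (larr F \<cdot> munit (lsrc F))"

lemma lax_monoidal_iff: "lax_monoidal D F \<longleftrightarrow> lax_typed F \<and> lax_assoc D F \<and> lax_left_unit D F \<and> lax_right_unit D F"
  by (auto simp: lax_monoidal_def lax_typed_def Let_def)

lemma lax_typing:
  assumes "lax_typed F"
  shows "monoidal_object D (lsrc F)" "monoidal_object D (ltrg F)" "larr F \<in> Arr D" "src D (larr F) = mobj (lsrc F)"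
    "trg D (larr F) = mobj (ltrg F)" "lunit F \<in> Cel D" "vdom D (lunit F) = munit (ltrg F)"
    "vcod D (lunit F) = larr F \<cdot> munit (lsrc F)" "lmult F \<in> Cel D"
    "vcod D (lmult F) = larr F \<cdot> mtens (lsrc F)"
    "vdom D (lmult F) = tens1 D (ltrg F) (larr F \<cdot> Pr1 D (mobj (lsrc F)) (mobj (lsrc F))) (larr F \<cdot> Pr2 D (mobj (lsrc F)) (mobj (lsrc F)))"
  using assms mtens_prod1[of "ltrg F" "larr F" "mobj (lsrc F)"] by (auto simp: lax_typed_def hom_iff cell_iff)

lemma lax_typedI:
  assumes "monoidal_object D (lsrc F)" "monoidal_object D (ltrg F)" "larr F \<in> hom D (mobj (lsrc F)) (mobj (ltrg F))"
    "lunit F \<in> cell D (munit (ltrg F)) (larr F \<cdot> munit (lsrc F))"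
    "lmult F \<in> cell D (tens1 D (ltrg F) (larr F \<cdot> Pr1 D (mobj (lsrc F)) (mobj (lsrc F))) (larr F \<cdot> Pr2 D (mobj (lsrc F)) (mobj (lsrc F))))
       (larr F \<cdot> mtens (lsrc F))"
  shows "lax_typed F"
  using assms mtens_prod1[of "ltrg F" "larr F" "mobj (lsrc F)"] by (auto simp: lax_typed_def hom_iff cell_iff)

lemma lmult_at_typing [simp]:
  assumes "lax_typed F" "x \<in> Arr D" "y \<in> Arr D" "src D x = src D y" "trg D x = mobj (lsrc F)" "trg D y = mobj (lsrc F)"
  shows "lmult_at D F x y \<in> Cel D" "vdom D (lmult_at D F x y) = tens1 D (ltrg F) (larr F \<cdot> x) (larr F \<cdot> y)"
    "vcod D (lmult_at D F x y) = larr F \<cdot> tens1 D (lsrc F) x y"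
  using assms lax_typing[OF assms(1)] monoidal_typing[OF lax_typing(1)[OF assms(1)]]
    monoidal_typing[OF lax_typing(2)[OF assms(1)]] tensor_object_typing[of "lsrc F"] tensor_object_typing[of "ltrg F"]
  by (simp_all add: lmult_at_def tens1_def)

lemma lmult_at_whisker [simp]:
  assumes "lax_typed F" "x \<in> Arr D" "y \<in> Arr D" "src D x = src D y" "trg D x = mobj (lsrc F)" "trg D y = mobj (lsrc F)"
    "h \<in> Arr D" "trg D h = src D y"
  shows "lmult_at D F x y \<lhd> h = lmult_at D F (x \<cdot> h) (y \<cdot> h)"
  using assms lax_typing[OF assms(1)] monoidal_typing[OF lax_typing(1)[OF assms(1)]]
    monoidal_typing[OF lax_typing(2)[OF assms(1)]] tensor_object_typing[of "lsrc F"] tensor_object_typing[of "ltrg F"]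
  by (simp add: lmult_at_def)

text \<open>Both sides are the horizontal composite of \<open>lmult F\<close> with the pairing of
  \<open>s\<close> and \<open>t\<close>, so naturality in generalized elements is
  interchange.\<close>

lemma lmult_natural:
  assumes F: "lax_typed F" and s: "s \<in> Cel D" "vdom D s = x" "vcod D s = x'" and t: "t \<in> Cel D" "vdom D t = y" "vcod D t = y'"
    and "src D x = src D y" "trg D x = mobj (lsrc F)" "trg D y = mobj (lsrc F)"
  shows "lmult_at D F x' y' \<bullet> tens2 D (ltrg F) (larr F \<rhd> s) (larr F \<rhd> t) =
    (larr F \<rhd> tens2 D (lsrc F) s t) \<bullet> lmult_at D F x y"
proof -
  note [simp] = lax_typing[OF F] monoidal_typing[OF lax_typing(1)[OF F]]
    monoidal_typing[OF lax_typing(2)[OF F]] tensor_object_typing[of "lsrc F"] tensor_object_typing[of "ltrg F"]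
  have [simp]: "x \<in> Arr D" "y \<in> Arr D" "x' \<in> Arr D" "y' \<in> Arr D" "src D x' = src D y" "src D y' = src D y"
    "trg D x' = mobj (lsrc F)" "trg D y' = mobj (lsrc F)"
    using assms parallel[of s] parallel[of t] by auto
  note [simp] = s t assms(8-)
  have 1: "larr F \<rhd> tens2 D (lsrc F) s t = vcod D (lmult F) \<rhd> \<lblot>s, t\<rblot>" by (simp add: tens2_def)
  have 2: "tens2 D (ltrg F) (larr F \<rhd> s) (larr F \<rhd> t) = vdom D (lmult F) \<rhd> \<lblot>s, t\<rblot>" by (simp add: tens1_hcmp)
  show ?thesis unfolding lmult_at_def 1 2
    by (rule exchange) simp_all
qed

lemma lax_assoc_at:
  assumes F: "lax_monoidal D F" and "x \<in> Arr D" "y \<in> Arr D" "z \<in> Arr D" "src D x = X" "src D y = X" "src D z = X"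
    "trg D x = mobj (lsrc F)" "trg D y = mobj (lsrc F)" "trg D z = mobj (lsrc F)"
  shows "(larr F \<rhd> assoc_at D (lsrc F) x y z) \<bullet> lmult_at D F x (tens1 D (lsrc F) y z)
        \<bullet> tens2 D (ltrg F) (id2 D (larr F \<cdot> x)) (lmult_at D F y z) =
      lmult_at D F (tens1 D (lsrc F) x y) z \<bullet> tens2 D (ltrg F) (lmult_at D F x y) (id2 D (larr F \<cdot> z))
        \<bullet> assoc_at D (ltrg F) (larr F \<cdot> x) (larr F \<cdot> y) (larr F \<cdot> z)"
proof -
  have T: "lax_typed F" and "lax_assoc D F" using F by (auto simp: lax_monoidal_iff)
  note [simp] = lax_typing[OF T] monoidal_typing[OF lax_typing(1)[OF T]] monoidal_typing[OF lax_typing(2)[OF T]]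
  from arg_cong[OF \<open>lax_assoc D F\<close>[unfolded lax_assoc_def triple_projs_def Let_def, simplified],
      of "\<lambda>t. t \<lhd> \<langle>\<langle>x, y\<rangle>, z\<rangle>"]
  show ?thesis using assms T by simp
qed

lemma lax_units_at:
  assumes F: "lax_monoidal D F" and x: "x \<in> Arr D" "src D x = X" "trg D x = mobj (lsrc F)"
  shows "(larr F \<rhd> (mlunit (lsrc F) \<lhd> x)) \<bullet> lmult_at D F (unit_at D (lsrc F) X) x
        \<bullet> tens2 D (ltrg F) (lunit F \<lhd> bang D X) (id2 D (larr F \<cdot> x)) = mlunit (ltrg F) \<lhd> (larr F \<cdot> x)"
    "(larr F \<rhd> (mrunit (lsrc F) \<lhd> x)) \<bullet> lmult_at D F x (unit_at D (lsrc F) X)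
        \<bullet> tens2 D (ltrg F) (id2 D (larr F \<cdot> x)) (lunit F \<lhd> bang D X) = mrunit (ltrg F) \<lhd> (larr F \<cdot> x)"
proof -
  have T: "lax_typed F" and l: "lax_left_unit D F" and r: "lax_right_unit D F" using F by (auto simp: lax_monoidal_iff)
  note [simp] = lax_typing[OF T] monoidal_typing[OF lax_typing(1)[OF T]] monoidal_typing[OF lax_typing(2)[OF T]]
  have [simp]: "X \<in> Obj D" using x by auto
  have u: "larr F \<cdot> (munit (lsrc F) \<cdot> bang D Y) = larr F \<cdot> unit_at D (lsrc F) Y" "munit (ltrg F) \<cdot> bang D Y = unit_at D (ltrg F) Y" for Y
    by (simp_all add: unit_at_def)
  from arg_cong[OF l[unfolded lax_left_unit_def Let_def], of "\<lambda>t. t \<lhd> x"]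
  show "(larr F \<rhd> (mlunit (lsrc F) \<lhd> x)) \<bullet> lmult_at D F (unit_at D (lsrc F) X) x
        \<bullet> tens2 D (ltrg F) (lunit F \<lhd> bang D X) (id2 D (larr F \<cdot> x)) = mlunit (ltrg F) \<lhd> (larr F \<cdot> x)"
    using x T by (simp add: u)
  from arg_cong[OF r[unfolded lax_right_unit_def Let_def], of "\<lambda>t. t \<lhd> x"]
  show "(larr F \<rhd> (mrunit (lsrc F) \<lhd> x)) \<bullet> lmult_at D F x (unit_at D (lsrc F) X)
        \<bullet> tens2 D (ltrg F) (id2 D (larr F \<cdot> x)) (lunit F \<lhd> bang D X) = mrunit (ltrg F) \<lhd> (larr F \<cdot> x)"
    using x T by (simp add: u)
qed

text \<open>The projections of the triple product enter as variables with their typing facts, so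
  that proofs of the associativity axiom compute with opaque arrows; the equation for
  \<open>triple_projs\<close> keeps their origin at hand.\<close>

lemma lax_monoidalI:
  assumes T: "lax_typed F"
    and assoc: "\<And>x y z. x \<in> Arr D \<Longrightarrow> y \<in> Arr D \<Longrightarrow> z \<in> Arr D \<Longrightarrow> src D x = Prd D (Prd D (mobj (lsrc F)) (mobj (lsrc F))) (mobj (lsrc F)) \<Longrightarrow>
      src D y = Prd D (Prd D (mobj (lsrc F)) (mobj (lsrc F))) (mobj (lsrc F)) \<Longrightarrow> src D z = Prd D (Prd D (mobj (lsrc F)) (mobj (lsrc F))) (mobj (lsrc F)) \<Longrightarrow>
      trg D x = mobj (lsrc F) \<Longrightarrow> trg D y = mobj (lsrc F) \<Longrightarrow> trg D z = mobj (lsrc F) \<Longrightarrow>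
      triple_projs D (mobj (lsrc F)) = (x, y, z) \<Longrightarrow>
      (larr F \<rhd> assoc_at D (lsrc F) x y z) \<bullet> lmult_at D F x (tens1 D (lsrc F) y z)
        \<bullet> tens2 D (ltrg F) (id2 D (larr F \<cdot> x)) (lmult_at D F y z) =
      lmult_at D F (tens1 D (lsrc F) x y) z \<bullet> tens2 D (ltrg F) (lmult_at D F x y) (id2 D (larr F \<cdot> z))
        \<bullet> assoc_at D (ltrg F) (larr F \<cdot> x) (larr F \<cdot> y) (larr F \<cdot> z)"
    and l: "(larr F \<rhd> mlunit (lsrc F)) \<bullet> lmult_at D F (unit_at D (lsrc F) (mobj (lsrc F))) (id1 D (mobj (lsrc F)))
        \<bullet> tens2 D (ltrg F) (lunit F \<lhd> bang D (mobj (lsrc F))) (id2 D (larr F)) = mlunit (ltrg F) \<lhd> larr F"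
    and r: "(larr F \<rhd> mrunit (lsrc F)) \<bullet> lmult_at D F (id1 D (mobj (lsrc F))) (unit_at D (lsrc F) (mobj (lsrc F)))
        \<bullet> tens2 D (ltrg F) (id2 D (larr F)) (lunit F \<lhd> bang D (mobj (lsrc F))) = mrunit (ltrg F) \<lhd> larr F"
  shows "lax_monoidal D F"
proof -
  note [simp] = lax_typing[OF T] monoidal_typing[OF lax_typing(1)[OF T]] 
  let ?c = "mobj (lsrc F)" let ?c2 = "Prd D ?c ?c"
  let ?x = "Pr1 D ?c ?c \<cdot> Pr1 D ?c2 ?c" and ?y = "Pr2 D ?c ?c \<cdot> Pr1 D ?c2 ?c" and ?z = "Pr2 D ?c2 ?c"
  have "lax_assoc D F"
    using assoc[of ?x ?y ?z] by (simp add: lax_assoc_def Let_def triple_projs_def)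
  then show ?thesis using T l r by (simp add: lax_monoidal_iff lax_left_unit_def lax_right_unit_def Let_def)
qed

lemma lax_comp_lmult_at:
  assumes F: "lax_typed F" and G: "lax_typed G" and FG: "ltrg F = lsrc G"
    and "x \<in> Arr D" "y \<in> Arr D" "src D x = src D y" "trg D x = mobj (lsrc F)" "trg D y = mobj (lsrc F)"
  shows "lmult_at D (lax_comp D G F) x y = (larr G \<rhd> lmult_at D F x y) \<bullet> lmult_at D G (larr F \<cdot> x) (larr F \<cdot> y)"
proof -
  note [simp] = lax_typing[OF F] lax_typing[OF G] monoidal_typing[OF lax_typing(1)[OF F]] monoidal_typing[OF lax_typing(1)[OF G]]
    monoidal_typing[OF lax_typing(2)[OF F]] tensor_object_typing[of "lsrc F"] tensor_object_typing[of "lsrc G"]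
  have "larr G \<cdot> tens1 D (lsrc G) (larr F \<cdot> Pr1 D (mobj (lsrc F)) (mobj (lsrc F))) (larr F \<cdot> Pr2 D (mobj (lsrc F)) (mobj (lsrc F))) =
     larr G \<cdot> mtens (lsrc G) \<cdot> \<langle>larr F \<cdot> Pr1 D (mobj (lsrc F)) (mobj (lsrc F)), larr F \<cdot> Pr2 D (mobj (lsrc F)) (mobj (lsrc F))\<rangle>"
    by (simp add: tens1_def)
  then show ?thesis
    using assms by (simp add: lmult_at_def lax_comp_def prod1_def)
qed

lemma lax_comp_typed:
  assumes F: "lax_typed F" and G: "lax_typed G" and FG: "ltrg F = lsrc G"
  shows "lax_typed (lax_comp D G F)"
proof -
  note [simp] = lax_typing[OF F] lax_typing[OF G] monoidal_typing[OF lax_typing(1)[OF F]] monoidal_typing[OF lax_typing(1)[OF G]]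
    monoidal_typing[OF lax_typing(2)[OF G]]
    monoidal_typing[OF lax_typing(2)[OF F]] tensor_object_typing[of "lsrc F"] tensor_object_typing[of "lsrc G"] tensor_object_typing[of "ltrg G"]
  have "larr G \<cdot> tens1 D (lsrc G) (larr F \<cdot> Pr1 D (mobj (lsrc F)) (mobj (lsrc F))) (larr F \<cdot> Pr2 D (mobj (lsrc F)) (mobj (lsrc F))) =
     larr G \<cdot> mtens (lsrc G) \<cdot> \<langle>larr F \<cdot> Pr1 D (mobj (lsrc F)) (mobj (lsrc F)), larr F \<cdot> Pr2 D (mobj (lsrc F)) (mobj (lsrc F))\<rangle>"
    by (simp add: tens1_def)
  then show ?thesis
    by (intro lax_typedI) (use FG in \<open>simp_all add: lax_comp_def hom_iff cell_iff prod1_def\<close>)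
qed

text \<open>The axioms of \<open>F\<close>, whiskered with \<open>g\<close>, are pasted to those of
  \<open>G\<close> at arrows that pass through \<open>f\<close>. Between them the multiplication of
  \<open>G\<close> is moved past the structure cells of \<open>F\<close> by
  \<open>lmult_natural\<close>.\<close>

lemma lax_comp_lax:
  assumes F: "lax_monoidal D F" and G: "lax_monoidal D G" and FG: "ltrg F = lsrc G"
  shows "lax_monoidal D (lax_comp D G F)"
proof -
  have TF: "lax_typed F" and TG: "lax_typed G" using F G by (simp_all add: lax_monoidal_iff)
  define A B E f g where A: "A = lsrc F" and B: "B = lsrc G" and E: "E = ltrg G" and f: "f = larr F" and g: "g = larr G"
  note fold = A[symmetric] B[symmetric] E[symmetric] f[symmetric] g[symmetric]
  have FB: "ltrg F = B" using FG B by simp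
  note [simp] = TF TG lax_typing[OF TF, unfolded fold FB] lax_typing[OF TG, unfolded fold] 
    monoidal_typing[OF lax_typing(1)[OF TF], unfolded fold] monoidal_typing[OF lax_typing(1)[OF TG], unfolded fold]
    monoidal_typing[OF lax_typing(2)[OF TG], unfolded fold]
    lax_comp_typed[OF TF TG FG]
    lmult_at_typing[OF TF, unfolded fold FB] lmult_at_typing[OF TG, unfolded fold] 
    lmult_at_whisker[OF TF, unfolded fold FB] lmult_at_whisker[OF TG, unfolded fold] 
  have sel [simp]: "lsrc (lax_comp D G F) = A" "ltrg (lax_comp D G F) = E" "larr (lax_comp D G F) = g \<cdot> f"
    by (simp_all add: lax_comp_def fold)
  note mu = lax_comp_lmult_at[OF TF TG FG, unfolded fold]
  have lu: "lunit (lax_comp D G F) = (g \<rhd> lunit F) \<bullet> lunit G" by (simp add: lax_comp_def g)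
  show ?thesis
  proof (rule lax_monoidalI, unfold sel)
    fix x y z X assume xyz [simp]: "x \<in> Arr D" "y \<in> Arr D" "z \<in> Arr D" "src D x = Prd D (Prd D (mobj A) (mobj A)) (mobj A)" 
      "src D y = Prd D (Prd D (mobj A) (mobj A)) (mobj A)"
      "src D z = Prd D (Prd D (mobj A) (mobj A)) (mobj A)" "trg D x = mobj A" "trg D y = mobj A" "trg D z = mobj A"
    have s1: "tens2 D E (id2 D (g \<cdot> f \<cdot> x)) ((g \<rhd> lmult_at D F y z) \<bullet> lmult_at D G (f \<cdot> y) (f \<cdot> z)) =
      tens2 D E (id2 D (g \<cdot> f \<cdot> x)) (g \<rhd> lmult_at D F y z) \<bullet> tens2 D E (id2 D (g \<cdot> f \<cdot> x)) (lmult_at D G (f \<cdot> y) (f \<cdot> z))"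
      by (subst tens2_vcmp) simp_all
    have s2: "tens2 D E ((g \<rhd> lmult_at D F x y) \<bullet> lmult_at D G (f \<cdot> x) (f \<cdot> y)) (id2 D (g \<cdot> f \<cdot> z)) =
      tens2 D E (g \<rhd> lmult_at D F x y) (id2 D (g \<cdot> f \<cdot> z)) \<bullet> tens2 D E (lmult_at D G (f \<cdot> x) (f \<cdot> y)) (id2 D (g \<cdot> f \<cdot> z))"
      by (subst tens2_vcmp) simp_all
    have n1: "lmult_at D G (f \<cdot> x) (f \<cdot> tens1 D A y z) \<bullet> tens2 D E (id2 D (g \<cdot> f \<cdot> x)) (g \<rhd> lmult_at D F y z) =
       (g \<rhd> tens2 D B (id2 D (f \<cdot> x)) (lmult_at D F y z)) \<bullet> lmult_at D G (f \<cdot> x) (tens1 D B (f \<cdot> y) (f \<cdot> z))"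
      using lmult_natural[OF TG, unfolded fold, of "id2 D (f \<cdot> x)" "f \<cdot> x" "f \<cdot> x" "lmult_at D F y z" "tens1 D B (f \<cdot> y) (f \<cdot> z)" "f \<cdot> tens1 D A y z"]
      by simp
    have n2: "lmult_at D G (f \<cdot> tens1 D A x y) (f \<cdot> z) \<bullet> tens2 D E (g \<rhd> lmult_at D F x y) (id2 D (g \<cdot> f \<cdot> z)) =
       (g \<rhd> tens2 D B (lmult_at D F x y) (id2 D (f \<cdot> z))) \<bullet> lmult_at D G (tens1 D B (f \<cdot> x) (f \<cdot> y)) (f \<cdot> z)"
      using lmult_natural[OF TG, unfolded fold, of "lmult_at D F x y" "tens1 D B (f \<cdot> x) (f \<cdot> y)" "f \<cdot> tens1 D A x y" "id2 D (f \<cdot> z)" "f \<cdot> z" "f \<cdot> z"]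
      by simp
    have a0: "(f \<rhd> assoc_at D A x y z) \<bullet> lmult_at D F x (tens1 D A y z) \<bullet> tens2 D B (id2 D (f \<cdot> x)) (lmult_at D F y z) =
      lmult_at D F (tens1 D A x y) z \<bullet> tens2 D B (lmult_at D F x y) (id2 D (f \<cdot> z)) \<bullet> assoc_at D B (f \<cdot> x) (f \<cdot> y) (f \<cdot> z)"
      by (rule lax_assoc_at[OF F, unfolded fold FB, of x y z "src D x"]) simp_all
    have a1: "((g \<cdot> f) \<rhd> assoc_at D A x y z) \<bullet> (g \<rhd> lmult_at D F x (tens1 D A y z))
        \<bullet> (g \<rhd> tens2 D B (id2 D (f \<cdot> x)) (lmult_at D F y z)) =
      (g \<rhd> lmult_at D F (tens1 D A x y) z) \<bullet> (g \<rhd> tens2 D B (lmult_at D F x y) (id2 D (f \<cdot> z)))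
        \<bullet> (g \<rhd> assoc_at D B (f \<cdot> x) (f \<cdot> y) (f \<cdot> z))"
      using arg_cong[OF a0, of "\<lambda>t. g \<rhd> t"] by simp
    have a2: "(g \<rhd> assoc_at D B (f \<cdot> x) (f \<cdot> y) (f \<cdot> z)) \<bullet> lmult_at D G (f \<cdot> x) (tens1 D B (f \<cdot> y) (f \<cdot> z))
        \<bullet> tens2 D E (id2 D (g \<cdot> f \<cdot> x)) (lmult_at D G (f \<cdot> y) (f \<cdot> z)) =
      lmult_at D G (tens1 D B (f \<cdot> x) (f \<cdot> y)) (f \<cdot> z) \<bullet> tens2 D E (lmult_at D G (f \<cdot> x) (f \<cdot> y)) (id2 D (g \<cdot> f \<cdot> z))
        \<bullet> assoc_at D E (g \<cdot> f \<cdot> x) (g \<cdot> f \<cdot> y) (g \<cdot> f \<cdot> z)"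
      by (rule lax_assoc_at[OF G, unfolded fold, of "f \<cdot> x" "f \<cdot> y" "f \<cdot> z" "src D x"]) simp_all
    show "((g \<cdot> f) \<rhd> assoc_at D A x y z) \<bullet> lmult_at D (lax_comp D G F) x (tens1 D A y z)
        \<bullet> tens2 D E (id2 D ((g \<cdot> f) \<cdot> x)) (lmult_at D (lax_comp D G F) y z) =
      lmult_at D (lax_comp D G F) (tens1 D A x y) z \<bullet> tens2 D E (lmult_at D (lax_comp D G F) x y) (id2 D ((g \<cdot> f) \<cdot> z))
        \<bullet> assoc_at D E ((g \<cdot> f) \<cdot> x) ((g \<cdot> f) \<cdot> y) ((g \<cdot> f) \<cdot> z)"
      by (simp add: mu s1 s2 vcmp_extend[OF n1] vcmp_extend[OF n2] vcmp_extend3[OF a1] a2)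
  next
    let ?c = "mobj A" let ?I = "unit_at D A (mobj A)"
    have u: "f \<cdot> (munit A \<cdot> bang D Y) = f \<cdot> unit_at D A Y" "g \<cdot> f \<cdot> (munit A \<cdot> bang D Y) = g \<cdot> f \<cdot> unit_at D A Y" 
      "g \<cdot> (munit B \<cdot> bang D Y) = g \<cdot> unit_at D B Y" "munit B \<cdot> bang D Y = unit_at D B Y" "munit E \<cdot> bang D Y = unit_at D E Y" for Y
      by (simp_all add: unit_at_def)
    have s1: "tens2 D E ((g \<rhd> lunit F \<lhd> bang D ?c) \<bullet> (lunit G \<lhd> bang D ?c)) (id2 D (g \<cdot> f)) =
      tens2 D E (g \<rhd> lunit F \<lhd> bang D ?c) (id2 D (g \<cdot> f)) \<bullet> tens2 D E (lunit G \<lhd> bang D ?c) (id2 D (g \<cdot> f))"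
      by (subst tens2_vcmp) (simp_all add: u)
    have n1: "lmult_at D G (f \<cdot> ?I) f \<bullet> tens2 D E (g \<rhd> lunit F \<lhd> bang D ?c) (id2 D (g \<cdot> f)) =
       (g \<rhd> tens2 D B (lunit F \<lhd> bang D ?c) (id2 D f)) \<bullet> lmult_at D G (unit_at D B ?c) f"
      using lmult_natural[OF TG, unfolded fold, of "lunit F \<lhd> bang D ?c" "unit_at D B ?c" "f \<cdot> ?I" "id2 D f" f f]
      by (simp add: u)
    have a0: "(f \<rhd> (mlunit A \<lhd> id1 D ?c)) \<bullet> lmult_at D F ?I (id1 D ?c) \<bullet> tens2 D B (lunit F \<lhd> bang D ?c) (id2 D (f \<cdot> id1 D ?c)) = mlunit B \<lhd> (f \<cdot> id1 D ?c)"
      by (rule lax_units_at(1)[OF F, unfolded fold FB]) simp_all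
    have a1: "((g \<cdot> f) \<rhd> mlunit A) \<bullet> (g \<rhd> lmult_at D F ?I (id1 D ?c)) \<bullet> (g \<rhd> tens2 D B (lunit F \<lhd> bang D ?c) (id2 D f)) =
       g \<rhd> (mlunit B \<lhd> f)"
      using arg_cong[OF a0, of "\<lambda>t. g \<rhd> t"] by (simp add: u)
    have a2: "(g \<rhd> (mlunit B \<lhd> f)) \<bullet> lmult_at D G (unit_at D B ?c) f \<bullet> tens2 D E (lunit G \<lhd> bang D ?c) (id2 D (g \<cdot> f)) = mlunit E \<lhd> (g \<cdot> f)"
      by (rule lax_units_at(1)[OF G, unfolded fold, of f ?c]) simp_all
    show "((g \<cdot> f) \<rhd> mlunit A) \<bullet> lmult_at D (lax_comp D G F) ?I (id1 D ?c)
        \<bullet> tens2 D E (lunit (lax_comp D G F) \<lhd> bang D ?c) (id2 D (g \<cdot> f)) = mlunit E \<lhd> (g \<cdot> f)"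
      by (simp add: mu lu s1 u vcmp_extend[OF n1] vcmp_extend3[OF a1] a2)
    have s1: "tens2 D E (id2 D (g \<cdot> f)) ((g \<rhd> lunit F \<lhd> bang D ?c) \<bullet> (lunit G \<lhd> bang D ?c)) =
      tens2 D E (id2 D (g \<cdot> f)) (g \<rhd> lunit F \<lhd> bang D ?c) \<bullet> tens2 D E (id2 D (g \<cdot> f)) (lunit G \<lhd> bang D ?c)"
      by (subst tens2_vcmp) (simp_all add: u)
    have n1: "lmult_at D G f (f \<cdot> ?I) \<bullet> tens2 D E (id2 D (g \<cdot> f)) (g \<rhd> lunit F \<lhd> bang D ?c) =
       (g \<rhd> tens2 D B (id2 D f) (lunit F \<lhd> bang D ?c)) \<bullet> lmult_at D G f (unit_at D B ?c)"
      using lmult_natural[OF TG, unfolded fold, of "id2 D f" f f "lunit F \<lhd> bang D ?c" "unit_at D B ?c" "f \<cdot> ?I"]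
      by (simp add: u)
    have a0: "(f \<rhd> (mrunit A \<lhd> id1 D ?c)) \<bullet> lmult_at D F (id1 D ?c) ?I \<bullet> tens2 D B (id2 D (f \<cdot> id1 D ?c)) (lunit F \<lhd> bang D ?c) = mrunit B \<lhd> (f \<cdot> id1 D ?c)"
      by (rule lax_units_at(2)[OF F, unfolded fold FB]) simp_all
    have a1: "((g \<cdot> f) \<rhd> mrunit A) \<bullet> (g \<rhd> lmult_at D F (id1 D ?c) ?I) \<bullet> (g \<rhd> tens2 D B (id2 D f) (lunit F \<lhd> bang D ?c)) =
       g \<rhd> (mrunit B \<lhd> f)"
      using arg_cong[OF a0, of "\<lambda>t. g \<rhd> t"] by (simp add: u)
    have a2: "(g \<rhd> (mrunit B \<lhd> f)) \<bullet> lmult_at D G f (unit_at D B ?c) \<bullet> tens2 D E (id2 D (g \<cdot> f)) (lunit G \<lhd> bang D ?c) = mrunit E \<lhd> (g \<cdot> f)"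
      by (rule lax_units_at(2)[OF G, unfolded fold, of f ?c]) simp_all
    show "((g \<cdot> f) \<rhd> mrunit A) \<bullet> lmult_at D (lax_comp D G F) (id1 D ?c) ?I
        \<bullet> tens2 D E (id2 D (g \<cdot> f)) (lunit (lax_comp D G F) \<lhd> bang D ?c) = mrunit E \<lhd> (g \<cdot> f)"
      by (simp add: mu lu s1 u vcmp_extend[OF n1] vcmp_extend3[OF a1] a2)
  qed simp
qed

end

section \<open>Identities, monoidal transformations and the axioms of the 2-category\<close>

context fp_2cat
begin

lemma lax_id_sel [simp]:
  "lsrc (lax_id D C) = C" "ltrg (lax_id D C) = C" "larr (lax_id D C) = id1 D (mobj C)"
  "lmult (lax_id D C) = id2 D (mtens C)" "lunit (lax_id D C) = id2 D (munit C)"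
  by (simp_all add: lax_id_def)

lemma lax_comp_sel [simp]:
  "lsrc (lax_comp D G F) = lsrc F" "ltrg (lax_comp D G F) = ltrg G" "larr (lax_comp D G F) = larr G \<cdot> larr F"
  by (simp_all add: lax_comp_def)

lemma lax_id_lax:
  assumes C: "monoidal_object D C"
  shows "lax_monoidal D (lax_id D C)"
proof -
  note [simp] = C monoidal_typing[OF C] tensor_object_typing[of C] tens1_projs[of C]
  have T: "lax_typed (lax_id D C)" by (rule lax_typedI) (simp_all add: hom_iff cell_iff)
  have mu [simp]: "lmult_at D (lax_id D C) x y = id2 D (tens1 D C x y)"
    if "x \<in> Arr D" "y \<in> Arr D" "src D x = src D y" "trg D x = mobj C" "trg D y = mobj C" for x y
    using that by (simp add: lmult_at_def tens1_def)
  have u: "munit C \<cdot> bang D (mobj C) = unit_at D C (mobj C)" by (simp add: unit_at_def)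
  show ?thesis
    by (rule lax_monoidalI[OF T]) (simp_all add: u)
qed

text \<open>Evaluation at the two projections loses nothing, because their pairing is an identity.
  Hence lax morphisms may be compared at generalized elements.\<close>

lemma lmult_eq_lmult_at:
  assumes F: "lax_typed F"
  shows "lmult F = lmult_at D F (Pr1 D (mobj (lsrc F)) (mobj (lsrc F))) (Pr2 D (mobj (lsrc F)) (mobj (lsrc F)))"
  using lax_typing[OF F] monoidal_typing[OF lax_typing(1)[OF F]] tensor_object_typing[of "lsrc F"] by (simp add: lmult_at_def)

lemma laxmor_eqI:
  assumes "lax_typed F" "lsrc F = lsrc G" "ltrg F = ltrg G" "larr F = larr G" "lax_typed G"
   "\<And>x y. x \<in> Arr D \<Longrightarrow> y \<in> Arr D \<Longrightarrow> src D x = src D y \<Longrightarrow> trg D x = mobj (lsrc F) \<Longrightarrow> trg D y = mobj (lsrc F) \<Longrightarrow>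
      lmult_at D F x y = lmult_at D G x y"
   "lunit F = lunit G"
  shows "F = G"
proof -
  have "mobj (lsrc F) \<in> Obj D" using monoidal_typing[OF lax_typing(1)[OF assms(1)]] by simp
  then have "lmult F = lmult G"
    using assms(2,6) lmult_eq_lmult_at[OF assms(1)] lmult_eq_lmult_at[OF assms(5)] by simp
  then show ?thesis using assms by (intro laxmor.expand) simp
qed

lemma monoidal_transformationD:
  assumes "monoidal_transformation D T"
  shows "lax_monoidal D (fdom T)" "lax_monoidal D (fcod T)" "lsrc (fcod T) = lsrc (fdom T)" "ltrg (fcod T) = ltrg (fdom T)"
    "lax_typed (fdom T)" "lax_typed (fcod T)"
    "fcell T \<in> Cel D" "vdom D (fcell T) = larr (fdom T)" "vcod D (fcell T) = larr (fcod T)"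
    "lunit (fcod T) = (fcell T \<lhd> munit (lsrc (fdom T))) \<bullet> lunit (fdom T)"
  using assms by (auto simp: monoidal_transformation_def Let_def cell_iff lax_monoidal_iff)

lemma monoidal_transformation_at:
  assumes T: "monoidal_transformation D T" and "x \<in> Arr D" "y \<in> Arr D" "src D x = src D y"
    "trg D x = mobj (lsrc (fdom T))" "trg D y = mobj (lsrc (fdom T))"
  shows "lmult_at D (fcod T) x y \<bullet> tens2 D (ltrg (fdom T)) (fcell T \<lhd> x) (fcell T \<lhd> y) =
    (fcell T \<lhd> tens1 D (lsrc (fdom T)) x y) \<bullet> lmult_at D (fdom T) x y"
proof -
  note TD = monoidal_transformationD[OF T]
  define t F F' A B where t: "t = fcell T" and F: "F = fdom T" and F': "F' = fcod T" and A: "A = lsrc (fdom T)" and B: "B = ltrg (fdom T)"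
  note fold = t[symmetric] A[symmetric] B[symmetric] F[symmetric] F'[symmetric]
  have AB [simp]: "lsrc F = A" "ltrg F = B" "lsrc F' = A" "ltrg F' = B"
    using TD(3,4) by (simp_all add: A B F F')
  have [simp]: "lax_typed F" "lax_typed F'" "t \<in> Cel D" "vdom D t = larr F" "vcod D t = larr F'"
    using TD by (simp_all add: F F' t)
  have [simp]: "monoidal_object D A" "monoidal_object D B" using lax_typing(1,2)[OF TD(5)] by (simp_all add: A B)
  note [simp] = monoidal_typing[of A] monoidal_typing[of B] tensor_object_typing[of A] tensor_object_typing[of B] lax_typing(3-)
  have [simp]: "x \<in> Arr D" "y \<in> Arr D" "src D x = src D y" "trg D x = mobj A" "trg D y = mobj A"
    using assms by (simp_all add: A)
  let ?c = "mobj A"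
  have e: "lmult F' \<bullet> tens2 D B (t \<lhd> Pr1 D ?c ?c) (t \<lhd> Pr2 D ?c ?c) = (t \<lhd> mtens A) \<bullet> lmult F"
    using T mtens_prod2[of B t ?c] by (simp add: monoidal_transformation_def Let_def fold)
  have "lmult_at D F' x y \<bullet> tens2 D B (t \<lhd> x) (t \<lhd> y) = (t \<lhd> tens1 D A x y) \<bullet> lmult_at D F x y"
    using arg_cong[OF e, of "\<lambda>t. t \<lhd> \<langle>x, y\<rangle>"] by (simp add: lmult_at_def tens1_def[of D A])
  then show ?thesis by (simp add: fold)
qed

lemma monoidal_transformationI:
  assumes "lax_monoidal D (fdom T)" "lax_monoidal D (fcod T)" "lsrc (fcod T) = lsrc (fdom T)" "ltrg (fcod T) = ltrg (fdom T)"
    "fcell T \<in> cell D (larr (fdom T)) (larr (fcod T))"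
    "\<And>x y. x \<in> Arr D \<Longrightarrow> y \<in> Arr D \<Longrightarrow> src D x = src D y \<Longrightarrow> trg D x = mobj (lsrc (fdom T)) \<Longrightarrow> trg D y = mobj (lsrc (fdom T)) \<Longrightarrow>
      src D y = Prd D (mobj (lsrc (fdom T))) (mobj (lsrc (fdom T))) \<Longrightarrow>
      x = Pr1 D (mobj (lsrc (fdom T))) (mobj (lsrc (fdom T))) \<Longrightarrow> y = Pr2 D (mobj (lsrc (fdom T))) (mobj (lsrc (fdom T))) \<Longrightarrow>
     lmult_at D (fcod T) x y \<bullet> tens2 D (ltrg (fdom T)) (fcell T \<lhd> x) (fcell T \<lhd> y) =
    (fcell T \<lhd> tens1 D (lsrc (fdom T)) x y) \<bullet> lmult_at D (fdom T) x y"
    "lunit (fcod T) = (fcell T \<lhd> munit (lsrc (fdom T))) \<bullet> lunit (fdom T)"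
  shows "monoidal_transformation D T"
proof -
  have F: "lax_typed (fdom T)" "lax_typed (fcod T)" using assms by (simp_all add: lax_monoidal_iff)
  note [simp] = lax_typing[OF F(1)] monoidal_typing[OF lax_typing(1)[OF F(1)]]
  have [simp]: "fcell T \<in> Cel D" "vdom D (fcell T) = larr (fdom T)" using assms(5) by (simp_all add: cell_iff)
  let ?c = "mobj (lsrc (fdom T))"
  show ?thesis
    using assms(1-5,7) assms(6)[of "Pr1 D ?c ?c" "Pr2 D ?c ?c"] mtens_prod2[of "ltrg (fdom T)" "fcell T" ?c]
      lmult_eq_lmult_at[OF F(1)] lmult_eq_lmult_at[OF F(2)] tens1_projs[of "lsrc (fdom T)"]
    by (simp add: monoidal_transformation_def Let_def)
qed

lemma monoidal_transformation_id:
  assumes F: "lax_monoidal D F"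
  shows "monoidal_transformation D (Framed F F (id2 D (larr F)))"
proof -
  have T: "lax_typed F" using F by (simp add: lax_monoidal_iff)
  note [simp] = F T lax_typing[OF T] monoidal_typing[OF lax_typing(1)[OF T]] monoidal_typing[OF lax_typing(2)[OF T]]
  show ?thesis by (rule monoidal_transformationI) (simp_all add: cell_iff)
qed

lemma monoidal_transformation_vcmp:
  assumes S: "monoidal_transformation D S" and T: "monoidal_transformation D T" and ST: "fcod S = fdom T"
  shows "monoidal_transformation D (Framed (fdom S) (fcod T) (fcell T \<bullet> fcell S))"
proof -
  note SD = monoidal_transformationD[OF S] and TD = monoidal_transformationD[OF T, folded ST]
  define s t F F' F'' A B where s: "s = fcell S" and t: "t = fcell T" and F: "F = fdom S" and F': "F' = fcod S" and F'': "F'' = fcod T"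
    and A: "A = lsrc (fdom S)" and B: "B = ltrg (fdom S)"
  note fold = s[symmetric] t[symmetric] A[symmetric] B[symmetric] F[symmetric] F'[symmetric] F''[symmetric]
  note [simp] = SD(1-9)[unfolded fold] TD(1-9)[unfolded fold] lax_typing[OF SD(5), unfolded fold] lax_typing[OF TD(5), unfolded fold]
     lax_typing[OF TD(6), unfolded fold]
  have [simp]: "lsrc F = A" "ltrg F = B" "lsrc F' = A" "lsrc F'' = A" "ltrg F' = B" "ltrg F'' = B"
    using SD(3,4) TD(3,4) by (simp_all add: A B F F' F'')
  have [simp]: "monoidal_object D A" "monoidal_object D B" using lax_typing(1,2)[OF SD(5)] by (simp_all add: A B)
  note [simp] = monoidal_typing[of A] monoidal_typing[of B]
  show ?thesis unfolding fold
  proof (rule monoidal_transformationI, unfold framed.sel)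
    fix x y assume "x \<in> Arr D" "y \<in> Arr D" "src D x = src D y" "trg D x = mobj (lsrc F)" "trg D y = mobj (lsrc F)"
    then have [simp]: "x \<in> Arr D" "y \<in> Arr D" "src D x = src D y" "trg D x = mobj A" "trg D y = mobj A" by simp_all
    have e1: "lmult_at D F' x y \<bullet> tens2 D B (s \<lhd> x) (s \<lhd> y) = (s \<lhd> tens1 D A x y) \<bullet> lmult_at D F x y"
      using monoidal_transformation_at[OF S, of x y] by (simp add: fold)
    have e2: "lmult_at D F'' x y \<bullet> tens2 D B (t \<lhd> x) (t \<lhd> y) = (t \<lhd> tens1 D A x y) \<bullet> lmult_at D F' x y"
      using monoidal_transformation_at[OF T, of x y, folded ST] by (simp add: fold)
    have e3: "tens2 D B ((t \<lhd> x) \<bullet> (s \<lhd> x)) ((t \<lhd> y) \<bullet> (s \<lhd> y)) = tens2 D B (t \<lhd> x) (t \<lhd> y) \<bullet> tens2 D B (s \<lhd> x) (s \<lhd> y)"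
      by (subst tens2_vcmp) simp_all
    show "lmult_at D F'' x y \<bullet> tens2 D (ltrg F) ((t \<bullet> s) \<lhd> x) ((t \<bullet> s) \<lhd> y) = ((t \<bullet> s) \<lhd> tens1 D (lsrc F) x y) \<bullet> lmult_at D F x y"
      by (simp add: e3 vcmp_extend[OF e2] e1)
  next
    show "lunit F'' = ((t \<bullet> s) \<lhd> munit (lsrc F)) \<bullet> lunit F"
      using SD(10) TD(10) by (simp add: fold)
  qed (simp_all add: cell_iff)
qed

lemma monoidal_transformation_hcmp:
  assumes S: "monoidal_transformation D S" and T: "monoidal_transformation D T" and ST: "ltrg (fdom S) = lsrc (fdom T)"
  shows "monoidal_transformation D (Framed (lax_comp D (fdom T) (fdom S)) (lax_comp D (fcod T) (fcod S)) (fcell T \<star> fcell S))"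
proof -
  note SD = monoidal_transformationD[OF S] and TD = monoidal_transformationD[OF T]
  define s t F F' G G' A B E where s: "s = fcell S" and t: "t = fcell T" and F: "F = fdom S" and F': "F' = fcod S" and G: "G = fdom T"
    and G': "G' = fcod T" and A: "A = lsrc (fdom S)" and B: "B = ltrg (fdom S)" and E: "E = ltrg (fdom T)"
  define f f' g g' where f: "f = larr F" and f': "f' = larr F'" and g: "g = larr G" and g': "g' = larr G'"
  note fold = s[symmetric] t[symmetric] A[symmetric] B[symmetric] E[symmetric] F[symmetric] F'[symmetric] G[symmetric] G'[symmetric]
    f[symmetric] f'[symmetric] g[symmetric] g'[symmetric]
  note [simp] = f[symmetric] f'[symmetric] g[symmetric] g'[symmetric]
  note [simp] = SD(1-9)[unfolded fold] TD(1-9)[unfolded fold] lax_typing[OF SD(5), unfolded fold] lax_typing[OF TD(5), unfolded fold]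
     lax_typing[OF SD(6), unfolded fold] lax_typing[OF TD(6), unfolded fold]
  have [simp]: "lsrc F = A" "ltrg F = B" "lsrc F' = A" "lsrc G = B" "ltrg F' = B" "lsrc G' = B" "ltrg G = E" "ltrg G' = E"
    using SD(3,4) TD(3,4) ST by (simp_all add: A B E F F' G G')
  have [simp]: "monoidal_object D A" "monoidal_object D B" "monoidal_object D E"
    using lax_typing(1,2)[OF SD(5)] lax_typing(2)[OF TD(5)] by (simp_all add: A B E)
  note [simp] = monoidal_typing[of A] monoidal_typing[of B] monoidal_typing[of E]
  have lc: "lax_monoidal D (lax_comp D G F)" "lax_monoidal D (lax_comp D G' F')" by (simp_all add: lax_comp_lax)
  have TF: "lax_typed F" "lax_typed F'" "lax_typed G" "lax_typed G'" by simp_all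
  show ?thesis unfolding fold
  proof (rule monoidal_transformationI, unfold framed.sel)
    fix x y assume "x \<in> Arr D" "y \<in> Arr D" "src D x = src D y" "trg D x = mobj (lsrc (lax_comp D G F))" "trg D y = mobj (lsrc (lax_comp D G F))"
    then have [simp]: "x \<in> Arr D" "y \<in> Arr D" "src D x = src D y" "trg D x = mobj A" "trg D y = mobj A" by simp_all
    have m1: "lmult_at D (lax_comp D G' F') x y = (g' \<rhd> lmult_at D F' x y) \<bullet> lmult_at D G' (f' \<cdot> x) (f' \<cdot> y)"
      by (rule lax_comp_lmult_at[unfolded fold, of F' G', unfolded fold]) simp_all
    have m2: "lmult_at D (lax_comp D G F) x y = (g \<rhd> lmult_at D F x y) \<bullet> lmult_at D G (f \<cdot> x) (f \<cdot> y)"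
      by (rule lax_comp_lmult_at[unfolded fold, of F G, unfolded fold]) simp_all
    \<comment> \<open>Splitting the composite with \<open>t\<close> applied first lets naturality of
      the multiplication of \<open>G'\<close>, monoidality of \<open>t\<close> and monoidality of
      \<open>s\<close> be used one after the other.\<close>
    have sp: "(t \<star> s) \<lhd> z = (g' \<rhd> (s \<lhd> z)) \<bullet> (t \<lhd> (f \<cdot> z))" if "z \<in> Arr D" "trg D z = mobj A" for z
      using that by (simp add: hcmp_right_first[of s t])
    have e0: "tens2 D E ((t \<star> s) \<lhd> x) ((t \<star> s) \<lhd> y) = 
        tens2 D E (g' \<rhd> (s \<lhd> x)) (g' \<rhd> (s \<lhd> y)) \<bullet> tens2 D E (t \<lhd> (f \<cdot> x)) (t \<lhd> (f \<cdot> y))"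
      unfolding sp[OF \<open>x \<in> Arr D\<close> \<open>trg D x = mobj A\<close>] sp[OF \<open>y \<in> Arr D\<close> \<open>trg D y = mobj A\<close>]
      by (subst tens2_vcmp) simp_all
    have e1: "lmult_at D G' (f' \<cdot> x) (f' \<cdot> y) \<bullet> tens2 D E (g' \<rhd> (s \<lhd> x)) (g' \<rhd> (s \<lhd> y)) = 
       (g' \<rhd> tens2 D B (s \<lhd> x) (s \<lhd> y)) \<bullet> lmult_at D G' (f \<cdot> x) (f \<cdot> y)"
      using lmult_natural[OF TF(4), of "s \<lhd> x" "f \<cdot> x" "f' \<cdot> x" "s \<lhd> y" "f \<cdot> y" "f' \<cdot> y"] by (simp add: fold)
    have e2: "lmult_at D G' (f \<cdot> x) (f \<cdot> y) \<bullet> tens2 D E (t \<lhd> (f \<cdot> x)) (t \<lhd> (f \<cdot> y)) = (t \<lhd> tens1 D B (f \<cdot> x) (f \<cdot> y)) \<bullet> lmult_at D G (f \<cdot> x) (f \<cdot> y)"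
      using monoidal_transformation_at[OF T, of "f \<cdot> x" "f \<cdot> y", unfolded fold] by simp
    have e3': "lmult_at D F' x y \<bullet> tens2 D B (s \<lhd> x) (s \<lhd> y) = (s \<lhd> tens1 D A x y) \<bullet> lmult_at D F x y"
      using monoidal_transformation_at[OF S, of x y] by (simp add: fold)
    have e3: "(g' \<rhd> lmult_at D F' x y) \<bullet> (g' \<rhd> tens2 D B (s \<lhd> x) (s \<lhd> y)) = (g' \<rhd> s \<lhd> tens1 D A x y) \<bullet> (g' \<rhd> lmult_at D F x y)"
      using arg_cong[OF e3', of "\<lambda>t. g' \<rhd> t"] by simp
    have e4: "(g' \<rhd> lmult_at D F x y) \<bullet> (t \<lhd> tens1 D B (f \<cdot> x) (f \<cdot> y)) = (t \<lhd> (f \<cdot> tens1 D A x y)) \<bullet> (g \<rhd> lmult_at D F x y)"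
      by (rule exchange[symmetric]) (simp_all add: fold)
    have e5: "(t \<star> s) \<lhd> tens1 D A x y = (g' \<rhd> s \<lhd> tens1 D A x y) \<bullet> (t \<lhd> (f \<cdot> tens1 D A x y))"
      by (rule sp) simp_all
    have "lmult_at D (lax_comp D G' F') x y \<bullet> tens2 D E ((t \<star> s) \<lhd> x) ((t \<star> s) \<lhd> y) = ((t \<star> s) \<lhd> tens1 D A x y) \<bullet> lmult_at D (lax_comp D G F) x y"
      unfolding e0 e5 m1 m2 
      by (simp add: vcmp_extend[OF e1] e2 vcmp_extend[OF e3] vcmp_extend[OF e4] fold)
    then show "lmult_at D (lax_comp D G' F') x y \<bullet> tens2 D (ltrg (lax_comp D G F)) ((t \<star> s) \<lhd> x) ((t \<star> s) \<lhd> y) = 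
       ((t \<star> s) \<lhd> tens1 D (lsrc (lax_comp D G F)) x y) \<bullet> lmult_at D (lax_comp D G F) x y" by simp
  next
    have u: "lunit F' = (s \<lhd> munit A) \<bullet> lunit F" "lunit G' = (t \<lhd> munit B) \<bullet> lunit G"
      using SD(10) TD(10) ST by (simp_all add: fold)
    have e: "(g' \<rhd> lunit F) \<bullet> (t \<lhd> munit B) = (t \<lhd> (f \<cdot> munit A)) \<bullet> (g \<rhd> lunit F)"
      by (rule exchange[symmetric]) (simp_all add: fold)
    show "lunit (lax_comp D G' F') = ((t \<star> s) \<lhd> munit (lsrc (lax_comp D G F))) \<bullet> lunit (lax_comp D G F)"
      by (simp add: lax_comp_def u hcmp_right_first[of s t] vcmp_extend[OF e] fold)
  qed (simp_all add: cell_iff lc fold)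
qed

lemma Mon_sel [simp]:
  "Obj (Mon D) = {C. monoidal_object D C}" "Arr (Mon D) = {F. lax_monoidal D F}"
  "Cel (Mon D) = {T. monoidal_transformation D T}" "src (Mon D) = lsrc" "trg (Mon D) = ltrg"
  "vdom (Mon D) = fdom" "vcod (Mon D) = fcod" "id1 (Mon D) = lax_id D"
  "id2 (Mon D) = (\<lambda>F. Framed F F (id2 D (larr F)))" "cmp (Mon D) = lax_comp D"
  "vcmp (Mon D) = (\<lambda>T S. Framed (fdom S) (fcod T) (fcell T \<bullet> fcell S))"
  "hcmp (Mon D) = (\<lambda>T S. Framed (lax_comp D (fdom T) (fdom S)) (lax_comp D (fcod T) (fcod S)) (fcell T \<star> fcell S))"
  by (simp_all add: Mon_def)

lemma lax_comp_id:
  assumes F: "lax_monoidal D F"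
  shows "lax_comp D (lax_id D (ltrg F)) F = F" "lax_comp D F (lax_id D (lsrc F)) = F"
proof -
  have T: "lax_typed F" using F by (simp add: lax_monoidal_iff)
  note [simp] = F T lax_typing[OF T] monoidal_typing[OF lax_typing(1)[OF T]] monoidal_typing[OF lax_typing(2)[OF T]]
    tensor_object_typing[of "lsrc F"] tensor_object_typing[of "ltrg F"] mtens_prod1[of "ltrg F" "larr F" "mobj (lsrc F)"]
  show "lax_comp D (lax_id D (ltrg F)) F = F" "lax_comp D F (lax_id D (lsrc F)) = F"
    by (rule laxmor.expand; simp add: lax_comp_def prod1_def tens1_def)+
qed

lemma lax_comp_assoc:
  assumes F: "lax_monoidal D F" and G: "lax_monoidal D G" and H: "lax_monoidal D H" and FG: "ltrg F = lsrc G" and GH: "ltrg G = lsrc H"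
  shows "lax_comp D (lax_comp D H G) F = lax_comp D H (lax_comp D G F)"
proof -
  have TF: "lax_typed F" and TG: "lax_typed G" and TH: "lax_typed H" using assms by (simp_all add: lax_monoidal_iff)
  note [simp] = F G H TF TG TH lax_typing[OF TF] monoidal_typing[OF lax_typing(1)[OF TF]] FG GH
    lax_typing[OF TG] monoidal_typing[OF lax_typing(1)[OF TG]] lax_typing[OF TH] monoidal_typing[OF lax_typing(1)[OF TH]] 
    lax_comp_typed lax_comp_lmult_at monoidal_typing[OF lax_typing(2)[OF TH]]
  show ?thesis
    by (rule laxmor_eqI) (simp_all, simp add: lax_comp_def)
qed

lemma lax_monoidal_typed [simp]: "lax_monoidal D F \<Longrightarrow> lax_typed F"
  by (simp add: lax_monoidal_iff)

lemma two_category_Mon: "two_category (Mon D)"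
  by (rule framed_two_category[where b = larr and ?b0.0 = mobj])
    (auto simp: lax_typing monoidal_typing lax_id_lax lax_comp_lax lax_comp_id lax_comp_assoc monoidal_transformation_id
      monoidal_transformation_vcmp monoidal_transformation_hcmp monoidal_transformationD)

end

section \<open>Products of graded monads and of universal cocones\<close>

locale fp_graded = fp_2cat D + graded D M
  for D :: "('o, 'a, 'c, 'z) fp_twocat_scheme" (structure) and M :: "('m, 'n) moncat"
begin

lemma id2_pair1_hcmp [simp]:
  assumes "f \<in> Arr D" "g \<in> Arr D" "src D f = src D g" "t \<in> Cel D" "trg D (vdom D t) = src D g"
  shows "\<langle>f, g\<rangle> \<rhd> t = \<lblot>f \<rhd> t, g \<rhd> t\<rblot>"
  using pair2_hcmp[of "id2 D f" "id2 D g" t] assms by simp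

definition gprod where
  "gprod A B = (let p = Pr1 D (gbase A) (gbase B); q = Pr2 D (gbase A) (gbase B) in
     GMonad (Prd D (gbase A) (gbase B)) (\<lambda>x \<in> MOb M. \<langle>gobj A x \<cdot> p, gobj B x \<cdot> q\<rangle>)
       (\<lambda>f \<in> MAr M. \<lblot>garr A f \<lhd> p, garr B f \<lhd> q\<rblot>)
       (\<lambda>x \<in> MOb M. \<lambda>y \<in> MOb M. \<lblot>gmult A x y \<lhd> p, gmult B x y \<lhd> q\<rblot>)
       \<lblot>gunit A \<lhd> p, gunit B \<lhd> q\<rblot>)"

definition gpr1 where
  "gpr1 A B = OplaxMor (gprod A B) A (Pr1 D (gbase A) (gbase B)) (\<lambda>x \<in> MOb M. id2 D (gobj A x \<cdot> Pr1 D (gbase A) (gbase B)))"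

definition gpr2 where
  "gpr2 A B = OplaxMor (gprod A B) B (Pr2 D (gbase A) (gbase B)) (\<lambda>x \<in> MOb M. id2 D (gobj B x \<cdot> Pr2 D (gbase A) (gbase B)))"

lemma gprod_sel [simp]:
  "gbase (gprod A B) = Prd D (gbase A) (gbase B)"
  "x \<in> MOb M \<Longrightarrow> gobj (gprod A B) x = \<langle>gobj A x \<cdot> Pr1 D (gbase A) (gbase B), gobj B x \<cdot> Pr2 D (gbase A) (gbase B)\<rangle>"
  "f \<in> MAr M \<Longrightarrow> garr (gprod A B) f = \<lblot>garr A f \<lhd> Pr1 D (gbase A) (gbase B), garr B f \<lhd> Pr2 D (gbase A) (gbase B)\<rblot>"
  "x \<in> MOb M \<Longrightarrow> y \<in> MOb M \<Longrightarrow>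
     gmult (gprod A B) x y = \<lblot>gmult A x y \<lhd> Pr1 D (gbase A) (gbase B), gmult B x y \<lhd> Pr2 D (gbase A) (gbase B)\<rblot>"
  "gunit (gprod A B) = \<lblot>gunit A \<lhd> Pr1 D (gbase A) (gbase B), gunit B \<lhd> Pr2 D (gbase A) (gbase B)\<rblot>"
  by (simp_all add: gprod_def Let_def)

lemma gpr_sel [simp]:
  "osrc (gpr1 A B) = gprod A B" "otrg (gpr1 A B) = A" "oarr (gpr1 A B) = Pr1 D (gbase A) (gbase B)"
  "x \<in> MOb M \<Longrightarrow> ocell (gpr1 A B) x = id2 D (gobj A x \<cdot> Pr1 D (gbase A) (gbase B))"
  "osrc (gpr2 A B) = gprod A B" "otrg (gpr2 A B) = B" "oarr (gpr2 A B) = Pr2 D (gbase A) (gbase B)"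
  "x \<in> MOb M \<Longrightarrow> ocell (gpr2 A B) x = id2 D (gobj B x \<cdot> Pr2 D (gbase A) (gbase B))"
  by (simp_all add: gpr1_def gpr2_def)

lemma gprod_graded:
  assumes A: "graded_monad M D A" and B: "graded_monad M D B"
  shows "graded_monad M D (gprod A B)"
proof -
  note [simp] = graded_monad_typing[OF A] graded_monad_typing[OF B] pair2_vcmp
  note eA = graded_monad_eqs[OF A] and eB = graded_monad_eqs[OF B]
  let ?p = "Pr1 D (gbase A) (gbase B)" and ?q = "Pr2 D (gbase A) (gbase B)"
  show ?thesis
  proof (rule graded_monadI, goal_cases)
    case (12 f g)
    note fg = 12
    have a: "(gmult A (Mcod M f) (Mcod M g) \<lhd> ?p) \<bullet> (garr A f \<star> (garr A g \<lhd> ?p)) = (garr A (f \<otimes>\<^sub>A\<^bsub>M\<^esub> g) \<lhd> ?p) \<bullet> (gmult A (Mdom M f) (Mdom M g) \<lhd> ?p)"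
      using arg_cong[OF eA(3)[OF fg], of "\<lambda>t. t \<lhd> ?p"] fg by simp
    have b: "(gmult B (Mcod M f) (Mcod M g) \<lhd> ?q) \<bullet> (garr B f \<star> (garr B g \<lhd> ?q)) = (garr B (f \<otimes>\<^sub>A\<^bsub>M\<^esub> g) \<lhd> ?q) \<bullet> (gmult B (Mdom M f) (Mdom M g) \<lhd> ?q)"
      using arg_cong[OF eB(3)[OF fg], of "\<lambda>t. t \<lhd> ?q"] fg by simp
    show ?case using fg by (simp add: a b)
  next
    case (13 x y z)
    note x = 13
    have a: "(gmult A (x \<otimes>\<^bsub>M\<^esub> y) z \<lhd> ?p) \<bullet> (gmult A x y \<lhd> (gobj A z \<cdot> ?p)) =
       (garr A (Massoc M x y z) \<lhd> ?p) \<bullet> (gmult A x (y \<otimes>\<^bsub>M\<^esub> z) \<lhd> ?p) \<bullet> (gobj A x \<rhd> (gmult A y z \<lhd> ?p))"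
      using arg_cong[OF eA(4)[OF x], of "\<lambda>t. t \<lhd> ?p"] x by simp
    have b: "(gmult B (x \<otimes>\<^bsub>M\<^esub> y) z \<lhd> ?q) \<bullet> (gmult B x y \<lhd> (gobj B z \<cdot> ?q)) =
       (garr B (Massoc M x y z) \<lhd> ?q) \<bullet> (gmult B x (y \<otimes>\<^bsub>M\<^esub> z) \<lhd> ?q) \<bullet> (gobj B x \<rhd> (gmult B y z \<lhd> ?q))"
      using arg_cong[OF eB(4)[OF x], of "\<lambda>t. t \<lhd> ?q"] x by simp
    show ?case using x by (simp add: a b)
  next
    case (14 x)
    note x = 14
    have a: "(garr A (Mrunit M x) \<lhd> ?p) \<bullet> (gmult A x (MI M) \<lhd> ?p) \<bullet> (gobj A x \<rhd> (gunit A \<lhd> ?p)) = id2 D (gobj A x \<cdot> ?p)"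
      using arg_cong[OF eA(5)[OF x], of "\<lambda>t. t \<lhd> ?p"] x by simp
    have b: "(garr B (Mrunit M x) \<lhd> ?q) \<bullet> (gmult B x (MI M) \<lhd> ?q) \<bullet> (gobj B x \<rhd> (gunit B \<lhd> ?q)) = id2 D (gobj B x \<cdot> ?q)"
      using arg_cong[OF eB(5)[OF x], of "\<lambda>t. t \<lhd> ?q"] x by simp
    show ?case using x by (simp add: a b)
  next
    case (15 x)
    note x = 15
    have a: "(garr A (Mlunit M x) \<lhd> ?p) \<bullet> (gmult A (MI M) x \<lhd> ?p) \<bullet> (gunit A \<lhd> (gobj A x \<cdot> ?p)) = id2 D (gobj A x \<cdot> ?p)"
      using arg_cong[OF eA(6)[OF x], of "\<lambda>t. t \<lhd> ?p"] x by simp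
    have b: "(garr B (Mlunit M x) \<lhd> ?q) \<bullet> (gmult B (MI M) x \<lhd> ?q) \<bullet> (gunit B \<lhd> (gobj B x \<cdot> ?q)) = id2 D (gobj B x \<cdot> ?q)"
      using arg_cong[OF eB(6)[OF x], of "\<lambda>t. t \<lhd> ?q"] x by simp
    show ?case using x by (simp add: a b)
  qed (simp_all add: hom_iff cell_iff eA(1,2) eB(1,2), simp_all add: gprod_def Let_def)
qed

lemma gpr_oplax:
  assumes A: "graded_monad M D A" and B: "graded_monad M D B"
  shows "oplax_morphism M D (gpr1 A B)" "oplax_morphism M D (gpr2 A B)"
proof -
  note [simp] = graded_monad_typing[OF A] graded_monad_typing[OF B]
  show "oplax_morphism M D (gpr1 A B)"
    by (rule oplax_morphismI) (simp_all add: A B gprod_graded hom_iff cell_iff, simp add: gpr1_def)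
  show "oplax_morphism M D (gpr2 A B)"
    by (rule oplax_morphismI) (simp_all add: A B gprod_graded hom_iff cell_iff, simp add: gpr2_def)
qed

definition gpair where
  "gpair W V = OplaxMor (osrc W) (gprod (otrg W) (otrg V)) \<langle>oarr W, oarr V\<rangle> (\<lambda>x \<in> MOb M. \<lblot>ocell W x, ocell V x\<rblot>)"

lemma gpair_sel [simp]:
  "osrc (gpair W V) = osrc W" "otrg (gpair W V) = gprod (otrg W) (otrg V)" "oarr (gpair W V) = \<langle>oarr W, oarr V\<rangle>"
  "x \<in> MOb M \<Longrightarrow> ocell (gpair W V) x = \<lblot>ocell W x, ocell V x\<rblot>"
  by (simp_all add: gpair_def)

lemma gpair_oplax:
  assumes W: "oplax_morphism M D W" and V: "oplax_morphism M D V" and [simp]: "osrc V = osrc W"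
  shows "oplax_morphism M D (gpair W V)"
proof -
  note [simp] = oplax_typing[OF W] oplax_typing[OF V] graded_monad_typing[OF oplax_typing(1)[OF W]]
    graded_monad_typing[OF oplax_typing(2)[OF W]] graded_monad_typing[OF oplax_typing(2)[OF V]] pair2_vcmp
  note eW = oplax_eqs[OF W] and eV = oplax_eqs[OF V, simplified]
  show ?thesis
    by (rule oplax_morphismI)
      (simp_all add: gprod_graded hom_iff cell_iff eW eV, simp add: gpair_def)
qed

lemma gprod_arr_eqI:
  assumes H: "oplax_morphism M D H" and K: "oplax_morphism M D K" 
    and [simp]: "osrc H = osrc K" "otrg H = gprod A B" "otrg K = gprod A B" and A: "graded_monad M D A" and B: "graded_monad M D B"
    and 1: "oplax_comp M D (gpr1 A B) H = oplax_comp M D (gpr1 A B) K" and 2: "oplax_comp M D (gpr2 A B) H = oplax_comp M D (gpr2 A B) K"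
  shows "H = K"
proof (rule oplaxmor_eqI)
  note [simp] = oplax_typing[OF H] oplax_typing[OF K] graded_monad_typing[OF A] graded_monad_typing[OF B]
    graded_monad_typing[OF oplax_typing(1)[OF K]]
  show e: "oarr H = oarr K"
    by (rule arr_eqI[where A = "gbase A" and B = "gbase B"])
      (use arg_cong[OF 1, of oarr] arg_cong[OF 2, of oarr] in simp_all)
  show "ocell H x = ocell K x" if "x \<in> MOb M" for x
  proof -
    have *: "\<langle>gobj A x \<cdot> Pr1 D (gbase A) (gbase B) \<cdot> oarr K, gobj B x \<cdot> Pr2 D (gbase A) (gbase B) \<cdot> oarr K\<rangle> = gobj (gprod A B) x \<cdot> oarr K"
      using that by simp
    show ?thesis
      by (rule cell_eqI[where A = "gbase A" and B = "gbase B"])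
        (use that e arg_cong[OF 1, of "\<lambda>W. ocell W x"] arg_cong[OF 2, of "\<lambda>W. ocell W x"] in simp_all)
  qed
qed (use oplax_typing(9)[OF H] oplax_typing(9)[OF K] in simp_all)

text \<open>Preservation by \<open>K\<close> speaks of products in \<open>GMnd M D\<close>, so the
  componentwise graded monad needs both dimensions of the universal property there. Conditions are
  checked after the two projections, whose structure cells are identities.\<close>

lemma gprod_product:
  assumes A: "graded_monad M D A" and B: "graded_monad M D B"
  shows "product_0cell (GMnd M D) A B (gprod A B) (gpr1 A B) (gpr2 A B)"
  unfolding product_0cell_def
proof (intro conjI ballI)
  note [simp] = graded_monad_typing[OF A] graded_monad_typing[OF B]
  show "gpr1 A B \<in> hom (GMnd M D) (gprod A B) A" "gpr2 A B \<in> hom (GMnd M D) (gprod A B) B"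
    by (simp_all add: hom_def gpr_oplax[OF A B])
next
  fix X W V assume "W \<in> hom (GMnd M D) X A" "V \<in> hom (GMnd M D) X B"
  then have W: "oplax_morphism M D W" and V: "oplax_morphism M D V" and [simp]: "osrc W = X" "osrc V = X" "otrg W = A" "otrg V = B"
    by (simp_all add: hom_def)
  have X: "graded_monad M D X" using oplax_typing(1)[OF W] by simp
  note [simp] = graded_monad_typing[OF A] graded_monad_typing[OF B] oplax_typing[OF W] oplax_typing[OF V] 
    graded_monad_typing[OF X]
  have G: "oplax_morphism M D (gpair W V)" using gpair_oplax[OF W V] by simp
  have 1: "oplax_comp M D (gpr1 A B) (gpair W V) = W"
    by (rule oplaxmor_eqI) (simp_all, simp add: oplax_comp_def)
  have 2: "oplax_comp M D (gpr2 A B) (gpair W V) = V"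
    by (rule oplaxmor_eqI) (simp_all, simp add: oplax_comp_def)
  show "\<exists>!h. h \<in> hom (GMnd M D) X (gprod A B) \<and> gpr1 A B \<cdot>\<^bsub>GMnd M D\<^esub> h = W \<and> gpr2 A B \<cdot>\<^bsub>GMnd M D\<^esub> h = V"
  proof (rule ex1I[of _ "gpair W V"])
    show "gpair W V \<in> hom (GMnd M D) X (gprod A B) \<and> gpr1 A B \<cdot>\<^bsub>GMnd M D\<^esub> gpair W V = W \<and> gpr2 A B \<cdot>\<^bsub>GMnd M D\<^esub> gpair W V = V"
      using G 1 2 by (simp add: hom_def)
    show "H = gpair W V"
      if "H \<in> hom (GMnd M D) X (gprod A B) \<and> gpr1 A B \<cdot>\<^bsub>GMnd M D\<^esub> H = W \<and> gpr2 A B \<cdot>\<^bsub>GMnd M D\<^esub> H = V" for H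
      by (rule gprod_arr_eqI[OF _ G _ _ _ A B]) (use that 1 2 in \<open>simp_all add: hom_def\<close>)
  qed
next
  fix X H K S T assume "X \<in> Obj (GMnd M D)" "H \<in> hom (GMnd M D) X (gprod A B)" "K \<in> hom (GMnd M D) X (gprod A B)"
    and ST: "S \<in> cell (GMnd M D) (gpr1 A B \<cdot>\<^bsub>GMnd M D\<^esub> H) (gpr1 A B \<cdot>\<^bsub>GMnd M D\<^esub> K)"
     "T \<in> cell (GMnd M D) (gpr2 A B \<cdot>\<^bsub>GMnd M D\<^esub> H) (gpr2 A B \<cdot>\<^bsub>GMnd M D\<^esub> K)"
  then have H: "oplax_morphism M D H" and K: "oplax_morphism M D K" and [simp]: "osrc H = X" "osrc K = X"
    "otrg H = gprod A B" "otrg K = gprod A B" and X: "graded_monad M D X"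
    by (simp_all add: hom_def)
  define h k where h: "h = oarr H" and k: "k = oarr K"
  note hk [simp] = h[symmetric] k[symmetric]
  let ?p = "Pr1 D (gbase A) (gbase B)" and ?q = "Pr2 D (gbase A) (gbase B)"
  note [simp] = graded_monad_typing[OF A] graded_monad_typing[OF B] oplax_typing[OF H, unfolded hk] oplax_typing[OF K, unfolded hk] 
    graded_monad_typing[OF X]
  define s t where s: "s = fcell S" and t: "t = fcell T"
  have tS: "oplax_transformation M D S" and tT: "oplax_transformation M D T"
    and S: "S = Framed (oplax_comp M D (gpr1 A B) H) (oplax_comp M D (gpr1 A B) K) s" 
    and T: "T = Framed (oplax_comp M D (gpr2 A B) H) (oplax_comp M D (gpr2 A B) K) t"
    using ST by (auto simp: cell_def s t framed.expand)
  have s1: "s \<in> cell D (?p \<cdot> h) (?p \<cdot> k)" "\<And>x. x \<in> MOb M \<Longrightarrow> (?p \<rhd> ocell K x) \<bullet> (s \<lhd> gobj X x) = (gobj A x \<rhd> s) \<bullet> (?p \<rhd> ocell H x)"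
    using tS by (auto simp: S oplax_transformation_iff)
  have t1: "t \<in> cell D (?q \<cdot> h) (?q \<cdot> k)" "\<And>x. x \<in> MOb M \<Longrightarrow> (?q \<rhd> ocell K x) \<bullet> (t \<lhd> gobj X x) = (gobj B x \<rhd> t) \<bullet> (?q \<rhd> ocell H x)"
    using tT by (auto simp: T oplax_transformation_iff)
  note [simp] = s1(1)[unfolded cell_iff] t1(1)[unfolded cell_iff]
  have ex1: "\<exists>!r. r \<in> cell D h k \<and> ?p \<rhd> r = s \<and> ?q \<rhd> r = t"
    by (rule cell_ex1) (use s1(1) t1(1) in simp_all)
  then obtain r where r: "r \<in> cell D h k" "?p \<rhd> r = s" "?q \<rhd> r = t" by blast
  note [simp] = r(1)[unfolded cell_iff]
  have gx: "gobj (gprod A B) x \<rhd> r = \<lblot>gobj A x \<rhd> s, gobj B x \<rhd> t\<rblot>" if "x \<in> MOb M" for x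
  proof -
    have "(gobj A x \<cdot> ?p) \<rhd> r = gobj A x \<rhd> s" using that whisker_whisker[of r ?p "gobj A x"] by (simp add: r(2))
    moreover have "(gobj B x \<cdot> ?q) \<rhd> r = gobj B x \<rhd> t" using that whisker_whisker[of r ?q "gobj B x"] by (simp add: r(3))
    ultimately show ?thesis using that by simp
  qed
  have rw: "?p \<rhd> (r \<lhd> gobj X x) = s \<lhd> gobj X x" "?q \<rhd> (r \<lhd> gobj X x) = t \<lhd> gobj X x" if "x \<in> MOb M" for x
    using that hcmp_assoc'[of "id2 D (gobj X x)" r "id2 D ?p"] hcmp_assoc'[of "id2 D (gobj X x)" r "id2 D ?q"] by (simp_all add: r(2,3))
  \<comment> \<open>The pair of transformations determines a 2-cell \<open>r\<close> into the
    product; that \<open>r\<close> is itself a transformation is seen after each projection.\<close>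
  have R: "oplax_transformation M D (Framed H K r)"
    unfolding oplax_transformation_iff framed.sel
  proof (intro conjI ballI)
    fix x assume x: "x \<in> MOb M"
    show "ocell K x \<bullet> (r \<lhd> gobj (osrc H) x) = (gobj (otrg H) x \<rhd> r) \<bullet> ocell H x"
    proof (rule cell_eqI[where A = "gbase A" and B = "gbase B"])
      show "?p \<rhd> (ocell K x \<bullet> (r \<lhd> gobj (osrc H) x)) = ?p \<rhd> ((gobj (otrg H) x \<rhd> r) \<bullet> ocell H x)"
        using x s1(2)[OF x] by (simp add: rw gx del: gprod_sel(2)) (simp add: x gx[unfolded gprod_sel])
      show "?q \<rhd> (ocell K x \<bullet> (r \<lhd> gobj (osrc H) x)) = ?q \<rhd> ((gobj (otrg H) x \<rhd> r) \<bullet> ocell H x)"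
        using x t1(2)[OF x] by (simp add: rw gx del: gprod_sel(2)) (simp add: x gx[unfolded gprod_sel])
    qed (use x in simp_all)
  qed (use H K r(1) in simp_all)
  show "\<exists>!\<theta>. \<theta> \<in> cell (GMnd M D) H K \<and> gpr1 A B \<rhd>\<^bsub>GMnd M D\<^esub> \<theta> = S \<and> gpr2 A B \<rhd>\<^bsub>GMnd M D\<^esub> \<theta> = T"
  proof (rule ex1I[of _ "Framed H K r"])
    show "Framed H K r \<in> cell (GMnd M D) H K \<and> gpr1 A B \<rhd>\<^bsub>GMnd M D\<^esub> Framed H K r = S \<and> gpr2 A B \<rhd>\<^bsub>GMnd M D\<^esub> Framed H K r = T"
      using R by (simp add: cell_def S T r)
    show "\<theta> = Framed H K r" if \<theta>: "\<theta> \<in> cell (GMnd M D) H K \<and> gpr1 A B \<rhd>\<^bsub>GMnd M D\<^esub> \<theta> = S \<and> gpr2 A B \<rhd>\<^bsub>GMnd M D\<^esub> \<theta> = T" for \<theta>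
    proof -
      have "fdom \<theta> = H" "fcod \<theta> = K" "fcell \<theta> \<in> cell D h k" "?p \<rhd> fcell \<theta> = s" "?q \<rhd> fcell \<theta> = t"
        using \<theta> by (auto simp: cell_def S T oplax_transformation_iff)
      then show ?thesis using ex1 r by (intro framed.expand) auto
    qed
  qed
qed

lemma cell_One_eq:
  assumes "s \<in> Cel D" "t \<in> Cel D" "vdom D s = vdom D t" "vcod D s = vcod D t" "trg D (vdom D s) = One D"
  shows "s = t"
proof -
  have "src D (vdom D s) \<in> Obj D" "vdom D s \<in> hom D (src D (vdom D s)) (One D)" "vcod D s \<in> hom D (src D (vdom D s)) (One D)"
    using assms parallel[of s] typing_Arr[of s] by (auto simp: hom_iff simp del: parallel typing_Arr)
  then have "\<exists>!r. r \<in> cell D (vdom D s) (vcod D s)" using terminal_One unfolding terminal_0cell_def by blast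
  then show ?thesis using assms by (auto simp: cell_iff)
qed

text \<open>Parallel 2-cells into \<open>One D\<close> are equal, so every axiom for a morphism or
  transformation into the trivial graded monad over it holds automatically.\<close>

lemma incl_One_terminal: "terminal_0cell (GMnd M D) (incl_obj M D (One D))"
  unfolding terminal_0cell_def
proof (intro conjI ballI)
  show "incl_obj M D (One D) \<in> Obj (GMnd M D)" by (simp add: incl_obj_graded)
next
  fix X assume "X \<in> Obj (GMnd M D)"
  then have X: "graded_monad M D X" by simp
  note [simp] = graded_monad_typing[OF X]
  let ?b = "OplaxMor X (incl_obj M D (One D)) (bang D (gbase X)) (\<lambda>x \<in> MOb M. id2 D (bang D (gbase X)))"
  have b: "oplax_morphism M D ?b"
    by (subst oplax_into_incl) (simp_all add: X cocone_def hom_iff cell_iff, auto intro!: cell_One_eq)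
  show "\<exists>!f. f \<in> hom (GMnd M D) X (incl_obj M D (One D))"
  proof (rule ex1I[of _ ?b])
    show "?b \<in> hom (GMnd M D) X (incl_obj M D (One D))" using b by (simp add: hom_def)
    fix f assume "f \<in> hom (GMnd M D) X (incl_obj M D (One D))"
    then have f: "oplax_morphism M D f" "osrc f = X" "otrg f = incl_obj M D (One D)" by (simp_all add: hom_def)
    note ft [simp] = oplax_typing[OF f(1)] f(2,3)
    have a: "oarr f = bang D (gbase X)" using bang_unique[of "oarr f"] by simp
    show "f = ?b"
    proof (rule oplaxmor_eqI)
      show "ocell f x = ocell ?b x" if "x \<in> MOb M" for x
        by (rule cell_One_eq) (use that a in simp_all)
    qed (use a in simp_all)
  qed
next
  fix X H K assume "H \<in> hom (GMnd M D) X (incl_obj M D (One D))" "K \<in> hom (GMnd M D) X (incl_obj M D (One D))"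
  then have H: "oplax_morphism M D H" and K: "oplax_morphism M D K" and [simp]: "osrc H = X" "osrc K = X"
    "otrg H = incl_obj M D (One D)" "otrg K = incl_obj M D (One D)" by (simp_all add: hom_def)
  have X: "graded_monad M D X" using oplax_typing(1)[OF H] by simp
  note [simp] = oplax_typing[OF H] oplax_typing[OF K] graded_monad_typing[OF X]
  have e [simp]: "oarr H = oarr K" using bang_unique[of "oarr H"] bang_unique[of "oarr K"] by simp
  have r: "oplax_transformation M D (Framed H K (id2 D (oarr K)))"
    unfolding oplax_transformation_iff using H K by (auto simp: cell_iff intro!: cell_One_eq)
  show "\<exists>!\<tau>. \<tau> \<in> cell (GMnd M D) H K"
  proof (rule ex1I[of _ "Framed H K (id2 D (oarr K))"])
    show "Framed H K (id2 D (oarr K)) \<in> cell (GMnd M D) H K" using r by (simp add: cell_def)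
    fix \<theta> assume "\<theta> \<in> cell (GMnd M D) H K"
    then have \<theta>: "fdom \<theta> = H" "fcod \<theta> = K" "fcell \<theta> \<in> cell D (oarr H) (oarr K)"
      by (auto simp: cell_def oplax_transformation_iff)
    have "fcell \<theta> = id2 D (oarr K)" by (rule cell_One_eq) (use \<theta> in \<open>simp_all add: cell_iff\<close>)
    then show "\<theta> = Framed H K (id2 D (oarr K))" using \<theta> by (intro framed.expand) simp
  qed
qed

end

lemma (in fp_2cat) two_functor_forget: "two_functor (Mon D) D Mon_forget"
  by (intro two_functor.intro two_functor_axioms.intro two_category_Mon two_category_axioms)
    (auto simp: hom_def cell_def Mon_forget_def monoidal_typing lax_typing monoidal_transformationD)

section \<open>Working with universal cocones\<close>

context graded
begin

lemma cocone_typing: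
  assumes "cocone A X W w"
  shows "W \<in> Arr D" "src D W = gbase A" "trg D W = X" "x \<in> MOb M \<Longrightarrow> w x \<in> Cel D"
    "x \<in> MOb M \<Longrightarrow> vdom D (w x) = W \<cdot> gobj A x" "x \<in> MOb M \<Longrightarrow> vcod D (w x) = W"
  using assms by (auto simp: cocone_def hom_iff cell_iff)

lemma cocone_eqs:
  assumes "cocone A X W w"
  shows "f \<in> MAr M \<Longrightarrow> w (Mcod M f) \<bullet> (W \<rhd> garr A f) = w (Mdom M f)"
    "x \<in> MOb M \<Longrightarrow> y \<in> MOb M \<Longrightarrow> w (x \<otimes>\<^bsub>M\<^esub> y) \<bullet> (W \<rhd> gmult A x y) = w y \<bullet> (w x \<lhd> gobj A y)"
    "w (MI M) \<bullet> (W \<rhd> gunit A) = id2 D W"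
  using assms by (auto simp: cocone_def)

lemma universal_coconeD:
  assumes "universal_cocone A k W w"
  shows "k \<in> Obj D" "cocone A k W w" using assms by (auto simp: universal_cocone_def)

lemma universal_cocone_ext1:
  assumes "universal_cocone A k W w" "X \<in> Obj D" "cocone A X V v"
  obtains h where "h \<in> Arr D" "src D h = k" "trg D h = X" "h \<cdot> W = V" "\<And>x. x \<in> MOb M \<Longrightarrow> h \<rhd> w x = v x"
  using assms unfolding universal_cocone_def by blast

lemma universal_cocone_cancel1:
  assumes "universal_cocone A k W w" "h \<in> Arr D" "h' \<in> Arr D" "src D h = k" "src D h' = k" "trg D h = trg D h'" "h \<cdot> W = h' \<cdot> W"
    "\<And>x. x \<in> MOb M \<Longrightarrow> h \<rhd> w x = h' \<rhd> w x"
  shows "h = h'"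
  using assms unfolding universal_cocone_def by blast

lemma universal_cocone_ext2:
  assumes "universal_cocone A k W w" "h \<in> Arr D" "h' \<in> Arr D" "src D h = k" "src D h' = k" "trg D h = trg D h'"
    "s \<in> Cel D" "vdom D s = h \<cdot> W" "vcod D s = h' \<cdot> W"
    "\<And>x. x \<in> MOb M \<Longrightarrow> (h' \<rhd> w x) \<bullet> (s \<lhd> gobj A x) = s \<bullet> (h \<rhd> w x)"
  obtains t where "t \<in> Cel D" "vdom D t = h" "vcod D t = h'" "t \<lhd> W = s"
proof -
  have "s \<in> cell D (h \<cdot> W) (h' \<cdot> W)" using assms by (simp add: cell_iff)
  then have "\<exists>t \<in> cell D h h'. t \<lhd> W = s" using assms(1-6,10) unfolding universal_cocone_def by blast
  then show ?thesis using that by (auto simp: cell_iff)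
qed

lemma universal_cocone_cancel2:
  assumes "universal_cocone A k W w" "t \<in> Cel D" "t' \<in> Cel D" "src D (vdom D t) = k" "vdom D t = vdom D t'" "vcod D t = vcod D t'"
    "t \<lhd> W = t' \<lhd> W"
  shows "t = t'"
  using assms unfolding universal_cocone_def by blast

lemma universal_cocone_cong:
  assumes A: "graded_monad M D A" and U: "universal_cocone A k W w" and "\<And>x. x \<in> MOb M \<Longrightarrow> w x = w' x"
  shows "universal_cocone A k W w'"
proof -
  have "cocone A k W w'" using universal_coconeD(2)[OF U] assms(3) graded_monad_typing[OF A] by (auto simp: cocone_def)
  then show ?thesis using U assms(3) unfolding universal_cocone_def by (simp, blast)
qed

text \<open>The inverse of \<open>t \<lhd> W\<close> is again compatible with the cocone, so it descends as well.\<close>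

lemma universal_cocone_invertible:
  assumes A: "graded_monad M D A" and U: "universal_cocone A k W w" and t: "t \<in> Cel D" "src D (vdom D t) = k"
    and inv: "invertible_cell D (t \<lhd> W)"
  shows "invertible_cell D t"
proof -
  note [simp] = graded_monad_typing[OF A] cocone_typing[OF universal_coconeD(2)[OF U]] universal_coconeD(1)[OF U] t
  define h h' where h: "h = vdom D t" and h': "h' = vcod D t"
  have [simp]: "vdom D t = h" "vcod D t = h'" "h \<in> Arr D" "h' \<in> Arr D" "src D h = k" "src D h' = k" "trg D h' = trg D h"
    using t parallel[of t] by (auto simp: h h' simp del: parallel)
  obtain s where s [simp]: "s \<in> Cel D" "vdom D s = h' \<cdot> W" "vcod D s = h \<cdot> W" and st: "s \<bullet> (t \<lhd> W) = id2 D (h \<cdot> W)"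
    "(t \<lhd> W) \<bullet> s = id2 D (h' \<cdot> W)"
    using inv by (auto simp: invertible_cell_def cell_iff)
  obtain u where u [simp]: "u \<in> Cel D" "vdom D u = h'" "vcod D u = h" and us: "u \<lhd> W = s"
  proof (rule universal_cocone_ext2[OF U, of h' h s])
    fix x assume x: "x \<in> MOb M"
    have e: "(h' \<rhd> w x) \<bullet> (t \<lhd> (W \<cdot> gobj A x)) = (t \<lhd> W) \<bullet> (h \<rhd> w x)"
      by (rule exchange[symmetric]) (use x in simp_all)
    have st1: "(t \<lhd> (W \<cdot> gobj A x)) \<bullet> (s \<lhd> gobj A x) = id2 D (h' \<cdot> W \<cdot> gobj A x)"
      using arg_cong[OF st(2), of "\<lambda>t. t \<lhd> gobj A x"] x by simp
    \<comment> \<open>The identity formed by \<open>s\<close> followed by \<open>t\<close> is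
      inserted on the right, \<open>t\<close> is exchanged with the action, and it is then cancelled
      against the \<open>s\<close> on the left.\<close>
    have "s \<bullet> (h' \<rhd> w x) = s \<bullet> (h' \<rhd> w x) \<bullet> (t \<lhd> (W \<cdot> gobj A x)) \<bullet> (s \<lhd> gobj A x)" using x by (simp add: st1)
    also have "\<dots> = s \<bullet> (t \<lhd> W) \<bullet> (h \<rhd> w x) \<bullet> (s \<lhd> gobj A x)" using x by (simp add: vcmp_extend[OF e])
    also have "\<dots> = (h \<rhd> w x) \<bullet> (s \<lhd> gobj A x)" using x by (simp add: vcmp_extend[OF st(1)])
    finally show "(h \<rhd> w x) \<bullet> (s \<lhd> gobj A x) = s \<bullet> (h' \<rhd> w x)" by simp
  qed simp_all
  have "u \<bullet> t = id2 D h" by (rule universal_cocone_cancel2[OF U]) (simp_all add: us st)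
  moreover have "t \<bullet> u = id2 D h'" by (rule universal_cocone_cancel2[OF U]) (simp_all add: us st)
  ultimately show ?thesis using u by (auto simp: invertible_cell_def cell_iff)
qed

end

section \<open>Universal cocones over products and over the terminal 0-cell\<close>

locale kleisli_fp = fp_graded D M
  for D :: "('o, 'a, 'c, 'z) fp_twocat_scheme" (structure) and M :: "('m, 'n) moncat" +
  fixes K \<eta> \<epsilon>
  assumes adj: "kleisli_adjunction M D K \<eta> \<epsilon>"
    and pres: "preserves_finite_products (GMnd M D) D K"
begin

definition gpairW where
  "gpairW A B W V = \<langle>W \<cdot> Pr1 D (gbase A) (gbase B), V \<cdot> Pr2 D (gbase A) (gbase B)\<rangle>"

definition gpairw where
  "gpairw A B w v = (\<lambda>x. \<lblot>w x \<lhd> Pr1 D (gbase A) (gbase B), v x \<lhd> Pr2 D (gbase A) (gbase B)\<rblot>)"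

text \<open>By preservation, the unit at \<open>gprod A B\<close> is a universal arrow whose vertex
  is a product of the vertices at \<open>A\<close> and \<open>B\<close>; naturality of
  \<open>\<eta>\<close> at the projections relates it to the units there.
  \<open>universal_product\<close> then replaces these vertices by \<open>k\<close> and
  \<open>l\<close>, and their product by the chosen one.\<close>

lemma gprod_universal_cocone:
  assumes A: "graded_monad M D A" and B: "graded_monad M D B"
    and U: "universal_cocone A k W w" and V: "universal_cocone B l V v"
  shows "universal_cocone (gprod A B) (Prd D k l) (gpairW A B W V) (gpairw A B w v)"
proof -
  interpret adj: two_adjunction "GMnd M D" D K "incl M D" \<eta> \<epsilon> by (rule adj)
  let ?P = "gprod A B" and ?Q = "Prd D k l" and ?p = "Pr1 D (gbase A) (gbase B)" and ?q = "Pr2 D (gbase A) (gbase B)"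
  note cW = universal_coconeD[OF U] and cV = universal_coconeD[OF V]
  have P: "graded_monad M D ?P" by (rule gprod_graded[OF A B])
  note [simp] = graded_monad_typing[OF A] graded_monad_typing[OF B] cW(1) cV(1) cocone_typing[OF cW(2)] cocone_typing[OF cV(2)] 
    A B P gpr_oplax[OF A B] adj.unit.typing_component
  let ?W = "OplaxMor A (incl_obj M D k) W (restrict w (MOb M))"
  let ?V = "OplaxMor B (incl_obj M D l) V (restrict v (MOb M))"
  let ?u = "OplaxMor ?P (incl_obj M D ?Q) (gpairW A B W V) (restrict (gpairw A B w v) (MOb M))"
  have uW: "universal_arrow (GMnd M D) D (incl M D) A k ?W"
    unfolding universal_arrow_iff_cocone[OF A] using universal_cocone_cong[OF A U, of "restrict w (MOb M)"] by simp
  have uV: "universal_arrow (GMnd M D) D (incl M D) B l ?V"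
    unfolding universal_arrow_iff_cocone[OF B] using universal_cocone_cong[OF B V, of "restrict v (MOb M)"] by simp
  have W: "oplax_morphism M D ?W" and V: "oplax_morphism M D ?V"
    using adj.right.universal_typing(2)[OF uW] adj.right.universal_typing(2)[OF uV] by simp_all
  \<comment> \<open>Each axiom of the paired action is the pair of the two given axioms, whiskered
    with the projections.\<close>
  have "cocone ?P ?Q (gpairW A B W V) (gpairw A B w v)"
  proof -
    have "(w (Mcod M f) \<lhd> ?p) \<bullet> (W \<rhd> (garr A f \<lhd> ?p)) = w (Mdom M f) \<lhd> ?p"
      "(v (Mcod M f) \<lhd> ?q) \<bullet> (V \<rhd> (garr B f \<lhd> ?q)) = v (Mdom M f) \<lhd> ?q" if "f \<in> MAr M" for f
      using arg_cong[OF cocone_eqs(1)[OF cW(2) that], of "\<lambda>t. t \<lhd> ?p"] arg_cong[OF cocone_eqs(1)[OF cV(2) that], of "\<lambda>t. t \<lhd> ?q"]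
        that by simp_all
    moreover have "(w (x \<otimes>\<^bsub>M\<^esub> y) \<lhd> ?p) \<bullet> (W \<rhd> (gmult A x y \<lhd> ?p)) = (w y \<lhd> ?p) \<bullet> (w x \<lhd> (gobj A y \<cdot> ?p))"
       "(v (x \<otimes>\<^bsub>M\<^esub> y) \<lhd> ?q) \<bullet> (V \<rhd> (gmult B x y \<lhd> ?q)) = (v y \<lhd> ?q) \<bullet> (v x \<lhd> (gobj B y \<cdot> ?q))" if "x \<in> MOb M" "y \<in> MOb M" for x y
      using arg_cong[OF cocone_eqs(2)[OF cW(2) that], of "\<lambda>t. t \<lhd> ?p"] arg_cong[OF cocone_eqs(2)[OF cV(2) that], of "\<lambda>t. t \<lhd> ?q"]
        that by simp_all
    moreover have "(w (MI M) \<lhd> ?p) \<bullet> (W \<rhd> (gunit A \<lhd> ?p)) = id2 D (W \<cdot> ?p)" "(v (MI M) \<lhd> ?q) \<bullet> (V \<rhd> (gunit B \<lhd> ?q)) = id2 D (V \<cdot> ?q)" 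
      using arg_cong[OF cocone_eqs(3)[OF cW(2)], of "\<lambda>t. t \<lhd> ?p"] arg_cong[OF cocone_eqs(3)[OF cV(2)], of "\<lambda>t. t \<lhd> ?q"] by simp_all
    ultimately show ?thesis
      by (simp add: cocone_def gpairW_def gpairw_def hom_iff cell_iff pair2_vcmp)
  qed
  then have "cocone ?P ?Q (gpairW A B W V) (restrict (gpairw A B w v) (MOb M))" by (auto simp: cocone_def)
  then have u: "oplax_morphism M D ?u" by (subst oplax_into_incl) simp_all
  have "universal_arrow (GMnd M D) D (incl M D) ?P ?Q ?u"
  proof (rule adj.right.universal_product)
    show "product_0cell D (on0 K A) (on0 K B) (on0 K ?P) (on1 K (gpr1 A B)) (on1 K (gpr2 A B))"
      using pres gprod_product[OF A B] by (auto simp: preserves_finite_products_def)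
    show "universal_arrow (GMnd M D) D (incl M D) ?P (on0 K ?P) (\<eta> ?P)" "universal_arrow (GMnd M D) D (incl M D) A (on0 K A) (\<eta> A)"
      "universal_arrow (GMnd M D) D (incl M D) B (on0 K B) (\<eta> B)"
      by (rule adj.unit_universal; simp)+
    show "on1 (incl M D) (on1 K (gpr1 A B)) \<cdot>\<^bsub>GMnd M D\<^esub> \<eta> ?P = \<eta> A \<cdot>\<^bsub>GMnd M D\<^esub> gpr1 A B"
      using adj.unit.nat1[of "gpr1 A B"] by simp
    show "on1 (incl M D) (on1 K (gpr2 A B)) \<cdot>\<^bsub>GMnd M D\<^esub> \<eta> ?P = \<eta> B \<cdot>\<^bsub>GMnd M D\<^esub> gpr2 A B"
      using adj.unit.nat1[of "gpr2 A B"] by simp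
    show "product_0cell D k l ?Q (Pr1 D k l) (Pr2 D k l)" by (rule product_Prd) simp_all
    show "on1 (incl M D) (Pr1 D k l) \<cdot>\<^bsub>GMnd M D\<^esub> ?u = ?W \<cdot>\<^bsub>GMnd M D\<^esub> gpr1 A B"
      by (rule oplaxmor_eqI) (simp_all add: gpairW_def gpairw_def, simp_all add: oplax_comp_def)
    show "on1 (incl M D) (Pr2 D k l) \<cdot>\<^bsub>GMnd M D\<^esub> ?u = ?V \<cdot>\<^bsub>GMnd M D\<^esub> gpr2 A B"
      by (rule oplaxmor_eqI) (simp_all add: gpairW_def gpairw_def, simp_all add: oplax_comp_def)
  qed (use uW uV u in simp_all)
  then have "universal_cocone ?P ?Q (gpairW A B W V) (restrict (gpairw A B w v) (MOb M))"
    unfolding universal_arrow_iff_cocone[OF P] by simp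
  then show ?thesis by (rule universal_cocone_cong[OF P]) simp
qed

text \<open>Preservation of the terminal 0-cell makes the identity of \<open>One D\<close>, with
  identity cells, a universal cocone, and every other cocone is a whiskering of it. The cocone
  axioms alone do not give this: for a group, seen as a discrete monoidal category, they admit every
  antihomomorphism into the invertible 2-cells on \<open>V\<close>.\<close>

lemma cocone_incl_One:
  assumes V: "cocone (incl_obj M D (One D)) X V v" and X: "X \<in> Obj D" and x: "x \<in> MOb M"
  shows "v x = id2 D V"
proof -
  interpret adj: two_adjunction "GMnd M D" D K "incl M D" \<eta> \<epsilon> by (rule adj)
  have "terminal_0cell D (on0 K (incl_obj M D (One D)))"
    using pres incl_One_terminal by (auto simp: preserves_finite_products_def)
  then have "universal_arrow (GMnd M D) D (incl M D) (incl_obj M D (One D)) (One D) (oplax_id M D (incl_obj M D (One D)))"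
    using adj.universal_terminal[OF terminal_One] incl_One_terminal by simp
  then have U: "universal_cocone (incl_obj M D (One D)) (One D) (id1 D (One D)) (ocell (oplax_id M D (incl_obj M D (One D))))"
    using universal_arrow_iff_cocone[OF incl_obj_graded[OF One_Obj]] by simp
  obtain h where h: "h \<in> Arr D" "src D h = One D" "trg D h = X" "h \<cdot> id1 D (One D) = V"
    "\<And>x. x \<in> MOb M \<Longrightarrow> h \<rhd> ocell (oplax_id M D (incl_obj M D (One D))) x = v x"
    using universal_cocone_ext1[OF U X V] by blast
  show ?thesis using h(1-4) h(5)[OF x, symmetric] x by simp
qed

end

section \<open>The monoidal structure of the Kleisli object\<close>

text \<open>The cocone formed by \<open>k\<close>, \<open>W\<close> and \<open>w\<close> is an
  arbitrary universal one. The adjunction acts in this locale only through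
  \<open>gprod_universal_cocone\<close> and \<open>cocone_incl_One\<close>.\<close>

locale kleisli_mon = kleisli_fp D M K \<eta> \<epsilon>
  for D :: "('o, 'a, 'c, 'z) fp_twocat_scheme" (structure) and M :: "('m, 'n) moncat" and K \<eta> \<epsilon> +
  fixes A k W w
  assumes A_graded: "graded_monad M (Mon D) A"
    and universal_W: "universal_cocone (GMnd_map_obj M Mon_forget A) k W w"
begin

abbreviation "C \<equiv> gbase A"
abbreviation "c \<equiv> mobj (gbase A)"
abbreviation "f m \<equiv> larr (gobj A m)"
abbreviation "\<phi> m \<equiv> lmult_at D (gobj A m)"
abbreviation "UA \<equiv> GMnd_map_obj M Mon_forget A"
abbreviation "p \<equiv> Pr1 D (mobj (gbase A)) (mobj (gbase A))"
abbreviation "q \<equiv> Pr2 D (mobj (gbase A)) (mobj (gbase A))"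

lemma graded_Mon: "graded (Mon D) M"
  by (simp add: graded_def strict_2cat_iff two_category_Mon monoidal_category_axioms)

lemma A_typing [simp]:
  "monoidal_object D C"
  "m \<in> MOb M \<Longrightarrow> lax_monoidal D (gobj A m)" "m \<in> MOb M \<Longrightarrow> lsrc (gobj A m) = C" "m \<in> MOb M \<Longrightarrow> ltrg (gobj A m) = C"
  "n \<in> MAr M \<Longrightarrow> monoidal_transformation D (garr A n)" "n \<in> MAr M \<Longrightarrow> fdom (garr A n) = gobj A (Mdom M n)"
  "n \<in> MAr M \<Longrightarrow> fcod (garr A n) = gobj A (Mcod M n)"
  "m \<in> MOb M \<Longrightarrow> l \<in> MOb M \<Longrightarrow> monoidal_transformation D (gmult A m l)"
  "m \<in> MOb M \<Longrightarrow> l \<in> MOb M \<Longrightarrow> fdom (gmult A m l) = lax_comp D (gobj A m) (gobj A l)"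
  "m \<in> MOb M \<Longrightarrow> l \<in> MOb M \<Longrightarrow> fcod (gmult A m l) = gobj A (m \<otimes>\<^bsub>M\<^esub> l)"
  "monoidal_transformation D (gunit A)" "fdom (gunit A) = lax_id D C" "fcod (gunit A) = gobj A (MI M)"
  using graded.graded_monad_typing[OF graded_Mon A_graded] by simp_all

lemma c_typing [simp]: "c \<in> Obj D" "munit C \<in> Arr D" "src D (munit C) = One D" "trg D (munit C) = c"
  "mlunit C \<in> Cel D" "vdom D (mlunit C) = tens1 D C (unit_at D C c) (id1 D c)" "vcod D (mlunit C) = id1 D c"
  "mrunit C \<in> Cel D" "vdom D (mrunit C) = tens1 D C (id1 D c) (unit_at D C c)" "vcod D (mrunit C) = id1 D c"
  using monoidal_typing[OF A_typing(1)] by simp_all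

lemma f_typing [simp]:
  assumes "m \<in> MOb M"
  shows "f m \<in> Arr D" "src D (f m) = c" "trg D (f m) = c"
    "lunit (gobj A m) \<in> Cel D" "vdom D (lunit (gobj A m)) = munit C" "vcod D (lunit (gobj A m)) = f m \<cdot> munit C"
  using lax_typing[of "gobj A m"] assms by simp_all

lemma \<phi>_typing [simp]:
  assumes "m \<in> MOb M" "x \<in> Arr D" "y \<in> Arr D" "src D x = src D y" "trg D x = c" "trg D y = c"
  shows "\<phi> m x y \<in> Cel D" "vdom D (\<phi> m x y) = tens1 D C (f m \<cdot> x) (f m \<cdot> y)" "vcod D (\<phi> m x y) = f m \<cdot> tens1 D C x y"
    "h \<in> Arr D \<Longrightarrow> trg D h = src D y \<Longrightarrow> \<phi> m x y \<lhd> h = \<phi> m (x \<cdot> h) (y \<cdot> h)"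
  using lmult_at_typing[of "gobj A m" x y] assms by simp_all

lemma UA_sel [simp]:
  "gbase UA = c" "m \<in> MOb M \<Longrightarrow> gobj UA m = f m" "n \<in> MAr M \<Longrightarrow> garr UA n = fcell (garr A n)"
  "m \<in> MOb M \<Longrightarrow> l \<in> MOb M \<Longrightarrow> gmult UA m l = fcell (gmult A m l)" "gunit UA = fcell (gunit A)"
  by (simp_all add: GMnd_map_obj_def Mon_forget_def)

lemma UA_graded: "graded_monad M D UA"
proof -
  interpret G: two_functor "GMnd M (Mon D)" "GMnd M D" "GMnd_map M Mon_forget"
    by (rule two_functor_GMnd_map[OF monoidal_category_axioms two_functor_forget])
  have "A \<in> Obj (GMnd M (Mon D))" using A_graded by (simp add: GMnd_def)
  from G.on0_Obj[OF this] show ?thesis by (simp add: GMnd_map_def)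
qed

lemma UA_cells [simp]:
  "n \<in> MAr M \<Longrightarrow> fcell (garr A n) \<in> Cel D" "n \<in> MAr M \<Longrightarrow> vdom D (fcell (garr A n)) = f (Mdom M n)"
  "n \<in> MAr M \<Longrightarrow> vcod D (fcell (garr A n)) = f (Mcod M n)"
  "m \<in> MOb M \<Longrightarrow> l \<in> MOb M \<Longrightarrow> fcell (gmult A m l) \<in> Cel D"
  "m \<in> MOb M \<Longrightarrow> l \<in> MOb M \<Longrightarrow> vdom D (fcell (gmult A m l)) = f m \<cdot> f l"
  "m \<in> MOb M \<Longrightarrow> l \<in> MOb M \<Longrightarrow> vcod D (fcell (gmult A m l)) = f (m \<otimes>\<^bsub>M\<^esub> l)"
  "fcell (gunit A) \<in> Cel D" "vdom D (fcell (gunit A)) = id1 D c" "vcod D (fcell (gunit A)) = f (MI M)"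
  using graded_monad_typing[OF UA_graded] by simp_all

lemma cocone_W: "cocone UA k W w" and k_Obj [simp]: "k \<in> Obj D"
  using universal_coconeD[OF universal_W] by simp_all

lemma W_typing [simp]:
  "W \<in> Arr D" "src D W = c" "trg D W = k" "m \<in> MOb M \<Longrightarrow> w m \<in> Cel D"
  "m \<in> MOb M \<Longrightarrow> vdom D (w m) = W \<cdot> f m" "m \<in> MOb M \<Longrightarrow> vcod D (w m) = W"
  using cocone_typing[OF cocone_W] by simp_all

lemma W_eqs:
  "n \<in> MAr M \<Longrightarrow> w (Mcod M n) \<bullet> (W \<rhd> fcell (garr A n)) = w (Mdom M n)"
  "m \<in> MOb M \<Longrightarrow> l \<in> MOb M \<Longrightarrow> w (m \<otimes>\<^bsub>M\<^esub> l) \<bullet> (W \<rhd> fcell (gmult A m l)) = w l \<bullet> (w m \<lhd> f l)"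
  "w (MI M) \<bullet> (W \<rhd> fcell (gunit A)) = id2 D W"
  using cocone_eqs[OF cocone_W] by simp_all

text \<open>This rule and the next two express monoidality of the 2-cells of \<open>A\<close> at
  generalized elements. They supply the three axioms of the action in
  \<open>tensor_cocone\<close>.\<close>

lemma \<phi>_garr:
  assumes "n \<in> MAr M" "x \<in> Arr D" "y \<in> Arr D" "src D x = src D y" "trg D x = c" "trg D y = c"
  shows "\<phi> (Mcod M n) x y \<bullet> tens2 D C (fcell (garr A n) \<lhd> x) (fcell (garr A n) \<lhd> y) =
    (fcell (garr A n) \<lhd> tens1 D C x y) \<bullet> \<phi> (Mdom M n) x y"
  using monoidal_transformation_at[of "garr A n" x y] assms by simp

lemma \<phi>_gmult:
  assumes "m \<in> MOb M" "l \<in> MOb M" "x \<in> Arr D" "y \<in> Arr D" "src D x = src D y" "trg D x = c" "trg D y = c"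
  shows "\<phi> (m \<otimes>\<^bsub>M\<^esub> l) x y \<bullet> tens2 D C (fcell (gmult A m l) \<lhd> x) (fcell (gmult A m l) \<lhd> y) =
    (fcell (gmult A m l) \<lhd> tens1 D C x y) \<bullet> (f m \<rhd> \<phi> l x y) \<bullet> \<phi> m (f l \<cdot> x) (f l \<cdot> y)"
  using monoidal_transformation_at[of "gmult A m l" x y] lax_comp_lmult_at[of "gobj A l" "gobj A m" x y] assms by simp

lemma \<phi>_gunit:
  assumes "x \<in> Arr D" "y \<in> Arr D" "src D x = src D y" "trg D x = c" "trg D y = c"
  shows "\<phi> (MI M) x y \<bullet> tens2 D C (fcell (gunit A) \<lhd> x) (fcell (gunit A) \<lhd> y) = fcell (gunit A) \<lhd> tens1 D C x y"
proof -
  have "mtens C \<cdot> \<langle>x, y\<rangle> = tens1 D C x y" by (simp add: tens1_def)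
  then have "lmult_at D (lax_id D C) x y = id2 D (tens1 D C x y)" 
    using tensor_object_typing[of C] assms by (simp add: lmult_at_def)
  then show ?thesis using monoidal_transformation_at[of "gunit A" x y] assms by simp
qed

text \<open>\<open>tens1\<close> at the two projections is the tensor itself. Keeping it in that
  form makes precomposition a substitution; this is the version for a pair of 2-cells under a left
  whisker.\<close>

lemma cmp_tens1_hcmp:
  assumes "tensor_object E" "s \<in> Cel D" "t \<in> Cel D" "src D (vdom D s) = src D (vdom D t)" "trg D (vdom D s) = mobj E" "trg D (vdom D t) = mobj E"
    "g \<in> Arr D" "src D g = mobj E"
  shows "(g \<cdot> tens1 D E (Pr1 D (mobj E) (mobj E)) (Pr2 D (mobj E) (mobj E))) \<rhd> \<lblot>s, t\<rblot> = g \<rhd> tens2 D E s t"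
proof -
  note [simp] = tensor_object_typing[OF assms(1)]
  have "(g \<cdot> tens1 D E (Pr1 D (mobj E) (mobj E)) (Pr2 D (mobj E) (mobj E))) \<rhd> \<lblot>s, t\<rblot> =
    g \<rhd> (tens1 D E (Pr1 D (mobj E) (mobj E)) (Pr2 D (mobj E) (mobj E)) \<rhd> \<lblot>s, t\<rblot>)" using assms by simp
  also have "\<dots> = g \<rhd> tens2 D E s t" using assms by (simp add: tens1_hcmp)
  finally show ?thesis .
qed

section \<open>The tensor of the Kleisli object\<close>

definition "W2 = \<langle>W \<cdot> p, W \<cdot> q\<rangle>"
definition "w2 m = \<lblot>w m \<lhd> p, w m \<lhd> q\<rblot>"
definition "UA2 = gprod UA UA"

lemma UA2_graded: "graded_monad M D UA2"
  unfolding UA2_def by (rule gprod_graded[OF UA_graded UA_graded])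

lemma universal_W2: "universal_cocone UA2 (Prd D k k) W2 w2"
  using gprod_universal_cocone[OF UA_graded UA_graded universal_W universal_W]
  by (simp add: W2_def w2_def[abs_def] gpairW_def gpairw_def UA2_def)

lemma UA2_sel [simp]: "m \<in> MOb M \<Longrightarrow> gobj UA2 m = \<langle>f m \<cdot> p, f m \<cdot> q\<rangle>" "gbase UA2 = Prd D c c"
  by (simp_all add: UA2_def)

text \<open>The tensor of \<open>C\<close>, as an oplax morphism with cells \<open>\<phi> m\<close>,
  is followed by the cocone \<open>W\<close>. Beyond the axioms of the two, the multiplication axiom
  takes one interchange, \<open>e4\<close>.\<close>

lemma tensor_cocone: "cocone UA2 k (W \<cdot> tens1 D C p q) (\<lambda>m. (w m \<lhd> tens1 D C p q) \<bullet> (W \<rhd> \<phi> m p q))"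
  unfolding cocone_def
proof (intro conjI ballI, goal_cases)
  case 1
  show ?case by (simp add: UA2_def hom_iff)
next
  case (2 m)
  then show ?case by (simp add: cell_iff)
next
  case (3 n)
  note n = 3
  let ?t = "fcell (garr A n)"
  have e1: "(W \<cdot> tens1 D C p q) \<rhd> garr UA2 n = W \<rhd> tens2 D C (?t \<lhd> p) (?t \<lhd> q)"
    using n by (simp add: UA2_def cmp_tens1_hcmp)
  have e2: "(W \<rhd> \<phi> (Mcod M n) p q) \<bullet> (W \<rhd> tens2 D C (?t \<lhd> p) (?t \<lhd> q)) = (W \<rhd> ?t \<lhd> tens1 D C p q) \<bullet> (W \<rhd> \<phi> (Mdom M n) p q)"
    using arg_cong[OF \<phi>_garr[OF n, of p q], of "\<lambda>t. W \<rhd> t"] n by simp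
  have e3: "(w (Mcod M n) \<lhd> tens1 D C p q) \<bullet> (W \<rhd> ?t \<lhd> tens1 D C p q) = w (Mdom M n) \<lhd> tens1 D C p q"
    using arg_cong[OF W_eqs(1)[OF n], of "\<lambda>t. t \<lhd> tens1 D C p q"] n by simp
  show ?case unfolding e1 using n by (simp add: e2 vcmp_extend[OF e3])
next
  case (4 m l)
  note ml = 4
  let ?t = "fcell (gmult A m l)"
  have e1: "(W \<cdot> tens1 D C p q) \<rhd> gmult UA2 m l = W \<rhd> tens2 D C (?t \<lhd> p) (?t \<lhd> q)"
    using ml by (simp add: UA2_def cmp_tens1_hcmp)
  have e2: "(W \<rhd> \<phi> (m \<otimes>\<^bsub>M\<^esub> l) p q) \<bullet> (W \<rhd> tens2 D C (?t \<lhd> p) (?t \<lhd> q)) = 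
      (W \<rhd> ?t \<lhd> tens1 D C p q) \<bullet> ((W \<cdot> f m) \<rhd> \<phi> l p q) \<bullet> (W \<rhd> \<phi> m (f l \<cdot> p) (f l \<cdot> q))"
    using arg_cong[OF \<phi>_gmult[OF ml, of p q], of "\<lambda>t. W \<rhd> t"] ml by simp
  have e3: "(w (m \<otimes>\<^bsub>M\<^esub> l) \<lhd> tens1 D C p q) \<bullet> (W \<rhd> ?t \<lhd> tens1 D C p q) = (w l \<lhd> tens1 D C p q) \<bullet> (w m \<lhd> (f l \<cdot> tens1 D C p q))"
    using arg_cong[OF W_eqs(2)[OF ml], of "\<lambda>t. t \<lhd> tens1 D C p q"] ml by simp
  have e4: "(w m \<lhd> (f l \<cdot> tens1 D C p q)) \<bullet> ((W \<cdot> f m) \<rhd> \<phi> l p q) = (W \<rhd> \<phi> l p q) \<bullet> (w m \<lhd> tens1 D C (f l \<cdot> p) (f l \<cdot> q))"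
    by (rule exchange) (use ml in simp_all)
  show ?case unfolding e1 using ml by (simp add: e2 vcmp_extend[OF e3] vcmp_extend[OF e4])
next
  case 5
  let ?t = "fcell (gunit A)"
  have e1: "(W \<cdot> tens1 D C p q) \<rhd> gunit UA2 = W \<rhd> tens2 D C (?t \<lhd> p) (?t \<lhd> q)"
    by (simp add: UA2_def cmp_tens1_hcmp)
  have e2: "(W \<rhd> \<phi> (MI M) p q) \<bullet> (W \<rhd> tens2 D C (?t \<lhd> p) (?t \<lhd> q)) = W \<rhd> ?t \<lhd> tens1 D C p q"
    using arg_cong[OF \<phi>_gunit[of p q], of "\<lambda>t. W \<rhd> t"] by simp
  have e3: "(w (MI M) \<lhd> tens1 D C p q) \<bullet> (W \<rhd> ?t \<lhd> tens1 D C p q) = id2 D (W \<cdot> tens1 D C p q)"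
    using arg_cong[OF W_eqs(3), of "\<lambda>t. t \<lhd> tens1 D C p q"] by simp
  show ?case unfolding e1 by (simp add: e2 e3)
qed

definition "T = (SOME T. T \<in> Arr D \<and> src D T = Prd D k k \<and> trg D T = k \<and> T \<cdot> W2 = W \<cdot> tens1 D C p q \<and>
   (\<forall>m \<in> MOb M. T \<rhd> w2 m = (w m \<lhd> tens1 D C p q) \<bullet> (W \<rhd> \<phi> m p q)))"

lemma T_props: "T \<in> Arr D \<and> src D T = Prd D k k \<and> trg D T = k \<and> T \<cdot> W2 = W \<cdot> tens1 D C p q \<and>
   (\<forall>m \<in> MOb M. T \<rhd> w2 m = (w m \<lhd> tens1 D C p q) \<bullet> (W \<rhd> \<phi> m p q))"
  unfolding T_def by (rule someI_ex) (rule universal_cocone_ext1[OF universal_W2 k_Obj tensor_cocone], blast)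

lemma T_typing [simp]: "T \<in> Arr D" "src D T = Prd D k k" "trg D T = k"
  using T_props by simp_all

lemma W2_typing [simp]: "W2 \<in> Arr D" "src D W2 = Prd D c c" "trg D W2 = Prd D k k"
  "m \<in> MOb M \<Longrightarrow> w2 m \<in> Cel D" "m \<in> MOb M \<Longrightarrow> vdom D (w2 m) = W2 \<cdot> \<langle>f m \<cdot> p, f m \<cdot> q\<rangle>"
  "m \<in> MOb M \<Longrightarrow> vcod D (w2 m) = W2"
  by (simp_all add: W2_def w2_def)

text \<open>The tensor and unit of the Kleisli object at generalized elements do not depend on its coherence
  cells, which are still to be constructed; \<open>L0\<close> has arbitrary ones.\<close>

definition "L0 = MonObj k T (W \<cdot> munit C) undefined undefined undefined"

definition kl_like where
  "kl_like L \<longleftrightarrow> mobj L = k \<and> mtens L = T \<and> munit L = W \<cdot> munit C"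

lemma kl_like_L0: "kl_like L0"
  by (simp add: kl_like_def L0_def)

lemma kl_like_mtens: "kl_like L \<Longrightarrow> mtens L = T"
  by (simp add: kl_like_def)

lemma kl_like_tensor [simp]: "kl_like L \<Longrightarrow> tensor_object L" "kl_like L \<Longrightarrow> mobj L = k"
  "kl_like L \<Longrightarrow> munit L = W \<cdot> munit C"
  using T_props by (simp_all add: kl_like_def tensor_object_def hom_iff)

text \<open>The factorization \<open>T \<cdot> W2 = W \<cdot> tens1 D C p q\<close> evaluated at the
  pair of \<open>x\<close> and \<open>y\<close>. As a rewrite rule it moves \<open>W\<close> out of
  nested tensors.\<close>

lemma tens1_W [simp]:
  assumes L: "kl_like L" and "x \<in> Arr D" "y \<in> Arr D" "src D x = src D y" "trg D x = c" "trg D y = c"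
  shows "tens1 D L (W \<cdot> x) (W \<cdot> y) = W \<cdot> tens1 D C x y"
proof -
  have "W2 \<cdot> \<langle>x, y\<rangle> = \<langle>W \<cdot> x, W \<cdot> y\<rangle>" using assms(2-) by (simp add: W2_def)
  then have "tens1 D L (W \<cdot> x) (W \<cdot> y) = T \<cdot> (W2 \<cdot> \<langle>x, y\<rangle>)" by (simp add: tens1_def kl_like_mtens[OF L])
  also have "\<dots> = (T \<cdot> W2) \<cdot> \<langle>x, y\<rangle>" using assms(2-) by simp
  also have "\<dots> = (W \<cdot> tens1 D C p q) \<cdot> \<langle>x, y\<rangle>" using T_props by metis
  also have "\<dots> = W \<cdot> tens1 D C x y" using assms(2-) by simp
  finally show ?thesis .
qed

lemma tens2_W:
  assumes L: "kl_like L" and "s \<in> Cel D" "t \<in> Cel D" "src D (vdom D s) = src D (vdom D t)" "trg D (vdom D s) = c" "trg D (vdom D t) = c"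
  shows "tens2 D L (W \<rhd> s) (W \<rhd> t) = W \<rhd> tens2 D C s t"
proof -
  have 1: "W2 \<rhd> \<lblot>s, t\<rblot> = \<lblot>W \<rhd> s, W \<rhd> t\<rblot>" using assms(2-) by (simp add: W2_def)
  have "tens2 D L (W \<rhd> s) (W \<rhd> t) = T \<rhd> (W2 \<rhd> \<lblot>s, t\<rblot>)" unfolding 1 by (simp add: tens2_def kl_like_mtens[OF L])
  also have "\<dots> = (T \<cdot> W2) \<rhd> \<lblot>s, t\<rblot>" using assms(2-) by simp
  also have "\<dots> = (W \<cdot> tens1 D C p q) \<rhd> \<lblot>s, t\<rblot>" using T_props by metis
  also have "\<dots> = W \<rhd> tens2 D C s t" by (rule cmp_tens1_hcmp) (use assms(2-) in simp_all)
  finally show ?thesis .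
qed

text \<open>The value of \<open>T \<rhd> w2 m\<close> at a pair. It rewrites a tensor of action
  cells in \<open>k\<close> as an action on a tensor in \<open>C\<close>, preceded by
  \<open>\<phi> m\<close>; this is how the lax structure of \<open>gobj A m\<close> enters the
  descent conditions.\<close>

lemma tens2_w:
  assumes L: "kl_like L" and m: "m \<in> MOb M" and "x \<in> Arr D" "y \<in> Arr D" "src D x = src D y" "trg D x = c" "trg D y = c"
  shows "tens2 D L (w m \<lhd> x) (w m \<lhd> y) = (w m \<lhd> tens1 D C x y) \<bullet> (W \<rhd> \<phi> m x y)"
proof -
  have 1: "w2 m \<lhd> \<langle>x, y\<rangle> = \<lblot>w m \<lhd> x, w m \<lhd> y\<rblot>" using assms(2-) by (simp add: w2_def)
  have "tens2 D L (w m \<lhd> x) (w m \<lhd> y) = T \<rhd> (w2 m \<lhd> \<langle>x, y\<rangle>)" unfolding 1 by (simp add: tens2_def kl_like_mtens[OF L])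
  also have "\<dots> = (T \<rhd> w2 m) \<lhd> \<langle>x, y\<rangle>" using assms(2-) by simp
  also have "\<dots> = ((w m \<lhd> tens1 D C p q) \<bullet> (W \<rhd> \<phi> m p q)) \<lhd> \<langle>x, y\<rangle>" using T_props m by metis
  also have "\<dots> = (w m \<lhd> tens1 D C x y) \<bullet> (W \<rhd> \<phi> m x y)" using assms(2-) by simp
  finally show ?thesis .
qed

text \<open>Precomposition with \<open>s\<close> and \<open>t\<close> makes the previous rule
  iterable: \<open>\<phi> m\<close> of an inner tensor, or the unit cell
  \<open>lunit (gobj A m)\<close>, is inserted there.\<close>

lemma tens2_w_cells:
  assumes L: "kl_like L" and m: "m \<in> MOb M" and x: "x \<in> Arr D" "y \<in> Arr D" "src D x = src D y" "trg D x = c" "trg D y = c"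
    and s: "s \<in> Cel D" "vcod D s = f m \<cdot> x" and t: "t \<in> Cel D" "vcod D t = f m \<cdot> y"
  shows "tens2 D L ((w m \<lhd> x) \<bullet> (W \<rhd> s)) ((w m \<lhd> y) \<bullet> (W \<rhd> t)) = (w m \<lhd> tens1 D C x y) \<bullet> (W \<rhd> (\<phi> m x y \<bullet> tens2 D C s t))"
proof -
  have [simp]: "src D (vdom D s) = src D y" "trg D (vdom D s) = c" "src D (vdom D t) = src D y" "trg D (vdom D t) = c"
    using s t x m parallel[of s] parallel[of t] by (auto simp del: parallel)
  note [simp] = x s t m L
  have 1: "tens2 D L (w m \<lhd> x) (w m \<lhd> y) \<bullet> tens2 D L (W \<rhd> s) (W \<rhd> t) =
     tens2 D L ((w m \<lhd> x) \<bullet> (W \<rhd> s)) ((w m \<lhd> y) \<bullet> (W \<rhd> t))"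
    by (rule tens2_vcmp) simp_all
  have "tens2 D L ((w m \<lhd> x) \<bullet> (W \<rhd> s)) ((w m \<lhd> y) \<bullet> (W \<rhd> t)) = tens2 D L (w m \<lhd> x) (w m \<lhd> y) \<bullet> tens2 D L (W \<rhd> s) (W \<rhd> t)"
    by (simp only: 1)
  also have "\<dots> = (w m \<lhd> tens1 D C x y) \<bullet> (W \<rhd> (\<phi> m x y \<bullet> tens2 D C s t))"
    by (simp add: tens2_W tens2_w)
  finally show ?thesis .
qed

text \<open>The one place where preservation of the terminal 0-cell is needed: \<open>W \<cdot> munit C\<close> is a cocone on
  the trivial graded monad, whose structure cells must be identities.\<close>

lemma w_unit:
  assumes m: "m \<in> MOb M"
  shows "(w m \<lhd> munit C) \<bullet> (W \<rhd> lunit (gobj A m)) = id2 D (W \<cdot> munit C)"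
proof -
  let ?v = "\<lambda>m. (w m \<lhd> munit C) \<bullet> (W \<rhd> lunit (gobj A m))"
  have "cocone (incl_obj M D (One D)) k (W \<cdot> munit C) ?v"
    unfolding cocone_def
  proof (intro conjI ballI, goal_cases)
    case 1
    show ?case by (simp add: hom_iff)
  next
    case (2 m)
    then show ?case by (simp add: cell_iff)
  next
    case (3 n)
    note n = 3
    have "lunit (gobj A (Mcod M n)) = (fcell (garr A n) \<lhd> munit C) \<bullet> lunit (gobj A (Mdom M n))"
      using monoidal_transformationD(10)[of "garr A n"] n by simp
    moreover have "(w (Mcod M n) \<lhd> munit C) \<bullet> (W \<rhd> fcell (garr A n) \<lhd> munit C) = w (Mdom M n) \<lhd> munit C"
      using arg_cong[OF W_eqs(1)[OF n], of "\<lambda>t. t \<lhd> munit C"] n by simp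
    note vcmp_extend[OF this]
    ultimately show ?case using n by simp
  next
    case (4 m l)
    note ml = 4
    have 1: "lunit (gobj A (m \<otimes>\<^bsub>M\<^esub> l)) = (fcell (gmult A m l) \<lhd> munit C) \<bullet> (f m \<rhd> lunit (gobj A l)) \<bullet> lunit (gobj A m)"
      using monoidal_transformationD(10)[of "gmult A m l"] ml by (simp add: lax_comp_def)
    have e: "(w (m \<otimes>\<^bsub>M\<^esub> l) \<lhd> munit C) \<bullet> (W \<rhd> fcell (gmult A m l) \<lhd> munit C) = (w l \<lhd> munit C) \<bullet> (w m \<lhd> (f l \<cdot> munit C))"
      using arg_cong[OF W_eqs(2)[OF ml], of "\<lambda>t. t \<lhd> munit C"] ml by simp
    have e2: "(w m \<lhd> (f l \<cdot> munit C)) \<bullet> ((W \<cdot> f m) \<rhd> lunit (gobj A l)) = (W \<rhd> lunit (gobj A l)) \<bullet> (w m \<lhd> munit C)"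
      by (rule exchange) (use ml in simp_all)
    show ?case using ml by (simp add: 1 vcmp_extend[OF e] vcmp_extend[OF e2])
  next
    case 5
    have 1: "lunit (gobj A (MI M)) = fcell (gunit A) \<lhd> munit C"
      using monoidal_transformationD(10)[of "gunit A"] by simp
    have e: "(w (MI M) \<lhd> munit C) \<bullet> (W \<rhd> fcell (gunit A) \<lhd> munit C) = id2 D (W \<cdot> munit C)"
      using arg_cong[OF W_eqs(3), of "\<lambda>t. t \<lhd> munit C"] by simp
    show ?case by (simp add: 1 e)
  qed
  from cocone_incl_One[OF this k_Obj m] show ?thesis .
qed

end

lemma (in strict_2cat) invertible_whisker:
  assumes t: "invertible_cell D t" and g: "g \<in> Arr D" 
  shows "trg D g = src D (vdom D t) \<Longrightarrow> invertible_cell D (t \<lhd> g)" "trg D (vdom D t) = src D g \<Longrightarrow> invertible_cell D (g \<rhd> t)"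
proof -
  obtain s where s [simp]: "s \<in> Cel D" "vdom D s = vcod D t" "vcod D s = vdom D t" and t' [simp]: "t \<in> Cel D"
    and e: "s \<bullet> t = id2 D (vdom D t)" "t \<bullet> s = id2 D (vcod D t)"
    using t by (auto simp: invertible_cell_def cell_iff)
  show "invertible_cell D (t \<lhd> g)" if [simp]: "trg D g = src D (vdom D t)"
    unfolding invertible_cell_def using whisker_right_vcmp[of t s g] whisker_right_vcmp[of s t g] g
    by (intro conjI bexI[of _ "s \<lhd> g"]) (simp_all add: e cell_iff del: whisker_right_vcmp)
  show "invertible_cell D (g \<rhd> t)" if [simp]: "trg D (vdom D t) = src D g"
    unfolding invertible_cell_def using whisker_left_vcmp[of t s g] whisker_left_vcmp[of s t g] g
    by (intro conjI bexI[of _ "g \<rhd> s"]) (simp_all add: e cell_iff del: whisker_left_vcmp)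
qed

section \<open>Descent of the associator and the unitors\<close>

context kleisli_mon
begin

abbreviation "x3 \<equiv> p \<cdot> Pr1 D (Prd D c c) c"
abbreviation "y3 \<equiv> q \<cdot> Pr1 D (Prd D c c) c"
abbreviation "z3 \<equiv> Pr2 D (Prd D c c) c"

definition "UA3 = gprod UA2 UA"
definition "W3 = \<langle>\<langle>W \<cdot> x3, W \<cdot> y3\<rangle>, W \<cdot> z3\<rangle>"
definition "w3 m = \<lblot>\<lblot>w m \<lhd> x3, w m \<lhd> y3\<rblot>, w m \<lhd> z3\<rblot>"

lemma UA3_graded: "graded_monad M D UA3"
  unfolding UA3_def by (rule gprod_graded[OF UA2_graded UA_graded])

lemma universal_W3: "universal_cocone UA3 (Prd D (Prd D k k) k) W3 w3"
proof -
  have U: "universal_cocone UA3 (Prd D (Prd D k k) k) (gpairW UA2 UA W2 W) (gpairw UA2 UA w2 w)"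
    unfolding UA3_def by (rule gprod_universal_cocone[OF UA2_graded UA_graded universal_W2 universal_W])
  have 1: "gpairW UA2 UA W2 W = W3" by (simp add: W2_def gpairW_def W3_def)
  have "gpairw UA2 UA w2 w m = w3 m" if "m \<in> MOb M" for m using that by (simp add: w2_def gpairw_def w3_def)
  then show ?thesis using universal_cocone_cong[OF UA3_graded U] by (simp add: 1)
qed

lemma UA3_sel [simp]: "m \<in> MOb M \<Longrightarrow> gobj UA3 m = \<langle>\<langle>f m \<cdot> x3, f m \<cdot> y3\<rangle>, f m \<cdot> z3\<rangle>" "gbase UA3 = Prd D (Prd D c c) c"
  by (simp_all add: UA3_def)

lemma W3_typing [simp]: "W3 \<in> Arr D" "src D W3 = Prd D (Prd D c c) c" "trg D W3 = Prd D (Prd D k k) k"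
  "m \<in> MOb M \<Longrightarrow> w3 m \<in> Cel D" "m \<in> MOb M \<Longrightarrow> vdom D (w3 m) = W3 \<cdot> \<langle>\<langle>f m \<cdot> x3, f m \<cdot> y3\<rangle>, f m \<cdot> z3\<rangle>"
  "m \<in> MOb M \<Longrightarrow> vcod D (w3 m) = W3"
  by (simp_all add: W3_def w3_def)

lemma k3_projs:
  assumes "triple_projs D k = (x, y, z)"
  shows "x \<in> Arr D" "y \<in> Arr D" "z \<in> Arr D"
    "src D x = Prd D (Prd D k k) k" "src D y = Prd D (Prd D k k) k" "src D z = Prd D (Prd D k k) k"
    "trg D x = k" "trg D y = k" "trg D z = k" "x \<cdot> W3 = W \<cdot> x3" "y \<cdot> W3 = W \<cdot> y3" "z \<cdot> W3 = W \<cdot> z3"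
    "m \<in> MOb M \<Longrightarrow> x \<rhd> w3 m = w m \<lhd> x3" "m \<in> MOb M \<Longrightarrow> y \<rhd> w3 m = w m \<lhd> y3"
    "m \<in> MOb M \<Longrightarrow> z \<rhd> w3 m = w m \<lhd> z3"
  using assms by (auto simp: triple_projs_def Let_def W3_def w3_def)

lemma \<phi>_assoc:
  assumes m: "m \<in> MOb M" and x: "x \<in> Arr D" "y \<in> Arr D" "z \<in> Arr D" "src D x = src D z" "src D y = src D z"
    "trg D x = c" "trg D y = c" "trg D z = c"
  shows "(f m \<rhd> assoc_at D C x y z) \<bullet> \<phi> m x (tens1 D C y z) \<bullet> tens2 D C (id2 D (f m \<cdot> x)) (\<phi> m y z) =
      \<phi> m (tens1 D C x y) z \<bullet> tens2 D C (\<phi> m x y) (id2 D (f m \<cdot> z)) \<bullet> assoc_at D C (f m \<cdot> x) (f m \<cdot> y) (f m \<cdot> z)"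
  by (rule lax_assoc_at[of "gobj A m", unfolded A_typing(3)[OF m] A_typing(4)[OF m]]) (use m x in simp_all)

lemma \<phi>_units:
  assumes m: "m \<in> MOb M" and x: "x \<in> Arr D" "src D x = X" "trg D x = c"
  shows "(f m \<rhd> (mlunit C \<lhd> x)) \<bullet> \<phi> m (unit_at D C X) x \<bullet> tens2 D C (lunit (gobj A m) \<lhd> bang D X) (id2 D (f m \<cdot> x)) = mlunit C \<lhd> (f m \<cdot> x)"
    "(f m \<rhd> (mrunit C \<lhd> x)) \<bullet> \<phi> m x (unit_at D C X) \<bullet> tens2 D C (id2 D (f m \<cdot> x)) (lunit (gobj A m) \<lhd> bang D X) = mrunit C \<lhd> (f m \<cdot> x)"
  by (rule lax_units_at[of "gobj A m", unfolded A_typing(3)[OF m] A_typing(4)[OF m]]; use m x in simp)+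

lemma tens2_w_right:
  assumes L: "kl_like L" and m: "m \<in> MOb M" and x: "x \<in> Arr D" "y \<in> Arr D" "z \<in> Arr D" "src D x = src D z" "src D y = src D z"
    "trg D x = c" "trg D y = c" "trg D z = c"
  shows "tens2 D L (w m \<lhd> x) (tens2 D L (w m \<lhd> y) (w m \<lhd> z)) = (w m \<lhd> tens1 D C x (tens1 D C y z)) \<bullet>
    (W \<rhd> \<phi> m x (tens1 D C y z)) \<bullet> (W \<rhd> tens2 D C (id2 D (f m \<cdot> x)) (\<phi> m y z))"
  using tens2_w_cells[OF L m, of x "tens1 D C y z" "id2 D (f m \<cdot> x)" "\<phi> m y z"] x m by (simp add: tens2_w[OF L m])

lemma tens2_w_left:
  assumes L: "kl_like L" and m: "m \<in> MOb M" and x: "x \<in> Arr D" "y \<in> Arr D" "z \<in> Arr D" "src D x = src D z" "src D y = src D z"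
    "trg D x = c" "trg D y = c" "trg D z = c"
  shows "tens2 D L (tens2 D L (w m \<lhd> x) (w m \<lhd> y)) (w m \<lhd> z) = (w m \<lhd> tens1 D C (tens1 D C x y) z) \<bullet>
    (W \<rhd> \<phi> m (tens1 D C x y) z) \<bullet> (W \<rhd> tens2 D C (\<phi> m x y) (id2 D (f m \<cdot> z)))"
  using tens2_w_cells[OF L m, of "tens1 D C x y" z "\<phi> m x y" "id2 D (f m \<cdot> z)"] x m by (simp add: tens2_w[OF L m])

text \<open>The cell to descend is the associator of \<open>C\<close> whiskered with
  \<open>W\<close>. Expanding the triple tensors of action cells by \<open>tens2_w_right\<close> and
  \<open>tens2_w_left\<close>, its compatibility with \<open>w3 m\<close> becomes the lax
  associativity of \<open>gobj A m\<close> whiskered with \<open>W\<close>, followed by one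
  exchange.\<close>

lemma assoc_exists:
  assumes L: "kl_like L" and xyz: "triple_projs D k = (x, y, z)"
  shows "\<exists>a \<in> Cel D. vdom D a = tens1 D L x (tens1 D L y z) \<and> vcod D a = tens1 D L (tens1 D L x y) z \<and>
    invertible_cell D a \<and> a \<lhd> W3 = W \<rhd> assoc_at D C x3 y3 z3"
proof -
  \<comment> \<open>Opaque names for the projections, so that the tensors and associators below are
    computed at arrows that have no inner structure.\<close>
  define x' y' z' where x': "x' = x3" and y': "y' = y3" and z': "z' = z3"
  have [simp]: "x' \<in> Arr D" "y' \<in> Arr D" "z' \<in> Arr D" "src D x' = Prd D (Prd D c c) c" "src D y' = Prd D (Prd D c c) c"
    "src D z' = Prd D (Prd D c c) c" "trg D x' = c" "trg D y' = c" "trg D z' = c"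
    by (simp_all add: x' y' z')
  note fold = x'[symmetric] y'[symmetric] z'[symmetric]
  note [simp] = k3_projs(1-12)[OF xyz, unfolded fold] and 2 = k3_projs(13-15)[OF xyz, unfolded fold]
  have proj: "x' \<cdot> \<langle>\<langle>f m \<cdot> x', f m \<cdot> y'\<rangle>, f m \<cdot> z'\<rangle> = f m \<cdot> x'" "y' \<cdot> \<langle>\<langle>f m \<cdot> x', f m \<cdot> y'\<rangle>, f m \<cdot> z'\<rangle> = f m \<cdot> y'"
    "z' \<cdot> \<langle>\<langle>f m \<cdot> x', f m \<cdot> y'\<rangle>, f m \<cdot> z'\<rangle> = f m \<cdot> z'" if "m \<in> MOb M" for m
    using that by (simp_all add: x' y' z')
  obtain a where a: "a \<in> Cel D" "vdom D a = tens1 D L x (tens1 D L y z)" "vcod D a = tens1 D L (tens1 D L x y) z"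
    "a \<lhd> W3 = W \<rhd> assoc_at D C x' y' z'"
  proof (rule universal_cocone_ext2[OF universal_W3, of "tens1 D L x (tens1 D L y z)" "tens1 D L (tens1 D L x y) z" "W \<rhd> assoc_at D C x' y' z'"])
    fix m assume m: "m \<in> MOb M"
    have r: "tens1 D L x (tens1 D L y z) \<rhd> w3 m = tens2 D L (w m \<lhd> x') (tens2 D L (w m \<lhd> y') (w m \<lhd> z'))"
      using m L by (simp add: tens1_hcmp 2)
    have l: "tens1 D L (tens1 D L x y) z \<rhd> w3 m = tens2 D L (tens2 D L (w m \<lhd> x') (w m \<lhd> y')) (w m \<lhd> z')"
      using m L by (simp add: tens1_hcmp 2)
    have a0: "(f m \<rhd> assoc_at D C x' y' z') \<bullet> \<phi> m x' (tens1 D C y' z') \<bullet> tens2 D C (id2 D (f m \<cdot> x')) (\<phi> m y' z') =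
      \<phi> m (tens1 D C x' y') z' \<bullet> tens2 D C (\<phi> m x' y') (id2 D (f m \<cdot> z')) \<bullet> assoc_at D C (f m \<cdot> x') (f m \<cdot> y') (f m \<cdot> z')"
      by (rule \<phi>_assoc[OF m]) simp_all
    have a1: "(W \<rhd> \<phi> m (tens1 D C x' y') z') \<bullet> (W \<rhd> tens2 D C (\<phi> m x' y') (id2 D (f m \<cdot> z'))) \<bullet> (W \<rhd> assoc_at D C (f m \<cdot> x') (f m \<cdot> y') (f m \<cdot> z')) =
      ((W \<cdot> f m) \<rhd> assoc_at D C x' y' z') \<bullet> (W \<rhd> \<phi> m x' (tens1 D C y' z')) \<bullet> (W \<rhd> tens2 D C (id2 D (f m \<cdot> x')) (\<phi> m y' z'))"
      using arg_cong[OF a0[symmetric], of "\<lambda>t. W \<rhd> t"] m by simp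
    have e: "(w m \<lhd> tens1 D C (tens1 D C x' y') z') \<bullet> ((W \<cdot> f m) \<rhd> assoc_at D C x' y' z') = 
      (W \<rhd> assoc_at D C x' y' z') \<bullet> (w m \<lhd> tens1 D C x' (tens1 D C y' z'))"
      by (rule exchange) (use m in simp_all)
    have tr: "tens2 D L (w m \<lhd> x') (tens2 D L (w m \<lhd> y') (w m \<lhd> z')) = (w m \<lhd> tens1 D C x' (tens1 D C y' z')) \<bullet>
        (W \<rhd> \<phi> m x' (tens1 D C y' z')) \<bullet> (W \<rhd> tens2 D C (id2 D (f m \<cdot> x')) (\<phi> m y' z'))"
      by (rule tens2_w_right[OF L m]) simp_all
    have tl: "tens2 D L (tens2 D L (w m \<lhd> x') (w m \<lhd> y')) (w m \<lhd> z') = (w m \<lhd> tens1 D C (tens1 D C x' y') z') \<bullet>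
        (W \<rhd> \<phi> m (tens1 D C x' y') z') \<bullet> (W \<rhd> tens2 D C (\<phi> m x' y') (id2 D (f m \<cdot> z')))"
      by (rule tens2_w_left[OF L m]) simp_all
    have s: "(W \<rhd> assoc_at D C x' y' z') \<lhd> gobj UA3 m = W \<rhd> assoc_at D C (f m \<cdot> x') (f m \<cdot> y') (f m \<cdot> z')"
      using m by (simp add: fold proj)
    show "(tens1 D L (tens1 D L x y) z \<rhd> w3 m) \<bullet> ((W \<rhd> assoc_at D C x' y' z') \<lhd> gobj UA3 m) =
       (W \<rhd> assoc_at D C x' y' z') \<bullet> (tens1 D L x (tens1 D L y z) \<rhd> w3 m)"
      unfolding r l s tr tl
      using m by (simp add: a1 vcmp_extend[OF e])
  qed (use L in simp_all)
  \<comment> \<open>Invertibility descends too: \<open>a \<lhd> W3\<close> is a whiskering of an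
    invertible cell.\<close>
  have "invertible_cell D (massoc C)" using A_typing(1) by (auto simp: monoidal_object_def Let_def triple_projs_def)
  then have "invertible_cell D (assoc_at D C x' y' z')"
    unfolding assoc_at_def by (rule invertible_whisker) (simp_all add: massoc_typing(4))
  then have "invertible_cell D (W \<rhd> assoc_at D C x' y' z')"
    by (rule invertible_whisker) simp_all
  then have "invertible_cell D a"
    using universal_cocone_invertible[OF UA3_graded universal_W3 a(1)] a L by simp
  with a show ?thesis unfolding x' y' z' by blast
qed

lemma unit_at_kl: "kl_like L \<Longrightarrow> X \<in> Obj D \<Longrightarrow> unit_at D L X = W \<cdot> unit_at D C X"
  by (simp add: unit_at_def)

text \<open>The unit at generalized elements is constant: it factors through \<open>One D\<close>,
  where every whiskered 2-cell becomes an identity.\<close>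

lemma unit_at_kl_hcmp:
  assumes L: "kl_like L" and t: "t \<in> Cel D" "trg D (vdom D t) = k" "src D (vdom D t) = X"
  shows "unit_at D L k \<rhd> t = id2 D (W \<cdot> unit_at D C X)"
proof -
  have [simp]: "X \<in> Obj D" using t by auto
  have 1: "bang D k \<rhd> t = id2 D (bang D X)" by (rule cell_One_eq) (use t in simp_all)
  have "unit_at D L k \<rhd> t = (W \<cdot> munit C) \<rhd> (bang D k \<rhd> t)" using L t by (simp add: unit_at_def)
  also have "\<dots> = id2 D (W \<cdot> unit_at D C X)" unfolding 1 by (simp add: unit_at_def)
  finally show ?thesis .
qed

lemma w_unit_at:
  assumes "m \<in> MOb M" "X \<in> Obj D"
  shows "(w m \<lhd> unit_at D C X) \<bullet> (W \<rhd> (lunit (gobj A m) \<lhd> bang D X)) = id2 D (W \<cdot> unit_at D C X)"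
  using arg_cong[OF w_unit[OF assms(1)], of "\<lambda>t. t \<lhd> bang D X"] assms by (simp add: unit_at_def)

text \<open>The cells to descend are the unitors of \<open>C\<close> whiskered with
  \<open>W\<close>. Their compatibility with \<open>w m\<close> is the lax unit axiom of
  \<open>gobj A m\<close> whiskered with \<open>W\<close>, up to one exchange.\<close>

lemma units_exist:
  assumes L: "kl_like L"
  shows "\<exists>l \<in> Cel D. vdom D l = tens1 D L (unit_at D L k) (id1 D k) \<and> vcod D l = id1 D k \<and> invertible_cell D l \<and> l \<lhd> W = W \<rhd> mlunit C"
    "\<exists>r \<in> Cel D. vdom D r = tens1 D L (id1 D k) (unit_at D L k) \<and> vcod D r = id1 D k \<and> invertible_cell D r \<and> r \<lhd> W = W \<rhd> mrunit C"
proof -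
  let ?u = "unit_at D C c"
  have ml: "invertible_cell D (W \<rhd> mlunit C)" "invertible_cell D (W \<rhd> mrunit C)"
    using A_typing(1) by (auto simp: monoidal_object_def Let_def triple_projs_def intro!: invertible_whisker)
  have W1: "tens1 D L (W \<cdot> ?u) W = W \<cdot> tens1 D C ?u (id1 D c)" "tens1 D L W (W \<cdot> ?u) = W \<cdot> tens1 D C (id1 D c) ?u"
    using tens1_W[OF L, of ?u "id1 D c"] tens1_W[OF L, of "id1 D c" ?u] by simp_all
  obtain l where l: "l \<in> Cel D" "vdom D l = tens1 D L (unit_at D L k) (id1 D k)" "vcod D l = id1 D k" "l \<lhd> W = W \<rhd> mlunit C"
  proof (rule universal_cocone_ext2[OF universal_W, of "tens1 D L (unit_at D L k) (id1 D k)" "id1 D k" "W \<rhd> mlunit C"])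
    fix m assume m: "m \<in> MOb M"
    have "tens1 D L (unit_at D L k) (id1 D k) \<rhd> w m = tens2 D L (id2 D (W \<cdot> ?u)) (w m)"
      using L m by (simp add: tens1_hcmp unit_at_kl_hcmp[OF L])
    \<comment> \<open>The constant unit argument is an identity; \<open>w_unit_at\<close> rewrites
      it as an action cell after the unit cell of \<open>gobj A m\<close>, the shape that
      \<open>tens2_w_cells\<close> requires.\<close>
    also have "\<dots> = tens2 D L ((w m \<lhd> ?u) \<bullet> (W \<rhd> (lunit (gobj A m) \<lhd> bang D c))) ((w m \<lhd> id1 D c) \<bullet> (W \<rhd> id2 D (f m)))"
      using m by (simp add: w_unit_at)
    also have "\<dots> = (w m \<lhd> tens1 D C ?u (id1 D c)) \<bullet> (W \<rhd> (\<phi> m ?u (id1 D c) \<bullet> tens2 D C (lunit (gobj A m) \<lhd> bang D c) (id2 D (f m))))"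
      by (rule tens2_w_cells[OF L m]) (use m in \<open>simp_all add: unit_at_def\<close>)
    finally have h: "tens1 D L (unit_at D L k) (id1 D k) \<rhd> w m =
      (w m \<lhd> tens1 D C ?u (id1 D c)) \<bullet> (W \<rhd> (\<phi> m ?u (id1 D c) \<bullet> tens2 D C (lunit (gobj A m) \<lhd> bang D c) (id2 D (f m))))" .
    have e: "(w m \<lhd> id1 D c) \<bullet> ((W \<cdot> f m) \<rhd> mlunit C) = (W \<rhd> mlunit C) \<bullet> (w m \<lhd> tens1 D C ?u (id1 D c))"
      by (rule exchange) (use m in simp_all)
    then have e': "(W \<rhd> mlunit C) \<bullet> (w m \<lhd> tens1 D C ?u (id1 D c)) = w m \<bullet> ((W \<cdot> f m) \<rhd> mlunit C)" using m by simp
    have u: "(f m \<rhd> mlunit C) \<bullet> \<phi> m ?u (id1 D c) \<bullet> tens2 D C (lunit (gobj A m) \<lhd> bang D c) (id2 D (f m)) = mlunit C \<lhd> f m"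
      using \<phi>_units(1)[OF m, of "id1 D c" c] m by simp
    have [simp]: "vcod D (tens2 D C (lunit (gobj A m) \<lhd> bang D c) (id2 D (f m))) = tens1 D C (f m \<cdot> ?u) (f m)"
      using m by (simp add: unit_at_def)
    have u': "((W \<cdot> f m) \<rhd> mlunit C) \<bullet> (W \<rhd> (\<phi> m ?u (id1 D c) \<bullet> tens2 D C (lunit (gobj A m) \<lhd> bang D c) (id2 D (f m)))) = W \<rhd> mlunit C \<lhd> f m"
      using arg_cong[OF u, of "\<lambda>t. W \<rhd> t"] m by simp
    have "(W \<rhd> mlunit C) \<bullet> (tens1 D L (unit_at D L k) (id1 D k) \<rhd> w m) = w m \<bullet> (W \<rhd> mlunit C \<lhd> f m)"
      unfolding h u'[symmetric] by (rule vcmp_extend[OF e', THEN trans]) (use m in simp_all)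
    then show "(id1 D k \<rhd> w m) \<bullet> ((W \<rhd> mlunit C) \<lhd> gobj UA m) = (W \<rhd> mlunit C) \<bullet> (tens1 D L (unit_at D L k) (id1 D k) \<rhd> w m)"
      using m by simp
  qed (use L in \<open>simp_all add: unit_at_kl W1\<close>)
  then have "invertible_cell D l" using universal_cocone_invertible[OF UA_graded universal_W l(1)] ml(1) L by simp
  with l show "\<exists>l \<in> Cel D. vdom D l = tens1 D L (unit_at D L k) (id1 D k) \<and> vcod D l = id1 D k \<and> invertible_cell D l \<and> l \<lhd> W = W \<rhd> mlunit C"
    by blast
  obtain r where r: "r \<in> Cel D" "vdom D r = tens1 D L (id1 D k) (unit_at D L k)" "vcod D r = id1 D k" "r \<lhd> W = W \<rhd> mrunit C"
  proof (rule universal_cocone_ext2[OF universal_W, of "tens1 D L (id1 D k) (unit_at D L k)" "id1 D k" "W \<rhd> mrunit C"])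
    fix m assume m: "m \<in> MOb M"
    have "tens1 D L (id1 D k) (unit_at D L k) \<rhd> w m = tens2 D L (w m) (id2 D (W \<cdot> ?u))"
      using L m by (simp add: tens1_hcmp unit_at_kl_hcmp[OF L])
    also have "\<dots> = tens2 D L ((w m \<lhd> id1 D c) \<bullet> (W \<rhd> id2 D (f m))) ((w m \<lhd> ?u) \<bullet> (W \<rhd> (lunit (gobj A m) \<lhd> bang D c)))"
      using m by (simp add: w_unit_at)
    also have "\<dots> = (w m \<lhd> tens1 D C (id1 D c) ?u) \<bullet> (W \<rhd> (\<phi> m (id1 D c) ?u \<bullet> tens2 D C (id2 D (f m)) (lunit (gobj A m) \<lhd> bang D c)))"
      by (rule tens2_w_cells[OF L m]) (use m in \<open>simp_all add: unit_at_def\<close>)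
    finally have h: "tens1 D L (id1 D k) (unit_at D L k) \<rhd> w m =
      (w m \<lhd> tens1 D C (id1 D c) ?u) \<bullet> (W \<rhd> (\<phi> m (id1 D c) ?u \<bullet> tens2 D C (id2 D (f m)) (lunit (gobj A m) \<lhd> bang D c)))" .
    have e: "(w m \<lhd> id1 D c) \<bullet> ((W \<cdot> f m) \<rhd> mrunit C) = (W \<rhd> mrunit C) \<bullet> (w m \<lhd> tens1 D C (id1 D c) ?u)"
      by (rule exchange) (use m in simp_all)
    then have e': "(W \<rhd> mrunit C) \<bullet> (w m \<lhd> tens1 D C (id1 D c) ?u) = w m \<bullet> ((W \<cdot> f m) \<rhd> mrunit C)" using m by simp
    have u: "(f m \<rhd> mrunit C) \<bullet> \<phi> m (id1 D c) ?u \<bullet> tens2 D C (id2 D (f m)) (lunit (gobj A m) \<lhd> bang D c) = mrunit C \<lhd> f m"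
      using \<phi>_units(2)[OF m, of "id1 D c" c] m by simp
    have [simp]: "vcod D (tens2 D C (id2 D (f m)) (lunit (gobj A m) \<lhd> bang D c)) = tens1 D C (f m) (f m \<cdot> ?u)"
      using m by (simp add: unit_at_def)
    have u': "((W \<cdot> f m) \<rhd> mrunit C) \<bullet> (W \<rhd> (\<phi> m (id1 D c) ?u \<bullet> tens2 D C (id2 D (f m)) (lunit (gobj A m) \<lhd> bang D c))) = W \<rhd> mrunit C \<lhd> f m"
      using arg_cong[OF u, of "\<lambda>t. W \<rhd> t"] m by simp
    have "(W \<rhd> mrunit C) \<bullet> (tens1 D L (id1 D k) (unit_at D L k) \<rhd> w m) = w m \<bullet> (W \<rhd> mrunit C \<lhd> f m)"
      unfolding h u'[symmetric] by (rule vcmp_extend[OF e', THEN trans]) (use m in simp_all)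
    then show "(id1 D k \<rhd> w m) \<bullet> ((W \<rhd> mrunit C) \<lhd> gobj UA m) = (W \<rhd> mrunit C) \<bullet> (tens1 D L (id1 D k) (unit_at D L k) \<rhd> w m)"
      using m by simp
  qed (use L in \<open>simp_all add: unit_at_kl W1\<close>)
  then have "invertible_cell D r" using universal_cocone_invertible[OF UA_graded universal_W r(1)] ml(2) L by simp
  with r show "\<exists>r \<in> Cel D. vdom D r = tens1 D L (id1 D k) (unit_at D L k) \<and> vcod D r = id1 D k \<and> invertible_cell D r \<and> r \<lhd> W = W \<rhd> mrunit C"
    by blast
qed

end

section \<open>The Kleisli object as a monoidal object\<close>

context kleisli_mon
begin

definition kl_data where
  "kl_data L \<longleftrightarrow> kl_like L \<and> assoc_typed L \<and> massoc L \<lhd> W3 = W \<rhd> assoc_at D C x3 y3 z3 \<and>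
     mlunit L \<in> cell D (tens1 D L (unit_at D L k) (id1 D k)) (id1 D k) \<and> mlunit L \<lhd> W = W \<rhd> mlunit C \<and>
     mrunit L \<in> cell D (tens1 D L (id1 D k) (unit_at D L k)) (id1 D k) \<and> mrunit L \<lhd> W = W \<rhd> mrunit C \<and>
     invertible_cell D (massoc L) \<and> invertible_cell D (mlunit L) \<and> invertible_cell D (mrunit L)"

lemma kl_data_exists: "\<exists>L. kl_data L"
proof -
  obtain x y z where xyz: "triple_projs D k = (x, y, z)" by (cases "triple_projs D k") auto
  obtain a where a: "a \<in> Cel D" "vdom D a = tens1 D L0 x (tens1 D L0 y z)" "vcod D a = tens1 D L0 (tens1 D L0 x y) z"
    "invertible_cell D a" "a \<lhd> W3 = W \<rhd> assoc_at D C x3 y3 z3" using assoc_exists[OF kl_like_L0 xyz] by blast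
  obtain l where l: "l \<in> Cel D" "vdom D l = tens1 D L0 (unit_at D L0 k) (id1 D k)" "vcod D l = id1 D k"
    "invertible_cell D l" "l \<lhd> W = W \<rhd> mlunit C" using units_exist(1)[OF kl_like_L0] by blast
  obtain r where r: "r \<in> Cel D" "vdom D r = tens1 D L0 (id1 D k) (unit_at D L0 k)" "vcod D r = id1 D k"
    "invertible_cell D r" "r \<lhd> W = W \<rhd> mrunit C" using units_exist(2)[OF kl_like_L0] by blast
  define L where "L = MonObj k T (W \<cdot> munit C) a l r"
  \<comment> \<open>Evaluation reads only the tensor and the unit, so the cells built over
    \<open>L0\<close> have the right type over \<open>L\<close>.\<close>
  have "tens1 D L0 g h = tens1 D L g h" for g h by (simp add: tens1_def L_def L0_def)
  moreover have "unit_at D L0 k = unit_at D L k" by (simp add: unit_at_def L_def L0_def)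
  moreover have "kl_like L" unfolding kl_like_def L_def by simp
  ultimately have "kl_data L" using a l r xyz by (simp add: kl_data_def cell_iff assoc_typed_def) (simp add: L_def)
  then show ?thesis by blast
qed

definition "kl = (SOME L. kl_data L)"

lemma kl_data: "kl_data kl"
  unfolding kl_def by (rule someI_ex[OF kl_data_exists])

lemma kl_basic [simp]: "kl_like kl" "assoc_typed kl" "tensor_object kl" "mobj kl = k" "munit kl = W \<cdot> munit C" 
  "mlunit kl \<in> Cel D" "vdom D (mlunit kl) = tens1 D kl (unit_at D kl k) (id1 D k)" "vcod D (mlunit kl) = id1 D k"
  "mrunit kl \<in> Cel D" "vdom D (mrunit kl) = tens1 D kl (id1 D k) (unit_at D kl k)" "vcod D (mrunit kl) = id1 D k"
  "mlunit kl \<lhd> W = W \<rhd> mlunit C" "mrunit kl \<lhd> W = W \<rhd> mrunit C"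
  using kl_data by (simp_all add: kl_data_def cell_iff)

lemma mtens_kl: "mtens kl = T"
  by (rule kl_like_mtens) simp

text \<open>By construction \<open>massoc kl \<lhd> W3\<close> is the associator of \<open>C\<close>
  under \<open>W\<close>; here it is evaluated at a tuple. With \<open>tens1_W\<close> and
  \<open>unit_W\<close> it reduces the axioms of \<open>kl\<close> to those of
  \<open>C\<close>.\<close>

lemma assoc_W [simp]:
  assumes "x \<in> Arr D" "y \<in> Arr D" "z \<in> Arr D" "src D x = src D z" "src D y = src D z" "trg D x = c" "trg D y = c" "trg D z = c"
  shows "assoc_at D kl (W \<cdot> x) (W \<cdot> y) (W \<cdot> z) = W \<rhd> assoc_at D C x y z"
proof -
  note [simp] = massoc_typing(1,4)[of kl]
  have 1: "W3 \<cdot> \<langle>\<langle>x, y\<rangle>, z\<rangle> = \<langle>\<langle>W \<cdot> x, W \<cdot> y\<rangle>, W \<cdot> z\<rangle>" using assms by (simp add: W3_def)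
  have "assoc_at D kl (W \<cdot> x) (W \<cdot> y) (W \<cdot> z) = massoc kl \<lhd> (W3 \<cdot> \<langle>\<langle>x, y\<rangle>, z\<rangle>)"
    unfolding 1 by (simp add: assoc_at_def)
  also have "\<dots> = (massoc kl \<lhd> W3) \<lhd> \<langle>\<langle>x, y\<rangle>, z\<rangle>" using assms by simp
  also have "\<dots> = (W \<rhd> assoc_at D C x3 y3 z3) \<lhd> \<langle>\<langle>x, y\<rangle>, z\<rangle>" using kl_data by (simp add: kl_data_def)
  also have "\<dots> = W \<rhd> assoc_at D C x y z" using assms by simp
  finally show ?thesis .
qed

text \<open>Instances of \<open>tens2_W\<close> in normal form, where
  \<open>W \<rhd> id2 D z\<close> has already become an identity 2-cell.\<close>

lemma tens2_W_id [simp]: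
  assumes "s \<in> Cel D" "z \<in> Arr D" "src D (vdom D s) = src D z" "trg D (vdom D s) = c" "trg D z = c"
  shows "tens2 D kl (W \<rhd> s) (id2 D (W \<cdot> z)) = W \<rhd> tens2 D C s (id2 D z)"
    "tens2 D kl (id2 D (W \<cdot> z)) (W \<rhd> s) = W \<rhd> tens2 D C (id2 D z) s"
proof -
  have "tens2 D kl (W \<rhd> s) (W \<rhd> id2 D z) = W \<rhd> tens2 D C s (id2 D z)" "tens2 D kl (W \<rhd> id2 D z) (W \<rhd> s) = W \<rhd> tens2 D C (id2 D z) s"
    by (rule tens2_W; use assms in simp)+
  then show "tens2 D kl (W \<rhd> s) (id2 D (W \<cdot> z)) = W \<rhd> tens2 D C s (id2 D z)"
    "tens2 D kl (id2 D (W \<cdot> z)) (W \<rhd> s) = W \<rhd> tens2 D C (id2 D z) s" using assms by simp_all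
qed

lemma unit_W: 
  assumes "x \<in> Arr D" "trg D x = c"
  shows "mlunit kl \<lhd> (W \<cdot> x) = W \<rhd> (mlunit C \<lhd> x)" "mrunit kl \<lhd> (W \<cdot> x) = W \<rhd> (mrunit C \<lhd> x)"
proof -
  have "mlunit kl \<lhd> (W \<cdot> x) = (mlunit kl \<lhd> W) \<lhd> x" using assms by (simp del: kl_basic(12))
  then show "mlunit kl \<lhd> (W \<cdot> x) = W \<rhd> (mlunit C \<lhd> x)" using assms by simp
  have "mrunit kl \<lhd> (W \<cdot> x) = (mrunit kl \<lhd> W) \<lhd> x" using assms by (simp del: kl_basic(13))
  then show "mrunit kl \<lhd> (W \<cdot> x) = W \<rhd> (mrunit C \<lhd> x)" using assms by simp
qed

text \<open>Whiskered with \<open>W2\<close>, both sides become the corresponding sides for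
  \<open>C\<close> whiskered with \<open>W\<close>, and whiskering with the universal
  \<open>W2\<close> is faithful.\<close>

lemma kl_triangle: "unit_triangle D kl"
proof -
  define x y where x: "x = Pr1 D k k" and y: "y = Pr2 D k k"
  define x' y' where x': "x' = p" and y': "y' = q"
  have [simp]: "x \<in> Arr D" "y \<in> Arr D" "src D x = Prd D k k" "src D y = Prd D k k" "trg D x = k" "trg D y = k"
    "x' \<in> Arr D" "y' \<in> Arr D" "src D x' = Prd D c c" "src D y' = Prd D c c" "trg D x' = c" "trg D y' = c"
    "x \<cdot> W2 = W \<cdot> x'" "y \<cdot> W2 = W \<cdot> y'"
    by (simp_all add: x y x' y' W2_def)
  note [simp] = unit_W unit_at_kl[of kl]
  have e: "tens2 D C (mrunit C \<lhd> x') (id2 D y') \<bullet> assoc_at D C x' (unit_at D C (Prd D c c)) y' = tens2 D C (id2 D x') (mlunit C \<lhd> y')"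
    by (rule triangle_at) simp_all
  have "tens2 D kl (mrunit kl \<lhd> x) (id2 D y) \<bullet> assoc_at D kl x (unit_at D kl (Prd D k k)) y = tens2 D kl (id2 D x) (mlunit kl \<lhd> y)"
  proof (rule universal_cocone_cancel2[OF universal_W2])
    show "(tens2 D kl (mrunit kl \<lhd> x) (id2 D y) \<bullet> assoc_at D kl x (unit_at D kl (Prd D k k)) y) \<lhd> W2 = tens2 D kl (id2 D x) (mlunit kl \<lhd> y) \<lhd> W2"
      using arg_cong[OF e, of "\<lambda>t. W \<rhd> t"] by simp
  qed simp_all
  then show ?thesis by (simp add: unit_triangle_def Let_def x y)
qed

definition "UA4 = gprod UA3 UA"
definition "W4 = gpairW UA3 UA W3 W"

lemma universal_W4: "universal_cocone UA4 (Prd D (Prd D (Prd D k k) k) k) W4 (gpairw UA3 UA w3 w)"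
  unfolding UA4_def W4_def by (rule gprod_universal_cocone[OF UA3_graded UA_graded universal_W3 universal_W])

text \<open>The same argument over the fourfold product, which is why universality of products of
  cocones is iterated up to \<open>W4\<close>.\<close>

lemma kl_pentagon: "pentagon D kl"
proof -
  obtain a b d e where q: "quadruple_projs D k = (a, b, d, e)" by (cases "quadruple_projs D k") auto
  obtain a' b' d' e' where q': "quadruple_projs D c = (a', b', d', e')" by (cases "quadruple_projs D c") auto
  have Q: "a = Pr1 D k k \<cdot> Pr1 D (Prd D k k) k \<cdot> Pr1 D (Prd D (Prd D k k) k) k" "b = Pr2 D k k \<cdot> Pr1 D (Prd D k k) k \<cdot> Pr1 D (Prd D (Prd D k k) k) k"
    "d = Pr2 D (Prd D k k) k \<cdot> Pr1 D (Prd D (Prd D k k) k) k" "e = Pr2 D (Prd D (Prd D k k) k) k"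
    using q by (auto simp: quadruple_projs_def triple_projs_def Let_def)
  have Q': "a' = x3 \<cdot> Pr1 D (Prd D (Prd D c c) c) c" "b' = y3 \<cdot> Pr1 D (Prd D (Prd D c c) c) c"
    "d' = z3 \<cdot> Pr1 D (Prd D (Prd D c c) c) c" "e' = Pr2 D (Prd D (Prd D c c) c) c"
    using q' by (auto simp: quadruple_projs_def triple_projs_def Let_def)
  let ?k4 = "Prd D (Prd D (Prd D k k) k) k" and ?c4 = "Prd D (Prd D (Prd D c c) c) c"
  have [simp]: "a \<in> Arr D" "b \<in> Arr D" "d \<in> Arr D" "e \<in> Arr D" "src D a = ?k4" "src D b = ?k4" "src D d = ?k4" "src D e = ?k4"
    "trg D a = k" "trg D b = k" "trg D d = k" "trg D e = k" by (simp_all add: Q)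
  have [simp]: "a' \<in> Arr D" "b' \<in> Arr D" "d' \<in> Arr D" "e' \<in> Arr D" "src D a' = ?c4" "src D b' = ?c4" "src D d' = ?c4" "src D e' = ?c4"
    "trg D a' = c" "trg D b' = c" "trg D d' = c" "trg D e' = c" by (simp_all add: Q')
  have W4: "W4 = \<langle>\<langle>\<langle>W \<cdot> a', W \<cdot> b'\<rangle>, W \<cdot> d'\<rangle>, W \<cdot> e'\<rangle>" by (simp add: W4_def gpairW_def W3_def Q')
  have [simp]: "W4 \<in> Arr D" "src D W4 = ?c4" "trg D W4 = ?k4" by (simp_all add: W4)
  have [simp]: "a \<cdot> W4 = W \<cdot> a'" "b \<cdot> W4 = W \<cdot> b'" "d \<cdot> W4 = W \<cdot> d'" "e \<cdot> W4 = W \<cdot> e'" by (simp_all add: W4 Q)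
  have P: "assoc_at D C (tens1 D C a' b') d' e' \<bullet> assoc_at D C a' b' (tens1 D C d' e') =
      tens2 D C (assoc_at D C a' b' d') (id2 D e') \<bullet> assoc_at D C a' (tens1 D C b' d') e'
        \<bullet> tens2 D C (id2 D a') (assoc_at D C b' d' e')"
    by (rule pentagon_at) simp_all
  have "assoc_at D kl (tens1 D kl a b) d e \<bullet> assoc_at D kl a b (tens1 D kl d e) =
      tens2 D kl (assoc_at D kl a b d) (id2 D e) \<bullet> assoc_at D kl a (tens1 D kl b d) e
        \<bullet> tens2 D kl (id2 D a) (assoc_at D kl b d e)" (is "?l = ?r")
  proof (rule universal_cocone_cancel2[OF universal_W4])
    show "?l \<lhd> W4 = ?r \<lhd> W4"
      using arg_cong[OF P, of "\<lambda>t. W \<rhd> t"] by simp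
  qed simp_all
  then show ?thesis by (simp add: pentagon_def q)
qed

lemma kl_monoidal [simp]: "monoidal_object D kl"
proof -
  have 1: "T \<in> hom D (Prd D k k) k" "W \<cdot> munit C \<in> hom D (One D) k" by (simp_all add: hom_iff)
  obtain x y z where xyz: "triple_projs D k = (x, y, z)" by (cases "triple_projs D k") auto
  have 2: "massoc kl \<in> cell D (tens1 D kl x (tens1 D kl y z)) (tens1 D kl (tens1 D kl x y) z)"
    using kl_basic(2) xyz by (simp add: assoc_typed_def)
  show ?thesis
    using kl_data 1 2 kl_pentagon kl_triangle unfolding monoidal_object_def kl_data_def Let_def kl_basic(4,5) mtens_kl xyz prod.case
    by (intro conjI) (simp_all add: xyz)
qed

end

section \<open>The universal property among monoidal objects\<close>

context kleisli_mon
begin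

text \<open>\<open>W\<close> as a strict morphism. Identities have the right type because
  \<open>T \<cdot> W2\<close> and \<open>munit kl\<close> are equal to \<open>W\<close> composed
  with the tensor and the unit of \<open>C\<close>.\<close>

definition "Wl = LaxMor C kl W (id2 D (W \<cdot> tens1 D C p q)) (id2 D (W \<cdot> munit C))"
definition "wl m = Framed (lax_comp D Wl (gobj A m)) Wl (w m)"

lemma Wl_sel [simp]: "lsrc Wl = C" "ltrg Wl = kl" "larr Wl = W" "lunit Wl = id2 D (W \<cdot> munit C)"
  "fdom (wl m) = lax_comp D Wl (gobj A m)" "fcod (wl m) = Wl" "fcell (wl m) = w m"
  by (simp_all add: Wl_def wl_def)

lemma Wl_typed [simp]: "lax_typed Wl"
  by (rule lax_typedI) (simp_all add: hom_iff cell_iff tens1_projs tensor_object_typing[of C] Wl_def)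

lemma Wl_lmult_at [simp]:
  assumes "x \<in> Arr D" "y \<in> Arr D" "src D x = src D y" "trg D x = c" "trg D y = c"
  shows "lmult_at D Wl x y = id2 D (W \<cdot> tens1 D C x y)"
  using assms by (simp add: lmult_at_def Wl_def)

text \<open>Instances of \<open>tens1_W\<close> in which \<open>W \<cdot> id1 D c\<close> has
  already been simplified to \<open>W\<close>.\<close>

lemma tens1_W_unit [simp]: 
  "tens1 D kl (W \<cdot> unit_at D C c) W = W \<cdot> tens1 D C (unit_at D C c) (id1 D c)"
  "tens1 D kl W (W \<cdot> unit_at D C c) = W \<cdot> tens1 D C (id1 D c) (unit_at D C c)"
  using tens1_W[of kl "unit_at D C c" "id1 D c"] tens1_W[of kl "id1 D c" "unit_at D C c"] by simp_all

lemma Wl_lax [simp]: "lax_monoidal D Wl"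
proof -
  have u: "munit C \<cdot> bang D c = unit_at D C c" by (simp add: unit_at_def)
  show ?thesis
    by (rule lax_monoidalI[OF Wl_typed]) (simp_all add: u)
qed

lemma lax_comp_Wl_lmult_at:
  assumes H: "lax_typed H" and "lsrc H = kl" "x \<in> Arr D" "y \<in> Arr D" "src D x = src D y" "trg D x = c" "trg D y = c"
  shows "lmult_at D (lax_comp D H Wl) x y = lmult_at D H (W \<cdot> x) (W \<cdot> y)"
proof -
  have "lmult_at D (lax_comp D H Wl) x y = (larr H \<rhd> lmult_at D Wl x y) \<bullet> lmult_at D H (larr Wl \<cdot> x) (larr Wl \<cdot> y)"
    by (rule lax_comp_lmult_at) (use assms in simp_all)
  then show ?thesis using assms lax_typing(3-5)[OF H] by simp
qed

lemma lax_comp_Wl_lunit: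
  assumes H: "lax_typed H" and "lsrc H = kl"
  shows "lunit (lax_comp D H Wl) = lunit H"
  using lax_typing(3-8)[OF H] assms(2) by (simp add: lax_comp_def)

text \<open>Compatibility with the multiplications is \<open>tens2_w\<close>, that is, the choice of
  \<open>T\<close>; compatibility with the units is \<open>w_unit\<close>. So the cocone lifts to
  \<open>Mon D\<close>.\<close>

lemma wl_monoidal [simp]:
  assumes m: "m \<in> MOb M"
  shows "monoidal_transformation D (wl m)"
proof (rule monoidal_transformationI, unfold Wl_sel lax_comp_sel)
  show "lax_monoidal D (lax_comp D Wl (gobj A m))" by (rule lax_comp_lax) (use m in simp_all)
  fix x y assume "x \<in> Arr D" "y \<in> Arr D" "src D x = src D y" "trg D x = mobj (lsrc (gobj A m))" "trg D y = mobj (lsrc (gobj A m))"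
  then have [simp]: "x \<in> Arr D" "y \<in> Arr D" "src D x = src D y" "trg D x = c" "trg D y = c" using m by simp_all
  have 1: "lmult_at D (lax_comp D Wl (gobj A m)) x y = (larr Wl \<rhd> \<phi> m x y) \<bullet> lmult_at D Wl (f m \<cdot> x) (f m \<cdot> y)"
    by (rule lax_comp_lmult_at) (use m in simp_all)
  have 2: "tens2 D kl (w m \<lhd> x) (w m \<lhd> y) = (w m \<lhd> tens1 D C x y) \<bullet> (W \<rhd> \<phi> m x y)"
    by (rule tens2_w) (use m in simp_all)
  show "lmult_at D Wl x y \<bullet> tens2 D kl (w m \<lhd> x) (w m \<lhd> y) =
    (w m \<lhd> tens1 D (lsrc (gobj A m)) x y) \<bullet> lmult_at D (lax_comp D Wl (gobj A m)) x y"
    using m by (simp add: 1 2)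
next
  show "id2 D (W \<cdot> munit C) = (w m \<lhd> munit (lsrc (gobj A m))) \<bullet> lunit (lax_comp D Wl (gobj A m))"
    using m w_unit[OF m] by (simp add: lax_comp_def)
qed (use m in \<open>simp_all add: cell_iff\<close>)

lemma Mon_cocone: "graded.cocone (Mon D) M A kl Wl wl"
proof -
  interpret mon: graded "Mon D" M by (rule graded_Mon)
  show ?thesis
    unfolding mon.cocone_def
  proof (intro conjI ballI, goal_cases)
    case (3 n)
    then show ?case using W_eqs(1)[OF 3] by (intro framed.expand) simp
  next
    case (4 m l)
    then show ?case using W_eqs(2)[OF 4] by (intro framed.expand) (simp add: lax_comp_assoc)
  next
    case 5
    show ?case using W_eqs(3) lax_comp_id(2)[OF Wl_lax] by (intro framed.expand) simp
  qed (simp_all add: hom_def cell_def)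
qed

text \<open>The multiplication of \<open>V\<close> descends along \<open>W2\<close>; its unit cell
  is reused, since \<open>h \<cdot> munit kl\<close> equals \<open>larr V \<cdot> munit C\<close>.
  The axioms of \<open>H\<close>, whiskered with \<open>W3\<close> or with \<open>W\<close>, are
  those of \<open>V\<close>.\<close>

lemma descend_lax:
  assumes V: "lax_monoidal D V" and Vsrc [simp]: "lsrc V = C" and Vtrg [simp]: "ltrg V = X"
    and u: "\<And>m. m \<in> MOb M \<Longrightarrow> monoidal_transformation D (u m)" "\<And>m. m \<in> MOb M \<Longrightarrow> fdom (u m) = lax_comp D V (gobj A m)"
      "\<And>m. m \<in> MOb M \<Longrightarrow> fcod (u m) = V"
    and h [simp]: "h \<in> Arr D" "src D h = k" "trg D h = mobj X" and hW: "h \<cdot> W = larr V" and hw: "\<And>m. m \<in> MOb M \<Longrightarrow> h \<rhd> w m = fcell (u m)"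
  shows "\<exists>H. lax_monoidal D H \<and> lsrc H = kl \<and> ltrg H = X \<and> larr H = h \<and> lax_comp D H Wl = V"
proof -
  have TV [simp]: "lax_typed V" using V by simp
  define v where v: "v = larr V"
  note [simp] = lax_typing[OF TV, unfolded Vsrc Vtrg v[symmetric]] v[symmetric]
  have X [simp]: "monoidal_object D X" using lax_typing(2)[OF TV] by simp
  note [simp] = monoidal_typing[OF X]
  have hv [simp]: "h \<cdot> W = v" using hW by simp
  have hW' [simp]: "h \<cdot> (W \<cdot> x) = v \<cdot> x" if "x \<in> Arr D" "trg D x = c" for x
    using that cmp_assoc'[of x W h] by simp
  define r where r: "r m = fcell (u m)" for m
  have r_typ [simp]: "r m \<in> Cel D" "vdom D (r m) = v \<cdot> f m" "vcod D (r m) = v" if "m \<in> MOb M" for m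
    using monoidal_transformationD(7-9)[OF u(1)[OF that]] u(2,3)[OF that] by (simp_all add: r)
  have hwx: "h \<rhd> (w m \<lhd> x) = r m \<lhd> x" if "m \<in> MOb M" "x \<in> Arr D" "trg D x = c" for m x
    using that hcmp_assoc'[of "id2 D x" "w m" "id2 D h"] hw[OF that(1)] by (simp add: r)
  have \<mu>_typ [simp]: "lmult_at D V x y \<in> Cel D" "vdom D (lmult_at D V x y) = tens1 D X (v \<cdot> x) (v \<cdot> y)"
     "vcod D (lmult_at D V x y) = v \<cdot> tens1 D C x y" "g \<in> Arr D \<Longrightarrow> trg D g = src D y \<Longrightarrow> lmult_at D V x y \<lhd> g = lmult_at D V (x \<cdot> g) (y \<cdot> g)"
     if "x \<in> Arr D" "y \<in> Arr D" "src D x = src D y" "trg D x = c" "trg D y = c" for x y g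
    using that by simp_all
  define pk qk where pk: "pk = Pr1 D k k" and qk: "qk = Pr2 D k k"
  have [simp]: "pk \<in> Arr D" "qk \<in> Arr D" "src D pk = Prd D k k" "src D qk = Prd D k k" "trg D pk = k" "trg D qk = k"
    "pk \<cdot> W2 = W \<cdot> p" "qk \<cdot> W2 = W \<cdot> q"
    by (simp_all add: pk qk W2_def)
  have pw2: "(h \<cdot> pk) \<rhd> w2 m = r m \<lhd> p" "(h \<cdot> qk) \<rhd> w2 m = r m \<lhd> q" if "m \<in> MOb M" for m
    using that by (simp_all add: pk qk w2_def hwx)
  \<comment> \<open>After \<open>T \<rhd> w2 m\<close> is expanded, the descent condition is the
    monoidality of \<open>u m\<close> at the two projections.\<close>
  obtain t where t [simp]: "t \<in> Cel D" "vdom D t = tens1 D X (h \<cdot> pk) (h \<cdot> qk)" "vcod D t = h \<cdot> T" and tW: "t \<lhd> W2 = lmult_at D V p q"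
  proof (rule universal_cocone_ext2[OF universal_W2, of "tens1 D X (h \<cdot> pk) (h \<cdot> qk)" "h \<cdot> T" "lmult_at D V p q"])
    have TW2: "T \<cdot> W2 = W \<cdot> tens1 D C p q" using T_props by simp
    show "vcod D (lmult_at D V p q) = (h \<cdot> T) \<cdot> W2" by (simp add: TW2)
    fix m assume m: "m \<in> MOb M"
    have Tw: "T \<rhd> w2 m = (w m \<lhd> tens1 D C p q) \<bullet> (W \<rhd> \<phi> m p q)" using T_props m by blast
    have "(h \<cdot> T) \<rhd> w2 m = h \<rhd> (T \<rhd> w2 m)" using m by simp
    also have "\<dots> = (r m \<lhd> tens1 D C p q) \<bullet> (v \<rhd> \<phi> m p q)" unfolding Tw using m by (simp add: hwx hv)
    finally have l: "(h \<cdot> T) \<rhd> w2 m = (r m \<lhd> tens1 D C p q) \<bullet> (v \<rhd> \<phi> m p q)" .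
    have rr: "tens1 D X (h \<cdot> pk) (h \<cdot> qk) \<rhd> w2 m = tens2 D X (r m \<lhd> p) (r m \<lhd> q)"
      using m by (simp add: tens1_hcmp pw2)
    have c1: "lmult_at D (lax_comp D V (gobj A m)) p q = (larr V \<rhd> \<phi> m p q) \<bullet> lmult_at D V (f m \<cdot> p) (f m \<cdot> q)"
      by (rule lax_comp_lmult_at) (use m in simp_all)
    have n: "lmult_at D V p q \<bullet> tens2 D X (r m \<lhd> p) (r m \<lhd> q) = (r m \<lhd> tens1 D C p q) \<bullet> (v \<rhd> \<phi> m p q) \<bullet> lmult_at D V (f m \<cdot> p) (f m \<cdot> q)"
      using monoidal_transformation_at[OF u(1)[OF m], of p q] m by (simp add: u(2,3) r c1)
    show "((h \<cdot> T) \<rhd> w2 m) \<bullet> (lmult_at D V p q \<lhd> gobj UA2 m) = lmult_at D V p q \<bullet> (tens1 D X (h \<cdot> pk) (h \<cdot> qk) \<rhd> w2 m)"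
      unfolding l rr n using m by simp
  qed simp_all
  define H where H: "H = LaxMor kl X h t (lunit V)"
  have Hsel [simp]: "lsrc H = kl" "ltrg H = X" "larr H = h" "lunit H = lunit V" by (simp_all add: H)
  have TH [simp]: "lax_typed H"
    by (rule lax_typedI) (simp_all add: hom_iff cell_iff, simp add: H mtens_kl pk qk)
  have HW: "lmult_at D H (W \<cdot> x) (W \<cdot> y) = lmult_at D V x y"
    if "x \<in> Arr D" "y \<in> Arr D" "src D x = src D y" "trg D x = c" "trg D y = c" for x y
  proof -
    have 1: "\<langle>W \<cdot> x, W \<cdot> y\<rangle> = W2 \<cdot> \<langle>x, y\<rangle>" using that by (simp add: W2_def)
    have "lmult_at D H (W \<cdot> x) (W \<cdot> y) = t \<lhd> (W2 \<cdot> \<langle>x, y\<rangle>)" unfolding lmult_at_def 1 by (simp add: H)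
    also have "\<dots> = (t \<lhd> W2) \<lhd> \<langle>x, y\<rangle>" using that by simp
    also have "\<dots> = lmult_at D V x y" unfolding tW using that by simp
    finally show ?thesis .
  qed
  have H_typ: "lmult_at D H x y \<in> Cel D" "vdom D (lmult_at D H x y) = tens1 D X (h \<cdot> x) (h \<cdot> y)"
     "vcod D (lmult_at D H x y) = h \<cdot> tens1 D kl x y" "g \<in> Arr D \<Longrightarrow> trg D g = src D y \<Longrightarrow> lmult_at D H x y \<lhd> g = lmult_at D H (x \<cdot> g) (y \<cdot> g)"
     if "x \<in> Arr D" "y \<in> Arr D" "src D x = src D y" "trg D x = k" "trg D y = k" for x y g
    using that lmult_at_typing[OF TH, of x y] lmult_at_whisker[OF TH, of x y g] by simp_all
  note [simp] = H_typ
  have "lax_monoidal D H"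
  proof (rule lax_monoidalI[OF TH], unfold Hsel kl_basic(4))
    fix x y z assume [simp]: "x \<in> Arr D" "y \<in> Arr D" "z \<in> Arr D" "src D x = Prd D (Prd D k k) k" "src D y = Prd D (Prd D k k) k"
      "src D z = Prd D (Prd D k k) k" "trg D x = k" "trg D y = k" "trg D z = k" and xyz: "triple_projs D k = (x, y, z)"
    define x' y' z' where x': "x' = x3" and y': "y' = y3" and z': "z' = z3"
    have [simp]: "x' \<in> Arr D" "y' \<in> Arr D" "z' \<in> Arr D" "src D x' = Prd D (Prd D c c) c" "src D y' = Prd D (Prd D c c) c"
      "src D z' = Prd D (Prd D c c) c" "trg D x' = c" "trg D y' = c" "trg D z' = c"
      by (simp_all add: x' y' z')
    have [simp]: "x \<cdot> W3 = W \<cdot> x'" "y \<cdot> W3 = W \<cdot> y'" "z \<cdot> W3 = W \<cdot> z'"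
      using k3_projs(10-12)[OF xyz] by (simp_all add: x' y' z')
    have e: "(v \<rhd> assoc_at D C x' y' z') \<bullet> lmult_at D V x' (tens1 D C y' z') \<bullet> tens2 D X (id2 D (v \<cdot> x')) (lmult_at D V y' z') =
      lmult_at D V (tens1 D C x' y') z' \<bullet> tens2 D X (lmult_at D V x' y') (id2 D (v \<cdot> z')) \<bullet> assoc_at D X (v \<cdot> x') (v \<cdot> y') (v \<cdot> z')"
      by (rule lax_assoc_at[OF V, unfolded Vsrc Vtrg v[symmetric]]) simp_all
    show "(h \<rhd> assoc_at D kl x y z) \<bullet> lmult_at D H x (tens1 D kl y z) \<bullet> tens2 D X (id2 D (h \<cdot> x)) (lmult_at D H y z) =
      lmult_at D H (tens1 D kl x y) z \<bullet> tens2 D X (lmult_at D H x y) (id2 D (h \<cdot> z)) \<bullet> assoc_at D X (h \<cdot> x) (h \<cdot> y) (h \<cdot> z)"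
      (is "?l = ?r")
    proof (rule universal_cocone_cancel2[OF universal_W3])
      show "?l \<lhd> W3 = ?r \<lhd> W3" using e by (simp add: HW hv)
    qed simp_all
  next
    have HWu: "lmult_at D H (W \<cdot> unit_at D C c) W = lmult_at D V (unit_at D C c) (id1 D c)"
      "lmult_at D H W (W \<cdot> unit_at D C c) = lmult_at D V (id1 D c) (unit_at D C c)"
      using HW[of "unit_at D C c" "id1 D c"] HW[of "id1 D c" "unit_at D C c"] by simp_all
    have b: "h \<cdot> unit_at D kl k = h \<cdot> (W \<cdot> munit C) \<cdot> bang D k" "munit X \<cdot> bang D k = unit_at D X k" 
       "v \<cdot> munit C \<cdot> bang D c = v \<cdot> unit_at D C c" "v \<cdot> munit C \<cdot> bang D k = h \<cdot> unit_at D kl k"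
       "munit X \<cdot> bang D c = unit_at D X c"
      by (simp_all add: unit_at_def)
    note [simp] = unit_at_kl[of kl]
    have "(v \<rhd> (mlunit C \<lhd> id1 D c)) \<bullet> lmult_at D V (unit_at D C c) (id1 D c) \<bullet> tens2 D X (lunit V \<lhd> bang D c) (id2 D (v \<cdot> id1 D c)) = mlunit X \<lhd> (v \<cdot> id1 D c)"
      by (rule lax_units_at(1)[OF V, unfolded Vsrc Vtrg v[symmetric]]) simp_all
    then have e: "(v \<rhd> mlunit C) \<bullet> lmult_at D V (unit_at D C c) (id1 D c) \<bullet> tens2 D X (lunit V \<lhd> bang D c) (id2 D v) = mlunit X \<lhd> v" by simp
    show "(h \<rhd> mlunit kl) \<bullet> lmult_at D H (unit_at D kl k) (id1 D k) \<bullet> tens2 D X (lunit V \<lhd> bang D k) (id2 D h) = mlunit X \<lhd> h"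
      (is "?l = ?r")
    proof (rule universal_cocone_cancel2[OF universal_W])
      show "?l \<lhd> W = ?r \<lhd> W" using e by (simp add: HWu hv b)
    qed (simp_all add: b)
    have "(v \<rhd> (mrunit C \<lhd> id1 D c)) \<bullet> lmult_at D V (id1 D c) (unit_at D C c) \<bullet> tens2 D X (id2 D (v \<cdot> id1 D c)) (lunit V \<lhd> bang D c) = mrunit X \<lhd> (v \<cdot> id1 D c)"
      by (rule lax_units_at(2)[OF V, unfolded Vsrc Vtrg v[symmetric]]) simp_all
    then have e: "(v \<rhd> mrunit C) \<bullet> lmult_at D V (id1 D c) (unit_at D C c) \<bullet> tens2 D X (id2 D v) (lunit V \<lhd> bang D c) = mrunit X \<lhd> v" by simp
    show "(h \<rhd> mrunit kl) \<bullet> lmult_at D H (id1 D k) (unit_at D kl k) \<bullet> tens2 D X (id2 D h) (lunit V \<lhd> bang D k) = mrunit X \<lhd> h"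
      (is "?l = ?r")
    proof (rule universal_cocone_cancel2[OF universal_W])
      show "?l \<lhd> W = ?r \<lhd> W" using e by (simp add: HWu hv b)
    qed (simp_all add: b)
  qed
  moreover have "lax_comp D H Wl = V"
  proof (rule laxmor_eqI)
    show "lax_typed (lax_comp D H Wl)" by (rule lax_comp_typed) simp_all
    show "lmult_at D (lax_comp D H Wl) x y = lmult_at D V x y"
      if "x \<in> Arr D" "y \<in> Arr D" "src D x = src D y" "trg D x = mobj (lsrc (lax_comp D H Wl))" "trg D y = mobj (lsrc (lax_comp D H Wl))" for x y
      using that HW by (simp add: lax_comp_Wl_lmult_at)
    show "lunit (lax_comp D H Wl) = lunit V" using lax_comp_Wl_lunit[OF TH] by simp
  qed (simp_all add: hv)
  ultimately show ?thesis by (intro exI[of _ H]) simp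
qed

end

lemma Mon_forget_sel: "on0 Mon_forget = mobj" "on1 Mon_forget = larr" "on2 Mon_forget = fcell"
  by (simp_all add: Mon_forget_def)

section \<open>Cancellation and 2-cells among monoidal objects\<close>

context kleisli_mon
begin

lemma lmult_W2:
  assumes H: "lax_typed H" and [simp]: "lsrc H = kl"
  shows "lmult H \<lhd> W2 = lmult_at D H (W \<cdot> p) (W \<cdot> q)"
  by (simp add: lmult_at_def W2_def)

text \<open>The underlying 1-cells agree by cancellation along \<open>W\<close>, the multiplications
  by cancellation along \<open>W2\<close>, and the unit cells at once because composition with
  \<open>Wl\<close> leaves them unchanged.\<close>

lemma Mon_cancel1:
  assumes H: "lax_monoidal D H" and H': "lax_monoidal D H'" and [simp]: "lsrc H = kl" "lsrc H' = kl" "ltrg H = ltrg H'"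
    and e: "lax_comp D H Wl = lax_comp D H' Wl" and w: "\<And>m. m \<in> MOb M \<Longrightarrow> larr H \<rhd> w m = larr H' \<rhd> w m"
  shows "H = H'"
proof -
  have T [simp]: "lax_typed H" "lax_typed H'" using H H' by simp_all
  note [simp] = lax_typing(3-5)[OF T(1)] lax_typing(3-5)[OF T(2)] lax_typing(9-11)[OF T(1)] lax_typing(9-11)[OF T(2)]
  have 1: "larr H = larr H'"
    by (rule universal_cocone_cancel1[OF universal_W]) (use arg_cong[OF e, of larr] w in simp_all)
  have "lmult H = lmult H'"
  proof (rule universal_cocone_cancel2[OF universal_W2])
    have "lmult_at D H (W \<cdot> p) (W \<cdot> q) = lmult_at D (lax_comp D H Wl) p q" by (rule lax_comp_Wl_lmult_at[symmetric]) simp_all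
    also have "\<dots> = lmult_at D H' (W \<cdot> p) (W \<cdot> q)" unfolding e by (rule lax_comp_Wl_lmult_at) simp_all
    finally show "lmult H \<lhd> W2 = lmult H' \<lhd> W2" by (simp add: lmult_W2)
    have "ltrg H = ltrg H'" by simp
    have "monoidal_object D (ltrg H')" using lax_typing(2)[OF T(2)] .
    then show "src D (vdom D (lmult H)) = Prd D k k" by (simp add: 1)
  qed (simp_all add: 1)
  moreover have "lunit H = lunit H'" using lax_comp_Wl_lunit[OF T(1)] lax_comp_Wl_lunit[OF T(2)] e by simp
  ultimately show ?thesis by (intro laxmor.expand) (simp add: 1)
qed

text \<open>Only the underlying 2-cell is descended. Its multiplicativity is an equation tested
  along \<open>W2\<close>, where it becomes that of \<open>S\<close>; its unit condition is that of
  \<open>S\<close>, since \<open>munit kl\<close> factors through \<open>W\<close>.\<close>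

lemma Mon_ext2:
  assumes H: "lax_monoidal D H" and H': "lax_monoidal D H'" and sel: "lsrc H = kl" "lsrc H' = kl" "ltrg H = X" "ltrg H' = X"
    and S: "monoidal_transformation D S" "fdom S = lax_comp D H Wl" "fcod S = lax_comp D H' Wl"
    and comp: "\<And>m. m \<in> MOb M \<Longrightarrow> (larr H' \<rhd> w m) \<bullet> (fcell S \<lhd> f m) = fcell S \<bullet> (larr H \<rhd> w m)"
  shows "\<exists>t. monoidal_transformation D (Framed H H' t) \<and> t \<lhd> W = fcell S"
proof -
  have T [simp]: "lax_typed H" "lax_typed H'" using H H' by simp_all
  define h h' s where h: "h = larr H" and h': "h' = larr H'" and s: "s = fcell S"
  note fold = h[symmetric] h'[symmetric] s[symmetric]
  note [simp] = sel h[symmetric] h'[symmetric] lax_typing(3-5)[OF T(1), unfolded fold sel] lax_typing(3-5)[OF T(2), unfolded fold sel]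
  have X [simp]: "monoidal_object D X" using lax_typing(2)[OF T(1)] by simp
  have s_typ [simp]: "s \<in> Cel D" "vdom D s = h \<cdot> W" "vcod D s = h' \<cdot> W"
    using monoidal_transformationD(7-9)[OF S(1)] S(2,3) by (simp_all add: s)
  obtain t where t [simp]: "t \<in> Cel D" "vdom D t = h" "vcod D t = h'" and tW: "t \<lhd> W = s"
    by (rule universal_cocone_ext2[OF universal_W, of h h' s]) (use comp in \<open>simp_all add: fold\<close>)
  have tWx: "t \<lhd> (W \<cdot> x) = s \<lhd> x" if "x \<in> Arr D" "trg D x = c" for x
    using that hcmp_assoc'[of "id2 D x" "id2 D W" t] by (simp add: tW)
  have "monoidal_transformation D (Framed H H' t)"
  proof (rule monoidal_transformationI, unfold framed.sel)
    fix x y assume xy: "x \<in> Arr D" "y \<in> Arr D" "src D x = src D y" "trg D x = mobj (lsrc H)" "trg D y = mobj (lsrc H)"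
      and xy': "src D y = Prd D (mobj (lsrc H)) (mobj (lsrc H))"
      "x = Pr1 D (mobj (lsrc H)) (mobj (lsrc H))" "y = Pr2 D (mobj (lsrc H)) (mobj (lsrc H))"
    have [simp]: "x \<in> Arr D" "y \<in> Arr D" "src D x = Prd D k k" "src D y = Prd D k k" "trg D x = k" "trg D y = k" using xy xy'(1) by simp_all
    have [simp]: "x \<cdot> W2 = W \<cdot> p" "y \<cdot> W2 = W \<cdot> q" using xy'(2,3) by (simp_all add: W2_def)
    have [simp]: "lmult_at D H x y \<in> Cel D" "vdom D (lmult_at D H x y) = tens1 D X (h \<cdot> x) (h \<cdot> y)"
      "vcod D (lmult_at D H x y) = h \<cdot> tens1 D kl x y" "lmult_at D H x y \<lhd> W2 = lmult_at D H (W \<cdot> p) (W \<cdot> q)"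
      "lmult_at D H' x y \<in> Cel D" "vdom D (lmult_at D H' x y) = tens1 D X (h' \<cdot> x) (h' \<cdot> y)"
      "vcod D (lmult_at D H' x y) = h' \<cdot> tens1 D kl x y" "lmult_at D H' x y \<lhd> W2 = lmult_at D H' (W \<cdot> p) (W \<cdot> q)"
      by simp_all
    have c1: "lmult_at D (lax_comp D H Wl) p q = lmult_at D H (W \<cdot> p) (W \<cdot> q)"
      "lmult_at D (lax_comp D H' Wl) p q = lmult_at D H' (W \<cdot> p) (W \<cdot> q)"
      by (rule lax_comp_Wl_lmult_at; simp)+
    have e: "lmult_at D H' (W \<cdot> p) (W \<cdot> q) \<bullet> tens2 D X (s \<lhd> p) (s \<lhd> q) = (s \<lhd> tens1 D C p q) \<bullet> lmult_at D H (W \<cdot> p) (W \<cdot> q)"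
      using monoidal_transformation_at[OF S(1), of p q] by (simp add: S(2,3) fold c1)
    have "lmult_at D H' x y \<bullet> tens2 D X (t \<lhd> x) (t \<lhd> y) = (t \<lhd> tens1 D kl x y) \<bullet> lmult_at D H x y" (is "?l = ?r")
    proof (rule universal_cocone_cancel2[OF universal_W2])
      show "?l \<lhd> W2 = ?r \<lhd> W2" using e by (simp add: tWx)
    qed simp_all
    then show "lmult_at D H' x y \<bullet> tens2 D (ltrg H) (t \<lhd> x) (t \<lhd> y) = (t \<lhd> tens1 D (lsrc H) x y) \<bullet> lmult_at D H x y" by simp
  next
    have "lunit H' = (s \<lhd> munit C) \<bullet> lunit H"
      using monoidal_transformationD(10)[OF S(1)] lax_comp_Wl_lunit[OF T(1)] lax_comp_Wl_lunit[OF T(2)] by (simp add: S(2,3) fold)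
    then show "lunit H' = (t \<lhd> munit (lsrc H)) \<bullet> lunit H" by (simp add: tWx)
  qed (simp_all add: H H' cell_iff)
  then show ?thesis using tW by (auto simp: s)
qed

lemma Mon_universal: "graded.universal_cocone (Mon D) M A kl Wl wl"
proof -
  interpret mon: graded "Mon D" M by (rule graded_Mon)
  show ?thesis
    unfolding mon.universal_cocone_def
  proof (intro conjI allI ballI impI Mon_cocone)
    show "kl \<in> Obj (Mon D)" by simp
  next
    fix X V u assume X: "X \<in> Obj (Mon D)" and cc: "mon.cocone A X V u"
    have V: "lax_monoidal D V" "lsrc V = C" "ltrg V = X"
      using mon.cocone_typing(1-3)[OF cc] by simp_all
    have TV: "lax_typed V" using V(1) by simp
    note [simp] = V lax_typing(3-5)[OF TV, unfolded V]
    have u [simp]: "monoidal_transformation D (u m)" "fdom (u m) = lax_comp D V (gobj A m)" "fcod (u m) = V" if "m \<in> MOb M" for m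
      using mon.cocone_typing(4-6)[OF cc that] by simp_all
    have u2 [simp]: "fcell (u m) \<in> Cel D" "vdom D (fcell (u m)) = larr V \<cdot> f m" "vcod D (fcell (u m)) = larr V" if "m \<in> MOb M" for m
      using monoidal_transformationD(7-9)[OF u(1)[OF that]] that by simp_all
    \<comment> \<open>The contents of the framed cells form a cocone on the underlying graded monad;
      each axiom is the content of the corresponding framed equation.\<close>
    have "cocone UA (mobj X) (larr V) (\<lambda>m. fcell (u m))"
      unfolding cocone_def
    proof (intro conjI ballI)
      show "fcell (u (Mcod M n)) \<bullet> (larr V \<rhd> garr UA n) = fcell (u (Mdom M n))" if "n \<in> MAr M" for n
        using arg_cong[OF mon.cocone_eqs(1)[OF cc that], of fcell] that by simp
      show "fcell (u (m \<otimes>\<^bsub>M\<^esub> l)) \<bullet> (larr V \<rhd> gmult UA m l) = fcell (u l) \<bullet> (fcell (u m) \<lhd> gobj UA l)"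
        if "m \<in> MOb M" "l \<in> MOb M" for m l
        using arg_cong[OF mon.cocone_eqs(2)[OF cc that], of fcell] that by simp
      show "fcell (u (MI M)) \<bullet> (larr V \<rhd> gunit UA) = id2 D (larr V)"
        using arg_cong[OF mon.cocone_eqs(3)[OF cc], of fcell] by simp
    qed (simp_all add: hom_iff cell_iff)
    moreover have "mobj X \<in> Obj D" using X monoidal_typing(1) by simp
    ultimately obtain h where h: "h \<in> Arr D" "src D h = k" "trg D h = mobj X" "h \<cdot> W = larr V" "\<And>m. m \<in> MOb M \<Longrightarrow> h \<rhd> w m = fcell (u m)"
      using universal_cocone_ext1[OF universal_W] by blast
    obtain H where H: "lax_monoidal D H" "lsrc H = kl" "ltrg H = X" "larr H = h" "lax_comp D H Wl = V"
      using descend_lax[OF V u h] by blast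
    have "H \<rhd>\<^bsub>Mon D\<^esub> wl m = u m" if "m \<in> MOb M" for m
      using that H h(5)[OF that] lax_comp_assoc[OF A_typing(2)[OF that] Wl_lax H(1)] by (intro framed.expand) simp
    then show "\<exists>H \<in> Arr (Mon D). src (Mon D) H = kl \<and> trg (Mon D) H = X \<and> H \<cdot>\<^bsub>Mon D\<^esub> Wl = V \<and> (\<forall>m \<in> MOb M. H \<rhd>\<^bsub>Mon D\<^esub> wl m = u m)"
      using H by (intro bexI[of _ H]) simp_all
  next
    fix H H' assume "H \<in> Arr (Mon D)" "H' \<in> Arr (Mon D)" "src (Mon D) H = kl" "src (Mon D) H' = kl" "trg (Mon D) H = trg (Mon D) H'"
      "H \<cdot>\<^bsub>Mon D\<^esub> Wl = H' \<cdot>\<^bsub>Mon D\<^esub> Wl" and e: "\<forall>m \<in> MOb M. H \<rhd>\<^bsub>Mon D\<^esub> wl m = H' \<rhd>\<^bsub>Mon D\<^esub> wl m"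
    moreover have "larr H \<rhd> w m = larr H' \<rhd> w m" if "m \<in> MOb M" for m
      using arg_cong[OF bspec[OF e that], of fcell] by simp
    ultimately show "H = H'" using Mon_cancel1[of H H'] by simp
  next
    fix H H' S assume H: "H \<in> Arr (Mon D)" "H' \<in> Arr (Mon D)" "S \<in> cell (Mon D) (H \<cdot>\<^bsub>Mon D\<^esub> Wl) (H' \<cdot>\<^bsub>Mon D\<^esub> Wl)"
      "src (Mon D) H = kl" "src (Mon D) H' = kl" "trg (Mon D) H = trg (Mon D) H'"
      and e: "\<forall>m \<in> MOb M. (H' \<rhd>\<^bsub>Mon D\<^esub> wl m) \<bullet>\<^bsub>Mon D\<^esub> (S \<lhd>\<^bsub>Mon D\<^esub> gobj A m) = S \<bullet>\<^bsub>Mon D\<^esub> (H \<rhd>\<^bsub>Mon D\<^esub> wl m)"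
    have c: "(larr H' \<rhd> w m) \<bullet> (fcell S \<lhd> f m) = fcell S \<bullet> (larr H \<rhd> w m)" if "m \<in> MOb M" for m
      using arg_cong[OF bspec[OF e that], of fcell] by simp
    have S: "monoidal_transformation D S" "fdom S = lax_comp D H Wl" "fcod S = lax_comp D H' Wl"
      using H(3) by (simp_all add: cell_def)
    have "\<exists>t. monoidal_transformation D (Framed H H' t) \<and> t \<lhd> W = fcell S"
      by (rule Mon_ext2[of H H' "trg (Mon D) H" S]) (use H S c in simp_all)
    then obtain t where t: "monoidal_transformation D (Framed H H' t)" "t \<lhd> W = fcell S" by blast
    have "Framed H H' t \<lhd>\<^bsub>Mon D\<^esub> Wl = S" using t S by (intro framed.expand) simp
    then show "\<exists>t \<in> cell (Mon D) H H'. t \<lhd>\<^bsub>Mon D\<^esub> Wl = S" using t(1) by (intro bexI[of _ "Framed H H' t"]) (simp_all add: cell_def)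
  next
    fix t t' assume t: "t \<in> Cel (Mon D)" "t' \<in> Cel (Mon D)" "src (Mon D) (vdom (Mon D) t) = kl" "vdom (Mon D) t = vdom (Mon D) t'"
      "vcod (Mon D) t = vcod (Mon D) t'" "t \<lhd>\<^bsub>Mon D\<^esub> Wl = t' \<lhd>\<^bsub>Mon D\<^esub> Wl"
    have tt: "monoidal_transformation D t" "monoidal_transformation D t'" using t by simp_all
    note D1 = monoidal_transformationD[OF tt(1)] and D2 = monoidal_transformationD[OF tt(2)]
    have "fcell t = fcell t'"
    proof (rule universal_cocone_cancel2[OF universal_W])
      show "fcell t \<lhd> W = fcell t' \<lhd> W" using arg_cong[OF t(6), of fcell] by simp
      show "src D (vdom D (fcell t)) = k" using t(3) D1(8) lax_typing(4)[OF D1(5)] by simp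
    qed (use t D1 D2 in simp_all)
    then show "t = t'" using t(4,5) by (intro framed.expand) simp
  qed
qed

end

section \<open>From universal cocones to the 2-adjunction and the comparison\<close>

context kleisli_fp
begin

text \<open>The construction starts from the unit of \<open>K\<close> at the underlying graded
  monad, and the lifted arrow has exactly this unit as its image. The second conjunct is then
  universality of the unit in \<open>D\<close>; it is the input that \<open>comparison_iso\<close>
  needs for standardness.\<close>

lemma Mon_universal_arrow:
  assumes A: "graded_monad M (Mon D) A"
  shows "\<exists>k u. universal_arrow (GMnd M (Mon D)) (Mon D) (incl M (Mon D)) A k u \<and>
     universal_arrow (GMnd M D) D (incl M D) (on0 (GMnd_map M Mon_forget) A) (on0 Mon_forget k) (on1 (GMnd_map M Mon_forget) u)"
proof -
  interpret adj: two_adjunction "GMnd M D" D K "incl M D" \<eta> \<epsilon> by (rule adj)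
  interpret forget: two_functor "GMnd M (Mon D)" "GMnd M D" "GMnd_map M Mon_forget"
    by (rule two_functor_GMnd_map[OF monoidal_category_axioms two_functor_forget])
  let ?UA = "GMnd_map_obj M Mon_forget A"
  have "A \<in> Obj (GMnd M (Mon D))" using A by (simp add: GMnd_def)
  from forget.on0_Obj[OF this] have UA: "graded_monad M D ?UA" by (simp add: GMnd_map_def)
  have u: "universal_arrow (GMnd M D) D (incl M D) ?UA (on0 K ?UA) (\<eta> ?UA)"
    by (rule adj.unit_universal) (use UA in simp)
  then have c: "osrc (\<eta> ?UA) = ?UA" "otrg (\<eta> ?UA) = incl_obj M D (on0 K ?UA)" "ocell (\<eta> ?UA) \<in> extensional (MOb M)"
    "universal_cocone ?UA (on0 K ?UA) (oarr (\<eta> ?UA)) (ocell (\<eta> ?UA))"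
    unfolding universal_arrow_iff_cocone[OF UA] by simp_all
  interpret kleisli_mon D M K \<eta> \<epsilon> A "on0 K ?UA" "oarr (\<eta> ?UA)" "ocell (\<eta> ?UA)"
    by unfold_locales (rule A, rule c(4))
  interpret mon: graded "Mon D" M by (rule graded_Mon)
  let ?u = "OplaxMor A (incl_obj M (Mon D) kl) Wl (restrict wl (MOb M))"
  have "mon.universal_cocone A kl Wl (restrict wl (MOb M))"
    by (rule mon.universal_cocone_cong[OF A Mon_universal]) simp
  then have 1: "universal_arrow (GMnd M (Mon D)) (Mon D) (incl M (Mon D)) A kl ?u"
    unfolding mon.universal_arrow_iff_cocone[OF A] by simp
  have "GMnd_map_obj M Mon_forget (incl_obj M (Mon D) kl) = incl_obj M D (on0 K ?UA)"
    using GMnd_map_incl(1)[where M = M and X = kl, OF two_functor_forget]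
    by (simp add: GMnd_map_def Mon_forget_sel)
  then have "on1 (GMnd_map M Mon_forget) ?u = \<eta> ?UA"
    using c(1-3) by (intro oplaxmor_eqI) (simp_all add: GMnd_map_def GMnd_map_arr_def Mon_forget_sel)
  with u 1 show ?thesis
    by (intro exI[of _ kl] exI[of _ ?u]) (simp add: GMnd_map_def Mon_forget_sel)
qed

end

theorem theorem13:
  fixes M :: "('m, 'n) moncat" and D :: "('o, 'a, 'c) fp_twocat"
  assumes "monoidal_category M"
    and "fp_two_category D"
    and "kleisli_adjunction M D K \<eta> \<epsilon>"
    and "preserves_finite_products (GMnd M D) D K"
  shows "admits_kleisli M (Mon D) \<and> kleisli_standard M D"
proof -
  have two: "two_category D" using assms(2) by (simp add: fp_two_category_def)
  interpret kleisli_fp D M K \<eta> \<epsilon>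
    using assms two by (simp add: kleisli_fp_def kleisli_fp_axioms_def fp_graded_def fp_2cat_def graded_def strict_2cat_iff)
  have mon: "graded (Mon D) M"
    by (simp add: graded_def strict_2cat_iff two_category_Mon assms(1))
  interpret incl: two_functor "Mon D" "GMnd M (Mon D)" "incl M (Mon D)"
    by (rule graded.two_functor_incl[OF mon])
  have obj: "graded_monad M (Mon D) A" if "A \<in> Obj (GMnd M (Mon D))" for A using that by (simp add: GMnd_def)
  have admits: "admits_kleisli M (Mon D)"
    unfolding admits_kleisli_def
    by (rule incl.adjunction_of_universal_arrows) (use Mon_universal_arrow[OF obj] in blast)
  moreover have "preserves_kleisli M (Mon D) D Mon_forget"
    unfolding preserves_kleisli_def
  proof (intro conjI allI impI admits two_functor_forget)
    show "admits_kleisli M D" using assms(3) by (auto simp: admits_kleisli_def)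
    fix K \<eta> \<epsilon> K' \<eta>' \<epsilon>'
    assume 1: "kleisli_adjunction M (Mon D) K \<eta> \<epsilon>" and 2: "kleisli_adjunction M D K' \<eta>' \<epsilon>'"
    \<comment> \<open>Both adjunctions are arbitrary here. At each object one universal arrow with a
      universal image is known, and \<open>comparison_iso\<close> transfers this to the given
      units.\<close>
    show "two_natural_iso (GMnd M (Mon D)) D (twofun_comp K' (GMnd_map M Mon_forget)) (twofun_comp Mon_forget K)
      (kleisli_comparison M D Mon_forget K \<eta> K' \<epsilon>')"
      unfolding kleisli_comparison_def
      by (rule comparison_iso[OF 1 2 two_functor_forget two_functor_GMnd_map[OF assms(1) two_functor_forget]
            GMnd_map_incl[OF two_functor_forget] Mon_universal_arrow[OF obj]])
  qed
  ultimately show ?thesis by (simp add: kleisli_standard_def)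
qed

end
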